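(* Let $T$ be a framed bottom tangle all of whose closed components are labeled by invariant functionals, elements of $U_{\mathbf s}^{*,\mathrm{inv}}$. Then $$\Phi\big(\Gamma_{U_{\rm full}}(T)\big)=\Gamma_{u_{\mathbf s}}(T),$$ where the invariant functionals are interpreted as their restrictions to $u_{\mathbf s}$ on the right-hand side and as their pullbacks by $\Phi$ on the left-hand side.
   Context: Lie data. $\mathfrak g$ is a complex simple Lie algebra with Cartan matrix $(a_{ij})_{i,j=1}^M$; $d_i$ are the minimal positive integers with $(d_ia_{ij})$ symmetric positive definite; $\alpha_i$ simple roots with $\langle\alpha_i,\alpha_j\rangle=d_ia_{ij}$; $\Lambda_r\subset\Lambda$ root and weight lattices; $\beta_1,\dots,\beta_N$ positive roots; $\rho$ half their sum; $L$ the least positive integer with $L\langle\lambda,\mu\rangle\in\mathbb Z$ for all $\lambda,\mu\in\Lambda$. Generic quantum group. $\mathcal A_s=\mathbb Z[s,s^{-1}]$, $q=s^L$, $q_i=q^{d_i}$, $q_\beta=q_i$ if $\beta$ has the length of $\alpha_i$; $[n]_i=(q_i^n-q_i^{-n})/(q_i-q_i^{-1})$ with the usual quantum factorials and binomials. Over the fraction field of $\mathcal A_s$ take the algebra generated by $E_i,F_i$ and the algebra $\mathrm{Map}(\Lambda,\mathcal A_s)$ of all functions, with relations $E_if(\lambda)=f(\lambda-\alpha_i)E_i$, $F_if(\lambda)=f(\lambda+\alpha_i)F_i$, $E_iF_j-F_jE_i=\delta_{ij}[K_i;0]$ with $[K_i;0](\lambda)=[\langle\lambda,\alpha_i\rangle/d_i]_i$,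 and the quantum Serre relations. $K_\gamma(\lambda)=q^{\langle\lambda,\gamma\rangle}=s^{L\langle\lambda,\gamma\rangle}$ ($\gamma\in\Lambda$), $K_i=K_{\alpha_i}$; $[K_i;m,n](\lambda)$ is the quantum binomial coefficient of $\langle\lambda,\alpha_i\rangle/d_i+m$ over $n$ in $q_i$; $[\lambda]$ is the indicator function of $\lambda\in\Lambda$. Lusztig's braid group action and a reduced word of the longest Weyl group element give an ordering of the positive roots and root vectors $E_{\beta_j},F_{\beta_j}$; $E_\beta^{(r)}=E_\beta^r/[r]_\beta!$, similarly $F$; $E_{(\vec r)}=E_{\beta_1}^{(r_1)}\cdots E_{\beta_N}^{(r_N)}$, $F_{(\vec r)}=F_{\beta_1}^{(r_1)}\cdots F_{\beta_N}^{(r_N)}$. $U_{\rm full}$ is the $\mathcal A_s$-subalgebra generated by $\mathrm{Map}(\Lambda,\mathcal A_s)$ and the divided powers; $U_{\rm weight}\subset U_{\rm full}$ is the $\mathcal A_s$-subalgebra generated by the divided powers, the $K_\gamma$ ($\gamma\in\Lambda$) and the $[K_i;m,n]$. $U_{\rm full}$ is a topological Hopf algebra with $\Delta(E_i)=E_i\otimes K_i+1\otimes E_i$, $\Delta(F_i)=F_i\otimes1+K_i^{-1}\otimes F_i$, $S(E_i)=-E_iK_i^{-1}$, $S(F_i)=-K_iF_i$, $\epsilon(E_i)=\epsilon(F_i)=0$, $\Delta[\lambda]=\sum_\gamma[\gamma]\otimes[\lambda-\gamma]$, $S[\lambda]=[-\lambda]$, $\epsilon[\lambda]=\delta_{\lambda,0}$.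 Completion. With $\{k\}=(1-q)(1-q^2)\cdots(1-q^k)$, $\widehat{\mathcal A}_s$ is the completion of $\mathcal A_s$ with respect to the ideals $\{k\}\mathcal A_s$. $\widehat U_{\rm full}^{\otimes m}$ is the completed tensor power whose elements are the sums $\sum_{k\ge0}\sum_{j=1}^{n_k}\{k\}\mathbf F_{j,k}\mathbf K_{j,k}\mathbf E_{j,k}$ with $n_k<\infty$, $\mathbf K_{j,k}\in\mathrm{Map}(\Lambda^{m},\mathcal A_s)$, and $\mathbf F_{j,k}$, $\mathbf E_{j,k}$ being $m$-fold tensor products of elements $F_{(\vec r)}$, respectively $E_{(\vec t)}$. $\widehat U_{\rm full}$ is a topological ribbon Hopf algebra with $g=K_{2\rho}$ and $$R=\Big(\sum_{\lambda,\gamma\in\Lambda}q^{\langle\lambda,\gamma\rangle}[\lambda]\otimes[\gamma]\Big)\sum_{\vec r}b_{\vec r}E_{(\vec r)}\otimes F_{(\vec r)},\qquad b_{\vec r}=\prod_jq_{\beta_j}^{r_j(r_j+1)/2}(1-q_{\beta_j}^{-2})^{r_j}[r_j]_{\beta_j}!.$$ Small quantum group. $l$ is a positive integer, $\mathbf s$ a primitive $lL$-th root of unity, $\mathbf q=\mathbf s^L$. The map $s\mapsto\mathbf s$ extends to $\widehat{\mathcal A}_s\to\mathbb Q(\mathbf s)$; $U_{\mathbf s}=\widehat U_{\rm full}\otimes_{\widehat{\mathcal A}_s}\mathbb Q(\mathbf s)$, and $\Phi:\widehat U_{\rm full}\to U_{\mathbf s}$ is the extension-of-scalars map, also denoting the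 induced map on completed tensor powers. For a positive root $\beta$ of the length of $\alpha_i$: $l_\beta=l/\gcd(l,d_i)$, $l'_\beta=l_\beta$ or $l_\beta/2$ according as $l_\beta$ is odd or even. $\Lambda_l=\{\lambda\in\Lambda:\langle\lambda,\gamma\rangle\in l\mathbb Z\ \forall\gamma\in\Lambda\}$. In $U_{\mathbf s}$ one has $E_\beta^{l'_\beta}=F_\beta^{l'_\beta}=0$ and $K_\lambda=1$ for $\lambda\in\Lambda_l$. The small quantum group $u_{\mathbf s}$ is the image of $U_{\rm weight}$ under $\Phi$, as an algebra over $\mathbb Q(\mathbf s)$; it is taken to be a finite-dimensional Hopf subalgebra of $U_{\mathbf s}$, and to be a ribbon Hopf algebra with $g=K_{2\rho}=\Phi(K_{2\rho})$ and $R$-matrix $$\Phi(R)=\Big(\tfrac1{|\Lambda/\Lambda_l|}\sum_{\lambda,\gamma\in\Lambda/\Lambda_l}\mathbf q^{-\langle\lambda,\gamma\rangle}K_\lambda\otimes K_\gamma\Big)\sum_{\vec r:\,r_j<l'_{\beta_j}}b_{\vec r}E_{(\vec r)}\otimes F_{(\vec r)}.$$ Invariant functionals. For a (topological) ribbon Hopf algebra $U$, $U^{*,\mathrm{inv}}$ is the set of (uniformly continuous) linear functionals $\psi$ to the (completed) ground ring with $\psi(ab)=\psi(bS^2(a))$ for all $a,b$. Tangles and universal invariant. A framed bottom tangle is a framed oriented tangle in $\mathbb R\times[-1,1]\times[0,1]$ (coordinates $x,y,z$; diagrams in the $xz$-plane), up to isotopy, whose $j$-th open component starts at $(2j,0,0)$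 and ends at $(2j-1,0,0)$, and which may have closed components. With $R=\sum_ka_k\otimes b_k$, $R^{-1}=\sum_k\tilde a_k\otimes\tilde b_k$: if there are $m$ open and no closed components, $\Gamma_U(T)$ in the completed $m$-th tensor power of $U$ is: in a diagram, at each local minimum (maximum) of $z$ at which the strand points right place $g$ ($g^{-1}$); at each positive crossing place $a_k$ on the lower and $b_k$ on the upper strand, at each negative crossing $\tilde a_k$ on the lower and $\tilde b_k$ on the upper strand; if both strands of a crossing point right, apply $S^2$ to the label on the strand pointing up and right; along each component multiply labels so that if $b$ precedes $a$ in the direction of orientation the product is $ab$; sum over all indices. If closed components are labeled by invariant functionals, write $T$ as an open tangle $P$ with right-pointing cups attached below that close up the components which become closed, and apply the labels to the corresponding tensor factors of $\Gamma_U(P)$. On the left-hand side of the identity, $\psi\circ\Phi$ is applied in the tensor factor of a closed component labeled $\psi$, and $\Phi$ in the factors of the open components. *)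

theory Defs
  imports
    Complex_Main
    "HOL-Library.Poly_Mapping"
    "HOL-Library.Function_Algebras"
    "HOL-Library.FuncSet"
    "HOL-Computational_Algebra.Polynomial"
    "HOL-Computational_Algebra.Fraction_Field"
begin

text \<open>
  Quotient objects are handled through representatives throughout: an algebra or module is a set of
  representatives in a free object together with the subset of representatives of 0, and equality
  means that the difference represents 0.
\<close>

section \<open>Scalars and free objects\<close>

text \<open>The Laurent polynomial ring over the integers is the group ring of the integers, with the
  indeterminate s corresponding to the generator 1.\<close>

type_synonym laurent = "int \<Rightarrow>\<^sub>0 int"
type_synonym lfrac = "laurent fract"

definition s_pow :: "int \<Rightarrow> laurent" where
  "s_pow k = Poly_Mapping.single k 1"

definition emb :: "laurent \<Rightarrow> lfrac" where
  "emb a = Fract a 1"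

definition unemb :: "lfrac \<Rightarrow> laurent" where
  "unemb = inv emb"

definition As :: "lfrac set" where
  "As = range emb"

text \<open>With concatenation as addition on words, \<open>'g list \<Rightarrow>\<^sub>0 'k\<close> is the free associative algebra on
  \<open>'g\<close>, with the library's convolution product.\<close>

instantiation list :: (type) monoid_add
begin
definition zero_list_def: "(0 :: 'a list) = []"
definition plus_list_def: "(xs :: 'a list) + ys = xs @ ys"
instance by standard (simp_all add: zero_list_def plus_list_def)
end

definition smul :: "'b::comm_ring_1 \<Rightarrow> ('a \<Rightarrow>\<^sub>0 'b) \<Rightarrow> ('a \<Rightarrow>\<^sub>0 'b)" where
  "smul c p = Poly_Mapping.map (\<lambda>x. c * x) p"

definition lin_ext :: "('a \<Rightarrow> ('c \<Rightarrow>\<^sub>0 'b)) \<Rightarrow> ('a \<Rightarrow>\<^sub>0 'b::comm_ring_1) \<Rightarrow> ('c \<Rightarrow>\<^sub>0 'b)" where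
  "lin_ext f p = (\<Sum>x\<in>Poly_Mapping.keys p. smul (Poly_Mapping.lookup p x) (f x))"

text \<open>Sum of a family in a group modulo the subgroup \<open>Z\<close>, for families that vanish modulo \<open>Z\<close>
  outside a finite set.\<close>

definition conv_sum :: "'a::ab_group_add set \<Rightarrow> 'i set \<Rightarrow> ('i \<Rightarrow> 'a) \<Rightarrow> 'a" where
  "conv_sum Z I f = sum f {i \<in> I. f i \<notin> Z}"

section \<open>Tensor powers\<close>

text \<open>
  Let \<open>B\<close> be the scalars, \<open>C\<close> the representatives of the elements of a module, \<open>Z\<close> the representatives
  of 0. The m-th algebraic tensor power consists of formal \<open>B\<close>-linear combinations of lists of length
  \<open>m\<close> (pure tensors), modulo \<open>tens_null B C Z m\<close>. The product of \<open>'a list \<Rightarrow>\<^sub>0 'b\<close> (concatenation of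
  lists) is the external tensor product.
\<close>

definition tens :: "'b set \<Rightarrow> ('c \<Rightarrow>\<^sub>0 'b) set \<Rightarrow> nat \<Rightarrow> (('c \<Rightarrow>\<^sub>0 'b) list \<Rightarrow>\<^sub>0 'b::comm_ring_1) set" where
  "tens B C m = {t. \<forall>xs \<in> Poly_Mapping.keys t.
     length xs = m \<and> set xs \<subseteq> C \<and> Poly_Mapping.lookup t xs \<in> B}"

inductive_set tens_null ::
  "'b set \<Rightarrow> ('c \<Rightarrow>\<^sub>0 'b) set \<Rightarrow> ('c \<Rightarrow>\<^sub>0 'b) set \<Rightarrow> nat \<Rightarrow> (('c \<Rightarrow>\<^sub>0 'b) list \<Rightarrow>\<^sub>0 'b::comm_ring_1) set"
  for B C Z m where
  zero: "0 \<in> tens_null B C Z m"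
| add: "t \<in> tens_null B C Z m \<Longrightarrow> u \<in> tens_null B C Z m \<Longrightarrow> t + u \<in> tens_null B C Z m"
| scale: "b \<in> B \<Longrightarrow> t \<in> tens_null B C Z m \<Longrightarrow> smul b t \<in> tens_null B C Z m"
| additive: "set xs \<subseteq> C \<Longrightarrow> set ys \<subseteq> C \<Longrightarrow> x \<in> C \<Longrightarrow> y \<in> C \<Longrightarrow> length xs + length ys + 1 = m \<Longrightarrow>
    Poly_Mapping.single (xs @ (x + y) # ys) 1 - Poly_Mapping.single (xs @ x # ys) 1
      - Poly_Mapping.single (xs @ y # ys) 1 \<in> tens_null B C Z m"
| homogeneous: "set xs \<subseteq> C \<Longrightarrow> set ys \<subseteq> C \<Longrightarrow> x \<in> C \<Longrightarrow> b \<in> B \<Longrightarrow> length xs + length ys + 1 = m \<Longrightarrow>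
    Poly_Mapping.single (xs @ smul b x # ys) 1 - Poly_Mapping.single (xs @ x # ys) b
      \<in> tens_null B C Z m"
| null: "set xs \<subseteq> C \<Longrightarrow> set ys \<subseteq> C \<Longrightarrow> x \<in> Z \<inter> C \<Longrightarrow> length xs + length ys + 1 = m \<Longrightarrow>
    Poly_Mapping.single (xs @ x # ys) 1 \<in> tens_null B C Z m"

text \<open>Factorwise product with respect to a bilinear product \<open>mul\<close> of the factors, and application of
  a linear map to one factor.\<close>

definition tens_mult :: "('a \<Rightarrow> 'a \<Rightarrow> 'a) \<Rightarrow> ('a list \<Rightarrow>\<^sub>0 'b) \<Rightarrow> ('a list \<Rightarrow>\<^sub>0 'b) \<Rightarrow> ('a list \<Rightarrow>\<^sub>0 'b::comm_ring_1)" where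
  "tens_mult mul t u = lin_ext (\<lambda>xs. lin_ext (\<lambda>ys. Poly_Mapping.single (map2 mul xs ys) 1) u) t"

definition tens_at :: "nat \<Rightarrow> ('a \<Rightarrow> 'a) \<Rightarrow> ('a list \<Rightarrow>\<^sub>0 'b) \<Rightarrow> ('a list \<Rightarrow>\<^sub>0 'b::comm_ring_1)" where
  "tens_at i f t = lin_ext (\<lambda>xs. Poly_Mapping.single (xs[i := f (xs ! i)]) 1) t"

section \<open>Diagrams of bottom tangles\<close>

text \<open>
  A diagram in the xz-plane is cut into horizontal slices, listed from bottom to top; each slice
  contains one elementary event. Strands at a given height are numbered \<open>0, 1, \<dots>\<close> from left to right.
  \<open>Cup i\<close> is a local minimum creating the strands \<open>i\<close> and \<open>i+1\<close> above it, \<open>Cap i\<close> a local maximum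
  joining the strands \<open>i\<close> and \<open>i+1\<close> below it. \<open>Cross i b\<close> interchanges the strands \<open>i\<close> and \<open>i+1\<close>; its
  slash strand runs between lower position \<open>i\<close> and upper position \<open>i+1\<close>, its backslash strand between
  lower position \<open>i+1\<close> and upper position \<open>i\<close>, and \<open>b\<close> says whether the slash strand is the upper
  (over-crossing) one. The framing is the blackboard framing.
\<close>

datatype slice = Cup nat | Cap nat | Cross nat bool

text \<open>A point \<open>(h, p, u)\<close> of an oriented path lies on strand \<open>p\<close> between the slices \<open>h - 1\<close> and \<open>h\<close>,
  and \<open>u\<close> says whether the path is going up there.\<close>

type_synonym point = "nat \<times> nat \<times> bool"

definition cross_perm :: "nat \<Rightarrow> nat \<Rightarrow> nat" where
  "cross_perm i p = (if p = i then i + 1 else if p = i + 1 then i else p)"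

fun step :: "slice list \<Rightarrow> point \<Rightarrow> point" where
  "step D (h, p, True) = (if h \<ge> length D then (h, p, True) else (case D ! h of
      Cup i \<Rightarrow> (h + 1, if p < i then p else p + 2, True)
    | Cap i \<Rightarrow> if p = i then (h, i + 1, False) else if p = i + 1 then (h, i, False)
               else (h + 1, if p < i then p else p - 2, True)
    | Cross i b \<Rightarrow> (h + 1, cross_perm i p, True)))"
| "step D (0, p, False) = (0, p, False)"
| "step D (Suc h, p, False) = (case D ! h of
      Cup i \<Rightarrow> if p = i then (Suc h, i + 1, True) else if p = i + 1 then (Suc h, i, True)
               else (h, if p < i then p else p - 2, False)
    | Cap i \<Rightarrow> (h, if p < i then p else p + 2, False)
    | Cross i b \<Rightarrow> (h, cross_perm i p, False))"

text \<open>Component \<open>j\<close> (counted from 0) starts at x-coordinate \<open>2(j+1)\<close> and ends at \<open>2(j+1) - 1\<close>, i.e. at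
  the bottom positions \<open>2j+1\<close> and \<open>2j\<close>.\<close>

definition path :: "slice list \<Rightarrow> nat \<Rightarrow> nat \<Rightarrow> point" where
  "path D j t = (step D ^^ t) (0, 2 * j + 1, True)"

definition visited :: "nat \<Rightarrow> slice list \<Rightarrow> point set" where
  "visited n D = {path D j t | j t. j < n}"

fun slice_ok :: "nat \<Rightarrow> slice \<Rightarrow> bool" where
  "slice_ok k (Cup i) = (i \<le> k)"
| "slice_ok k (Cap i) = (i + 2 \<le> k)"
| "slice_ok k (Cross i b) = (i + 2 \<le> k)"

fun next_width :: "nat \<Rightarrow> slice \<Rightarrow> nat" where
  "next_width k (Cup i) = k + 2"
| "next_width k (Cap i) = k - 2"
| "next_width k (Cross i b) = k"

definition width :: "nat \<Rightarrow> slice list \<Rightarrow> nat \<Rightarrow> nat" where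
  "width n D h = foldl next_width (2 * n) (take h D)"

text \<open>Bottom tangles with \<open>n\<close> open and no closed components.\<close>

definition bottom_tangle :: "nat \<Rightarrow> slice list \<Rightarrow> bool" where
  "bottom_tangle n D \<longleftrightarrow>
     (\<forall>h < length D. slice_ok (width n D h) (D ! h)) \<and> width n D (length D) = 0
   \<and> (\<forall>j < n. \<exists>t. path D j t = (0, 2 * j, False))
   \<and> (\<forall>h \<le> length D. \<forall>p < width n D h. \<exists>u. (h, p, u) \<in> visited n D)"

text \<open>
  Labels live in slots \<open>(h, b)\<close> of slice \<open>h\<close>: \<open>(h, False)\<close> is the lower and \<open>(h, True)\<close> the upper strand
  of a crossing, and \<open>(h, False)\<close> is the only slot of a right-pointing extremum; left-pointing extrema
  carry no label.
\<close>

type_synonym slot = "nat \<times> bool"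

definition right_extremum :: "nat \<Rightarrow> slice list \<Rightarrow> nat \<Rightarrow> bool" where
  "right_extremum n D h = (case D ! h of
      Cup i \<Rightarrow> (h + 1, i, False) \<in> visited n D
    | Cap i \<Rightarrow> (h, i, True) \<in> visited n D
    | Cross i b \<Rightarrow> False)"

definition slots_at :: "nat \<Rightarrow> slice list \<Rightarrow> nat \<Rightarrow> slot list" where
  "slots_at n D h = (case D ! h of
      Cross i b \<Rightarrow> [(h, False), (h, True)]
    | _ \<Rightarrow> if right_extremum n D h then [(h, False)] else [])"

definition slots :: "nat \<Rightarrow> slice list \<Rightarrow> slot list" where
  "slots n D = concat (map (slots_at n D) [0..<length D])"

text \<open>The slots met by a path on the step that starts at the given point.\<close>

fun visit :: "slice list \<Rightarrow> point \<Rightarrow> slot list" where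
  "visit D (h, p, True) = (if h \<ge> length D then [] else (case D ! h of
      Cup i \<Rightarrow> []
    | Cap i \<Rightarrow> if p = i then [(h, False)] else []
    | Cross i b \<Rightarrow> if p = i then [(h, b)] else if p = i + 1 then [(h, \<not> b)] else []))"
| "visit D (0, p, False) = []"
| "visit D (Suc h, p, False) = (case D ! h of
      Cup i \<Rightarrow> if p = i then [(h, False)] else []
    | Cap i \<Rightarrow> []
    | Cross i b \<Rightarrow> if p = i + 1 then [(h, b)] else if p = i then [(h, \<not> b)] else [])"

definition component_slots :: "slice list \<Rightarrow> nat \<Rightarrow> slot list" where
  "component_slots D j =
     concat (map (\<lambda>t. visit D (path D j t)) [0..<(LEAST t. path D j t = (0, 2 * j, False))])"

text \<open>Products along the components: a label met later stands further to the left.\<close>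

definition component_products ::
  "('a \<Rightarrow> 'a \<Rightarrow> 'a) \<Rightarrow> 'a \<Rightarrow> nat \<Rightarrow> slice list \<Rightarrow> 'a list \<Rightarrow> 'a list" where
  "component_products mul one n D xs =
     map (\<lambda>j. foldr mul (map (\<lambda>\<sigma>. the (map_of (zip (slots n D) xs) \<sigma>)) (rev (component_slots D j))) one)
       [0..<n]"

definition slash_up :: "nat \<Rightarrow> slice list \<Rightarrow> nat \<Rightarrow> nat \<Rightarrow> bool" where
  "slash_up n D h i \<longleftrightarrow> (h, i, True) \<in> visited n D"

definition backslash_up :: "nat \<Rightarrow> slice list \<Rightarrow> nat \<Rightarrow> nat \<Rightarrow> bool" where
  "backslash_up n D h i \<longleftrightarrow> (h, i + 1, True) \<in> visited n D"

text \<open>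
  The tensor of labels of slice \<open>h\<close>, given \<open>R\<close>, its inverse, \<open>g\<close>, its inverse, and the square of the
  antipode. A crossing is positive iff the slash strand is upper exactly when both strands go up or
  both go down. Both strands point right iff slash goes up and backslash goes down, in which case
  slash is the strand pointing up and right.
\<close>

definition slice_label ::
  "nat \<Rightarrow> slice list \<Rightarrow> ('a \<Rightarrow> 'a) \<Rightarrow> ('a list \<Rightarrow>\<^sub>0 'b) \<Rightarrow> ('a list \<Rightarrow>\<^sub>0 'b) \<Rightarrow> ('a list \<Rightarrow>\<^sub>0 'b) \<Rightarrow>
    ('a list \<Rightarrow>\<^sub>0 'b) \<Rightarrow> nat \<Rightarrow> ('a list \<Rightarrow>\<^sub>0 'b::comm_ring_1)" where
  "slice_label n D S2 R R' g g' h = (case D ! h of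
      Cup i \<Rightarrow> if right_extremum n D h then g else 1
    | Cap i \<Rightarrow> if right_extremum n D h then g' else 1
    | Cross i b \<Rightarrow>
        (if slash_up n D h i \<and> \<not> backslash_up n D h i then tens_at (if b then 1 else 0) S2 else id)
          (if b \<longleftrightarrow> (slash_up n D h i \<longleftrightarrow> backslash_up n D h i) then R else R'))"

text \<open>The part of a list indexed by \<open>slots n D\<close> that belongs to slice \<open>h\<close>.\<close>

definition chunk :: "nat \<Rightarrow> slice list \<Rightarrow> nat \<Rightarrow> 'a list \<Rightarrow> 'a list" where
  "chunk n D h xs =
     take (length (slots_at n D h)) (drop (length (concat (map (slots_at n D) [0..<h]))) xs)"

text \<open>
  A bottom tangle with closed components is given by a bottom tangle without closed components and a
  list \<open>lab\<close> of optional labels: component \<open>j\<close> is closed up by a right-pointing cup attached below it,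
  and labeled by \<open>\<psi>\<close>, iff \<open>lab ! j = Some \<psi>\<close>. Otherwise it stays open.
\<close>

definition open_part :: "'f option list \<Rightarrow> 'a list \<Rightarrow> 'a list" where
  "open_part lab xs = map snd (filter (\<lambda>(o', x). o' = None) (zip lab xs))"

definition apply_labels :: "('a \<Rightarrow> 'b) option list \<Rightarrow> 'a list \<Rightarrow> ('a list \<Rightarrow>\<^sub>0 'b::comm_ring_1)" where
  "apply_labels lab xs = Poly_Mapping.single (open_part lab xs)
     (prod_list (map (\<lambda>(o', x). case o' of None \<Rightarrow> 1 | Some \<psi> \<Rightarrow> \<psi> x) (zip lab xs)))"

section \<open>Root data\<close>

text \<open>Weights are given by their coordinates with respect to the fundamental weights, so the weight
  lattice is the whole type \<open>'n \<Rightarrow> int\<close>.\<close>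

type_synonym 'n weight = "'n \<Rightarrow> int"

definition symmetrizer :: "('n::finite \<Rightarrow> 'n \<Rightarrow> int) \<Rightarrow> ('n \<Rightarrow> nat) \<Rightarrow> bool" where
  "symmetrizer a d \<longleftrightarrow> (\<forall>i. 0 < d i) \<and> (\<forall>i j. int (d i) * a i j = int (d j) * a j i)
   \<and> (\<forall>x :: 'n \<Rightarrow> real. x \<noteq> 0 \<longrightarrow> (\<Sum>i\<in>UNIV. \<Sum>j\<in>UNIV. of_nat (d i) * of_int (a i j) * x i * x j) > 0)"

definition simple_root :: "('n \<Rightarrow> 'n \<Rightarrow> int) \<Rightarrow> 'n \<Rightarrow> 'n weight" where
  "simple_root a j = (\<lambda>i. a i j)"

definition reflect :: "('n \<Rightarrow> 'n \<Rightarrow> int) \<Rightarrow> 'n \<Rightarrow> 'n weight \<Rightarrow> 'n weight" where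
  "reflect a i x = (\<lambda>k. x k - x i * simple_root a i k)"

definition reduced_word :: "('n \<Rightarrow> 'n \<Rightarrow> int) \<Rightarrow> 'n list \<Rightarrow> bool" where
  "reduced_word a w \<longleftrightarrow> (\<forall>v. foldr (reflect a) v = foldr (reflect a) w \<longrightarrow> length w \<le> length v)"

text \<open>The Cartan matrices of the complex simple Lie algebras are the indecomposable ones of finite
  type; \<open>w\<close> is a reduced word of the longest Weyl group element.\<close>

locale root_datum =
  fixes a :: "'n::finite \<Rightarrow> 'n \<Rightarrow> int" and d :: "'n \<Rightarrow> nat" and w :: "'n list"
  assumes cartan_diag: "a i i = 2"
    and cartan_off_diag: "i \<noteq> j \<Longrightarrow> a i j \<le> 0"
    and cartan_zero: "a i j = 0 \<Longrightarrow> a j i = 0"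
    and indecomposable: "S \<noteq> {} \<Longrightarrow> S \<noteq> UNIV \<Longrightarrow> \<exists>i\<in>S. \<exists>j\<in>-S. a i j \<noteq> 0"
    and symm: "symmetrizer a d"
    and minimal: "symmetrizer a d' \<Longrightarrow> d i \<le> d' i"
    and reduced: "reduced_word a w"
    and longest: "reduced_word a v \<Longrightarrow> length v \<le> length w"
begin

abbreviation \<alpha> :: "'n \<Rightarrow> 'n weight" where
  "\<alpha> \<equiv> simple_root a"

abbreviation N :: nat where
  "N \<equiv> length w"

text \<open>If \<open>\<lambda> = (\<Sum>j. c j \<cdot> \<alpha> j)\<close> with rational \<open>c\<close>, then
  \<open>\<langle>\<lambda>, \<mu>\<rangle> = (\<Sum>j. c j \<cdot> \<langle>\<alpha> j, \<mu>\<rangle>)\<close>, and \<open>\<langle>\<mu>, \<alpha> j\<rangle> = d j \<cdot> \<mu> j\<close>.\<close>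

definition root_coords :: "'n weight \<Rightarrow> 'n \<Rightarrow> rat" where
  "root_coords x = (THE c. \<forall>i. (\<Sum>j\<in>UNIV. c j * of_int (\<alpha> j i)) = of_int (x i))"

definition pairing :: "'n weight \<Rightarrow> 'n weight \<Rightarrow> rat" where
  "pairing x y = (\<Sum>j\<in>UNIV. root_coords x j * of_nat (d j) * of_int (y j))"

definition L :: nat where
  "L = (LEAST k. 0 < k \<and> (\<forall>x y. of_nat k * pairing x y \<in> \<int>))"

text \<open>The integer \<open>L\<langle>\<lambda>, \<mu>\<rangle>\<close>.\<close>

definition Lpairing :: "'n weight \<Rightarrow> 'n weight \<Rightarrow> int" where
  "Lpairing x y = \<lfloor>of_nat L * pairing x y\<rfloor>"

text \<open>The positive roots in the ordering given by the reduced word; the root with index \<open>j\<close> has the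
  length of \<open>\<alpha> (w ! j)\<close>.\<close>

definition pos_root :: "nat \<Rightarrow> 'n weight" where
  "pos_root j = foldr (reflect a) (take j w) (\<alpha> (w ! j))"

definition two_rho :: "'n weight" where
  "two_rho = (\<Sum>j<N. pos_root j)"

section \<open>The generic quantum group\<close>

definition q_pow :: "int \<Rightarrow> lfrac" where
  "q_pow k = emb (s_pow (int L * k))"

definition qi_pow :: "'n \<Rightarrow> int \<Rightarrow> lfrac" where
  "qi_pow i k = q_pow (int (d i) * k)"

definition qint :: "'n \<Rightarrow> int \<Rightarrow> lfrac" where
  "qint i k = (qi_pow i k - qi_pow i (- k)) / (qi_pow i 1 - qi_pow i (- 1))"

definition qfact :: "'n \<Rightarrow> nat \<Rightarrow> lfrac" where
  "qfact i r = (\<Prod>k=1..r. qint i (int k))"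

definition qbinom :: "'n \<Rightarrow> int \<Rightarrow> nat \<Rightarrow> lfrac" where
  "qbinom i x r = (\<Prod>k=1..r. qint i (x - int k + 1) / qint i (int k))"

end

datatype 'n gen = GE 'n | GF 'n | GM "'n weight \<Rightarrow> laurent"

type_synonym 'n falg = "'n gen list \<Rightarrow>\<^sub>0 lfrac"

definition gen_el :: "'n gen \<Rightarrow> 'n falg" where
  "gen_el x = Poly_Mapping.single [x] 1"

abbreviation Eg :: "'n \<Rightarrow> 'n falg" where "Eg i \<equiv> gen_el (GE i)"
abbreviation Fg :: "'n \<Rightarrow> 'n falg" where "Fg i \<equiv> gen_el (GF i)"
abbreviation Mg :: "('n weight \<Rightarrow> laurent) \<Rightarrow> 'n falg" where "Mg f \<equiv> gen_el (GM f)"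

definition ind :: "'n weight \<Rightarrow> 'n falg" where
  "ind v = Mg (\<lambda>x. if x = v then 1 else 0)"

definition hom_ext :: "('n gen \<Rightarrow> 'n falg) \<Rightarrow> 'n falg \<Rightarrow> 'n falg" where
  "hom_ext \<phi> = lin_ext (\<lambda>u. prod_list (map \<phi> u))"

definition antihom_ext :: "('n gen \<Rightarrow> 'n falg) \<Rightarrow> 'n falg \<Rightarrow> 'n falg" where
  "antihom_ext \<phi> = lin_ext (\<lambda>u. prod_list (map \<phi> (rev u)))"

inductive_set alg_closure :: "'n falg set \<Rightarrow> 'n falg set" for G where
  base: "x \<in> G \<Longrightarrow> x \<in> alg_closure G"
| scalar: "smul (emb c) 1 \<in> alg_closure G"
| add: "x \<in> alg_closure G \<Longrightarrow> y \<in> alg_closure G \<Longrightarrow> x + y \<in> alg_closure G"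
| mult: "x \<in> alg_closure G \<Longrightarrow> y \<in> alg_closure G \<Longrightarrow> x * y \<in> alg_closure G"

type_synonym 'n tensor = "'n falg list \<Rightarrow>\<^sub>0 lfrac"
type_synonym 'n ctensor = "nat \<Rightarrow> 'n weight list \<Rightarrow> 'n tensor"

context root_datum
begin

definition Kfun :: "'n weight \<Rightarrow> 'n weight \<Rightarrow> laurent" where
  "Kfun \<gamma> x = s_pow (Lpairing x \<gamma>)"

abbreviation Kg :: "'n weight \<Rightarrow> 'n falg" where
  "Kg \<gamma> \<equiv> Mg (Kfun \<gamma>)"

definition Kbinom :: "'n \<Rightarrow> int \<Rightarrow> nat \<Rightarrow> 'n weight \<Rightarrow> laurent" where
  "Kbinom i m r x = unemb (qbinom i (x i + m) r)"

definition Kint :: "'n \<Rightarrow> 'n weight \<Rightarrow> laurent" where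
  "Kint i x = unemb (qint i (x i))"

definition serre :: "('n \<Rightarrow> 'n falg) \<Rightarrow> 'n \<Rightarrow> 'n \<Rightarrow> 'n falg" where
  "serre X i j = (let m = nat (1 - a i j) in
     \<Sum>r\<le>m. smul ((-1) ^ r * qbinom i (int m) r) (X i ^ (m - r) * X j * X i ^ r))"

text \<open>The quantum group over the fraction field is \<open>'n falg\<close> modulo the two-sided ideal \<open>qideal\<close>. The
  first three relations say that the functions form a copy of the algebra of all functions.\<close>

inductive_set qideal :: "'n falg set" where
  map_add: "Mg (f + g) - Mg f - Mg g \<in> qideal"
| map_mult: "Mg (f * g) - Mg f * Mg g \<in> qideal"
| map_const: "Mg (\<lambda>_. c) - smul (emb c) 1 \<in> qideal"
| E_map: "Eg i * Mg f - Mg (\<lambda>x. f (x - \<alpha> i)) * Eg i \<in> qideal"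
| F_map: "Fg i * Mg f - Mg (\<lambda>x. f (x + \<alpha> i)) * Fg i \<in> qideal"
| E_F: "Eg i * Fg j - Fg j * Eg i - (if i = j then Mg (Kint i) else 0) \<in> qideal"
| serre_E: "i \<noteq> j \<Longrightarrow> serre Eg i j \<in> qideal"
| serre_F: "i \<noteq> j \<Longrightarrow> serre Fg i j \<in> qideal"
| zero: "0 \<in> qideal"
| add: "x \<in> qideal \<Longrightarrow> y \<in> qideal \<Longrightarrow> x + y \<in> qideal"
| left: "x \<in> qideal \<Longrightarrow> y * x \<in> qideal"
| right: "x \<in> qideal \<Longrightarrow> x * y \<in> qideal"

definition divpow :: "'n \<Rightarrow> 'n falg \<Rightarrow> nat \<Rightarrow> 'n falg" where
  "divpow i x r = smul (1 / qfact i r) (x ^ r)"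

text \<open>Lusztig's braid group action, in the version (\<open>T''\<close> with sign \<open>+1\<close>) for which the product
  formula for the R-matrix below, with factors in the given order, is correct.\<close>

fun braid_gen :: "'n \<Rightarrow> 'n gen \<Rightarrow> 'n falg" where
  "braid_gen i (GE j) = (if i = j then - (Fg i * Kg (\<alpha> i)) else
     let m = nat (- a i j) in
     \<Sum>r\<le>m. smul ((-1) ^ r * qi_pow i (- int r)) (divpow i (Eg i) (m - r) * Eg j * divpow i (Eg i) r))"
| "braid_gen i (GF j) = (if i = j then - (Kg (- \<alpha> i) * Eg i) else
     let m = nat (- a i j) in
     \<Sum>r\<le>m. smul ((-1) ^ r * qi_pow i (int r)) (divpow i (Fg i) r * Fg j * divpow i (Fg i) (m - r)))"
| "braid_gen i (GM f) = Mg (f \<circ> reflect a i)"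

definition braid :: "'n \<Rightarrow> 'n falg \<Rightarrow> 'n falg" where
  "braid i = hom_ext (braid_gen i)"

definition root_E :: "nat \<Rightarrow> 'n falg" where
  "root_E j = foldr braid (take j w) (Eg (w ! j))"

definition root_F :: "nat \<Rightarrow> 'n falg" where
  "root_F j = foldr braid (take j w) (Fg (w ! j))"

text \<open>The products of divided powers of root vectors; exponent vectors are lists of length \<open>N\<close>.\<close>

definition Emon :: "nat list \<Rightarrow> 'n falg" where
  "Emon r = prod_list (map (\<lambda>j. divpow (w ! j) (root_E j) (r ! j)) [0..<N])"

definition Fmon :: "nat list \<Rightarrow> 'n falg" where
  "Fmon r = prod_list (map (\<lambda>j. divpow (w ! j) (root_F j) (r ! j)) [0..<N])"

definition exp_weight :: "nat list \<Rightarrow> 'n weight" where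
  "exp_weight r = (\<lambda>k. \<Sum>j<N. int (r ! j) * pos_root j k)"

definition divided_powers :: "'n falg set" where
  "divided_powers = {divpow (w ! j) (root_E j) r | j r. j < N} \<union> {divpow (w ! j) (root_F j) r | j r. j < N}"

text \<open>Both subalgebras are represented by their full preimages in the free algebra.\<close>

definition Ufull :: "'n falg set" where
  "Ufull = alg_closure (range Mg \<union> divided_powers \<union> qideal)"

definition Uweight :: "'n falg set" where
  "Uweight = alg_closure (range Kg \<union> {Mg (Kbinom i m r) | i m r. True} \<union> divided_powers \<union> qideal)"

fun antipode_gen :: "'n gen \<Rightarrow> 'n falg" where
  "antipode_gen (GE i) = - (Eg i * Kg (- \<alpha> i))"
| "antipode_gen (GF i) = - (Kg (\<alpha> i) * Fg i)"
| "antipode_gen (GM f) = Mg (\<lambda>x. f (- x))"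

definition antipode :: "'n falg \<Rightarrow> 'n falg" where
  "antipode = antihom_ext antipode_gen"

section \<open>Completion\<close>

definition brace :: "nat \<Rightarrow> laurent" where
  "brace k = (\<Prod>i=1..k. 1 - s_pow (int L * int i))"

definition cutoff :: "nat \<Rightarrow> 'n falg set" where
  "cutoff k = {smul (emb (brace k)) v + x | v x. v \<in> Ufull \<and> x \<in> qideal}"

text \<open>Elements of the completions are compatible families of representatives modulo \<open>brace k\<close>.\<close>

definition Ahat :: "(nat \<Rightarrow> laurent) set" where
  "Ahat = {c. \<forall>k. brace k dvd c (Suc k) - c k}"

definition Uhat :: "(nat \<Rightarrow> 'n falg) set" where
  "Uhat = {x. \<forall>k. x k \<in> Ufull \<and> x (Suc k) - x k \<in> cutoff k}"

definition Uhat_null :: "(nat \<Rightarrow> 'n falg) set" where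
  "Uhat_null = {x \<in> Uhat. \<forall>k. x k \<in> cutoff k}"

text \<open>
  An element \<open>X\<close> of the m-th completed tensor power is described, for each level \<open>k\<close> and all weights
  \<open>\<mu>\<^sub>1, \<dots>, \<mu>\<^sub>m\<close>, by the class modulo \<open>brace k\<close> of its product with the tensor of the indicators of the
  \<open>\<mu>\<^sub>i\<close>, which lies in the m-th algebraic tensor power of \<open>Ufull\<close>.
\<close>

definition tensor_null :: "nat \<Rightarrow> nat \<Rightarrow> 'n tensor set" where
  "tensor_null k m = {t + smul (emb (brace k)) u | t u.
     t \<in> tens_null As Ufull qideal m \<and> u \<in> tens As Ufull m}"

text \<open>The product of \<open>F K E\<close> with the indicators of \<open>\<mu>\<close>, for \<open>F\<close>, \<open>E\<close> tensors of monomials with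
  exponents \<open>rs\<close>, \<open>ts\<close> and \<open>K\<close> a function \<open>f\<close> on m-tuples of weights; moving the indicators to the left of
  \<open>E\<close> shifts them by the weights of the factors of \<open>E\<close>.\<close>

definition FKE :: "('n weight list \<Rightarrow> laurent) \<times> nat list list \<times> nat list list \<Rightarrow> 'n weight list \<Rightarrow> 'n tensor" where
  "FKE = (\<lambda>(f, rs, ts) \<mu>.
     Poly_Mapping.single (map (\<lambda>(r, t, v). Fmon r * Emon t * ind v) (zip rs (zip ts \<mu>)))
       (emb (f (map2 (\<lambda>v t. v + exp_weight t) \<mu> ts))))"

definition FKE_data :: "nat \<Rightarrow> (('n weight list \<Rightarrow> laurent) \<times> nat list list \<times> nat list list) set" where
  "FKE_data m = {(f, rs, ts). length rs = m \<and> length ts = m \<and> (\<forall>r \<in> set rs \<union> set ts. length r = N)}"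

definition ctensors :: "nat \<Rightarrow> 'n ctensor set" where
  "ctensors m = {X. (\<forall>k \<mu>. length \<mu> = m \<longrightarrow> X k \<mu> \<in> tens As Ufull m) \<and>
     (\<exists>T. (\<forall>k. set (T k) \<subseteq> FKE_data m) \<and>
       (\<forall>k \<mu>. length \<mu> = m \<longrightarrow>
          X k \<mu> - (\<Sum>i<k. smul (emb (brace i)) (\<Sum>y\<leftarrow>T i. FKE y \<mu>)) \<in> tensor_null k m))}"

definition ctensor_one :: "'n ctensor" where
  "ctensor_one k \<nu> = Poly_Mapping.single (map ind \<nu>) 1"

text \<open>Since \<open>Y[\<nu>]\<close> is the sum of all \<open>[\<mu>]Y[\<nu>]\<close>, the component of \<open>XY\<close> at \<open>\<nu>\<close> is the sum of
  all \<open>X[\<mu>]Y[\<nu>]\<close>, a finite sum at each level.\<close>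

definition ctensor_mult :: "nat \<Rightarrow> 'n ctensor \<Rightarrow> 'n ctensor \<Rightarrow> 'n ctensor" where
  "ctensor_mult m X Y k \<nu> =
     conv_sum (tensor_null k m) {\<mu>. length \<mu> = m} (\<lambda>\<mu>. tens_mult (*) (X k \<mu>) (Y k \<nu>))"

section \<open>The R-matrix and the universal invariant of the completed quantum group\<close>

definition bcoef :: "nat list \<Rightarrow> lfrac" where
  "bcoef r = (\<Prod>j<N. qi_pow (w ! j) (int (r ! j * (r ! j + 1) div 2))
     * (1 - qi_pow (w ! j) (- 2)) ^ (r ! j) * qfact (w ! j) (r ! j))"

definition R_cartan :: "'n ctensor" where
  "R_cartan k \<mu> = Poly_Mapping.single (map ind \<mu>) (emb (s_pow (Lpairing (\<mu> ! 0) (\<mu> ! 1))))"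

text \<open>At level \<open>k\<close> only the finitely many terms with coefficient not divisible by \<open>brace k\<close> count.\<close>

definition R_theta :: "'n ctensor" where
  "R_theta k \<mu> = (\<Sum>r | length r = N \<and> bcoef r \<notin> {emb (brace k * c) | c. True}.
     Poly_Mapping.single [Emon r * ind (\<mu> ! 0), Fmon r * ind (\<mu> ! 1)] (bcoef r))"

definition R_full :: "'n ctensor" where
  "R_full = ctensor_mult 2 R_cartan R_theta"

definition is_R_full_inverse :: "'n ctensor \<Rightarrow> bool" where
  "is_R_full_inverse R' \<longleftrightarrow> R' \<in> ctensors 2 \<and>
     (\<forall>k \<nu>. length \<nu> = 2 \<longrightarrow>
        ctensor_mult 2 R_full R' k \<nu> - ctensor_one k \<nu> \<in> tensor_null k 2 \<and>
        ctensor_mult 2 R' R_full k \<nu> - ctensor_one k \<nu> \<in> tensor_null k 2)"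

definition labels_full :: "'n ctensor \<Rightarrow> nat \<Rightarrow> slice list \<Rightarrow> 'n ctensor" where
  "labels_full R' n D k \<mu> = prod_list (map (\<lambda>h.
     slice_label n D (antipode \<circ> antipode)
       (R_full k (chunk n D h \<mu>)) (R' k (chunk n D h \<mu>))
       (Poly_Mapping.single [Kg two_rho * ind (chunk n D h \<mu> ! 0)] 1)
       (Poly_Mapping.single [Kg (- two_rho) * ind (chunk n D h \<mu> ! 0)] 1) h) [0..<length D])"

text \<open>The tensor of all labels is the sum of its components at all weights \<open>\<mu>\<close> of the slots;
  \<open>R'\<close> is the inverse of \<open>R_full\<close>.\<close>

definition Gamma_full :: "'n ctensor \<Rightarrow> nat \<Rightarrow> slice list \<Rightarrow> 'n ctensor" where
  "Gamma_full R' n D k \<nu> = conv_sum (tensor_null k n) {\<mu>. length \<mu> = length (slots n D)}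
     (\<lambda>\<mu>. lin_ext (\<lambda>xs. Poly_Mapping.single
                 (map2 (\<lambda>x v. x * ind v) (component_products (*) 1 n D xs) \<nu>) 1)
            (labels_full R' n D k \<mu>))"

end

section \<open>The quantum group at a root of unity\<close>

type_synonym 'n us = "(nat \<Rightarrow> 'n falg) \<Rightarrow>\<^sub>0 complex"

text \<open>Extends the product of families \<open>nat \<Rightarrow> 'n falg\<close> (which is pointwise) bilinearly. Not to be
  confused with the product that \<open>\<Rightarrow>\<^sub>0\<close> inherits from addition of families.\<close>

definition us_mult :: "'n us \<Rightarrow> 'n us \<Rightarrow> 'n us" where
  "us_mult p r = lin_ext (\<lambda>x. lin_ext (\<lambda>y. Poly_Mapping.single (x * y) 1) r) p"

definition us_one :: "'n us" where
  "us_one = Poly_Mapping.single 1 1"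

text \<open>Extension of scalars \<open>x \<mapsto> x \<otimes> 1\<close> on the completion, and its restriction to \<open>Ufull\<close>.\<close>

definition Phi_hat :: "(nat \<Rightarrow> 'n falg) \<Rightarrow> 'n us" where
  "Phi_hat x = Poly_Mapping.single x 1"

definition Phi :: "'n falg \<Rightarrow> 'n us" where
  "Phi x = Phi_hat (\<lambda>_. x)"

text \<open>The component at \<open>\<nu>\<close> of an algebraic tensor, viewed as a completed tensor.\<close>

definition component_at :: "'n weight list \<Rightarrow> ('n us list \<Rightarrow>\<^sub>0 complex) \<Rightarrow> ('n us list \<Rightarrow>\<^sub>0 complex)" where
  "component_at \<nu> = lin_ext (\<lambda>ps. Poly_Mapping.single (map2 (\<lambda>p v. us_mult p (Phi (ind v))) ps \<nu>) 1)"

locale root_of_unity_datum = root_datum a d w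
  for a :: "'n::finite \<Rightarrow> 'n \<Rightarrow> int" and d w +
  fixes l :: nat and z :: complex
  assumes l_pos: "0 < l"
    and primitive: "z ^ (l * L) = 1" "\<And>k. 0 < k \<Longrightarrow> k < l * L \<Longrightarrow> z ^ k \<noteq> 1"
begin

definition Qz :: "complex set" where
  "Qz = {poly (map_poly of_rat f) z / poly (map_poly of_rat g) z | f g :: rat poly. True}"

definition ev :: "laurent \<Rightarrow> complex" where
  "ev c = (\<Sum>k\<in>Poly_Mapping.keys c. of_int (Poly_Mapping.lookup c k) * z powi k)"

abbreviation evK :: "lfrac \<Rightarrow> complex" where
  "evK x \<equiv> ev (unemb x)"

text \<open>As \<open>brace k\<close> evaluates to 0 for \<open>k \<ge> l\<close>, evaluation extends to the completion through level \<open>l\<close>.\<close>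

definition ev_hat :: "(nat \<Rightarrow> laurent) \<Rightarrow> complex" where
  "ev_hat c = ev (c l)"

text \<open>The base change of the completion along \<open>ev_hat\<close>: formal combinations of elements \<open>x \<otimes> 1\<close> with
  coefficients in \<open>Qz\<close>.\<close>

definition Us :: "'n us set" where
  "Us = {p. Poly_Mapping.keys p \<subseteq> Uhat \<and> range (Poly_Mapping.lookup p) \<subseteq> Qz}"

inductive_set us_null :: "'n us set" where
  zero: "0 \<in> us_null"
| add: "p \<in> us_null \<Longrightarrow> r \<in> us_null \<Longrightarrow> p + r \<in> us_null"
| scale: "c \<in> Qz \<Longrightarrow> p \<in> us_null \<Longrightarrow> smul c p \<in> us_null"
| additive: "x \<in> Uhat \<Longrightarrow> y \<in> Uhat \<Longrightarrow> Phi_hat (x + y) - Phi_hat x - Phi_hat y \<in> us_null"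
| homogeneous: "c \<in> Ahat \<Longrightarrow> x \<in> Uhat \<Longrightarrow>
    Phi_hat (\<lambda>k. smul (emb (c k)) (x k)) - smul (ev_hat c) (Phi_hat x) \<in> us_null"
| null: "x \<in> Uhat_null \<Longrightarrow> Phi_hat x \<in> us_null"

definition us_S2 :: "'n us \<Rightarrow> 'n us" where
  "us_S2 = lin_ext (\<lambda>x. Phi_hat (\<lambda>k. antipode (antipode (x k))))"

text \<open>
  Invariant functionals. The topology on the algebra of functions is that of pointwise convergence,
  and a linear functional \<open>\<psi>\<close> to the discrete field \<open>Qz\<close> is (uniformly) continuous iff
  \<open>f \<mapsto> \<psi> (x f)\<close> is, for every \<open>x\<close>, i.e. depends on finitely many values of \<open>f\<close>.
\<close>

definition us_linear :: "('n us \<Rightarrow> complex) \<Rightarrow> bool" where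
  "us_linear \<psi> \<longleftrightarrow> (\<forall>p\<in>Us. \<psi> p \<in> Qz) \<and> (\<forall>p\<in>Us. \<forall>r\<in>Us. \<psi> (p + r) = \<psi> p + \<psi> r)
    \<and> (\<forall>c\<in>Qz. \<forall>p\<in>Us. \<psi> (smul c p) = c * \<psi> p) \<and> (\<forall>p\<in>us_null. \<psi> p = 0)"

definition us_continuous :: "('n us \<Rightarrow> complex) \<Rightarrow> bool" where
  "us_continuous \<psi> \<longleftrightarrow> (\<forall>x\<in>Ufull. \<exists>S. finite S \<and>
     (\<forall>f. (\<forall>v\<in>S. f v = 0) \<longrightarrow> \<psi> (Phi (x * Mg f)) = 0))"

definition inv_functionals :: "('n us \<Rightarrow> complex) set" where
  "inv_functionals = {\<psi>. us_linear \<psi> \<and> us_continuous \<psi> \<and>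
     (\<forall>p\<in>Us. \<forall>r\<in>Us. \<psi> (us_mult p r) = \<psi> (us_mult r (us_S2 p)))}"

section \<open>The small quantum group and its universal invariant\<close>

definition small :: "'n us set" where
  "small = {p. Poly_Mapping.keys p \<subseteq> (\<lambda>x _. x) ` Uweight \<and> range (Poly_Mapping.lookup p) \<subseteq> Qz}"

definition l_root' :: "nat \<Rightarrow> nat" where
  "l_root' j = (let m = l div gcd l (d (w ! j)) in if odd m then m else m div 2)"

definition Lambda_l :: "'n weight set" where
  "Lambda_l = {x. \<forall>y. \<exists>m::int. pairing x y = of_int (int l * m)}"

definition weight_cosets :: "'n weight set set" where
  "weight_cosets = UNIV // {(x, y). x - y \<in> Lambda_l}"

text \<open>The summands do not depend on the chosen representatives of the cosets.\<close>

definition coset_rep :: "'n weight set \<Rightarrow> 'n weight" where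
  "coset_rep X = (SOME x. x \<in> X)"

definition R_small :: "'n us list \<Rightarrow>\<^sub>0 complex" where
  "R_small = tens_mult us_mult
     (\<Sum>X\<in>weight_cosets. \<Sum>Y\<in>weight_cosets.
        Poly_Mapping.single [Phi (Kg (coset_rep X)), Phi (Kg (coset_rep Y))]
          (1 / of_nat (card weight_cosets) * z powi (- Lpairing (coset_rep X) (coset_rep Y))))
     (\<Sum>r | length r = N \<and> (\<forall>j<N. r ! j < l_root' j).
        Poly_Mapping.single [Phi (Emon r), Phi (Fmon r)] (evK (bcoef r)))"

abbreviation small_tensor_null :: "nat \<Rightarrow> ('n us list \<Rightarrow>\<^sub>0 complex) set" where
  "small_tensor_null m \<equiv> tens_null Qz small us_null m"

definition is_R_small_inverse :: "('n us list \<Rightarrow>\<^sub>0 complex) \<Rightarrow> bool" where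
  "is_R_small_inverse R' \<longleftrightarrow> R' \<in> tens Qz small 2 \<and>
     tens_mult us_mult R_small R' - Poly_Mapping.single [us_one, us_one] 1 \<in> small_tensor_null 2 \<and>
     tens_mult us_mult R' R_small - Poly_Mapping.single [us_one, us_one] 1 \<in> small_tensor_null 2"

definition Gamma_small :: "('n us list \<Rightarrow>\<^sub>0 complex) \<Rightarrow> nat \<Rightarrow> slice list \<Rightarrow> ('n us list \<Rightarrow>\<^sub>0 complex)" where
  "Gamma_small R' n D =
     lin_ext (\<lambda>xs. Poly_Mapping.single (component_products us_mult us_one n D xs) 1)
       (prod_list (map (\<lambda>h. slice_label n D us_S2 R_small R'
          (Poly_Mapping.single [Phi (Kg two_rho)] 1)
          (Poly_Mapping.single [Phi (Kg (- two_rho))] 1) h) [0..<length D]))"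

text \<open>With closed components: the labels are restricted to \<open>small\<close>.\<close>

definition Gamma_small_labeled ::
  "('n us list \<Rightarrow>\<^sub>0 complex) \<Rightarrow> nat \<Rightarrow> slice list \<Rightarrow> ('n us \<Rightarrow> complex) option list \<Rightarrow>
    ('n us list \<Rightarrow>\<^sub>0 complex)" where
  "Gamma_small_labeled R' n D lab =
     lin_ext (apply_labels (map (map_option (\<lambda>\<psi>. restrict \<psi> small)) lab)) (Gamma_small R' n D)"

text \<open>
  A completed tensor over the base-changed algebra is given by its products with indicators, as above.
  For the invariant of the completed generic algebra, \<open>\<Phi>\<close> is applied in the open factors and \<open>\<psi> \<circ> \<Phi>\<close>
  in the factors labeled \<open>\<psi>\<close>. Since \<open>brace l\<close> evaluates to 0, level \<open>l\<close> suffices, and as \<open>\<psi>\<close> is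
  continuous it is applied to a factor by summing over all indicators in that factor.
\<close>

definition Phi_tensor_labeled :: "('n us \<Rightarrow> complex) option list \<Rightarrow> 'n tensor \<Rightarrow> ('n us list \<Rightarrow>\<^sub>0 complex)" where
  "Phi_tensor_labeled lab t = (\<Sum>xs\<in>Poly_Mapping.keys t.
     smul (evK (Poly_Mapping.lookup t xs)) (apply_labels lab (map Phi xs)))"

abbreviation Us_tensor_null :: "nat \<Rightarrow> ('n us list \<Rightarrow>\<^sub>0 complex) set" where
  "Us_tensor_null m \<equiv> tens_null Qz Us us_null m"

definition Phi_Gamma_full_labeled ::
  "'n ctensor \<Rightarrow> nat \<Rightarrow> slice list \<Rightarrow> ('n us \<Rightarrow> complex) option list \<Rightarrow>
    'n weight list \<Rightarrow> ('n us list \<Rightarrow>\<^sub>0 complex)" where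
  "Phi_Gamma_full_labeled R' n D lab \<nu> =
     conv_sum (Us_tensor_null (length \<nu>)) {\<mu>. length \<mu> = n \<and> open_part lab \<mu> = \<nu>}
       (\<lambda>\<mu>. Phi_tensor_labeled lab (Gamma_full R' n D l \<mu>))"

definition ctensor_eq :: "nat \<Rightarrow> ('n weight list \<Rightarrow> ('n us list \<Rightarrow>\<^sub>0 complex)) \<Rightarrow>
    ('n weight list \<Rightarrow> ('n us list \<Rightarrow>\<^sub>0 complex)) \<Rightarrow> bool" where
  "ctensor_eq m X Y \<longleftrightarrow> (\<forall>\<nu>. length \<nu> = m \<longrightarrow> X \<nu> - Y \<nu> \<in> Us_tensor_null m)"

end

end

theory Submission
  imports Defs "HOL-Analysis.Cartesian_Space"
begin

text \<open>The map \<open>\<Phi>\<close> carries \<open>R\<close> to the R-matrix of the small quantum group: a coefficient \<open>b\<close> vanishes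
  at the root of unity as soon as one exponent reaches the order of nilpotency, and the Cartan part
  becomes a finite Fourier transform on the quotient of the weight lattice by its radical modulo \<open>l\<close>.
  Hence it also carries \<open>R\<inverse>\<close> to the small inverse, and both invariants are sums of images of the same
  products of labels. What remains is convergence. In front of an indicator of a weight every
  element of \<open>Map(\<Lambda>)\<close> is a scalar, and elements of the quantum group shift weights by finitely many amounts;
  each slot of a diagram is met exactly once along its components, so that for a given weight at
  the end of each component only finitely many indicators contribute and their sum acts as the
  identity. In a closed component continuity of \<open>\<psi> \<circ> \<Phi>\<close> makes the sum over the remaining weight finite.\<close>

section \<open>Congruence modulo a subgroup\<close>

text \<open>Everything is computed with representatives: classes never appear as objects, so
  congruence modulo \<open>qideal\<close>, \<open>us_null\<close>, \<open>tens_null\<close> and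
  \<open>tensor_null k\<close> is tracked explicitly, and every map has to be shown to respect it.
  The quotients share the locale \<open>quotient_algebra\<close>, whose product laws hold exactly on
  representatives. The square of the antipode respects the relations because it is conjugation by
  \<open>Kg two_rho'\<close>, which avoids checking the antipode on each relation.

  The obstacle that shapes the proof is that \<open>R\<close> and its inverse exist only as families
  of components, one for each tuple of indicators, whereas the small R-matrix is one finite tensor.
  The two can be compared only after multiplication by indicators, and such components can be
  multiplied together only if the intermediate sums over weights are finite. Hence every label is
  first written, modulo \<open>brace l\<close>, as a finite combination of pure tensors that are the
  same for all weights, only the coefficients varying. The level is \<open>l\<close> because
  \<open>brace l\<close> is killed by evaluation at the root of unity.\<close>

definition add_subgroup :: "'a::ab_group_add set \<Rightarrow> bool" where
  "add_subgroup Z \<longleftrightarrow> 0 \<in> Z \<and> (\<forall>x\<in>Z. \<forall>y\<in>Z. x - y \<in> Z)"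

definition eqmod :: "'a::ab_group_add set \<Rightarrow> 'a \<Rightarrow> 'a \<Rightarrow> bool" where
  "eqmod Z x y \<longleftrightarrow> x - y \<in> Z"

lemma add_subgroup_0: "add_subgroup Z \<Longrightarrow> 0 \<in> Z"
  and add_subgroup_diff: "add_subgroup Z \<Longrightarrow> x \<in> Z \<Longrightarrow> y \<in> Z \<Longrightarrow> x - y \<in> Z"
  by (auto simp: add_subgroup_def)

lemma add_subgroup_uminus: "add_subgroup Z \<Longrightarrow> x \<in> Z \<Longrightarrow> - x \<in> Z"
  using add_subgroup_diff[of Z 0 x] by (simp add: add_subgroup_0)

lemma add_subgroup_add: "add_subgroup Z \<Longrightarrow> x \<in> Z \<Longrightarrow> y \<in> Z \<Longrightarrow> x + y \<in> Z"
  using add_subgroup_diff[of Z x "- y"] by (simp add: add_subgroup_uminus)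

lemma add_subgroup_sum: "add_subgroup Z \<Longrightarrow> (\<And>i. i \<in> I \<Longrightarrow> f i \<in> Z) \<Longrightarrow> sum f I \<in> Z"
  by (induction I rule: infinite_finite_induct) (auto simp: add_subgroup_0 add_subgroup_add)

lemma eqmod_refl: "add_subgroup Z \<Longrightarrow> eqmod Z x x"
  by (simp add: eqmod_def add_subgroup_0)

lemma eqmod_sym: "add_subgroup Z \<Longrightarrow> eqmod Z x y \<Longrightarrow> eqmod Z y x"
  unfolding eqmod_def using add_subgroup_uminus by fastforce

lemma eqmod_trans: "add_subgroup Z \<Longrightarrow> eqmod Z x y \<Longrightarrow> eqmod Z y z \<Longrightarrow> eqmod Z x z"
  unfolding eqmod_def using add_subgroup_add[of Z "x - y" "y - z"] by simp

lemma eqmod_add: "add_subgroup Z \<Longrightarrow> eqmod Z x y \<Longrightarrow> eqmod Z x' y' \<Longrightarrow> eqmod Z (x + x') (y + y')"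
  unfolding eqmod_def using add_subgroup_add[of Z "x - y" "x' - y'"] by (simp add: algebra_simps)

lemma eqmod_sum: "add_subgroup Z \<Longrightarrow> (\<And>i. i \<in> I \<Longrightarrow> eqmod Z (f i) (g i)) \<Longrightarrow> eqmod Z (sum f I) (sum g I)"
  unfolding eqmod_def sum_subtractf[symmetric] by (rule add_subgroup_sum)

lemma eqmod_in: "add_subgroup Z \<Longrightarrow> eqmod Z x y \<Longrightarrow> y \<in> Z \<Longrightarrow> x \<in> Z"
  unfolding eqmod_def using add_subgroup_add[of Z "x - y" y] by simp

lemma eqmod_0: "eqmod Z x 0 \<longleftrightarrow> x \<in> Z"
  by (simp add: eqmod_def)

lemma eqmod_mono: "eqmod Z x y \<Longrightarrow> Z \<subseteq> Z' \<Longrightarrow> eqmod Z' x y"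
  by (auto simp: eqmod_def)

text \<open>\<open>conv_sum\<close> keeps exactly the summands outside \<open>Z\<close>, and a
  finite \<open>S\<close> containing their indices adds only finitely many elements of
  \<open>Z\<close>. Exhibiting \<open>S\<close> also rules out the default value 0 of a sum over an
  infinite set. The freedom to enlarge \<open>S\<close> allows several sums to be compared over one
  common box.\<close>

lemma conv_sum_eqmod:
  assumes Z: "add_subgroup Z" and S: "finite S" "S \<subseteq> I" and null: "\<And>i. i \<in> I \<Longrightarrow> i \<notin> S \<Longrightarrow> f i \<in> Z"
  shows "eqmod Z (conv_sum Z I f) (sum f S)"
proof -
  let ?T = "{i \<in> I. f i \<notin> Z}"
  have T: "?T \<subseteq> S" using null by auto
  have "sum f S = sum f ?T + sum f (S - ?T)"
    using sum.subset_diff[OF T S(1), of f] by (simp add: add.commute)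
  moreover have "sum f (S - ?T) \<in> Z"
    using S(2) by (intro add_subgroup_sum[OF Z]) auto
  ultimately show ?thesis
    unfolding eqmod_def conv_sum_def using add_subgroup_uminus[OF Z] by simp
qed

section \<open>Scalar multiplication and linear extension\<close>

lemma lookup_smul [simp]: "Poly_Mapping.lookup (smul c p) x = c * Poly_Mapping.lookup p x"
  by (simp add: smul_def map.rep_eq when_def)

lemma smul_0_left [simp]: "smul 0 p = 0"
  and smul_0_right [simp]: "smul c 0 = 0"
  and smul_1 [simp]: "smul 1 p = p"
  and smul_smul [simp]: "smul c (smul c' p) = smul (c * c') p"
  and smul_add: "smul c (p + q) = smul c p + smul c q"
  and smul_add_left: "smul (c + c') p = smul c p + smul c' p"
  and smul_diff: "smul c (p - q) = smul c p - smul c q"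
  and smul_uminus: "smul (- c) p = - smul c p"
  by (auto intro!: poly_mapping_eqI simp: lookup_add lookup_minus algebra_simps)

lemma smul_single [simp]: "smul c (Poly_Mapping.single x b) = Poly_Mapping.single x (c * b)"
  by (rule poly_mapping_eqI) (simp add: lookup_single when_def)

lemma smul_sum: "smul c (sum f I) = (\<Sum>i\<in>I. smul c (f i))"
  by (induction I rule: infinite_finite_induct) (auto simp: smul_add)

lemma smul_sum_list: "smul c (\<Sum>y\<leftarrow>ys. f y) = (\<Sum>y\<leftarrow>ys. smul c (f y))"
  by (induction ys) (auto simp: smul_add)

lemma poly_mapping_expand: "p = (\<Sum>x\<in>Poly_Mapping.keys p. Poly_Mapping.single x (Poly_Mapping.lookup p x))"
proof (rule poly_mapping_eqI)
  fix y
  show "Poly_Mapping.lookup p y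
      = Poly_Mapping.lookup (\<Sum>x\<in>Poly_Mapping.keys p. Poly_Mapping.single x (Poly_Mapping.lookup p x)) y"
    by (cases "y \<in> Poly_Mapping.keys p")
      (auto simp: lookup_sum lookup_single when_def in_keys_iff)
qed

text \<open>Finite support makes every element a sum of basis terms. The bilinear identities below
  are reduced to single basis elements in this way.\<close>

lemma pm_induct [case_names zero single add]:
  fixes p :: "'a \<Rightarrow>\<^sub>0 'b::comm_monoid_add"
  assumes 0: "P 0" and single: "\<And>x c. P (Poly_Mapping.single x c)"
    and add: "\<And>p q. P p \<Longrightarrow> P q \<Longrightarrow> P (p + q)"
  shows "P p"
proof -
  have "P (\<Sum>x\<in>S. Poly_Mapping.single x (Poly_Mapping.lookup p x))" for S
    by (induction S rule: infinite_finite_induct) (auto simp: 0 single add)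
  from this[of "Poly_Mapping.keys p"] show ?thesis
    using poly_mapping_expand[of p] by simp
qed

lemma smul_mult_left: "smul c p * q = smul c (p * q)"
  for p q :: "'a::monoid_add \<Rightarrow>\<^sub>0 'b::comm_ring_1"
  by (simp add: smul_def mult_map_scale_conv_mult mult.assoc)

lemma smul_mult_right: "p * smul c q = smul c (p * q)"
  for p q :: "'a::monoid_add \<Rightarrow>\<^sub>0 'b::comm_ring_1"
proof (induction p rule: pm_induct)
  case (single x b)
  show ?case
    by (induction q rule: pm_induct) (auto simp: smul_add algebra_simps mult_single)
qed (auto simp: algebra_simps smul_add)

lemma lin_ext_superset:
  assumes "finite S" "Poly_Mapping.keys p \<subseteq> S"
  shows "lin_ext f p = (\<Sum>x\<in>S. smul (Poly_Mapping.lookup p x) (f x))"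
  unfolding lin_ext_def using assms
  by (intro sum.mono_neutral_left) (auto simp: in_keys_iff)

lemma lin_ext_0 [simp]: "lin_ext f 0 = 0"
  by (simp add: lin_ext_def)

lemma lin_ext_single [simp]: "lin_ext f (Poly_Mapping.single x c) = smul c (f x)"
  by (simp add: lin_ext_superset[of "{x}"])

lemma lin_ext_add: "lin_ext f (p + q) = lin_ext f p + lin_ext f q"
proof -
  let ?S = "Poly_Mapping.keys p \<union> Poly_Mapping.keys q"
  have "Poly_Mapping.keys (p + q) \<subseteq> ?S" by (rule keys_add)
  then show ?thesis
    by (simp add: lin_ext_superset[of ?S] lookup_add smul_add_left sum.distrib)
qed

lemma lin_ext_smul: "lin_ext f (smul c p) = smul c (lin_ext f p)"
  by (induction p rule: pm_induct) (auto simp: smul_add lin_ext_add)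

lemma lin_ext_uminus: "lin_ext f (- p) = - lin_ext f p"
  using lin_ext_smul[of f "-1" p] by (simp add: smul_uminus)

lemma lin_ext_diff: "lin_ext f (p - q) = lin_ext f p - lin_ext f q"
  using lin_ext_add[of f p "- q"] by (simp add: lin_ext_uminus)

lemma lin_ext_sum: "lin_ext f (sum g I) = (\<Sum>i\<in>I. lin_ext f (g i))"
  by (induction I rule: infinite_finite_induct) (auto simp: lin_ext_add)

lemma lin_ext_sum_list: "lin_ext f (\<Sum>y\<leftarrow>ys. g y) = (\<Sum>y\<leftarrow>ys. lin_ext f (g y))"
  by (induction ys) (auto simp: lin_ext_add)

lemma lin_ext_fun_add: "lin_ext (\<lambda>x. f x + g x) p = lin_ext f p + lin_ext g p"
  by (simp add: lin_ext_def smul_add sum.distrib)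

lemma lin_ext_fun_smul: "lin_ext (\<lambda>x. smul c (f x)) p = smul c (lin_ext f p)"
  by (simp add: lin_ext_def smul_sum mult.commute)

lemma lin_ext_fun_0 [simp]: "lin_ext (\<lambda>x. 0) p = 0"
  by (simp add: lin_ext_def)

lemma lin_ext_cong: "(\<And>x. x \<in> Poly_Mapping.keys p \<Longrightarrow> f x = g x) \<Longrightarrow> lin_ext f p = lin_ext g p"
  by (simp add: lin_ext_def)

lemma lin_ext_lin_ext: "lin_ext g (lin_ext f p) = lin_ext (\<lambda>x. lin_ext g (f x)) p"
  by (induction p rule: pm_induct) (auto simp: lin_ext_add lin_ext_smul)

lemma lin_ext_id: "lin_ext (\<lambda>x. Poly_Mapping.single x 1) p = p"
  by (induction p rule: pm_induct) (auto simp: lin_ext_add)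

text \<open>\<open>F\<close> acts on the basis, and for tensors the basis consists of lists of
  representatives. Whether \<open>lmap F\<close> descends to the tensor power is a separate matter,
  settled below by \<open>slotwise_linear\<close>.\<close>

definition lmap :: "('a \<Rightarrow> 'c) \<Rightarrow> ('a \<Rightarrow>\<^sub>0 'b) \<Rightarrow> ('c \<Rightarrow>\<^sub>0 'b::comm_ring_1)" where
  "lmap F = lin_ext (\<lambda>x. Poly_Mapping.single (F x) 1)"

lemma lmap_0 [simp]: "lmap F 0 = 0"
  and lmap_single [simp]: "lmap F (Poly_Mapping.single x c) = Poly_Mapping.single (F x) c"
  and lmap_add: "lmap F (p + q) = lmap F p + lmap F q"
  and lmap_diff: "lmap F (p - q) = lmap F p - lmap F q"
  and lmap_smul: "lmap F (smul c p) = smul c (lmap F p)"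
  and lmap_sum: "lmap F (sum g I) = (\<Sum>i\<in>I. lmap F (g i))"
  and lmap_sum_list: "lmap F (\<Sum>y\<leftarrow>ys. h y) = (\<Sum>y\<leftarrow>ys. lmap F (h y))"
  by (auto simp: lmap_def lin_ext_add lin_ext_diff lin_ext_smul lin_ext_sum lin_ext_sum_list)

lemma lmap_lmap: "lmap G (lmap F p) = lmap (\<lambda>x. G (F x)) p"
  by (simp add: lmap_def lin_ext_lin_ext)

lemma lmap_cong: "(\<And>x. x \<in> Poly_Mapping.keys p \<Longrightarrow> f x = g x) \<Longrightarrow> lmap f p = lmap g p"
  by (simp add: lmap_def lin_ext_def)

lemma lmap_id [simp]: "lmap (\<lambda>x. x) p = p"
  by (simp add: lmap_def lin_ext_id)

lemma tens_at_eq_lmap: "tens_at i f = lmap (\<lambda>xs. xs[i := f (xs ! i)])"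
  by (rule ext) (simp add: tens_at_def lmap_def)

lemma tens_mult_add_left: "tens_mult mul (t + t') u = tens_mult mul t u + tens_mult mul t' u"
  and tens_mult_add_right: "tens_mult mul t (u + u') = tens_mult mul t u + tens_mult mul t u'"
  and tens_mult_smul_left: "tens_mult mul (smul c t) u = smul c (tens_mult mul t u)"
  and tens_mult_smul_right: "tens_mult mul t (smul c u) = smul c (tens_mult mul t u)"
  and tens_mult_0_left [simp]: "tens_mult mul 0 u = 0"
  and tens_mult_0_right [simp]: "tens_mult mul t 0 = 0"
  by (simp_all add: tens_mult_def lin_ext_add lin_ext_fun_add lin_ext_smul lin_ext_fun_smul)

lemma tens_mult_diff_left: "tens_mult mul (t - t') u = tens_mult mul t u - tens_mult mul t' u"
  using tens_mult_add_left[of mul "t - t'" t' u] by simp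

lemma tens_mult_diff_right: "tens_mult mul t (u - u') = tens_mult mul t u - tens_mult mul t u'"
  using tens_mult_add_right[of mul t "u - u'" u'] by simp

lemma tens_mult_single [simp]:
  "tens_mult mul (Poly_Mapping.single xs b) (Poly_Mapping.single ys c)
    = Poly_Mapping.single (map2 mul xs ys) (b * c)"
  by (simp add: tens_mult_def)

lemma tens_mult_single_right:
  "tens_mult mul t (Poly_Mapping.single ys c) = smul c (lmap (\<lambda>xs. map2 mul xs ys) t)"
  by (simp add: tens_mult_def lmap_def lin_ext_fun_smul[symmetric])

lemma tens_mult_single_left:
  "tens_mult mul (Poly_Mapping.single xs c) t = smul c (lmap (\<lambda>ys. map2 mul xs ys) t)"
  by (simp add: tens_mult_def lmap_def)

lemma tens_mult_sum_left: "tens_mult mul (sum f I) u = (\<Sum>i\<in>I. tens_mult mul (f i) u)"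
  by (simp add: tens_mult_def lin_ext_sum)

lemma tens_mult_sum_right: "tens_mult mul u (sum f I) = (\<Sum>i\<in>I. tens_mult mul u (f i))"
  by (induction I rule: infinite_finite_induct) (auto simp: tens_mult_add_right)

lemma tens_mult_sum_list_left: "tens_mult mul (\<Sum>y\<leftarrow>ys. f y) u = (\<Sum>y\<leftarrow>ys. tens_mult mul (f y) u)"
  by (induction ys) (auto simp: tens_mult_add_left)

lemma tens_mult_sum_list_right: "tens_mult mul u (\<Sum>y\<leftarrow>ys. f y) = (\<Sum>y\<leftarrow>ys. tens_mult mul u (f y))"
  by (induction ys) (auto simp: tens_mult_add_right)

text \<open>Lists of unequal lengths cause no trouble: \<open>map2\<close> truncates to the shortest
  list, and truncation is associative too.\<close>

lemma tens_mult_assoc: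
  assumes assoc: "\<And>x y z. mul (mul x y) z = mul x (mul y z)"
  shows "tens_mult mul (tens_mult mul t u) v = tens_mult mul t (tens_mult mul u v)"
proof (induction t rule: pm_induct)
  case (single xs b)
  show ?case
  proof (induction u rule: pm_induct)
    case (single ys c)
    show ?case
    proof (induction v rule: pm_induct)
      case (single zs e)
      have "map2 mul (map2 mul xs ys) zs = map2 mul xs (map2 mul ys zs)"
        by (rule nth_equalityI) (auto simp: assoc)
      then show ?case by (simp add: mult.assoc)
    qed (auto simp: tens_mult_add_right)
  qed (auto simp: tens_mult_add_right tens_mult_add_left)
qed (auto simp: tens_mult_add_left)

section \<open>Tensor powers of an algebra modulo an ideal\<close>

text \<open>Common setting of the generic algebra (\<open>full\<close>), its base change
  (\<open>us\<close>) and the small quantum group (\<open>sm\<close>). Bilinearity, associativity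
  and unit laws are equalities of representatives, since all products come from free objects; the
  quotient enters only through \<open>Z\<close> being closed under addition, scalars and products
  with \<open>C\<close>.\<close>

locale quotient_algebra =
  fixes B :: "'b::comm_ring_1 set" and C Z :: "('c \<Rightarrow>\<^sub>0 'b) set"
    and mul :: "('c \<Rightarrow>\<^sub>0 'b) \<Rightarrow> ('c \<Rightarrow>\<^sub>0 'b) \<Rightarrow> ('c \<Rightarrow>\<^sub>0 'b)" and one :: "'c \<Rightarrow>\<^sub>0 'b"
  assumes B1: "1 \<in> B" and B_diff: "b \<in> B \<Longrightarrow> b' \<in> B \<Longrightarrow> b - b' \<in> B"
    and B_mult: "b \<in> B \<Longrightarrow> b' \<in> B \<Longrightarrow> b * b' \<in> B"
    and C_add: "x \<in> C \<Longrightarrow> y \<in> C \<Longrightarrow> x + y \<in> C" and C_smul: "b \<in> B \<Longrightarrow> x \<in> C \<Longrightarrow> smul b x \<in> C"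
    and Z0: "0 \<in> Z" and Z_add: "x \<in> Z \<Longrightarrow> y \<in> Z \<Longrightarrow> x + y \<in> Z"
    and Z_smul: "b \<in> B \<Longrightarrow> x \<in> Z \<Longrightarrow> smul b x \<in> Z"
    and Z_C: "Z \<subseteq> C"
    and mul_C: "x \<in> C \<Longrightarrow> y \<in> C \<Longrightarrow> mul x y \<in> C" and one_C: "one \<in> C"
    and mul_Z_left: "x \<in> Z \<Longrightarrow> y \<in> C \<Longrightarrow> mul x y \<in> Z"
    and mul_Z_right: "x \<in> C \<Longrightarrow> y \<in> Z \<Longrightarrow> mul x y \<in> Z"
    and mul_add_left: "mul (x + x') y = mul x y + mul x' y"
    and mul_add_right: "mul x (y + y') = mul x y + mul x y'"
    and mul_smul_left: "mul (smul b x) y = smul b (mul x y)"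
    and mul_smul_right: "mul x (smul b y) = smul b (mul x y)"
    and mul_assoc: "mul (mul x y) z = mul x (mul y z)"
    and one_left: "mul one x = x" and one_right: "mul x one = x"
begin

abbreviation "tn \<equiv> tens B C"
abbreviation "nl \<equiv> tens_null B C Z"

lemma B0: "0 \<in> B"
  using B_diff[OF B1 B1] by simp

lemma B_uminus: "b \<in> B \<Longrightarrow> - b \<in> B"
  using B_diff[OF B0, of b] by simp

lemma B_add: "b \<in> B \<Longrightarrow> b' \<in> B \<Longrightarrow> b + b' \<in> B"
  using B_diff[of b "- b'"] B_uminus by simp

lemma C0: "0 \<in> C"
  using Z0 Z_C by auto

lemma add_subgroup_Z: "add_subgroup Z"
proof -
  have "x - y \<in> Z" if "x \<in> Z" "y \<in> Z" for x y
    using Z_add[OF that(1) Z_smul[OF B_uminus[OF B1] that(2)]] by (simp add: smul_uminus)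
  then show ?thesis by (auto simp: add_subgroup_def Z0)
qed

lemma C_sum: "(\<And>i. i \<in> I \<Longrightarrow> f i \<in> C) \<Longrightarrow> sum f I \<in> C"
  by (induction I rule: infinite_finite_induct) (auto simp: C0 C_add)

lemma add_subgroup_nl: "add_subgroup (nl m)"
proof -
  have "x - y \<in> nl m" if "x \<in> nl m" "y \<in> nl m" for x y
    using tens_null.add[OF that(1) tens_null.scale[OF B_uminus[OF B1] that(2)]]
    by (simp add: smul_uminus)
  then show ?thesis by (auto simp: add_subgroup_def intro: tens_null.zero)
qed

lemmas nl_refl = eqmod_refl[OF add_subgroup_nl]
  and nl_sym = eqmod_sym[OF add_subgroup_nl]
  and nl_trans [trans] = eqmod_trans[OF add_subgroup_nl]
  and nl_add = eqmod_add[OF add_subgroup_nl]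
  and nl_sum = eqmod_sum[OF add_subgroup_nl]

lemma nl_smul: "b \<in> B \<Longrightarrow> eqmod (nl m) t u \<Longrightarrow> eqmod (nl m) (smul b t) (smul b u)"
  unfolding eqmod_def smul_diff[symmetric] by (rule tens_null.scale)

lemma tn_0: "0 \<in> tn m"
  by (simp add: tens_def)

lemma tn_iff: "t \<in> tn m \<longleftrightarrow> (\<forall>xs \<in> Poly_Mapping.keys t. length xs = m \<and> set xs \<subseteq> C)
    \<and> (\<forall>xs. Poly_Mapping.lookup t xs \<in> B)"
  unfolding tens_def using B0 by (auto simp: in_keys_iff) 

lemma tn_single: "length xs = m \<Longrightarrow> set xs \<subseteq> C \<Longrightarrow> b \<in> B \<Longrightarrow> Poly_Mapping.single xs b \<in> tn m"
  by (auto simp: tens_def)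

lemma tn_add: "t \<in> tn m \<Longrightarrow> u \<in> tn m \<Longrightarrow> t + u \<in> tn m"
  unfolding tn_iff using keys_add[of t u] by (fastforce simp: lookup_add intro: B_add)

lemma tn_smul: "b \<in> B \<Longrightarrow> t \<in> tn m \<Longrightarrow> smul b t \<in> tn m"
  unfolding tn_iff by (auto simp: in_keys_iff B_mult)

lemma tn_diff: "t \<in> tn m \<Longrightarrow> u \<in> tn m \<Longrightarrow> t - u \<in> tn m"
  using tn_add[of t m "smul (-1) u"] tn_smul[of "-1" u m] by (simp add: smul_uminus B_uminus B1)

lemma tn_sum: "(\<And>i. i \<in> I \<Longrightarrow> f i \<in> tn m) \<Longrightarrow> sum f I \<in> tn m"
  by (induction I rule: infinite_finite_induct) (auto simp: tn_0 tn_add)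

lemma tn_sum_list: "(\<And>y. y \<in> set ys \<Longrightarrow> f y \<in> tn m) \<Longrightarrow> (\<Sum>y\<leftarrow>ys. f y) \<in> tn m"
  by (induction ys) (auto simp: tn_0 tn_add)

lemma tn_induct [consumes 1, case_names zero single add]:
  assumes t: "t \<in> tn m" and 0: "P 0"
    and single: "\<And>xs b. length xs = m \<Longrightarrow> set xs \<subseteq> C \<Longrightarrow> b \<in> B \<Longrightarrow> P (Poly_Mapping.single xs b)"
    and add: "\<And>t u. t \<in> tn m \<Longrightarrow> u \<in> tn m \<Longrightarrow> P t \<Longrightarrow> P u \<Longrightarrow> P (t + u)"
  shows "P t"
proof -
  have "P (\<Sum>x\<in>S. Poly_Mapping.single x (Poly_Mapping.lookup t x))
      \<and> (\<Sum>x\<in>S. Poly_Mapping.single x (Poly_Mapping.lookup t x)) \<in> tn m" if "S \<subseteq> Poly_Mapping.keys t" for S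
    using that
  proof (induction S rule: infinite_finite_induct)
    case (insert x S)
    then have "length x = m" "set x \<subseteq> C" "Poly_Mapping.lookup t x \<in> B"
      using t by (auto simp: tens_def)
    then show ?case using insert by (auto intro!: add single tn_add tn_single)
  qed (auto simp: 0 tn_0)
  from this[of "Poly_Mapping.keys t"] show ?thesis
    using poly_mapping_expand[of t] by simp
qed

text \<open>Universal property of the tensor power: the hypotheses send each kind of generator of
  \<open>tens_null\<close> into \<open>Z'\<close>. The target is an arbitrary subgroup stable under
  scalars, so the rule covers maps between tensor powers as well as the evaluation of functionals in
  some factors.\<close>

lemma tens_null_lift:
  assumes t: "t \<in> nl m" and Z': "add_subgroup Z'" and scale: "\<And>b z. b \<in> B \<Longrightarrow> z \<in> Z' \<Longrightarrow> smul b z \<in> Z'"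
    and additive: "\<And>xs ys x y. set xs \<subseteq> C \<Longrightarrow> set ys \<subseteq> C \<Longrightarrow> x \<in> C \<Longrightarrow> y \<in> C \<Longrightarrow>
      length xs + length ys + 1 = m \<Longrightarrow> eqmod Z' (F (xs @ (x + y) # ys)) (F (xs @ x # ys) + F (xs @ y # ys))"
    and homogeneous: "\<And>xs ys x b. set xs \<subseteq> C \<Longrightarrow> set ys \<subseteq> C \<Longrightarrow> x \<in> C \<Longrightarrow> b \<in> B \<Longrightarrow>
      length xs + length ys + 1 = m \<Longrightarrow> eqmod Z' (F (xs @ smul b x # ys)) (smul b (F (xs @ x # ys)))"
    and null: "\<And>xs ys x. set xs \<subseteq> C \<Longrightarrow> set ys \<subseteq> C \<Longrightarrow> x \<in> Z \<Longrightarrow>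
      length xs + length ys + 1 = m \<Longrightarrow> F (xs @ x # ys) \<in> Z'"
  shows "lin_ext F t \<in> Z'"
  using t
proof (induction rule: tens_null.induct)
  case (additive xs ys x y)
  from assms(4)[OF this] show ?case
    by (simp add: lin_ext_diff lin_ext_add eqmod_def diff_diff_eq)
next
  case (homogeneous xs ys x b)
  from assms(5)[OF this] show ?case
    by (simp add: lin_ext_diff eqmod_def)
qed (auto simp: add_subgroup_0[OF Z'] add_subgroup_add[OF Z'] lin_ext_add lin_ext_smul scale null)

definition linear_mod :: "(('c \<Rightarrow>\<^sub>0 'b) \<Rightarrow> ('c \<Rightarrow>\<^sub>0 'b)) \<Rightarrow> bool" where
  "linear_mod \<phi> \<longleftrightarrow> (\<forall>x\<in>C. \<phi> x \<in> C) \<and> (\<forall>x\<in>C. \<forall>y\<in>C. eqmod Z (\<phi> (x + y)) (\<phi> x + \<phi> y))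
    \<and> (\<forall>b\<in>B. \<forall>x\<in>C. eqmod Z (\<phi> (smul b x)) (smul b (\<phi> x))) \<and> (\<forall>x\<in>Z. \<phi> x \<in> Z)"

lemma linear_mod_id: "linear_mod (\<lambda>x. x)"
  by (auto simp: linear_mod_def intro!: eqmod_refl[OF add_subgroup_Z])

lemma linear_mod_mul: "a \<in> C \<Longrightarrow> b \<in> C \<Longrightarrow> linear_mod (\<lambda>x. mul a (mul x b))"
  by (auto simp: linear_mod_def mul_C mul_add_left mul_add_right mul_smul_left mul_smul_right
      mul_Z_left mul_Z_right intro!: eqmod_refl[OF add_subgroup_Z])

lemma linear_mod_mul_left: "a \<in> C \<Longrightarrow> linear_mod (\<lambda>x. mul a x)"
  using linear_mod_mul[of a one] by (simp add: one_C one_right)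

lemma linear_mod_mul_right: "b \<in> C \<Longrightarrow> linear_mod (\<lambda>x. mul x b)"
  using linear_mod_mul[of one b] by (simp add: one_C one_left)

text \<open>Additivity is applied to \<open>x = y + (x - y)\<close>, and the pure tensor with the
  null entry \<open>x - y\<close> is added back.\<close>

lemma nl_pure_cong:
  assumes xs: "set xs \<subseteq> C" and ys: "set ys \<subseteq> C" and x: "x \<in> C" "y \<in> C" and eq: "eqmod Z x y"
    and m: "length xs + length ys + 1 = m" and b: "b \<in> B"
  shows "eqmod (nl m) (Poly_Mapping.single (xs @ x # ys) b) (Poly_Mapping.single (xs @ y # ys) b)"
proof -
  have z: "x - y \<in> Z" "x - y \<in> C" using eq Z_C by (auto simp: eqmod_def)
  have "Poly_Mapping.single (xs @ (y + (x - y)) # ys) 1 - Poly_Mapping.single (xs @ y # ys) 1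
      - Poly_Mapping.single (xs @ (x - y) # ys) 1 + Poly_Mapping.single (xs @ (x - y) # ys) 1 \<in> nl m"
    using z by (intro tens_null.add[OF tens_null.additive tens_null.null] xs ys x m) auto
  then have "eqmod (nl m) (Poly_Mapping.single (xs @ x # ys) 1) (Poly_Mapping.single (xs @ y # ys) 1)"
    by (simp add: eqmod_def)
  from nl_smul[OF b this] show ?thesis by simp
qed

lemma nl_pure_null:
  assumes "set xs \<subseteq> C" "set ys \<subseteq> C" "x \<in> Z" "length xs + length ys + 1 = m" "b \<in> B"
  shows "Poly_Mapping.single (xs @ x # ys) b \<in> nl m"
  using tens_null.scale[OF assms(5) tens_null.null[of xs C ys x Z m B]] assms Z_C by auto

lemma nl_pure_add:
  assumes "set xs \<subseteq> C" "set ys \<subseteq> C" "x \<in> C" "y \<in> C" "length xs + length ys + 1 = m"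
  shows "eqmod (nl m) (Poly_Mapping.single (xs @ (x + y) # ys) 1)
    (Poly_Mapping.single (xs @ x # ys) 1 + Poly_Mapping.single (xs @ y # ys) 1)"
  using tens_null.additive[OF assms] by (simp add: eqmod_def diff_diff_eq)

lemma nl_pure_smul:
  assumes "set xs \<subseteq> C" "set ys \<subseteq> C" "x \<in> C" "b \<in> B" "length xs + length ys + 1 = m"
  shows "eqmod (nl m) (Poly_Mapping.single (xs @ smul b x # ys) 1) (Poly_Mapping.single (xs @ x # ys) b)"
  using tens_null.homogeneous[OF assms] by (simp add: eqmod_def)

lemma nl_pure_sum:
  assumes xs: "set xs \<subseteq> C" and ys: "set ys \<subseteq> C" and f: "\<And>i. i \<in> I \<Longrightarrow> f i \<in> C"
    and m: "length xs + length ys + 1 = m" and b: "b \<in> B"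
  shows "eqmod (nl m) (Poly_Mapping.single (xs @ sum f I # ys) b) (\<Sum>i\<in>I. Poly_Mapping.single (xs @ f i # ys) b)"
proof -
  have "eqmod (nl m) (Poly_Mapping.single (xs @ sum f I # ys) 1) (\<Sum>i\<in>I. Poly_Mapping.single (xs @ f i # ys) 1)"
    using f
  proof (induction I rule: infinite_finite_induct)
    case (insert i I)
    show ?case
      using nl_trans[OF nl_pure_add[OF xs ys _ _ m] nl_add[OF nl_refl insert.IH]] insert
      by (simp add: C_sum)
  next
    case (infinite I)
    then show ?case using nl_pure_null[OF xs ys Z0 m B1] by (simp add: eqmod_0)
  next
    case empty
    then show ?case using nl_pure_null[OF xs ys Z0 m B1] by (simp add: eqmod_0)
  qed
  from nl_smul[OF b this] show ?thesis by (simp add: smul_sum)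
qed

text \<open>A map of pure tensors that is linear in every argument, each argument entering exactly one factor
  of the value.\<close>

definition slotwise_linear :: "nat \<Rightarrow> nat \<Rightarrow> (('c \<Rightarrow>\<^sub>0 'b) list \<Rightarrow> ('c \<Rightarrow>\<^sub>0 'b) list) \<Rightarrow> bool" where
  "slotwise_linear m m' F \<longleftrightarrow> (\<forall>xs ys. set xs \<subseteq> C \<longrightarrow> set ys \<subseteq> C \<longrightarrow> length xs + length ys + 1 = m \<longrightarrow>
    (\<exists>xs' ys' \<phi>. set xs' \<subseteq> C \<and> set ys' \<subseteq> C \<and> length xs' + length ys' + 1 = m' \<and> linear_mod \<phi>
      \<and> (\<forall>y\<in>C. F (xs @ y # ys) = xs' @ \<phi> y # ys')))"

lemma slotwise_linearE:
  assumes "slotwise_linear m m' F" "set xs \<subseteq> C" "set ys \<subseteq> C" "length xs + length ys + 1 = m"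
  obtains xs' ys' \<phi> where "set xs' \<subseteq> C" "set ys' \<subseteq> C" "length xs' + length ys' + 1 = m'" "linear_mod \<phi>"
    "\<And>y. y \<in> C \<Longrightarrow> F (xs @ y # ys) = xs' @ \<phi> y # ys'"
  using assms unfolding slotwise_linear_def by metis

text \<open>A generator of \<open>tens_null\<close> concerns a single argument. This argument enters
  a single factor of the value through a linear map, so the generator goes to a relation of the same
  kind in that factor.\<close>

lemma lmap_nl:
  assumes F: "slotwise_linear m m' F" and t: "t \<in> nl m"
  shows "lmap F t \<in> nl m'"
  unfolding lmap_def
proof (rule tens_null_lift[OF t add_subgroup_nl tens_null.scale])
  fix xs ys x y assume h: "set xs \<subseteq> C" "set ys \<subseteq> C" "x \<in> C" "y \<in> C" "length xs + length ys + 1 = m"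
  obtain xs' ys' \<phi> where 1: "set xs' \<subseteq> C" "set ys' \<subseteq> C" "length xs' + length ys' + 1 = m'" "linear_mod \<phi>"
    and 2: "\<And>y. y \<in> C \<Longrightarrow> F (xs @ y # ys) = xs' @ \<phi> y # ys'"
    by (rule slotwise_linearE[OF F h(1,2,5)]) blast
  have "eqmod (nl m') (Poly_Mapping.single (xs' @ \<phi> (x + y) # ys') 1)
      (Poly_Mapping.single (xs' @ (\<phi> x + \<phi> y) # ys') 1)"
    using 1 h by (intro nl_pure_cong B1) (auto simp: linear_mod_def C_add)
  also have "eqmod (nl m') \<dots> (Poly_Mapping.single (xs' @ \<phi> x # ys') 1 + Poly_Mapping.single (xs' @ \<phi> y # ys') 1)"
    using 1 h by (intro nl_pure_add) (auto simp: linear_mod_def)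
  finally show "eqmod (nl m') (Poly_Mapping.single (F (xs @ (x + y) # ys)) 1)
      (Poly_Mapping.single (F (xs @ x # ys)) 1 + Poly_Mapping.single (F (xs @ y # ys)) 1)"
    using h by (simp add: 2 C_add)
next
  fix xs ys x b assume h: "set xs \<subseteq> C" "set ys \<subseteq> C" "x \<in> C" "b \<in> B" "length xs + length ys + 1 = m"
  obtain xs' ys' \<phi> where 1: "set xs' \<subseteq> C" "set ys' \<subseteq> C" "length xs' + length ys' + 1 = m'" "linear_mod \<phi>"
    and 2: "\<And>y. y \<in> C \<Longrightarrow> F (xs @ y # ys) = xs' @ \<phi> y # ys'"
    by (rule slotwise_linearE[OF F h(1,2,5)]) blast
  have "eqmod (nl m') (Poly_Mapping.single (xs' @ \<phi> (smul b x) # ys') 1)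
      (Poly_Mapping.single (xs' @ smul b (\<phi> x) # ys') 1)"
    using 1 h by (intro nl_pure_cong B1) (auto simp: linear_mod_def C_smul)
  also have "eqmod (nl m') \<dots> (Poly_Mapping.single (xs' @ \<phi> x # ys') b)"
    using 1 h by (intro nl_pure_smul) (auto simp: linear_mod_def)
  finally show "eqmod (nl m') (Poly_Mapping.single (F (xs @ smul b x # ys)) 1)
      (smul b (Poly_Mapping.single (F (xs @ x # ys)) 1))"
    using h by (simp add: 2 C_smul)
next
  fix xs ys x assume h: "set xs \<subseteq> C" "set ys \<subseteq> C" "x \<in> Z" "length xs + length ys + 1 = m"
  obtain xs' ys' \<phi> where 1: "set xs' \<subseteq> C" "set ys' \<subseteq> C" "length xs' + length ys' + 1 = m'" "linear_mod \<phi>"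
    and 2: "\<And>y. y \<in> C \<Longrightarrow> F (xs @ y # ys) = xs' @ \<phi> y # ys'"
    by (rule slotwise_linearE[OF F h(1,2,4)]) blast
  have "x \<in> C" using h Z_C by auto
  with 1 h show "Poly_Mapping.single (F (xs @ x # ys)) 1 \<in> nl m'"
    by (auto simp: 2 linear_mod_def intro!: nl_pure_null B1)
qed

lemma lmap_cong_nl: "slotwise_linear m m' F \<Longrightarrow> eqmod (nl m) t u \<Longrightarrow> eqmod (nl m') (lmap F t) (lmap F u)"
  unfolding eqmod_def lmap_diff[symmetric] by (rule lmap_nl)

lemma tn_lmap:
  assumes t: "t \<in> tn m" and F: "\<And>xs. length xs = m \<Longrightarrow> set xs \<subseteq> C \<Longrightarrow> length (F xs) = m' \<and> set (F xs) \<subseteq> C"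
  shows "lmap F t \<in> tn m'"
  using t by (induction t rule: tn_induct) (auto simp: tn_0 lmap_add F F[THEN conjunct2, THEN subsetD] intro!: tn_single tn_add)

lemma slotwise_linear_map2:
  assumes lin: "\<And>i. i < m \<Longrightarrow> linear_mod (\<lambda>x. f x (as ! i))" and len: "length as = m"
  shows "slotwise_linear m m (\<lambda>xs. map2 f xs as)"
  unfolding slotwise_linear_def
proof (intro allI impI)
  fix xs ys assume h: "set xs \<subseteq> C" "set ys \<subseteq> C" "length xs + length ys + 1 = m"
  let ?i = "length xs"
  let ?b = "take ?i as" and ?c = "drop (Suc ?i) as"
  have as: "as = ?b @ as ! ?i # ?c" using h len by (simp add: id_take_nth_drop)
  have C: "set (map2 f us bs) \<subseteq> C" if "set us \<subseteq> C" "\<And>b. b \<in> set bs \<Longrightarrow> b \<in> set as" for us bs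
  proof
    fix z assume "z \<in> set (map2 f us bs)"
    then obtain u b where z: "z = f u b" "u \<in> set us" "b \<in> set bs"
      by (auto dest: set_zip_leftD set_zip_rightD)
    from that(2)[OF z(3)] obtain i where "i < m" "b = as ! i"
      using len by (auto simp: in_set_conv_nth)
    then show "z \<in> C" using lin[of i] z that(1) by (auto simp: linear_mod_def)
  qed
  have 1: "map2 f (xs @ y # ys) as = map2 f xs ?b @ f y (as ! ?i) # map2 f ys ?c" for y
  proof -
    have "map2 f (xs @ y # ys) as = map2 f (xs @ y # ys) (?b @ as ! ?i # ?c)"
      using as by simp
    also have "\<dots> = map2 f xs ?b @ f y (as ! ?i) # map2 f ys ?c"
      using h len by (subst zip_append) simp_all
    finally show ?thesis .
  qed
  have 2: "set (map2 f xs ?b) \<subseteq> C"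
    by (rule C[OF h(1)]) (rule in_set_takeD)
  have 3: "set (map2 f ys ?c) \<subseteq> C"
    by (rule C[OF h(2)]) (rule in_set_dropD)
  have 4: "length (map2 f xs ?b) + length (map2 f ys ?c) + 1 = m"
    using h len by simp
  have 5: "linear_mod (\<lambda>x. f x (as ! ?i))"
    using h by (intro lin) simp
  show "\<exists>xs' ys' \<phi>. set xs' \<subseteq> C \<and> set ys' \<subseteq> C \<and> length xs' + length ys' + 1 = m \<and> linear_mod \<phi>
      \<and> (\<forall>y\<in>C. map2 f (xs @ y # ys) as = xs' @ \<phi> y # ys')"
    using 1 2 3 4 5 by blast
qed

lemma tens_mult_nl_left:
  assumes t: "t \<in> nl m" and u: "u \<in> tn m"
  shows "tens_mult mul t u \<in> nl m"
  using u
proof (induction u rule: tn_induct)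
  case (single ys b)
  then have "slotwise_linear m m (\<lambda>xs. map2 mul xs ys)"
    by (intro slotwise_linear_map2 linear_mod_mul_right) (auto simp: in_set_conv_nth subset_iff)
  then show ?case using single t by (auto simp: tens_mult_single_right intro!: tens_null.scale lmap_nl)
qed (auto simp: tens_mult_add_right intro: tens_null.intros)

lemma tens_mult_nl_right:
  assumes t: "t \<in> tn m" and u: "u \<in> nl m"
  shows "tens_mult mul t u \<in> nl m"
  using t
proof (induction t rule: tn_induct)
  case (single xs b)
  \<comment> \<open>The varying list has to come first for \<open>slotwise_linear_map2\<close>, so
    the arguments of \<open>mul\<close> are exchanged.\<close>
  have "slotwise_linear m m (\<lambda>ys. map2 (\<lambda>y x. mul x y) ys xs)"
    using single by (intro slotwise_linear_map2 linear_mod_mul_left) (auto simp: in_set_conv_nth subset_iff)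
  moreover have "map2 (\<lambda>y x. mul x y) ys xs = map2 mul xs ys" for ys
    by (rule nth_equalityI) auto
  ultimately show ?case
    using single u by (auto simp: tens_mult_single_left intro!: tens_null.scale lmap_nl)
qed (auto simp: tens_mult_add_left intro: tens_null.intros)

text \<open>The factors are replaced one after the other, the left one first. Hence \<open>u\<close>
  and \<open>t'\<close> are the two factors held fixed, which explains the asymmetric membership
  hypotheses.\<close>

lemma tens_mult_cong_nl:
  assumes "eqmod (nl m) t t'" "eqmod (nl m) u u'" "t' \<in> tn m" "u \<in> tn m"
  shows "eqmod (nl m) (tens_mult mul t u) (tens_mult mul t' u')"
proof -
  have "eqmod (nl m) (tens_mult mul t u) (tens_mult mul t' u)"
    using assms unfolding eqmod_def tens_mult_diff_left[symmetric] by (intro tens_mult_nl_left)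
  also have "eqmod (nl m) \<dots> (tens_mult mul t' u')"
    using assms unfolding eqmod_def tens_mult_diff_right[symmetric] by (intro tens_mult_nl_right)
  finally show ?thesis .
qed

lemma tn_tens_mult:
  assumes t: "t \<in> tn m" and u: "u \<in> tn m"
  shows "tens_mult mul t u \<in> tn m"
  using t
proof (induction t rule: tn_induct)
  case (single xs b)
  show ?case using u
  proof (induction u rule: tn_induct)
    case (single ys c)
    have "set (map2 mul xs ys) \<subseteq> C"
      using single(2) \<open>set xs \<subseteq> C\<close> by (fastforce intro!: mul_C dest: set_zip_leftD set_zip_rightD)
    then show ?case using single \<open>length xs = m\<close> \<open>b \<in> B\<close>
      by (auto intro!: tn_single B_mult)
  qed (auto simp: tens_mult_add_right tn_0 tn_add)
qed (auto simp: tens_mult_add_left tn_0 tn_add)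

lemma times_single_right: "t * Poly_Mapping.single ys b = smul b (lmap (\<lambda>xs. xs @ ys) t)"
  by (induction t rule: pm_induct)
    (auto simp: mult_single plus_list_def lmap_add smul_add algebra_simps)

lemma times_single_left: "Poly_Mapping.single xs b * t = smul b (lmap (\<lambda>ys. xs @ ys) t)"
  by (induction t rule: pm_induct)
    (auto simp: mult_single plus_list_def lmap_add smul_add algebra_simps)

lemma tn_times:
  assumes t: "t \<in> tn m" and u: "u \<in> tn m'"
  shows "t * u \<in> tn (m + m')"
  using u
proof (induction u rule: tn_induct)
  case (single ys b)
  then show ?case by (auto simp: times_single_right intro!: tn_smul tn_lmap[OF t])
qed (auto simp: distrib_left tn_0 tn_add)

lemma times_nl_left:
  assumes t: "t \<in> nl m" and u: "u \<in> tn m'"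
  shows "t * u \<in> nl (m + m')"
  using u
proof (induction u rule: tn_induct)
  case (single ys b)
  then have "slotwise_linear m (m + m') (\<lambda>xs. xs @ ys)"
    unfolding slotwise_linear_def
  proof (intro allI impI)
    fix as bs assume "set as \<subseteq> C" "set bs \<subseteq> C" "length as + length bs + 1 = m"
    with single show "\<exists>xs' ys' \<phi>. set xs' \<subseteq> C \<and> set ys' \<subseteq> C \<and> length xs' + length ys' + 1 = m + m' \<and> linear_mod \<phi>
      \<and> (\<forall>y\<in>C. (as @ y # bs) @ ys = xs' @ \<phi> y # ys')"
      by (intro exI[of _ as] exI[of _ "bs @ ys"] exI[of _ "\<lambda>x. x"]) (auto simp: linear_mod_id)
  qed
  then show ?case using single t by (auto simp: times_single_right intro!: tens_null.scale lmap_nl)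
qed (auto simp: distrib_left intro: tens_null.intros)

lemma times_nl_right:
  assumes t: "t \<in> tn m" and u: "u \<in> nl m'"
  shows "t * u \<in> nl (m + m')"
  using t
proof (induction t rule: tn_induct)
  case (single xs b)
  then have "slotwise_linear m' (m + m') (\<lambda>ys. xs @ ys)"
    unfolding slotwise_linear_def
  proof (intro allI impI)
    fix as bs assume "set as \<subseteq> C" "set bs \<subseteq> C" "length as + length bs + 1 = m'"
    with single show "\<exists>xs' ys' \<phi>. set xs' \<subseteq> C \<and> set ys' \<subseteq> C \<and> length xs' + length ys' + 1 = m + m' \<and> linear_mod \<phi>
      \<and> (\<forall>y\<in>C. xs @ (as @ y # bs) = xs' @ \<phi> y # ys')"
      by (intro exI[of _ "xs @ as"] exI[of _ bs] exI[of _ "\<lambda>x. x"]) (auto simp: linear_mod_id)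
  qed
  then show ?case using single u by (auto simp: times_single_left intro!: tens_null.scale lmap_nl)
qed (auto simp: distrib_right intro: tens_null.intros)

lemma times_cong_nl:
  assumes "eqmod (nl m) t t'" "eqmod (nl m') u u'" "t' \<in> tn m" "u \<in> tn m'"
  shows "eqmod (nl (m + m')) (t * u) (t' * u')"
proof -
  have "eqmod (nl (m + m')) (t * u) (t' * u)"
    using assms unfolding eqmod_def left_diff_distrib[symmetric] by (intro times_nl_left)
  also have "eqmod (nl (m + m')) \<dots> (t' * u')"
    using assms unfolding eqmod_def right_diff_distrib[symmetric] by (intro times_nl_right)
  finally show ?thesis .
qed

lemma slotwise_linear_list_update:
  assumes lin: "linear_mod f"
  shows "slotwise_linear m m (\<lambda>xs. xs[i := f (xs ! i)])"
  unfolding slotwise_linear_def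
proof (intro allI impI)
  fix as bs assume h: "set as \<subseteq> C" "set bs \<subseteq> C" "length as + length bs + 1 = m"
  have fC: "f x \<in> C" if "x \<in> C" for x using lin that by (auto simp: linear_mod_def)
  \<comment> \<open>The updated position is compared with the position of the varying argument. If
    they differ, the update changes a constant entry (or nothing, when \<open>i\<close> exceeds the
    list) and the argument passes through unchanged; if they agree, it passes through
    \<open>f\<close>.\<close>
  consider "i < length as" | "i = length as" | k where "i = Suc (length as + k)"
    by (metis less_imp_Suc_add linorder_neqE_nat)
  then show "\<exists>xs' ys' \<phi>. set xs' \<subseteq> C \<and> set ys' \<subseteq> C \<and> length xs' + length ys' + 1 = m \<and> linear_mod \<phi>
      \<and> (\<forall>y\<in>C. (as @ y # bs)[i := f ((as @ y # bs) ! i)] = xs' @ \<phi> y # ys')"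
  proof cases
    case 1
    then have "set (as[i := f (as ! i)]) \<subseteq> C"
      using h fC[of "as ! i"] 1 by (intro set_update_subsetI) (auto dest: nth_mem)
    then show ?thesis using 1 h
      by (intro exI[of _ "as[i := f (as ! i)]"] exI[of _ bs] exI[of _ "\<lambda>x. x"])
        (auto simp: linear_mod_id nth_append list_update_append)
  next
    case 2
    then show ?thesis using h lin
      by (intro exI[of _ as] exI[of _ bs] exI[of _ f]) auto
  next
    case 3
    have "set (bs[k := f (bs ! k)]) \<subseteq> C"
    proof (cases "k < length bs")
      case True
      then show ?thesis using h fC[of "bs ! k"] by (intro set_update_subsetI) (auto dest: nth_mem)
    qed (use h in \<open>auto simp: list_update_beyond\<close>)
    then show ?thesis using 3 h
      by (intro exI[of _ as] exI[of _ "bs[k := f (bs ! k)]"] exI[of _ "\<lambda>x. x"])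
        (auto simp: linear_mod_id nth_append list_update_append)
  qed
qed

end

section \<open>Scalars\<close>

lemma emb_add: "emb (x + y) = emb x + emb y"
  and emb_mult: "emb (x * y) = emb x * emb y"
  and emb_diff: "emb (x - y) = emb x - emb y"
  and emb_0 [simp]: "emb 0 = 0"
  and emb_1 [simp]: "emb 1 = 1"
  and emb_uminus: "emb (- x) = - emb x"
  by (simp_all add: emb_def Zero_fract_def One_fract_def)

lemma emb_eq_iff: "emb x = emb y \<longleftrightarrow> x = y"
  by (simp add: emb_def eq_fract)

lemma inj_emb: "inj emb"
  by (simp add: inj_def emb_eq_iff)

lemma unemb_emb [simp]: "unemb (emb x) = x"
  by (simp add: unemb_def inj_emb)

lemma emb_unemb: "x \<in> As \<Longrightarrow> emb (unemb x) = x"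
  by (auto simp: As_def)

lemma emb_in_As [simp]: "emb x \<in> As"
  by (simp add: As_def)

lemma emb_prod: "emb (prod f I) = (\<Prod>i\<in>I. emb (f i))"
  by (induction I rule: infinite_finite_induct) (auto simp: emb_mult)

lemma s_pow_add: "s_pow (j + k) = s_pow j * s_pow k"
  by (simp add: s_pow_def mult_single)

lemma s_pow_0 [simp]: "s_pow 0 = 1"
  by (simp add: s_pow_def)

lemma s_pow_eq_iff: "s_pow j = s_pow k \<longleftrightarrow> j = k"
  by (metis lookup_single_eq lookup_single_not_eq one_neq_zero s_pow_def)

section \<open>The pairing\<close>

lemma common_denominator:
  assumes "finite (Q :: rat set)"
  shows "\<exists>k::nat. 0 < k \<and> (\<forall>r\<in>Q. of_nat k * r \<in> \<int>)"
  using assms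
proof (induction Q rule: finite_induct)
  case (insert r Q)
  then obtain k :: nat where k: "0 < k" "\<forall>r\<in>Q. of_nat k * r \<in> \<int>" by auto
  obtain p b where pb: "quotient_of r = (p, b)" by (cases "quotient_of r")
  have b: "b > 0" using quotient_of_denom_pos[OF pb] .
  have r: "r = of_int p / of_int b" using quotient_of_div[OF pb] .
  have nb: "of_nat (nat b) = (of_int b :: rat)" using b by simp
  have 1: "of_nat (k * nat b) * r = of_int (int k * p)"
    using b by (simp add: r nb)
  have 2: "of_nat (k * nat b) * t = of_int b * (of_nat k * t)" for t :: rat
    by (simp only: of_nat_mult nb mult_ac)
  have "of_nat (k * nat b) * t \<in> \<int>" if "t \<in> insert r Q" for t
  proof (cases "t = r")
    case True
    show ?thesis unfolding True 1 by (rule Ints_of_int)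
  next
    case False
    then show ?thesis using that k unfolding 2 by (intro Ints_mult[OF Ints_of_int]) auto
  qed
  then have "\<forall>t\<in>insert r Q. of_nat (k * nat b) * t \<in> \<int>" by blast
  moreover have "0 < k * nat b" using k b by simp
  ultimately show ?case by blast
qed auto

context root_datum
begin

lemma d_pos: "0 < d i"
  and d_symm: "int (d i) * a i j = int (d j) * a j i"
  using symm by (auto simp: symmetrizer_def)

text \<open>On a vector killed by the Cartan matrix the symmetrized quadratic form vanishes, so
  positive definiteness forces the vector to be 0.\<close>

lemma cartan_kernel:
  fixes c :: "'n \<Rightarrow> rat"
  assumes "\<And>i. (\<Sum>j\<in>UNIV. c j * of_int (a i j)) = 0"
  shows "c j = 0"
proof -
  let ?x = "\<lambda>j. of_rat (c j) :: real"
  have 0: "(\<Sum>j\<in>UNIV. of_int (a i j) * ?x j) = 0" for i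
  proof -
    have "of_rat (\<Sum>j\<in>UNIV. c j * of_int (a i j)) = (0::real)" using assms by simp
    then show ?thesis by (simp add: of_rat_sum of_rat_mult mult.commute)
  qed
  have "(\<Sum>i\<in>UNIV. \<Sum>j\<in>UNIV. of_nat (d i) * of_int (a i j) * ?x i * ?x j)
      = (\<Sum>i\<in>UNIV. of_nat (d i) * ?x i * (\<Sum>j\<in>UNIV. of_int (a i j) * ?x j))"
    by (simp add: sum_distrib_left algebra_simps)
  then have "\<not> (\<Sum>i\<in>UNIV. \<Sum>j\<in>UNIV. of_nat (d i) * of_int (a i j) * ?x i * ?x j) > 0"
    by (simp add: 0)
  then have "?x = 0" using symm unfolding symmetrizer_def by blast
  then have "?x j = 0" by (metis zero_fun_apply)
  then show ?thesis by simp
qed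

text \<open>A square matrix with trivial kernel is invertible on both sides: over the rationals the
  simple roots form a basis. This makes the definite description in \<open>root_coords\<close>
  meaningful.\<close>

lemma root_coords_ex1:
  fixes x :: "'n \<Rightarrow> int"
  shows "\<exists>!c. \<forall>i. (\<Sum>j\<in>UNIV. c j * of_int (\<alpha> j i)) = (of_int (x i) :: rat)"
proof -
  define A :: "rat^'n^'n" where "A = (\<chi> i j. of_int (a i j))"
  have Av: "(A *v v) $ i = (\<Sum>j\<in>UNIV. v $ j * of_int (a i j))" for v i
    by (simp add: A_def matrix_vector_mult_def mult.commute)
  have "\<forall>v. A *v v = 0 \<longrightarrow> v = 0"
  proof (intro allI impI)
    fix v assume "A *v v = 0"
    then have "(\<Sum>j\<in>UNIV. v $ j * of_int (a i j)) = 0" for i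
      using Av[of v i] by simp
    then have "v $ j = 0" for j using cartan_kernel[of "\<lambda>j. v $ j" j] by simp
    then show "v = 0" by (simp add: vec_eq_iff)
  qed
  then obtain B where "B ** A = mat 1" using matrix_left_invertible_ker[of A] by auto
  then have "A ** B = mat 1" using matrix_left_right_inverse by auto
  then have "A *v (B *v y) = y" for y by (simp add: matrix_vector_mul_assoc)
  then have "(\<Sum>j\<in>UNIV. (B *v (\<chi> i. of_int (x i))) $ j * of_int (a i j)) = of_int (x i)" for i
    using Av[of "B *v (\<chi> i. of_int (x i))" i] by simp
  then have ex: "\<exists>c. \<forall>i. (\<Sum>j\<in>UNIV. c j * of_int (\<alpha> j i)) = (of_int (x i) :: rat)"
    unfolding simple_root_def by blast
  moreover have "c = c'" if "\<forall>i. (\<Sum>j\<in>UNIV. c j * of_int (\<alpha> j i)) = (of_int (x i) :: rat)"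
    "\<forall>i. (\<Sum>j\<in>UNIV. c' j * of_int (\<alpha> j i)) = (of_int (x i) :: rat)" for c c'
  proof
    fix j
    have "(\<Sum>j\<in>UNIV. (c j - c' j) * of_int (a i j)) = 0" for i
      using that by (simp add: left_diff_distrib sum_subtractf simple_root_def)
    from cartan_kernel[of "\<lambda>j. c j - c' j" j, OF this] show "c j = c' j" by simp
  qed
  ultimately show ?thesis by blast
qed

lemma root_coords: "(\<Sum>j\<in>UNIV. root_coords x j * of_int (a i j)) = of_int (x i)"
  using theI'[OF root_coords_ex1[of x]] unfolding root_coords_def simple_root_def by blast

lemma root_coords_unique: "(\<And>i. (\<Sum>j\<in>UNIV. c j * of_int (a i j)) = of_int (x i)) \<Longrightarrow> root_coords x = c"
  unfolding root_coords_def by (rule the1_equality[OF root_coords_ex1]) (auto simp: simple_root_def)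

lemma root_coords_add: "root_coords (x + y) = (\<lambda>j. root_coords x j + root_coords y j)"
  by (rule root_coords_unique) (simp add: distrib_right sum.distrib root_coords)

text \<open>Only the finitely many root coordinates of the fundamental weights enter, and these have
  a common denominator. The existence of \<open>L\<close> rests on this.\<close>

lemma root_coords_expand:
  "root_coords x = (\<lambda>j. \<Sum>i\<in>UNIV. of_int (x i) * root_coords (\<lambda>k. if k = i then 1 else 0) j)"
proof (rule root_coords_unique)
  fix k
  have "(\<Sum>j\<in>UNIV. (\<Sum>i\<in>UNIV. of_int (x i) * root_coords (\<lambda>k. if k = i then 1 else 0) j) * of_int (a k j))
    = (\<Sum>i\<in>UNIV. of_int (x i) * (\<Sum>j\<in>UNIV. root_coords (\<lambda>k. if k = i then 1 else 0) j * of_int (a k j)))"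
    unfolding sum_distrib_right sum_distrib_left by (subst sum.swap) (simp add: mult.assoc)
  also have "\<dots> = of_int (x k)" by (simp add: root_coords if_distrib cong: if_cong)
  finally show "(\<Sum>j\<in>UNIV. (\<Sum>i\<in>UNIV. of_int (x i) * root_coords (\<lambda>k. if k = i then 1 else 0) j) * of_int (a k j))
    = of_int (x k)" .
qed

lemma root_coords_simple_root: "root_coords (\<alpha> i) = (\<lambda>j. if j = i then 1 else 0)"
  by (rule root_coords_unique) (simp add: simple_root_def if_distrib[of "\<lambda>c. c * _"] cong: if_cong)

lemma pairing_add_left: "pairing (x + x') y = pairing x y + pairing x' y"
  by (simp add: pairing_def root_coords_add distrib_right sum.distrib)

text \<open>Once both weights are written in root coordinates, the pairing is the bilinear form with
  the symmetric matrix \<open>d i * a i j\<close>.\<close>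

lemma pairing_commute: "pairing x y = pairing y x"
proof -
  have expand: "pairing x y = (\<Sum>j\<in>UNIV. \<Sum>k\<in>UNIV. root_coords x j * (of_nat (d j) * of_int (a j k)) * root_coords y k)"
    for x y
    unfolding pairing_def
    by (subst root_coords[of y, symmetric]) (simp add: sum_distrib_left algebra_simps)
  have symm': "of_nat (d j) * of_int (a j k) = (of_nat (d k) * of_int (a k j) :: rat)" for j k
  proof -
    have "of_int (int (d j) * a j k) = (of_int (int (d k) * a k j) :: rat)" by (simp only: d_symm)
    then show ?thesis by simp
  qed
  show ?thesis
    unfolding expand
    by (subst sum.swap, intro sum.cong refl) (subst symm', simp only: mult_ac)
qed

lemma pairing_add_right: "pairing x (y + y') = pairing x y + pairing x y'"
  using pairing_add_left[of y y' x] by (simp add: pairing_commute)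

lemma pairing_simple_root: "pairing (\<alpha> i) y = of_nat (d i) * of_int (y i)"
  by (simp add: pairing_def root_coords_simple_root if_distrib[of "\<lambda>c. c * _"] cong: if_cong)

lemma L_exists: "\<exists>k. 0 < k \<and> (\<forall>x y. of_nat k * pairing x y \<in> \<int>)"
proof -
  have "finite (range (\<lambda>(i, j). root_coords (\<lambda>k. if k = i then 1 else 0) j))" by simp
  from common_denominator[OF this] obtain k :: nat
    where k: "0 < k" "\<And>i j. of_nat k * root_coords (\<lambda>k. if k = i then 1 else 0) j \<in> \<int>" by auto
  have "of_nat k * root_coords x j \<in> \<int>" for x j
    by (subst root_coords_expand) (auto simp: sum_distrib_left mult.left_commute[of "of_nat k"] intro!: Ints_sum Ints_mult k)
  then have "of_nat k * pairing x y \<in> \<int>" for x y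
    unfolding pairing_def sum_distrib_left mult.assoc[symmetric]
    by (intro Ints_sum Ints_mult[OF Ints_mult[OF _ Ints_of_nat] Ints_of_int])
  with k(1) show ?thesis by blast
qed

lemma L_pos: "0 < L"
  and L_pairing_int: "of_nat L * pairing x y \<in> \<int>"
  using LeastI_ex[OF L_exists] unfolding L_def by auto

text \<open>By the choice of \<open>L\<close> the floor in \<open>Lpairing\<close> is taken of an
  integer. Identities for \<open>Lpairing\<close> can therefore be proved in the rationals.\<close>

lemma of_int_Lpairing: "of_int (Lpairing x y) = of_nat L * pairing x y"
  using L_pairing_int[of x y] by (auto simp: Lpairing_def elim!: Ints_cases)

lemma Lpairing_add_left: "Lpairing (x + x') y = Lpairing x y + Lpairing x' y"
  and Lpairing_add_right: "Lpairing x (y + y') = Lpairing x y + Lpairing x y'"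
  and Lpairing_commute: "Lpairing x y = Lpairing y x"
  and Lpairing_simple_root: "Lpairing (\<alpha> i) y = int L * int (d i) * y i"
proof -
  have [simp]: "j = k" if "(of_int j :: rat) = of_int k" for j k using that by simp
  show "Lpairing (x + x') y = Lpairing x y + Lpairing x' y"
    by (rule of_int_eq_iff[where ?'a = rat, THEN iffD1]) (simp add: of_int_Lpairing pairing_add_left algebra_simps)
  show "Lpairing x (y + y') = Lpairing x y + Lpairing x y'"
    by (rule of_int_eq_iff[where ?'a = rat, THEN iffD1]) (simp add: of_int_Lpairing pairing_add_right algebra_simps)
  show "Lpairing x y = Lpairing y x"
    by (rule of_int_eq_iff[where ?'a = rat, THEN iffD1]) (simp add: of_int_Lpairing pairing_commute)
  show "Lpairing (\<alpha> i) y = int L * int (d i) * y i"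
    by (rule of_int_eq_iff[where ?'a = rat, THEN iffD1]) (simp add: of_int_Lpairing pairing_simple_root)
qed

lemma Lpairing_0_left [simp]: "Lpairing 0 y = 0"
  using Lpairing_add_left[of 0 0 y] by simp

lemma Lpairing_0_right [simp]: "Lpairing x 0 = 0"
  using Lpairing_add_right[of x 0 0] by simp

lemma Lpairing_uminus_left [simp]: "Lpairing (- x) y = - Lpairing x y"
  using Lpairing_add_left[of x "- x" y] by simp

lemma Lpairing_uminus_right [simp]: "Lpairing x (- y) = - Lpairing x y"
  using Lpairing_add_right[of x y "- y"] by simp

lemma Lpairing_diff_left: "Lpairing (x - x') y = Lpairing x y - Lpairing x' y"
  using Lpairing_add_left[of x "- x'" y] by simp

section \<open>The generic quantum group\<close>

text \<open>A scalar acts as multiplication by the element \<open>smul c 1\<close>, so closure under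
  left multiplication is enough.\<close>

lemma smul_in_qideal: "x \<in> qideal \<Longrightarrow> smul c x \<in> qideal"
  using qideal.left[of x "smul c 1"] by (simp add: smul_mult_left)

lemma quotient_algebra_full: "quotient_algebra As Ufull qideal (*) 1"
proof
  show "b - b' \<in> As" if "b \<in> As" "b' \<in> As" for b b'
    using that by (auto simp: As_def emb_diff[symmetric])
  show "b * b' \<in> As" if "b \<in> As" "b' \<in> As" for b b'
    using that by (auto simp: As_def emb_mult[symmetric])
  show "1 \<in> As" by (metis emb_1 emb_in_As)
  show "smul b x \<in> Ufull" if "b \<in> As" "x \<in> Ufull" for b x
    using that alg_closure.mult[OF alg_closure.scalar, of x _ "unemb b"]
    by (simp add: Ufull_def smul_mult_left emb_unemb)
  show "1 \<in> Ufull"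
    using alg_closure.scalar[of 1] by (simp add: Ufull_def)
qed (auto simp: Ufull_def smul_mult_left smul_mult_right smul_in_qideal algebra_simps
    intro: alg_closure.intros qideal.intros)

sublocale full: quotient_algebra As Ufull qideal "(*)" 1
  by (rule quotient_algebra_full)

lemmas qideal_refl = eqmod_refl[OF full.add_subgroup_Z]
  and qideal_sym = eqmod_sym[OF full.add_subgroup_Z]
  and qideal_trans [trans] = eqmod_trans[OF full.add_subgroup_Z]
  and qideal_add = eqmod_add[OF full.add_subgroup_Z]
  and qideal_sum = eqmod_sum[OF full.add_subgroup_Z]

lemma qideal_mult_left: "eqmod qideal x y \<Longrightarrow> eqmod qideal (z * x) (z * y)"
  unfolding eqmod_def right_diff_distrib[symmetric] by (rule qideal.left)

lemma qideal_mult_right: "eqmod qideal x y \<Longrightarrow> eqmod qideal (x * z) (y * z)"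
  unfolding eqmod_def left_diff_distrib[symmetric] by (rule qideal.right)

lemma qideal_mult: "eqmod qideal x y \<Longrightarrow> eqmod qideal x' y' \<Longrightarrow> eqmod qideal (x * x') (y * y')"
  using qideal_trans[OF qideal_mult_right qideal_mult_left] .

lemma qideal_smul: "eqmod qideal x y \<Longrightarrow> eqmod qideal (smul c x) (smul c y)"
  unfolding eqmod_def smul_diff[symmetric] by (rule smul_in_qideal)

lemma Mg_in_Ufull: "Mg f \<in> Ufull"
  unfolding Ufull_def by (intro alg_closure.base) auto

lemma ind_in_Ufull: "ind v \<in> Ufull"
  unfolding ind_def by (rule Mg_in_Ufull)

lemma Mg_mult: "eqmod qideal (Mg f * Mg g) (Mg (f * g))"
  by (rule qideal_sym) (simp add: eqmod_def qideal.map_mult)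

lemma Mg_const: "eqmod qideal (Mg (\<lambda>_. c)) (smul (emb c) 1)"
  by (simp add: eqmod_def qideal.map_const)

lemma Mg_add: "eqmod qideal (Mg (f + g)) (Mg f + Mg g)"
  using qideal.map_add[of f g] by (simp add: eqmod_def diff_diff_eq)

text \<open>On the support of the indicator \<open>f\<close> agrees with the constant
  \<open>f v\<close>, and constant functions are scalars by \<open>map_const\<close>.\<close>

lemma Mg_ind: "eqmod qideal (Mg f * ind v) (smul (emb (f v)) (ind v))"
proof -
  have "f * (\<lambda>x. if x = v then 1 else 0) = (\<lambda>_. f v) * (\<lambda>x. if x = v then 1 else 0)"
    by (rule ext) simp
  then have "eqmod qideal (Mg f * ind v) (Mg ((\<lambda>_. f v) * (\<lambda>x. if x = v then 1 else 0)))"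
    using Mg_mult[of f "\<lambda>x. if x = v then 1 else 0"] by (simp add: ind_def)
  also have "eqmod qideal \<dots> (Mg (\<lambda>_. f v) * ind v)"
    unfolding ind_def by (rule qideal_sym[OF Mg_mult])
  also have "eqmod qideal \<dots> (smul (emb (f v)) 1 * ind v)"
    by (rule qideal_mult_right[OF Mg_const])
  finally show ?thesis by (simp add: smul_mult_left)
qed

section \<open>Weights\<close>

fun gen_weight :: "'n gen \<Rightarrow> 'n weight" where
  "gen_weight (GE i) = \<alpha> i"
| "gen_weight (GF i) = - \<alpha> i"
| "gen_weight (GM f) = 0"

definition word_weight :: "'n gen list \<Rightarrow> 'n weight" where
  "word_weight u = sum_list (map gen_weight u)"

lemma word_weight_Nil [simp]: "word_weight [] = 0"
  and word_weight_Cons [simp]: "word_weight (x # u) = gen_weight x + word_weight u"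
  and word_weight_append [simp]: "word_weight (u @ v) = word_weight u + word_weight v"
  by (auto simp: word_weight_def)

text \<open>Weights of the words occurring in a representative, not of its class. They may be more
  than necessary, but they form a finite set, which bounds all sums of indicators below.\<close>

definition weights :: "'n falg \<Rightarrow> 'n weight set" where
  "weights p = word_weight ` Poly_Mapping.keys p"

lemma finite_weights: "finite (weights p)"
  by (simp add: weights_def)

lemma weights_mult: "weights (p * q) \<subseteq> {x + y | x y. x \<in> weights p \<and> y \<in> weights q}"
  using keys_mult[of p q] unfolding weights_def by (fastforce simp: plus_list_def)

lemma weights_add: "weights (p + q) \<subseteq> weights p \<union> weights q"
  using keys_add[of p q] unfolding weights_def by auto

lemma weights_Mg: "weights (Mg f) = {0}"
  by (simp add: weights_def gen_el_def)

lemma weights_ind: "weights (ind v) = {0}"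
  by (simp add: ind_def weights_Mg)

lemma weights_1: "weights 1 = {0}"
  by (simp add: weights_def zero_list_def)

lemma Mg_gen: "eqmod qideal (Mg f * gen_el g) (gen_el g * Mg (\<lambda>x. f (x + gen_weight g)))"
proof (cases g)
  case (GE i)
  have "eqmod qideal (Eg i * Mg (\<lambda>x. f (x + \<alpha> i))) (Mg f * Eg i)"
    using qideal.E_map[of i "\<lambda>x. f (x + \<alpha> i)"] by (simp add: eqmod_def)
  then show ?thesis using GE qideal_sym by simp
next
  case (GF i)
  have "eqmod qideal (Fg i * Mg (\<lambda>x. f (x - \<alpha> i))) (Mg f * Fg i)"
    using qideal.F_map[of i "\<lambda>x. f (x - \<alpha> i)"] by (simp add: eqmod_def)
  then show ?thesis using GF qideal_sym by simp
next
  case (GM h)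
  have "eqmod qideal (Mg f * Mg h) (Mg (f * h))" by (rule Mg_mult)
  also have "f * h = h * f" by (simp add: mult.commute)
  also have "eqmod qideal (Mg (h * f)) (Mg h * Mg f)" by (rule qideal_sym[OF Mg_mult])
  finally show ?thesis using GM by simp
qed

lemma single_Cons: "Poly_Mapping.single (g # u) 1 = gen_el g * (Poly_Mapping.single u 1 :: 'n falg)"
  by (simp add: gen_el_def mult_single plus_list_def)

lemma single_Nil: "Poly_Mapping.single [] 1 = (1 :: 'n falg)"
  by (metis single_one zero_list_def)

lemma Mg_word:
  "eqmod qideal (Mg f * Poly_Mapping.single u 1) (Poly_Mapping.single u 1 * Mg (\<lambda>x. f (x + word_weight u)))"
proof (induction u arbitrary: f)
  case Nil
  then show ?case by (simp add: single_Nil qideal_refl)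
next
  case (Cons g u)
  have "eqmod qideal (Mg f * gen_el g * Poly_Mapping.single u 1)
      (gen_el g * Mg (\<lambda>x. f (x + gen_weight g)) * Poly_Mapping.single u 1)"
    by (rule qideal_mult_right[OF Mg_gen])
  also have "eqmod qideal \<dots> (gen_el g * (Poly_Mapping.single u 1 * Mg (\<lambda>x. f (x + word_weight u + gen_weight g))))"
    unfolding mult.assoc by (rule qideal_mult_left[OF Cons.IH[of "\<lambda>x. f (x + gen_weight g)"]])
  also have "(\<lambda>x. f (x + word_weight u + gen_weight g)) = (\<lambda>x. f (x + word_weight (g # u)))"
    by (simp only: word_weight_Cons add.assoc add.commute[of "gen_weight g"])
  finally show ?case by (simp only: single_Cons mult.assoc)
qed

text \<open>All commutation of functions past elements takes place in front of an indicator, where a function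
  becomes a scalar.\<close>

lemma Mg_mult_ind:
  assumes "\<And>\<gamma>. \<gamma> \<in> weights p \<Longrightarrow> f (v + \<gamma>) = c"
  shows "eqmod qideal (Mg f * p * ind v) (smul (emb c) (p * ind v))"
proof -
  have word: "eqmod qideal (Mg f * Poly_Mapping.single u b * ind v) (smul (emb c) (Poly_Mapping.single u b * ind v))"
    if u: "u \<in> Poly_Mapping.keys p" for u b
  proof -
    have fc: "f (v + word_weight u) = c" using u assms by (auto simp: weights_def)
    have "eqmod qideal (Mg f * Poly_Mapping.single u 1 * ind v)
        (Poly_Mapping.single u 1 * (Mg (\<lambda>x. f (x + word_weight u)) * ind v))"
      using qideal_mult_right[OF Mg_word] by (simp add: mult.assoc)
    also have "eqmod qideal \<dots> (Poly_Mapping.single u 1 * smul (emb c) (ind v))"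
      using qideal_mult_left[OF Mg_ind[of "\<lambda>x. f (x + word_weight u)" v]] by (simp add: fc)
    finally have "eqmod qideal (Mg f * Poly_Mapping.single u 1 * ind v) (smul (emb c) (Poly_Mapping.single u 1 * ind v))"
      by (simp add: smul_mult_right)
    then have "eqmod qideal (smul b (Mg f * Poly_Mapping.single u 1 * ind v))
        (smul b (smul (emb c) (Poly_Mapping.single u 1 * ind v)))"
      by (rule qideal_smul)
    moreover have "Poly_Mapping.single u b = smul b (Poly_Mapping.single u 1)" by simp
    ultimately show ?thesis
      by (simp only: smul_mult_left smul_mult_right smul_smul mult.commute[of b])
  qed
  have "eqmod qideal (\<Sum>u\<in>Poly_Mapping.keys p. Mg f * Poly_Mapping.single u (Poly_Mapping.lookup p u) * ind v)
    (\<Sum>u\<in>Poly_Mapping.keys p. smul (emb c) (Poly_Mapping.single u (Poly_Mapping.lookup p u) * ind v))"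
    by (rule qideal_sum[OF word])
  then show ?thesis
    by (simp add: sum_distrib_left[symmetric] sum_distrib_right[symmetric] smul_sum[symmetric]
        poly_mapping_expand[of p, symmetric])
qed

text \<open>The function with value 1 at \<open>u\<close> only, once moved to the right of
  \<open>p\<close>, is evaluated at the shifted weights \<open>v + \<gamma>\<close>, and none of
  these is \<open>u\<close>. This kills all but finitely many terms of each sum over
  weights.\<close>

lemma ind_mult_ind_null:
  assumes "\<And>\<gamma>. \<gamma> \<in> weights p \<Longrightarrow> u \<noteq> v + \<gamma>"
  shows "ind u * p * ind v \<in> qideal"
  using Mg_mult_ind[of p "\<lambda>x. if x = u then 1 else 0" v 0] assms
  by (simp add: ind_def eqmod_0) metis

lemma sum_ind_eq_Mg: "finite S \<Longrightarrow> eqmod qideal (\<Sum>u\<in>S. ind u) (Mg (\<lambda>x. if x \<in> S then 1 else 0))"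
proof (induction S rule: finite_induct)
  case empty
  have "eqmod qideal (Mg (\<lambda>_. 0)) 0" using Mg_const[of 0] by simp
  then show ?case by (simp add: qideal_sym)
next
  case (insert u S)
  have "(\<lambda>x. if x = u then 1 else 0) + (\<lambda>x. if x \<in> S then 1 else 0) = (\<lambda>x. if x \<in> insert u S then 1 else (0::laurent))"
    using insert by (intro ext) auto
  moreover have "eqmod qideal (ind u + (\<Sum>u\<in>S. ind u)) (ind u + Mg (\<lambda>x. if x \<in> S then 1 else 0))"
    by (rule qideal_add[OF qideal_refl insert.IH])
  moreover have "eqmod qideal \<dots> (Mg ((\<lambda>x. if x = u then 1 else 0) + (\<lambda>x. if x \<in> S then 1 else 0)))"
    unfolding ind_def by (rule qideal_sym[OF Mg_add])
  ultimately show ?case using insert qideal_trans by simp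
qed

text \<open>The counterpart of \<open>ind_mult_ind_null\<close>: a finite sum of indicators acts as
  the identity as soon as it covers every weight to which \<open>p\<close> shifts
  \<open>v\<close>.\<close>

lemma sum_ind_mult_ind:
  assumes "finite S" "\<And>\<gamma>. \<gamma> \<in> weights p \<Longrightarrow> v + \<gamma> \<in> S"
  shows "eqmod qideal ((\<Sum>u\<in>S. ind u) * p * ind v) (p * ind v)"
  using qideal_trans[OF qideal_mult_right[OF qideal_mult_right[OF sum_ind_eq_Mg[OF assms(1)]]]
      Mg_mult_ind[of p "\<lambda>x. if x \<in> S then 1 else 0" v 1]] assms(2) by simp

end

text \<open>Unification produces eta-expanded sums of weights, which these rules would turn into abstractions.\<close>

lemmas fun_apply = plus_fun_apply zero_fun_apply times_fun_apply uminus_apply minus_apply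
declare fun_apply [simp del]

context root_datum
begin

text \<open>Inclusion rather than equality, because terms may cancel: 0 counts as homogeneous of
  every weight.\<close>

definition homogeneous :: "'n weight \<Rightarrow> 'n falg \<Rightarrow> bool" where
  "homogeneous \<gamma> p \<longleftrightarrow> weights p \<subseteq> {\<gamma>}"

lemma weights_smul: "weights (smul c p) \<subseteq> weights p"
  by (auto simp: weights_def in_keys_iff)

lemma homogeneous_add: "homogeneous \<gamma> p \<Longrightarrow> homogeneous \<gamma> q \<Longrightarrow> homogeneous \<gamma> (p + q)"
  unfolding homogeneous_def using weights_add[of p q] by blast

lemma homogeneous_0: "homogeneous \<gamma> 0"
  by (simp add: homogeneous_def weights_def)

lemma homogeneous_sum: "(\<And>i. i \<in> I \<Longrightarrow> homogeneous \<gamma> (f i)) \<Longrightarrow> homogeneous \<gamma> (sum f I)"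
  by (induction I rule: infinite_finite_induct) (auto simp: homogeneous_0 homogeneous_add)

lemma homogeneous_smul: "homogeneous \<gamma> p \<Longrightarrow> homogeneous \<gamma> (smul c p)"
  unfolding homogeneous_def using weights_smul[of c p] by blast

lemma homogeneous_uminus: "homogeneous \<gamma> p \<Longrightarrow> homogeneous \<gamma> (- p)"
  using homogeneous_smul[of \<gamma> p "-1"] by (simp add: smul_uminus)

lemma homogeneous_1: "homogeneous 0 1"
  by (simp add: homogeneous_def weights_1)

lemma homogeneous_mult: "homogeneous \<gamma> p \<Longrightarrow> homogeneous \<delta> q \<Longrightarrow> homogeneous (\<gamma> + \<delta>) (p * q)"
  unfolding homogeneous_def using weights_mult[of p q] by blast

lemma homogeneous_gen: "homogeneous (gen_weight g) (gen_el g)"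
  by (simp add: homogeneous_def weights_def gen_el_def)

lemma homogeneous_power: "homogeneous \<gamma> p \<Longrightarrow> homogeneous (\<lambda>k. int r * \<gamma> k) (p ^ r)"
proof (induction r)
  case 0
  have "(\<lambda>k. int 0 * \<gamma> k) = 0" by (intro ext) (simp add: fun_apply)
  then show ?case using homogeneous_1 by simp
next
  case (Suc r)
  have "(\<lambda>k. int (Suc r) * \<gamma> k) = \<gamma> + (\<lambda>k. int r * \<gamma> k)"
    by (intro ext) (simp add: fun_apply distrib_right)
  then show ?case using homogeneous_mult[OF Suc.prems Suc.IH[OF Suc.prems]] by simp
qed

lemma homogeneous_divpow: "homogeneous \<gamma> p \<Longrightarrow> homogeneous (\<lambda>k. int r * \<gamma> k) (divpow i p r)"
  unfolding divpow_def by (intro homogeneous_smul homogeneous_power)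

lemma homogeneous_prod_list:
  "(\<And>j. j \<in> set js \<Longrightarrow> homogeneous (\<gamma> j) (x j)) \<Longrightarrow>
    homogeneous (\<Sum>j\<leftarrow>js. \<gamma> j) (prod_list (map x js))"
  by (induction js) (auto simp: homogeneous_1 homogeneous_mult)

lemma reflect_add: "reflect a i (x + y) = reflect a i x + reflect a i y"
  by (intro ext) (simp add: fun_apply reflect_def algebra_simps)

lemma reflect_0: "reflect a i 0 = 0"
  by (intro ext) (simp add: fun_apply reflect_def)

lemma reflect_uminus: "reflect a i (- x) = - reflect a i x"
  by (intro ext) (simp add: fun_apply reflect_def)

lemma reflect_sum_list: "reflect a i (\<Sum>x\<leftarrow>xs. f x) = (\<Sum>x\<leftarrow>xs. reflect a i (f x))"
  by (induction xs) (simp_all only: list.map sum_list.Nil sum_list.Cons reflect_0 reflect_add)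

lemma reflect_simple_root: "reflect a i (\<alpha> j) = (\<lambda>k. \<alpha> j k - a i j * \<alpha> i k)"
  by (intro ext) (simp add: fun_apply reflect_def simple_root_def)

text \<open>The braid operators lift the simple reflections. For \<open>i \<noteq> j\<close> the two
  divided powers in each summand have total exponent \<open>- a i j\<close>, independent of
  \<open>r\<close>, which accounts for the multiple of \<open>\<alpha> i\<close> added by the
  reflection. The \<open>nat\<close> loses nothing, since off-diagonal Cartan entries are
  nonpositive.\<close>

lemma homogeneous_braid_gen: "homogeneous (reflect a i (gen_weight g)) (braid_gen i g)"
proof (cases g)
  case (GE j)
  show ?thesis
  proof (cases "i = j")
    case True
    have "reflect a i (\<alpha> i) = gen_weight (GF i) + gen_weight (GM (Kfun (\<alpha> i)))"
      by (intro ext) (simp add: fun_apply reflect_simple_root cartan_diag)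
    then show ?thesis using GE True homogeneous_uminus[OF homogeneous_mult[OF homogeneous_gen homogeneous_gen]]
      by (metis braid_gen.simps(1) gen_weight.simps(1))
  next
    case False
    let ?m = "nat (- a i j)"
    have wt: "reflect a i (\<alpha> j) = (\<lambda>k. int (?m - r) * gen_weight (GE i) k) + gen_weight (GE j)
        + (\<lambda>k. int r * gen_weight (GE i) k)" if "r \<le> ?m" for r
    proof
      fix k
      have m: "int (?m - r) = - a i j - int r" using that cartan_off_diag[OF False] by simp
      show "reflect a i (\<alpha> j) k = ((\<lambda>k. int (?m - r) * gen_weight (GE i) k) + gen_weight (GE j)
        + (\<lambda>k. int r * gen_weight (GE i) k)) k"
        by (simp only: plus_fun_apply m) (simp add: fun_apply reflect_simple_root algebra_simps)
    qed
    have "homogeneous (reflect a i (\<alpha> j)) (divpow i (Eg i) (?m - r) * Eg j * divpow i (Eg i) r)"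
      if "r \<le> ?m" for r
      unfolding wt[OF that] by (intro homogeneous_mult homogeneous_divpow homogeneous_gen)
    then show ?thesis using GE False
      by (auto simp: Let_def intro!: homogeneous_sum homogeneous_smul)
  qed
next
  case (GF j)
  show ?thesis
  proof (cases "i = j")
    case True
    have "reflect a i (- \<alpha> i) = gen_weight (GM (Kfun (- \<alpha> i))) + gen_weight (GE i)"
      by (intro ext) (simp add: fun_apply reflect_uminus reflect_simple_root cartan_diag)
    then show ?thesis using GF True homogeneous_uminus[OF homogeneous_mult[OF homogeneous_gen homogeneous_gen]]
      by (metis braid_gen.simps(2) gen_weight.simps(2))
  next
    case False
    let ?m = "nat (- a i j)"
    have wt: "reflect a i (- \<alpha> j) = (\<lambda>k. int r * gen_weight (GF i) k) + gen_weight (GF j)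
        + (\<lambda>k. int (?m - r) * gen_weight (GF i) k)" if "r \<le> ?m" for r
    proof
      fix k
      have m: "int (?m - r) = - a i j - int r" using that cartan_off_diag[OF False] by simp
      show "reflect a i (- \<alpha> j) k = ((\<lambda>k. int r * gen_weight (GF i) k) + gen_weight (GF j)
        + (\<lambda>k. int (?m - r) * gen_weight (GF i) k)) k"
        by (simp only: plus_fun_apply m) (simp add: fun_apply reflect_uminus reflect_simple_root algebra_simps)
    qed
    have "homogeneous (reflect a i (- \<alpha> j)) (divpow i (Fg i) r * Fg j * divpow i (Fg i) (?m - r))"
      if "r \<le> ?m" for r
      unfolding wt[OF that] by (intro homogeneous_mult homogeneous_divpow homogeneous_gen)
    then show ?thesis using GF False
      by (auto simp: Let_def intro!: homogeneous_sum homogeneous_smul)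
  qed
next
  case (GM f)
  then show ?thesis using homogeneous_gen[of "GM (f \<circ> reflect a i)"] by (simp add: reflect_0)
qed

lemma homogeneous_braid:
  assumes "homogeneous \<gamma> p"
  shows "homogeneous (reflect a i \<gamma>) (braid i p)"
  unfolding braid_def hom_ext_def lin_ext_def
proof (intro homogeneous_sum homogeneous_smul)
  fix u assume "u \<in> Poly_Mapping.keys p"
  then have "word_weight u = \<gamma>" using assms by (auto simp: homogeneous_def weights_def)
  then have "reflect a i \<gamma> = (\<Sum>g\<leftarrow>u. reflect a i (gen_weight g))"
    by (simp add: word_weight_def reflect_sum_list[symmetric])
  then show "homogeneous (reflect a i \<gamma>) (prod_list (map (braid_gen i) u))"
    using homogeneous_prod_list[of u "\<lambda>g. reflect a i (gen_weight g)" "braid_gen i"]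
    by (simp add: homogeneous_braid_gen)
qed

lemma homogeneous_foldr_braid:
  "homogeneous \<gamma> p \<Longrightarrow> homogeneous (foldr (reflect a) v \<gamma>) (foldr braid v p)"
  by (induction v) (auto simp: homogeneous_braid)

lemma homogeneous_root_E: "homogeneous (pos_root j) (root_E j)"
  unfolding pos_root_def root_E_def
  using homogeneous_foldr_braid[OF homogeneous_gen[of "GE (w ! j)"]] by simp

lemma homogeneous_root_F: "homogeneous (- pos_root j) (root_F j)"
proof -
  have "foldr (reflect a) v (- x) = - foldr (reflect a) v x" for v x
    by (induction v) (simp_all only: foldr.simps o_apply id_apply reflect_uminus)
  then show ?thesis
    unfolding pos_root_def root_F_def
    using homogeneous_foldr_braid[OF homogeneous_gen[of "GF (w ! j)"], of "take j w"] by simp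
qed

lemma sum_list_weights: "(\<Sum>j\<leftarrow>js. \<gamma> j) k = (\<Sum>j\<leftarrow>js. \<gamma> j k)"
  for \<gamma> :: "'j \<Rightarrow> 'n weight"
  by (induction js) (auto simp: fun_apply)

lemma homogeneous_Emon: "homogeneous (exp_weight r) (Emon r)"
proof -
  have "exp_weight r = (\<Sum>j\<leftarrow>[0..<N]. (\<lambda>k. int (r ! j) * pos_root j k))"
    by (intro ext, simp only: exp_weight_def sum_list_weights)
      (simp add: fun_apply interv_sum_list_conv_sum_set_nat atLeast0LessThan)
  then show ?thesis unfolding Emon_def
    by (simp only:) (intro homogeneous_prod_list homogeneous_divpow homogeneous_root_E)
qed

lemma homogeneous_Fmon: "homogeneous (- exp_weight r) (Fmon r)"
proof -
  have "- exp_weight r = (\<Sum>j\<leftarrow>[0..<N]. (\<lambda>k. int (r ! j) * (- pos_root j) k))"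
    by (intro ext, simp only: sum_list_weights)
      (simp add: fun_apply exp_weight_def interv_sum_list_conv_sum_set_nat atLeast0LessThan sum_negf)
  then show ?thesis unfolding Fmon_def
    by (simp only:) (intro homogeneous_prod_list homogeneous_divpow homogeneous_root_F)
qed

lemma Mg_mult_ind_homogeneous:
  "homogeneous \<gamma> p \<Longrightarrow> eqmod qideal (Mg f * p * ind v) (smul (emb (f (v + \<gamma>))) (p * ind v))"
  by (rule Mg_mult_ind) (auto simp: homogeneous_def)

section \<open>The subalgebras\<close>

lemma Uweight_add: "x \<in> Uweight \<Longrightarrow> y \<in> Uweight \<Longrightarrow> x + y \<in> Uweight"
  and Uweight_mult: "x \<in> Uweight \<Longrightarrow> y \<in> Uweight \<Longrightarrow> x * y \<in> Uweight"
  and Uweight_1: "1 \<in> Uweight"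
  and Uweight_Kg: "Kg \<gamma> \<in> Uweight"
  and Uweight_divided_powers: "divided_powers \<subseteq> Uweight"
  and Uweight_qideal: "qideal \<subseteq> Uweight"
  using alg_closure.scalar[of 1] by (auto simp: Uweight_def intro: alg_closure.intros)

lemma Uweight_subset_Ufull: "Uweight \<subseteq> Ufull"
proof
  fix x assume "x \<in> Uweight"
  then show "x \<in> Ufull" unfolding Uweight_def Ufull_def
    by (induction rule: alg_closure.induct) (auto intro: alg_closure.intros)
qed

lemma Uweight_prod_list: "set xs \<subseteq> Uweight \<Longrightarrow> prod_list xs \<in> Uweight"
  by (induction xs) (auto simp: Uweight_1 Uweight_mult)

lemma Emon_in_Uweight: "Emon r \<in> Uweight"
  and Fmon_in_Uweight: "Fmon r \<in> Uweight"
proof -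
  have "divpow (w ! j) (root_E j) k \<in> Uweight" "divpow (w ! j) (root_F j) k \<in> Uweight" if "j < N" for j k
    using that Uweight_divided_powers unfolding divided_powers_def by blast+
  then show "Emon r \<in> Uweight" "Fmon r \<in> Uweight"
    unfolding Emon_def Fmon_def by (auto intro!: Uweight_prod_list)
qed

lemma Emon_in_Ufull: "Emon r \<in> Ufull"
  and Fmon_in_Ufull: "Fmon r \<in> Ufull"
  using Emon_in_Uweight Fmon_in_Uweight Uweight_subset_Ufull by auto

section \<open>The square of the antipode\<close>

lemma antihom_ext_mult: "antihom_ext \<phi> (x * y) = antihom_ext \<phi> y * antihom_ext \<phi> x"
proof (induction x rule: pm_induct)
  case (single u b)
  show ?case
  proof (induction y rule: pm_induct)
    case (single v c)
    show ?case
      by (simp add: antihom_ext_def mult_single plus_list_def smul_mult_left smul_mult_right mult.commute)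
  next
    case (add p q)
    then show ?case by (simp add: antihom_ext_def lin_ext_add distrib_left distrib_right)
  qed (simp add: antihom_ext_def)
next
  case (add p q)
  then show ?case by (simp add: antihom_ext_def lin_ext_add distrib_left distrib_right)
qed (simp add: antihom_ext_def)

lemma antihom_ext_1: "antihom_ext \<phi> 1 = 1"
  for \<phi> :: "'n gen \<Rightarrow> 'n falg"
proof -
  have "antihom_ext \<phi> (Poly_Mapping.single [] 1) = 1" by (simp add: antihom_ext_def)
  then show ?thesis by (simp add: single_Nil)
qed

lemma antipode_gen_el: "antipode (gen_el g) = antipode_gen g"
  by (simp add: antipode_def antihom_ext_def gen_el_def)

lemma antipode_mult: "antipode (x * y) = antipode y * antipode x"
  and antipode_add: "antipode (x + y) = antipode x + antipode y"
  and antipode_smul: "antipode (smul c x) = smul c (antipode x)"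
  and antipode_uminus: "antipode (- x) = - antipode x"
  and antipode_diff: "antipode (x - y) = antipode x - antipode y"
  and antipode_1: "antipode 1 = 1"
  by (auto simp: antipode_def antihom_ext_mult antihom_ext_1)
    (auto simp: antihom_ext_def lin_ext_add lin_ext_smul lin_ext_uminus lin_ext_diff)

text \<open>The pairing of this weight with every simple root is that of twice the half sum of the positive
  roots.\<close>

definition two_rho' :: "'n weight" where
  "two_rho' = (\<lambda>_. 2)"

lemma Kg_Kg_uminus: "eqmod qideal (Kg (- \<gamma>) * Kg \<gamma>) 1"
proof -
  have "Kfun (- \<gamma>) * Kfun \<gamma> = (\<lambda>_. 1)"
    by (intro ext) (simp add: fun_apply Kfun_def s_pow_add[symmetric])
  then show ?thesis
    using qideal_trans[OF Mg_mult[of "Kfun (- \<gamma>)" "Kfun \<gamma>"]] Mg_const[of 1] by simp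
qed

lemma Kg_gen_Kg:
  "eqmod qideal (Kg \<gamma> * gen_el g * Kg (- \<gamma>)) (smul (emb (s_pow (Lpairing (gen_weight g) \<gamma>))) (gen_el g))"
proof -
  have "eqmod qideal (Kg \<gamma> * gen_el g * Kg (- \<gamma>))
      (gen_el g * (Mg (\<lambda>x. Kfun \<gamma> (x + gen_weight g)) * Kg (- \<gamma>)))"
    using qideal_mult_right[OF Mg_gen] by (simp add: mult.assoc)
  also have "eqmod qideal \<dots> (gen_el g * Mg ((\<lambda>x. Kfun \<gamma> (x + gen_weight g)) * Kfun (- \<gamma>)))"
    by (rule qideal_mult_left[OF Mg_mult])
  also have "(\<lambda>x. Kfun \<gamma> (x + gen_weight g)) * Kfun (- \<gamma>) = (\<lambda>_. s_pow (Lpairing (gen_weight g) \<gamma>))"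
    by (intro ext) (simp add: fun_apply Kfun_def s_pow_add[symmetric] Lpairing_add_left)
  also have "eqmod qideal (gen_el g * Mg (\<lambda>_. s_pow (Lpairing (gen_weight g) \<gamma>)))
      (gen_el g * smul (emb (s_pow (Lpairing (gen_weight g) \<gamma>))) 1)"
    by (rule qideal_mult_left[OF Mg_const])
  finally show ?thesis by (simp add: smul_mult_right)
qed

text \<open>For a generator of index \<open>i\<close> the square of the antipode is conjugation by
  \<open>Kg (\<alpha> i)\<close>, which depends on \<open>i\<close>. Such a conjugation only
  multiplies the generator by a power of s, and \<open>two_rho'\<close> pairs with
  \<open>\<alpha> i\<close> as \<open>\<alpha> i\<close> does with itself. So one element serves for
  all generators.\<close>

lemma antipode_antipode_gen:
  "eqmod qideal (antipode (antipode (gen_el g))) (Kg two_rho' * gen_el g * Kg (- two_rho'))"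
proof -
  have *: "Lpairing (\<alpha> i) two_rho' = Lpairing (\<alpha> i) (\<alpha> i)" for i
    by (simp add: Lpairing_simple_root two_rho'_def) (simp add: simple_root_def cartan_diag)
  have neg: "(\<lambda>x. Kfun \<gamma> (- x)) = Kfun (- \<gamma>)" for \<gamma>
    by (intro ext) (simp add: fun_apply Kfun_def)
  have "eqmod qideal (antipode (antipode (gen_el g)))
      (smul (emb (s_pow (Lpairing (gen_weight g) two_rho'))) (gen_el g))"
  proof (cases g)
    case (GE i)
    have "antipode (antipode (gen_el g)) = Kg (\<alpha> i) * gen_el g * Kg (- \<alpha> i)"
      by (simp add: GE antipode_gen_el antipode_uminus antipode_mult neg mult.assoc)
    then show ?thesis using Kg_gen_Kg[of "\<alpha> i" g] by (simp add: GE *)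
  next
    case (GF i)
    have "antipode (antipode (gen_el g)) = Kg (\<alpha> i) * gen_el g * Kg (- \<alpha> i)"
      by (simp add: GF antipode_gen_el antipode_uminus antipode_mult neg mult.assoc)
    then show ?thesis using Kg_gen_Kg[of "\<alpha> i" g] by (simp add: GF *)
  next
    case (GM f)
    then show ?thesis by (simp add: antipode_gen_el qideal_refl)
  qed
  then show ?thesis using Kg_gen_Kg[of two_rho' g] qideal_sym qideal_trans by blast
qed

text \<open>The conjugating elements cancel between neighbouring generators of a word. A conjugation
  visibly preserves the ideal and both subalgebras, so the antipode need not be evaluated on the
  Serre relations or on root vectors.\<close>

lemma antipode_antipode: "eqmod qideal (antipode (antipode x)) (Kg two_rho' * x * Kg (- two_rho'))"
proof (induction x rule: pm_induct)
  case (single u b)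
  have "eqmod qideal (antipode (antipode (Poly_Mapping.single u 1)))
      (Kg two_rho' * Poly_Mapping.single u 1 * Kg (- two_rho'))"
  proof (induction u)
    case Nil
    have "eqmod qideal 1 (Kg two_rho' * Kg (- two_rho'))"
      using qideal_sym[OF Kg_Kg_uminus[of "- two_rho'"]] by simp
    then show ?case by (simp add: single_Nil antipode_1)
  next
    case (Cons g u)
    have "antipode (antipode (Poly_Mapping.single (g # u) 1))
        = antipode (antipode (gen_el g)) * antipode (antipode (Poly_Mapping.single u 1))"
      by (simp add: single_Cons antipode_mult)
    also have "eqmod qideal \<dots> (Kg two_rho' * gen_el g * Kg (- two_rho')
        * (Kg two_rho' * Poly_Mapping.single u 1 * Kg (- two_rho')))"
      by (rule qideal_mult[OF antipode_antipode_gen Cons.IH])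
    also have "\<dots> = (Kg two_rho' * gen_el g) * (Kg (- two_rho') * Kg two_rho') * (Poly_Mapping.single u 1 * Kg (- two_rho'))"
      by (simp add: mult.assoc)
    also have "eqmod qideal \<dots> ((Kg two_rho' * gen_el g) * 1 * (Poly_Mapping.single u 1 * Kg (- two_rho')))"
      by (intro qideal_mult_left qideal_mult_right Kg_Kg_uminus)
    finally show ?case by (simp add: single_Cons mult.assoc)
  qed
  then have "eqmod qideal (smul b (antipode (antipode (Poly_Mapping.single u 1))))
      (smul b (Kg two_rho' * Poly_Mapping.single u 1 * Kg (- two_rho')))"
    by (rule qideal_smul)
  moreover have "Poly_Mapping.single u b = smul b (Poly_Mapping.single u 1)" by simp
  ultimately show ?case by (simp only: antipode_smul smul_mult_left smul_mult_right)
next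
  case (add x y)
  from qideal_add[OF this] show ?case by (simp add: antipode_add algebra_simps)
qed (simp add: antipode_def antihom_ext_def qideal_refl)

lemma antipode_antipode_qideal: "x \<in> qideal \<Longrightarrow> antipode (antipode x) \<in> qideal"
  by (rule eqmod_in[OF full.add_subgroup_Z antipode_antipode]) (intro qideal.left qideal.right)

lemma antipode_antipode_Uweight:
  assumes "x \<in> Uweight"
  shows "antipode (antipode x) \<in> Uweight"
proof -
  have "antipode (antipode x) - Kg two_rho' * x * Kg (- two_rho') \<in> Uweight"
    using antipode_antipode Uweight_qideal by (auto simp: eqmod_def)
  from Uweight_add[OF this Uweight_mult[OF Uweight_mult[OF Uweight_Kg assms] Uweight_Kg, of two_rho' "- two_rho'"]]
  show ?thesis by simp
qed

lemma antipode_antipode_Ufull: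
  assumes "x \<in> Ufull"
  shows "antipode (antipode x) \<in> Ufull"
proof -
  have "antipode (antipode x) - Kg two_rho' * x * Kg (- two_rho') \<in> Ufull"
    using antipode_antipode full.Z_C by (auto simp: eqmod_def)
  from full.C_add[OF this full.mul_C[OF full.mul_C[OF Mg_in_Ufull assms] Mg_in_Ufull, of "Kfun two_rho'" "Kfun (- two_rho')"]]
  show ?thesis by simp
qed

lemma linear_mod_antipode: "full.linear_mod (antipode \<circ> antipode)"
  by (simp add: full.linear_mod_def antipode_add antipode_smul antipode_antipode_Ufull
      antipode_antipode_qideal qideal_refl)

text \<open>Reflecting the argument of a function twice restores it, so functions are fixed exactly
  and not only modulo the relations.\<close>

lemma antipode_antipode_ind: "antipode (antipode (x * ind v)) = antipode (antipode x) * ind v"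
  by (simp add: antipode_mult ind_def antipode_gen_el)

end

section \<open>The quantum group at a root of unity\<close>

lemma smul_diff_left: "smul (c - c') p = smul c p - smul c' p"
  by (rule poly_mapping_eqI) (simp add: lookup_minus left_diff_distrib)

lemma poly_of_rat_add: "poly (map_poly of_rat (f + g)) z = poly (map_poly of_rat f) z + poly (map_poly of_rat g) z"
  for z :: complex
proof -
  have "map_poly of_rat (f + g) = map_poly of_rat f + (map_poly of_rat g :: complex poly)"
    by (rule poly_eqI) (simp add: coeff_map_poly of_rat_add)
  then show ?thesis by simp
qed

lemma poly_of_rat_smult: "poly (map_poly of_rat (smult c g)) z = of_rat c * poly (map_poly of_rat g) z"
  for z :: complex
proof -
  have "map_poly of_rat (smult c g) = smult (of_rat c) (map_poly of_rat g :: complex poly)"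
    by (rule poly_eqI) (simp add: coeff_map_poly of_rat_mult)
  then show ?thesis by simp
qed

lemma poly_of_rat_mult: "poly (map_poly of_rat (f * g)) z = poly (map_poly of_rat f) z * poly (map_poly of_rat g) z"
  for z :: complex
proof (induction f)
  case (pCons c f)
  have "poly (map_poly of_rat (pCons c f)) z = of_rat c + z * poly (map_poly of_rat f) z" for c f
    by (simp add: map_poly_pCons)
  then show ?case using pCons
    by (simp add: poly_of_rat_add poly_of_rat_smult algebra_simps)
qed simp

context root_of_unity_datum
begin

lemma z_nonzero: "z \<noteq> 0"
  using primitive(1) l_pos L_pos by (metis mult_pos_pos power_0_left neq0_conv zero_neq_one)

abbreviation "at_z f \<equiv> poly (map_poly of_rat f) z"

lemma QzI: "at_z f / at_z g \<in> Qz"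
  unfolding Qz_def by blast

lemma QzE:
  assumes "x \<in> Qz" obtains f g where "x = at_z f / at_z g" "at_z g \<noteq> 0"
proof -
  obtain f g where x: "x = at_z f / at_z g" using assms by (auto simp: Qz_def)
  show thesis
  proof (cases "at_z g = 0")
    case True
    \<comment> \<open>Division by zero yields 0, which is represented as 0/1.\<close>
    then show ?thesis using x that[of 0 1] by simp
  qed (use x that in blast)
qed

lemma Qz_1: "1 \<in> Qz"
  using QzI[of 1 1] by simp

lemma Qz_z: "z \<in> Qz"
  using QzI[of "[:0, 1:]" 1] by (simp add: map_poly_pCons)

lemma Qz_mult: "x \<in> Qz \<Longrightarrow> y \<in> Qz \<Longrightarrow> x * y \<in> Qz"
  by (elim QzE) (simp add: poly_of_rat_mult[symmetric] QzI)

lemma Qz_divide: "x \<in> Qz \<Longrightarrow> y \<in> Qz \<Longrightarrow> x / y \<in> Qz"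
  by (elim QzE) (simp add: poly_of_rat_mult[symmetric] QzI)

lemma Qz_uminus: "x \<in> Qz \<Longrightarrow> - x \<in> Qz"
proof -
  assume "x \<in> Qz"
  moreover have "-1 \<in> Qz" using QzI[of "[:-1:]" 1] by (simp add: map_poly_pCons)
  ultimately show ?thesis using Qz_mult[of "-1" x] by simp
qed

lemma Qz_add: "x \<in> Qz \<Longrightarrow> y \<in> Qz \<Longrightarrow> x + y \<in> Qz"
proof (elim QzE)
  fix f g f' g' assume "x = at_z f / at_z g" "at_z g \<noteq> 0" "y = at_z f' / at_z g'" "at_z g' \<noteq> 0"
  then have "x + y = at_z (f * g' + f' * g) / at_z (g * g')"
    by (simp add: poly_of_rat_add poly_of_rat_mult add_frac_eq)
  then show "x + y \<in> Qz" using QzI by simp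
qed

lemma Qz_diff: "x \<in> Qz \<Longrightarrow> y \<in> Qz \<Longrightarrow> x - y \<in> Qz"
  using Qz_add[of x "- y"] Qz_uminus by simp

lemma Qz_0: "0 \<in> Qz"
  using Qz_diff[OF Qz_1 Qz_1] by simp

lemma Qz_of_int: "of_int k \<in> Qz"
proof (induction k rule: int_induct[of _ 0])
  case (step1 i)
  then show ?case using Qz_add[OF _ Qz_1] by simp
next
  case (step2 i)
  then show ?case using Qz_diff[OF _ Qz_1] by simp
qed (simp add: Qz_0)

lemma Qz_power: "x \<in> Qz \<Longrightarrow> x ^ k \<in> Qz"
  by (induction k) (auto simp: Qz_1 Qz_mult)

lemma Qz_powi: "z powi k \<in> Qz"
  using Qz_power[OF Qz_z] Qz_divide[OF Qz_1 Qz_power[OF Qz_z]]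
  by (auto simp: power_int_def divide_inverse power_inverse)

lemma Qz_sum: "(\<And>i. i \<in> I \<Longrightarrow> f i \<in> Qz) \<Longrightarrow> sum f I \<in> Qz"
  by (induction I rule: infinite_finite_induct) (auto simp: Qz_0 Qz_add)

lemma ev_in_Qz: "ev c \<in> Qz"
  unfolding ev_def by (intro Qz_sum Qz_mult Qz_of_int Qz_powi)

lemma ev_superset: "finite S \<Longrightarrow> Poly_Mapping.keys c \<subseteq> S \<Longrightarrow>
    ev c = (\<Sum>k\<in>S. of_int (Poly_Mapping.lookup c k) * z powi k)"
  unfolding ev_def by (intro sum.mono_neutral_left) (auto simp: in_keys_iff)

lemma ev_single: "ev (Poly_Mapping.single k b) = of_int b * z powi k"
  by (subst ev_superset[of "{k}"]) auto

lemma ev_0 [simp]: "ev 0 = 0"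
  by (simp add: ev_def)

lemma ev_add: "ev (x + y) = ev x + ev y"
proof -
  let ?S = "Poly_Mapping.keys x \<union> Poly_Mapping.keys y"
  have "Poly_Mapping.keys (x + y) \<subseteq> ?S" by (rule keys_add)
  then show ?thesis
    by (simp add: ev_superset[of ?S] lookup_add distrib_right sum.distrib)
qed

lemma ev_s_pow [simp]: "ev (s_pow k) = z powi k"
  by (simp add: s_pow_def ev_single)

lemma ev_1 [simp]: "ev 1 = 1"
  using ev_s_pow[of 0] by simp

lemma ev_mult: "ev (x * y) = ev x * ev y"
proof (induction x rule: pm_induct)
  case (single k b)
  show ?case
  proof (induction y rule: pm_induct)
    case (single j c)
    then show ?case using z_nonzero by (simp add: mult_single ev_single power_int_add)
  qed (auto simp: distrib_left ev_add)
qed (auto simp: distrib_right ev_add)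

lemma ev_uminus: "ev (- x) = - ev x"
  using ev_add[of x "- x"] by (simp add: eq_neg_iff_add_eq_0 add.commute)

lemma ev_diff: "ev (x - y) = ev x - ev y"
  using ev_add[of x "- y"] by (simp add: ev_uminus)

lemma ev_prod: "ev (prod f I) = (\<Prod>i\<in>I. ev (f i))"
  by (induction I rule: infinite_finite_induct) (auto simp: ev_mult)

text \<open>The factor of index \<open>l\<close> is 1 - q^l, and q^l evaluates to
  \<open>z ^ (l * L)\<close>, that is, to 1.\<close>

lemma ev_brace: "ev (brace l) = 0"
proof -
  have "z powi (int L * int l) = 1"
    using primitive(1) by (simp add: mult.commute flip: of_nat_mult)
  then have "ev (1 - s_pow (int L * int l)) = 0" by (simp add: ev_diff)
  then show ?thesis unfolding brace_def ev_prod using l_pos by (intro prod_zero) auto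
qed

subsection \<open>The base-changed algebra\<close>

lemma cutoff_add: "x \<in> cutoff k \<Longrightarrow> y \<in> cutoff k \<Longrightarrow> x + y \<in> cutoff k"
proof -
  assume "x \<in> cutoff k" "y \<in> cutoff k"
  then obtain v u x' y' where "x = smul (emb (brace k)) v + x'" "y = smul (emb (brace k)) u + y'"
    "v \<in> Ufull" "u \<in> Ufull" "x' \<in> qideal" "y' \<in> qideal" by (auto simp: cutoff_def)
  then have "x + y = smul (emb (brace k)) (v + u) + (x' + y')" "v + u \<in> Ufull" "x' + y' \<in> qideal"
    by (auto simp: smul_add full.C_add full.Z_add)
  then show ?thesis unfolding cutoff_def by blast
qed

lemma cutoff_mult_left: "y \<in> Ufull \<Longrightarrow> x \<in> cutoff k \<Longrightarrow> y * x \<in> cutoff k"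
  and cutoff_mult_right: "y \<in> Ufull \<Longrightarrow> x \<in> cutoff k \<Longrightarrow> x * y \<in> cutoff k"
proof -
  assume y: "y \<in> Ufull" and "x \<in> cutoff k"
  then obtain v x' where *: "x = smul (emb (brace k)) v + x'" "v \<in> Ufull" "x' \<in> qideal"
    by (auto simp: cutoff_def)
  then have "y * x = smul (emb (brace k)) (y * v) + y * x'" "y * v \<in> Ufull" "y * x' \<in> qideal"
    using y by (auto simp: distrib_left smul_mult_right full.mul_C qideal.left)
  then show "y * x \<in> cutoff k" unfolding cutoff_def by blast
  from * have "x * y = smul (emb (brace k)) (v * y) + x' * y" "v * y \<in> Ufull" "x' * y \<in> qideal"
    using y by (auto simp: distrib_right smul_mult_left full.mul_C qideal.right)
  then show "x * y \<in> cutoff k" unfolding cutoff_def by blast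
qed

lemma qideal_subset_cutoff: "qideal \<subseteq> cutoff k"
proof
  fix x assume "x \<in> qideal"
  then have "x = smul (emb (brace k)) 0 + x" "(0 :: 'n falg) \<in> Ufull" "x \<in> qideal"
    by (auto simp: full.C0)
  then show "x \<in> cutoff k" unfolding cutoff_def by blast
qed

lemma cutoff_smul_brace: "x \<in> Ufull \<Longrightarrow> smul (emb (brace k * c)) x \<in> cutoff k"
proof -
  assume "x \<in> Ufull"
  then have "smul (emb (brace k * c)) x = smul (emb (brace k)) (smul (emb c) x) + 0"
    "smul (emb c) x \<in> Ufull" "(0 :: 'n falg) \<in> qideal"
    by (auto simp: emb_mult full.C_smul qideal.zero)
  then show ?thesis unfolding cutoff_def by blast
qed

lemma cutoff_smul: "x \<in> cutoff k \<Longrightarrow> smul (emb c) x \<in> cutoff k"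
  using cutoff_mult_left[of "smul (emb c) 1" x k] full.C_smul[OF emb_in_As full.one_C]
  by (simp add: smul_mult_left)

lemma const_in_Uhat: "x \<in> Ufull \<Longrightarrow> (\<lambda>_. x) \<in> Uhat"
  using qideal_subset_cutoff qideal.zero by (auto simp: Uhat_def)

lemma Uhat_add: "x \<in> Uhat \<Longrightarrow> y \<in> Uhat \<Longrightarrow> x + y \<in> Uhat"
proof -
  assume *: "x \<in> Uhat" "y \<in> Uhat"
  have "(x + y) (Suc k) - (x + y) k = (x (Suc k) - x k) + (y (Suc k) - y k)" for k
    by (simp add: fun_apply)
  moreover have "(x (Suc k) - x k) + (y (Suc k) - y k) \<in> cutoff k" for k
    using * by (intro cutoff_add) (auto simp: Uhat_def)
  moreover have "(x + y) k \<in> Ufull" for k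
    using * by (simp add: Uhat_def fun_apply full.C_add)
  ultimately show ?thesis by (simp add: Uhat_def)
qed

lemma Uhat_mult: "x \<in> Uhat \<Longrightarrow> y \<in> Uhat \<Longrightarrow> x * y \<in> Uhat"
proof -
  assume *: "x \<in> Uhat" "y \<in> Uhat"
  \<comment> \<open>Discrete product rule: each difference lies in the cutoff and is multiplied by
    an element of \<open>Ufull\<close>.\<close>
  have "(x * y) (Suc k) - (x * y) k = (x (Suc k) - x k) * y (Suc k) + x k * (y (Suc k) - y k)" for k
    by (simp add: fun_apply left_diff_distrib right_diff_distrib)
  moreover have "(x (Suc k) - x k) * y (Suc k) + x k * (y (Suc k) - y k) \<in> cutoff k" for k
    using * by (intro cutoff_add cutoff_mult_left cutoff_mult_right) (auto simp: Uhat_def)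
  moreover have "(x * y) k \<in> Ufull" for k
    using * by (simp add: Uhat_def fun_apply full.mul_C)
  ultimately show ?thesis by (simp add: Uhat_def)
qed

lemma Uhat_smul: "c \<in> Ahat \<Longrightarrow> x \<in> Uhat \<Longrightarrow> (\<lambda>k. smul (emb (c k)) (x k)) \<in> Uhat"
proof -
  assume *: "c \<in> Ahat" "x \<in> Uhat"
  have "smul (emb (c (Suc k))) (x (Suc k)) - smul (emb (c k)) (x k) \<in> cutoff k" for k
  proof -
    obtain e where e: "c (Suc k) - c k = brace k * e" using *(1) by (auto simp: Ahat_def dvd_def)
    have "smul (emb (c (Suc k))) (x (Suc k)) - smul (emb (c k)) (x k)
      = smul (emb (c (Suc k) - c k)) (x (Suc k)) + smul (emb (c k)) (x (Suc k) - x k)"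
      by (simp add: emb_diff smul_diff smul_diff_left)
    moreover have "smul (emb (brace k * e)) (x (Suc k)) + smul (emb (c k)) (x (Suc k) - x k) \<in> cutoff k"
      using *(2) by (intro cutoff_add cutoff_smul_brace cutoff_smul) (auto simp: Uhat_def)
    ultimately show ?thesis by (simp add: e)
  qed
  moreover have "smul (emb (c k)) (x k) \<in> Ufull" for k
    using *(2) by (simp add: Uhat_def full.C_smul)
  ultimately show ?thesis by (simp add: Uhat_def)
qed

lemma Uhat_null_mult_left: "x \<in> Uhat \<Longrightarrow> y \<in> Uhat_null \<Longrightarrow> x * y \<in> Uhat_null"
  and Uhat_null_mult_right: "y \<in> Uhat \<Longrightarrow> x \<in> Uhat_null \<Longrightarrow> x * y \<in> Uhat_null"
proof -
  assume *: "x \<in> Uhat" "y \<in> Uhat_null"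
  have "(x * y) k \<in> cutoff k" for k
    using cutoff_mult_left[of "x k" "y k" k] * by (simp add: Uhat_null_def Uhat_def fun_apply)
  then show "x * y \<in> Uhat_null" using * Uhat_mult[of x y] by (simp add: Uhat_null_def)
next
  assume *: "y \<in> Uhat" "x \<in> Uhat_null"
  have "(x * y) k \<in> cutoff k" for k
    using cutoff_mult_right[of "y k" "x k" k] * by (simp add: Uhat_null_def Uhat_def fun_apply)
  then show "x * y \<in> Uhat_null" using * Uhat_mult[of x y] by (simp add: Uhat_null_def)
qed

lemma Us_iff: "p \<in> Us \<longleftrightarrow> Poly_Mapping.keys p \<subseteq> Uhat \<and> (\<forall>x. Poly_Mapping.lookup p x \<in> Qz)"
  by (auto simp: Us_def)

lemma Us_0: "0 \<in> Us"
  by (simp add: Us_iff Qz_0)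

lemma Us_add: "p \<in> Us \<Longrightarrow> r \<in> Us \<Longrightarrow> p + r \<in> Us"
  unfolding Us_iff using keys_add[of p r] by (auto simp: lookup_add Qz_add)

lemma Us_smul: "b \<in> Qz \<Longrightarrow> p \<in> Us \<Longrightarrow> smul b p \<in> Us"
  unfolding Us_iff by (auto simp: Qz_mult in_keys_iff)

lemma Us_single: "x \<in> Uhat \<Longrightarrow> b \<in> Qz \<Longrightarrow> Poly_Mapping.single x b \<in> Us"
  by (auto simp: Us_iff lookup_single when_def Qz_0)

lemma Us_diff: "p \<in> Us \<Longrightarrow> r \<in> Us \<Longrightarrow> p - r \<in> Us"
  using Us_add[of p "smul (-1) r"] Us_smul[of "-1" r] Qz_uminus[OF Qz_1] by (simp add: smul_uminus)

lemma Us_induct [consumes 1, case_names zero single add]: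
  assumes p: "p \<in> Us" and 0: "P 0" and single: "\<And>x b. x \<in> Uhat \<Longrightarrow> b \<in> Qz \<Longrightarrow> P (Poly_Mapping.single x b)"
    and add: "\<And>p r. p \<in> Us \<Longrightarrow> r \<in> Us \<Longrightarrow> P p \<Longrightarrow> P r \<Longrightarrow> P (p + r)"
  shows "P p"
proof -
  have "P (\<Sum>x\<in>S. Poly_Mapping.single x (Poly_Mapping.lookup p x))
      \<and> (\<Sum>x\<in>S. Poly_Mapping.single x (Poly_Mapping.lookup p x)) \<in> Us" if "S \<subseteq> Poly_Mapping.keys p" for S
    using that
  proof (induction S rule: infinite_finite_induct)
    case (insert x S)
    then show ?case using p by (auto simp: Us_iff[of p] intro!: add single Us_add Us_single)
  qed (auto simp: 0 Us_0)
  from this[of "Poly_Mapping.keys p"] show ?thesis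
    using poly_mapping_expand[of p] by simp
qed

lemma us_mult_single [simp]:
  "us_mult (Poly_Mapping.single x b) (Poly_Mapping.single y c) = Poly_Mapping.single (x * y) (b * c)"
  by (simp add: us_mult_def)

lemma us_mult_add_left: "us_mult (p + p') r = us_mult p r + us_mult p' r"
  and us_mult_add_right: "us_mult p (r + r') = us_mult p r + us_mult p r'"
  and us_mult_smul_left: "us_mult (smul b p) r = smul b (us_mult p r)"
  and us_mult_smul_right: "us_mult p (smul b r) = smul b (us_mult p r)"
  and us_mult_0_left [simp]: "us_mult 0 r = 0"
  and us_mult_0_right [simp]: "us_mult p 0 = 0"
  by (simp_all add: us_mult_def lin_ext_add lin_ext_fun_add lin_ext_smul lin_ext_fun_smul)

lemma us_mult_diff_left: "us_mult (p - p') r = us_mult p r - us_mult p' r"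
  using us_mult_add_left[of "p - p'" p' r] by simp

lemma us_mult_diff_right: "us_mult p (r - r') = us_mult p r - us_mult p r'"
  using us_mult_add_right[of p "r - r'" r'] by simp

lemma us_mult_assoc: "us_mult (us_mult p r) t = us_mult p (us_mult r t)"
proof (induction p rule: pm_induct)
  case (single x b)
  show ?case
  proof (induction r rule: pm_induct)
    case (single y c)
    show ?case
      by (induction t rule: pm_induct) (auto simp: us_mult_add_right mult.assoc)
  qed (auto simp: us_mult_add_right us_mult_add_left)
qed (auto simp: us_mult_add_left)

lemma us_mult_one_left: "us_mult us_one p = p"
  and us_mult_one_right: "us_mult p us_one = p"
  by (induction p rule: pm_induct) (auto simp: us_one_def us_mult_add_right us_mult_add_left)

lemma Us_mult: "p \<in> Us \<Longrightarrow> r \<in> Us \<Longrightarrow> us_mult p r \<in> Us"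
proof (induction p rule: Us_induct)
  case (single x b)
  show ?case using \<open>r \<in> Us\<close>
    by (induction r rule: Us_induct) (auto simp: us_mult_add_right Us_0 Us_add Us_single single Uhat_mult Qz_mult)
qed (auto simp: us_mult_add_left Us_0 Us_add)

lemma us_null_subset: "us_null \<subseteq> Us"
proof
  fix p assume "p \<in> us_null"
  then show "p \<in> Us"
    by (induction rule: us_null.induct)
      (auto simp: Us_0 Us_add Us_smul Phi_hat_def Uhat_null_def ev_hat_def ev_in_Qz
        intro!: Us_diff Us_single Uhat_add Uhat_smul Qz_1)
qed

text \<open>By linearity \<open>r\<close> may be taken to be a basis element \<open>t\<close> of
  \<open>Uhat\<close>. Multiplication by \<open>t\<close> turns each generating relation into the
  same relation between products in \<open>Uhat\<close>.\<close>

lemma us_null_mult_left: "p \<in> us_null \<Longrightarrow> r \<in> Us \<Longrightarrow> us_mult p r \<in> us_null"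
proof (induction rule: us_null.induct)
  case (additive x y)
  from \<open>r \<in> Us\<close> show ?case
  proof (induction r rule: Us_induct)
    case (single t b)
    have "smul b (Phi_hat (x * t + y * t) - Phi_hat (x * t) - Phi_hat (y * t)) \<in> us_null"
      using additive single by (intro us_null.scale us_null.additive Uhat_mult)
    then show ?case by (simp add: Phi_hat_def us_mult_diff_left smul_diff distrib_right)
  qed (auto simp: us_mult_add_right us_null.intros)
next
  case (homogeneous c x)
  from \<open>r \<in> Us\<close> show ?case
  proof (induction r rule: Us_induct)
    case (single t b)
    have "smul b (Phi_hat (\<lambda>k. smul (emb (c k)) ((x * t) k)) - smul (ev_hat c) (Phi_hat (x * t))) \<in> us_null"
      using homogeneous single by (intro us_null.scale us_null.homogeneous Uhat_mult)
    moreover have "(\<lambda>k. smul (emb (c k)) (x k)) * t = (\<lambda>k. smul (emb (c k)) ((x * t) k))"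
      by (intro ext) (simp add: fun_apply smul_mult_left)
    ultimately show ?case
      by (simp add: Phi_hat_def us_mult_diff_left us_mult_smul_left smul_diff mult.commute)
  qed (auto simp: us_mult_add_right us_null.intros)
next
  case (null x)
  from \<open>r \<in> Us\<close> show ?case
  proof (induction r rule: Us_induct)
    case (single t b)
    have "smul b (Phi_hat (x * t)) \<in> us_null"
      using null single by (intro us_null.scale us_null.null Uhat_null_mult_right)
    then show ?case by (simp add: Phi_hat_def)
  qed (auto simp: us_mult_add_right us_null.intros)
qed (auto simp: us_mult_add_left us_mult_smul_left us_null.intros)

lemma us_null_mult_right: "p \<in> us_null \<Longrightarrow> r \<in> Us \<Longrightarrow> us_mult r p \<in> us_null"
proof (induction rule: us_null.induct)
  case (additive x y)
  from \<open>r \<in> Us\<close> show ?case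
  proof (induction r rule: Us_induct)
    case (single t b)
    have "smul b (Phi_hat (t * x + t * y) - Phi_hat (t * x) - Phi_hat (t * y)) \<in> us_null"
      using additive single by (intro us_null.scale us_null.additive Uhat_mult)
    then show ?case by (simp add: Phi_hat_def us_mult_diff_right smul_diff distrib_left)
  qed (auto simp: us_mult_add_left us_null.intros)
next
  case (homogeneous c x)
  from \<open>r \<in> Us\<close> show ?case
  proof (induction r rule: Us_induct)
    case (single t b)
    have "smul b (Phi_hat (\<lambda>k. smul (emb (c k)) ((t * x) k)) - smul (ev_hat c) (Phi_hat (t * x))) \<in> us_null"
      using homogeneous single by (intro us_null.scale us_null.homogeneous Uhat_mult)
    moreover have "t * (\<lambda>k. smul (emb (c k)) (x k)) = (\<lambda>k. smul (emb (c k)) ((t * x) k))"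
      by (intro ext) (simp add: fun_apply smul_mult_right)
    ultimately show ?case
      by (simp add: Phi_hat_def us_mult_diff_right us_mult_smul_right smul_diff mult.commute)
  qed (auto simp: us_mult_add_left us_null.intros)
next
  case (null x)
  from \<open>r \<in> Us\<close> show ?case
  proof (induction r rule: Us_induct)
    case (single t b)
    have "smul b (Phi_hat (t * x)) \<in> us_null"
      using null single by (intro us_null.scale us_null.null Uhat_null_mult_left)
    then show ?case by (simp add: Phi_hat_def)
  qed (auto simp: us_mult_add_left us_null.intros)
qed (auto simp: us_mult_add_right us_mult_smul_right us_null.intros)

lemma us_one_eq: "us_one = Phi (1 :: 'n falg)"
proof -
  have *: "(1 :: nat \<Rightarrow> 'n falg) = (\<lambda>_. 1)" by (intro ext) simp
  show ?thesis unfolding us_one_def Phi_def Phi_hat_def by (simp only: *)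
qed

lemma Phi_in_Us: "x \<in> Ufull \<Longrightarrow> Phi x \<in> Us"
  by (simp add: Phi_def Phi_hat_def Us_single const_in_Uhat Qz_1)

lemma quotient_algebra_us: "quotient_algebra Qz Us us_null us_mult us_one"
proof
  show "us_one \<in> Us" unfolding us_one_eq by (rule Phi_in_Us[OF full.one_C])
qed (use us_null_subset in \<open>auto intro: us_null.intros simp: Qz_1 Qz_diff Qz_mult Us_add Us_smul Us_mult us_null_mult_left us_null_mult_right
    us_mult_add_left us_mult_add_right us_mult_smul_left us_mult_smul_right us_mult_assoc us_mult_one_left us_mult_one_right\<close>)

sublocale us: quotient_algebra Qz Us us_null us_mult us_one
  by (rule quotient_algebra_us)

lemma Phi_mult: "Phi (x * y) = us_mult (Phi x) (Phi y)"
proof -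
  have "(\<lambda>_. x) * (\<lambda>_. y) = (\<lambda>_::nat. x * y)" by (intro ext) (simp add: fun_apply)
  then show ?thesis by (simp add: Phi_def Phi_hat_def)
qed

lemma Phi_add: "x \<in> Ufull \<Longrightarrow> y \<in> Ufull \<Longrightarrow> eqmod us_null (Phi (x + y)) (Phi x + Phi y)"
proof -
  assume "x \<in> Ufull" "y \<in> Ufull"
  from us_null.additive[OF const_in_Uhat[OF this(1)] const_in_Uhat[OF this(2)]] show ?thesis
    by (simp add: Phi_def eqmod_def diff_diff_eq plus_fun_def)
qed

text \<open>A Laurent polynomial is a constant family in \<open>Ahat\<close>, and
  \<open>ev_hat\<close> restricts to \<open>ev\<close> on constant families.\<close>

lemma Phi_smul: "x \<in> Ufull \<Longrightarrow> eqmod us_null (Phi (smul (emb c) x)) (smul (ev c) (Phi x))"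
  using us_null.homogeneous[OF _ const_in_Uhat, of "\<lambda>_. c" x]
  by (simp add: Phi_def eqmod_def Ahat_def ev_hat_def)

lemma Phi_null: "x \<in> qideal \<Longrightarrow> Phi x \<in> us_null"
  using qideal_subset_cutoff full.Z_C unfolding Phi_def
  by (intro us_null.null) (auto simp: Uhat_null_def const_in_Uhat)

lemma Phi_cong: "x \<in> Ufull \<Longrightarrow> y \<in> Ufull \<Longrightarrow> eqmod qideal x y \<Longrightarrow> eqmod us_null (Phi x) (Phi y)"
proof -
  assume xy: "x \<in> Ufull" "y \<in> Ufull" and eq: "eqmod qideal x y"
  have z: "x - y \<in> qideal" "x - y \<in> Ufull" using eq full.Z_C by (auto simp: eqmod_def)
  have "eqmod us_null (Phi (y + (x - y))) (Phi y + Phi (x - y))" by (rule Phi_add[OF xy(2) z(2)])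
  moreover have "eqmod us_null (Phi y + Phi (x - y)) (Phi y + 0)"
    by (intro eqmod_add us.add_subgroup_Z eqmod_refl) (simp add: eqmod_0 Phi_null z)
  ultimately show ?thesis using eqmod_trans[OF us.add_subgroup_Z] by fastforce
qed

end

context quotient_algebra
begin

lemma nl_subset_tn: "nl m \<subseteq> tn m"
proof
  fix t assume "t \<in> nl m"
  then show "t \<in> tn m"
    by (induction rule: tens_null.induct)
      (auto simp: tn_0 tn_add tn_smul B1 intro!: tn_diff tn_single C_add C_smul)
qed

end

section \<open>Tensors modulo \<open>brace k\<close>, and tensors with integral coefficients\<close>

context root_datum
begin

lemma tensor_nullE:
  assumes "t \<in> tensor_null k m"
  obtains u v where "t = u + smul (emb (brace k)) v" "u \<in> full.nl m" "v \<in> full.tn m"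
  using assms unfolding tensor_null_def by blast

lemma tensor_nullI: "u \<in> full.nl m \<Longrightarrow> v \<in> full.tn m \<Longrightarrow> u + smul (emb (brace k)) v \<in> tensor_null k m"
  unfolding tensor_null_def by blast

lemma nl_subset_tensor_null: "full.nl m \<subseteq> tensor_null k m"
  using tensor_nullI[OF _ full.tn_0] by fastforce

lemma add_subgroup_tensor_null: "add_subgroup (tensor_null k m)"
proof -
  have "t - t' \<in> tensor_null k m" if tt: "t \<in> tensor_null k m" "t' \<in> tensor_null k m" for t t'
  proof -
    obtain u v where "t = u + smul (emb (brace k)) v" "u \<in> full.nl m" "v \<in> full.tn m"
      by (rule tensor_nullE[OF tt(1)])
    moreover obtain u' v' where "t' = u' + smul (emb (brace k)) v'" "u' \<in> full.nl m" "v' \<in> full.tn m"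
      by (rule tensor_nullE[OF tt(2)])
    moreover from calculation have "t - t' = (u - u') + smul (emb (brace k)) (v - v')" by (simp add: smul_diff)
    ultimately show ?thesis
      by (simp only:) (intro tensor_nullI full.tn_diff add_subgroup_diff[OF full.add_subgroup_nl])
  qed
  moreover have "0 \<in> tensor_null k m" using nl_subset_tensor_null tens_null.zero by blast
  ultimately show ?thesis by (simp add: add_subgroup_def)
qed

lemmas tensor_null_refl = eqmod_refl[OF add_subgroup_tensor_null]
  and tensor_null_sym = eqmod_sym[OF add_subgroup_tensor_null]
  and tensor_null_trans [trans] = eqmod_trans[OF add_subgroup_tensor_null]
  and tensor_null_add = eqmod_add[OF add_subgroup_tensor_null]
  and tensor_null_sum = eqmod_sum[OF add_subgroup_tensor_null]

lemma nl_imp_tensor_null: "eqmod (full.nl m) t u \<Longrightarrow> eqmod (tensor_null k m) t u"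
  by (rule eqmod_mono[OF _ nl_subset_tensor_null])

lemma tensor_null_lmap:
  assumes "full.slotwise_linear m m' F" "\<And>xs. length xs = m \<Longrightarrow> set xs \<subseteq> Ufull \<Longrightarrow> length (F xs) = m' \<and> set (F xs) \<subseteq> Ufull"
    and "eqmod (tensor_null k m) t t'"
  shows "eqmod (tensor_null k m') (lmap F t) (lmap F t')"
proof -
  obtain u v where "t - t' = u + smul (emb (brace k)) v" "u \<in> full.nl m" "v \<in> full.tn m"
    using assms(3) by (auto simp: eqmod_def elim: tensor_nullE)
  then show ?thesis unfolding eqmod_def lmap_diff[symmetric]
    by (simp add: lmap_add lmap_smul) (intro tensor_nullI full.lmap_nl[OF assms(1)] full.tn_lmap assms(2))
qed

lemma tensor_null_times:
  assumes "eqmod (tensor_null k m) t t'" "eqmod (tensor_null k m') u u'" "t' \<in> full.tn m" "u \<in> full.tn m'"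
  shows "eqmod (tensor_null k (m + m')) (t * u) (t' * u')"
proof -
  obtain x v where *: "t - t' = x + smul (emb (brace k)) v" "x \<in> full.nl m" "v \<in> full.tn m"
    using assms(1) by (auto simp: eqmod_def elim: tensor_nullE)
  obtain x' v' where **: "u - u' = x' + smul (emb (brace k)) v'" "x' \<in> full.nl m'" "v' \<in> full.tn m'"
    using assms(2) by (auto simp: eqmod_def elim: tensor_nullE)
  have "eqmod (tensor_null k (m + m')) (t * u) (t' * u)"
    unfolding eqmod_def left_diff_distrib[symmetric] *(1)
    by (simp add: distrib_right smul_mult_left) (intro tensor_nullI full.times_nl_left full.tn_times * assms)
  also have "eqmod (tensor_null k (m + m')) \<dots> (t' * u')"
    unfolding eqmod_def right_diff_distrib[symmetric] **(1)
    by (simp add: distrib_left smul_mult_right) (intro tensor_nullI full.times_nl_right full.tn_times ** assms)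
  finally show ?thesis .
qed

lemma tensor_null_tens_mult:
  assumes "eqmod (tensor_null k m) t t'" "eqmod (tensor_null k m) u u'" "t' \<in> full.tn m" "u \<in> full.tn m"
  shows "eqmod (tensor_null k m) (tens_mult (*) t u) (tens_mult (*) t' u')"
proof -
  obtain x v where *: "t - t' = x + smul (emb (brace k)) v" "x \<in> full.nl m" "v \<in> full.tn m"
    using assms(1) by (auto simp: eqmod_def elim: tensor_nullE)
  obtain x' v' where **: "u - u' = x' + smul (emb (brace k)) v'" "x' \<in> full.nl m" "v' \<in> full.tn m"
    using assms(2) by (auto simp: eqmod_def elim: tensor_nullE)
  have "eqmod (tensor_null k m) (tens_mult (*) t u) (tens_mult (*) t' u)"
    unfolding eqmod_def tens_mult_diff_left[symmetric] *(1)
    by (simp add: tens_mult_add_left tens_mult_smul_left)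
      (intro tensor_nullI full.tens_mult_nl_left full.tn_tens_mult * assms)
  also have "eqmod (tensor_null k m) \<dots> (tens_mult (*) t' u')"
    unfolding eqmod_def tens_mult_diff_right[symmetric] **(1)
    by (simp add: tens_mult_add_right tens_mult_smul_right)
      (intro tensor_nullI full.tens_mult_nl_right full.tn_tens_mult ** assms)
  finally show ?thesis .
qed

text \<open>Only the coefficients are restricted. Unlike membership in \<open>full.tn m\<close>,
  this is preserved by \<open>lmap F\<close> for every \<open>F\<close>.\<close>

definition integral :: "'n tensor \<Rightarrow> bool" where
  "integral t \<longleftrightarrow> (\<forall>xs. Poly_Mapping.lookup t xs \<in> As)"

lemma tn_integral: "t \<in> full.tn m \<Longrightarrow> integral t"
  by (simp add: full.tn_iff integral_def)

lemma integral_single: "integral (Poly_Mapping.single xs (emb c))"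
  using full.B0 by (auto simp: integral_def lookup_single when_def)

lemma integral_0: "integral 0"
  using full.B0 by (simp add: integral_def)

lemma integral_add: "integral t \<Longrightarrow> integral u \<Longrightarrow> integral (t + u)"
  by (auto simp: integral_def lookup_add full.B_add)

lemma integral_smul: "integral t \<Longrightarrow> integral (smul (emb c) t)"
  by (auto simp: integral_def full.B_mult)

lemma integral_sum: "(\<And>i. i \<in> I \<Longrightarrow> integral (f i)) \<Longrightarrow> integral (sum f I)"
  by (induction I rule: infinite_finite_induct) (auto simp: integral_0 integral_add)

lemma integral_induct [consumes 1, case_names zero single add]:
  assumes t: "integral t" and 0: "P 0" and single: "\<And>xs c. P (Poly_Mapping.single xs (emb c))"
    and add: "\<And>t u. integral t \<Longrightarrow> integral u \<Longrightarrow> P t \<Longrightarrow> P u \<Longrightarrow> P (t + u)"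
  shows "P t"
proof -
  have "P (\<Sum>x\<in>S. Poly_Mapping.single x (Poly_Mapping.lookup t x))
      \<and> integral (\<Sum>x\<in>S. Poly_Mapping.single x (Poly_Mapping.lookup t x))" for S
  proof (induction S rule: infinite_finite_induct)
    case (insert x S)
    have "Poly_Mapping.lookup t x \<in> As" using t by (simp add: integral_def)
    then obtain c where "Poly_Mapping.lookup t x = emb c" by (auto simp: As_def)
    then show ?case using insert by (auto intro!: add single integral_add integral_single)
  qed (auto simp: 0 integral_0)
  from this[of "Poly_Mapping.keys t"] show ?thesis
    using poly_mapping_expand[of t] by simp
qed

lemma integral_lmap: "integral t \<Longrightarrow> integral (lmap F t)"
  by (induction rule: integral_induct) (auto simp: integral_0 lmap_add integral_add integral_single)

lemma integral_tens_mult: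
  assumes "integral t" "integral u" shows "integral (tens_mult mul t u)"
  using assms(1)
proof (induction t rule: integral_induct)
  case (single xs c)
  show ?case using assms(2)
    by (induction u rule: integral_induct)
      (auto simp: integral_0 tens_mult_add_right integral_add emb_mult[symmetric] integral_single)
qed (auto simp: integral_0 tens_mult_add_left integral_add)

lemma integral_times:
  assumes "integral t" "integral u" shows "integral (t * u)"
  using assms(1)
proof (induction t rule: integral_induct)
  case (single xs c)
  show ?case using assms(2)
    by (induction u rule: integral_induct)
      (auto simp: integral_0 distrib_left integral_add mult_single emb_mult[symmetric] integral_single)
qed (auto simp: integral_0 distrib_right integral_add)

end

section \<open>Base change of tensors to the root of unity\<close>

context root_of_unity_datum
begin

text \<open>The map induced by \<open>Phi\<close> on tensors; evaluation of scalars is additive on integral tensors only.\<close>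

definition Phi_tensor :: "'n tensor \<Rightarrow> ('n us list \<Rightarrow>\<^sub>0 complex)" where
  "Phi_tensor t = (\<Sum>xs\<in>Poly_Mapping.keys t. Poly_Mapping.single (map Phi xs) (evK (Poly_Mapping.lookup t xs)))"

lemma evK_0 [simp]: "evK 0 = 0"
  by (metis emb_0 ev_0 unemb_emb)

lemma evK_add: "x \<in> As \<Longrightarrow> y \<in> As \<Longrightarrow> evK (x + y) = evK x + evK y"
  by (auto simp: As_def emb_add[symmetric] ev_add)

lemma Phi_tensor_superset: "finite S \<Longrightarrow> Poly_Mapping.keys t \<subseteq> S \<Longrightarrow>
    Phi_tensor t = (\<Sum>xs\<in>S. Poly_Mapping.single (map Phi xs) (evK (Poly_Mapping.lookup t xs)))"
  unfolding Phi_tensor_def by (intro sum.mono_neutral_left) (auto simp: in_keys_iff)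

lemma Phi_tensor_0 [simp]: "Phi_tensor 0 = 0"
  by (simp add: Phi_tensor_def)

lemma Phi_tensor_single: "Phi_tensor (Poly_Mapping.single xs (emb c)) = Poly_Mapping.single (map Phi xs) (ev c)"
  by (subst Phi_tensor_superset[of "{xs}"]) auto

lemma Phi_tensor_add:
  assumes "integral t" "integral u" shows "Phi_tensor (t + u) = Phi_tensor t + Phi_tensor u"
proof -
  let ?S = "Poly_Mapping.keys t \<union> Poly_Mapping.keys u"
  have "Poly_Mapping.keys (t + u) \<subseteq> ?S" by (rule keys_add)
  then show ?thesis using assms
    by (simp add: Phi_tensor_superset[of ?S] lookup_add evK_add integral_def single_add sum.distrib)
qed

lemma Phi_tensor_smul: "integral t \<Longrightarrow> Phi_tensor (smul (emb c) t) = smul (ev c) (Phi_tensor t)"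
  by (induction rule: integral_induct)
    (auto simp: smul_add Phi_tensor_add integral_smul emb_mult[symmetric] Phi_tensor_single ev_mult)

lemma Phi_tensor_diff:
  assumes "integral t" "integral u" shows "Phi_tensor (t - u) = Phi_tensor t - Phi_tensor u"
proof -
  have "t - u = t + smul (emb (- 1)) u" by (simp add: emb_uminus smul_uminus)
  then show ?thesis using assms
    by (simp only: Phi_tensor_add[OF assms(1) integral_smul] Phi_tensor_smul) (simp add: ev_uminus smul_uminus)
qed

lemma Phi_tensor_sum: "(\<And>i. i \<in> I \<Longrightarrow> integral (f i)) \<Longrightarrow> Phi_tensor (sum f I) = (\<Sum>i\<in>I. Phi_tensor (f i))"
  by (induction I rule: infinite_finite_induct) (auto simp: Phi_tensor_add integral_sum)

lemma Phi_tensor_lmap: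
  "integral t \<Longrightarrow> (\<And>xs. map Phi (F xs) = G (map Phi xs)) \<Longrightarrow> Phi_tensor (lmap F t) = lmap G (Phi_tensor t)"
  by (induction rule: integral_induct)
    (auto simp: lmap_add Phi_tensor_add integral_lmap Phi_tensor_single)

lemma Phi_tensor_lmap_length:
  "t \<in> full.tn m \<Longrightarrow> (\<And>xs. length xs = m \<Longrightarrow> map Phi (F xs) = G (map Phi xs)) \<Longrightarrow>
    Phi_tensor (lmap F t) = lmap G (Phi_tensor t)"
proof (induction rule: full.tn_induct)
  case (single xs b)
  then show ?case by (auto simp: As_def Phi_tensor_single)
qed (auto simp: lmap_add Phi_tensor_add integral_lmap tn_integral)

lemma map_Phi_mult: "map Phi (map2 (*) xs ys) = map2 us_mult (map Phi xs) (map Phi ys)"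
  by (rule nth_equalityI) (auto simp: Phi_mult)

lemma Phi_tensor_tens_mult:
  assumes "integral t" "integral u"
  shows "Phi_tensor (tens_mult (*) t u) = tens_mult us_mult (Phi_tensor t) (Phi_tensor u)"
  using assms(1)
proof (induction t rule: integral_induct)
  case (single xs c)
  show ?case using assms(2)
    by (induction u rule: integral_induct)
      (auto simp: tens_mult_add_right Phi_tensor_add integral_tens_mult integral_single
        emb_mult[symmetric] Phi_tensor_single ev_mult map_Phi_mult simp del: map_map)
qed (auto simp: tens_mult_add_left Phi_tensor_add integral_tens_mult assms(2))

lemma Phi_tensor_times:
  assumes "integral t" "integral u"
  shows "Phi_tensor (t * u) = Phi_tensor t * Phi_tensor u"
  using assms(1)
proof (induction t rule: integral_induct)
  case (single xs c)
  show ?case using assms(2)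
    by (induction u rule: integral_induct)
      (auto simp: distrib_left Phi_tensor_add integral_times integral_single
        emb_mult[symmetric] Phi_tensor_single ev_mult mult_single plus_list_def)
qed (auto simp: distrib_right Phi_tensor_add integral_times assms(2))

lemma map_Phi_Us: "set xs \<subseteq> Ufull \<Longrightarrow> set (map Phi xs) \<subseteq> Us"
  by (auto simp: Phi_in_Us)

lemma Phi_tensor_tn: "t \<in> full.tn m \<Longrightarrow> Phi_tensor t \<in> us.tn m"
proof (induction rule: full.tn_induct)
  case (single xs b)
  then show ?case by (auto simp: As_def Phi_tensor_single ev_in_Qz subset_iff intro!: us.tn_single Phi_in_Us)
qed (auto simp: us.tn_0 Phi_tensor_add tn_integral us.tn_add)

text \<open>Modulo \<open>us_null\<close>, \<open>Phi\<close> is additive, turns scalars into their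
  evaluations and kills \<open>qideal\<close>, so each kind of generator goes to a relation.
  Integrality is carried through the induction because additivity of \<open>Phi_tensor\<close>
  depends on it.\<close>

lemma Phi_tensor_nl: "t \<in> full.nl m \<Longrightarrow> Phi_tensor t \<in> us.nl m"
proof -
  have single1: "Phi_tensor (Poly_Mapping.single xs 1) = Poly_Mapping.single (map Phi xs) 1"
    and int1: "integral (Poly_Mapping.single xs 1)" for xs
    using Phi_tensor_single[of xs 1] integral_single[of xs 1] by auto
  have int_diff: "integral (t - u)" if "integral t" "integral u" for t u
    using that full.B_diff by (auto simp: integral_def lookup_minus)
  assume "t \<in> full.nl m"
  then have "integral t \<and> Phi_tensor t \<in> us.nl m"
  proof (induction rule: tens_null.induct)
    case (scale b t)
    then show ?case by (auto simp: As_def Phi_tensor_smul integral_smul ev_in_Qz intro!: tens_null.scale)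
  next
    case (additive xs ys x y)
    have "eqmod (us.nl m) (Poly_Mapping.single (map Phi xs @ Phi (x + y) # map Phi ys) 1)
        (Poly_Mapping.single (map Phi xs @ (Phi x + Phi y) # map Phi ys) 1)"
      using additive by (intro us.nl_pure_cong Phi_add map_Phi_Us us.B1) (auto intro!: Phi_in_Us full.C_add us.C_add)
    also have "eqmod (us.nl m) \<dots> (Poly_Mapping.single (map Phi xs @ Phi x # map Phi ys) 1
        + Poly_Mapping.single (map Phi xs @ Phi y # map Phi ys) 1)"
      using additive by (intro us.nl_pure_add map_Phi_Us) (auto intro!: Phi_in_Us)
    finally have eq: "Poly_Mapping.single (map Phi xs @ Phi (x + y) # map Phi ys) 1
        - Poly_Mapping.single (map Phi xs @ Phi x # map Phi ys) 1
        - Poly_Mapping.single (map Phi xs @ Phi y # map Phi ys) 1 \<in> us.nl m"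
      by (simp add: eqmod_def diff_diff_eq)
    have "Phi_tensor (Poly_Mapping.single (xs @ (x + y) # ys) 1 - Poly_Mapping.single (xs @ x # ys) 1
        - Poly_Mapping.single (xs @ y # ys) 1)
      = Poly_Mapping.single (map Phi xs @ Phi (x + y) # map Phi ys) 1
        - Poly_Mapping.single (map Phi xs @ Phi x # map Phi ys) 1
        - Poly_Mapping.single (map Phi xs @ Phi y # map Phi ys) 1"
      by (simp only: Phi_tensor_diff int_diff int1 single1 map_append list.map)
    then show ?case using eq int_diff[OF int_diff[OF int1 int1] int1] by (simp only: simp_thms)
  next
    case (homogeneous xs ys x b)
    then obtain c where c: "b = emb c" by (auto simp: As_def)
    have "eqmod (us.nl m) (Poly_Mapping.single (map Phi xs @ Phi (smul b x) # map Phi ys) 1)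
        (Poly_Mapping.single (map Phi xs @ smul (ev c) (Phi x) # map Phi ys) 1)"
      using homogeneous unfolding c
      by (intro us.nl_pure_cong Phi_smul map_Phi_Us us.B1) (auto intro!: Phi_in_Us full.C_smul us.C_smul ev_in_Qz)
    also have "eqmod (us.nl m) \<dots> (Poly_Mapping.single (map Phi xs @ Phi x # map Phi ys) (ev c))"
      using homogeneous by (intro us.nl_pure_smul map_Phi_Us) (auto intro!: Phi_in_Us ev_in_Qz)
    finally show ?case
      by (simp add: Phi_tensor_diff int_diff int1 single1 eqmod_def c integral_single Phi_tensor_single)
  next
    case (null xs ys x)
    then show ?case using us.nl_pure_null[of "map Phi xs" "map Phi ys" "Phi x" m 1]
      by (simp add: int1 single1 map_Phi_Us[simplified] Phi_null us.B1)
  qed (auto simp: integral_0 tens_null.zero integral_add Phi_tensor_add intro: tens_null.add)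
  then show ?thesis by simp
qed

text \<open>The multiple of \<open>brace l\<close> allowed by \<open>tensor_null l m\<close>
  disappears under evaluation. This is why congruences at level \<open>l\<close> descend to the root
  of unity.\<close>

lemma Phi_tensor_cong:
  assumes eq: "eqmod (tensor_null l m) t u" and int: "integral t" "integral u"
  shows "eqmod (us.nl m) (Phi_tensor t) (Phi_tensor u)"
proof -
  obtain x v where *: "t - u = x + smul (emb (brace l)) v" "x \<in> full.nl m" "v \<in> full.tn m"
    using eq by (auto simp: eqmod_def elim: tensor_nullE)
  have ints: "integral x" "integral v" using * full.nl_subset_tn tn_integral by blast+
  have "Phi_tensor t - Phi_tensor u = Phi_tensor (t - u)" by (simp add: Phi_tensor_diff int)
  also have "\<dots> = Phi_tensor x"
    using ints by (simp add: * Phi_tensor_add integral_smul Phi_tensor_smul ev_brace)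
  finally show ?thesis unfolding eqmod_def using Phi_tensor_nl[OF *(2)] by simp
qed

lemma component_at_eq: "component_at \<nu> t = tens_mult us_mult t (Poly_Mapping.single (map (\<lambda>v. Phi (ind v)) \<nu>) 1)"
proof -
  have "map2 (\<lambda>p v. us_mult p (Phi (ind v))) ps \<nu> = map2 us_mult ps (map (\<lambda>v. Phi (ind v)) \<nu>)" for ps
    by (rule nth_equalityI) auto
  then show ?thesis by (simp add: component_at_def tens_mult_single_right lmap_def)
qed

lemma ind_tensor_tn: "length \<nu> = m \<Longrightarrow> Poly_Mapping.single (map (\<lambda>v. Phi (ind v)) \<nu>) 1 \<in> us.tn m"
  by (auto intro!: us.tn_single us.B1 Phi_in_Us ind_in_Ufull)

lemma component_at_cong:
  "eqmod (us.nl m) t u \<Longrightarrow> length \<nu> = m \<Longrightarrow> eqmod (us.nl m) (component_at \<nu> t) (component_at \<nu> u)"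
  unfolding component_at_eq eqmod_def tens_mult_diff_left[symmetric]
  by (rule us.tens_mult_nl_left[OF _ ind_tensor_tn])

lemma component_at_tn: "t \<in> us.tn m \<Longrightarrow> length \<nu> = m \<Longrightarrow> component_at \<nu> t \<in> us.tn m"
  unfolding component_at_eq by (rule us.tn_tens_mult[OF _ ind_tensor_tn])

text \<open>The lists in \<open>t\<close> have length \<open>m\<close>, so the indicators split
  exactly at the boundary between the two tensors.\<close>

lemma component_at_times:
  assumes "t \<in> us.tn m" "length \<mu> = m"
  shows "component_at (\<mu> @ \<nu>) (t * u) = component_at \<mu> t * component_at \<nu> u"
proof -
  have "component_at \<nu> = lmap (\<lambda>ps. map2 (\<lambda>p v. us_mult p (Phi (ind v))) ps \<nu>)" for \<nu>
    by (simp add: component_at_def lmap_def)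
  note c = this
  show ?thesis using assms(1)
  proof (induction t rule: us.tn_induct)
    case (single xs b)
    show ?case
    proof (induction u rule: pm_induct)
      case (single ys b')
      show ?case using \<open>length xs = m\<close> assms(2)
        by (simp add: c mult_single plus_list_def)
    qed (auto simp: c distrib_left lmap_add)
  qed (auto simp: c distrib_right lmap_add)
qed

subsection \<open>The square of the antipode\<close>

lemma us_S2_add: "us_S2 (p + r) = us_S2 p + us_S2 r"
  and us_S2_diff: "us_S2 (p - r) = us_S2 p - us_S2 r"
  and us_S2_smul: "us_S2 (smul b p) = smul b (us_S2 p)"
  and us_S2_Phi_hat: "us_S2 (Phi_hat x) = Phi_hat (\<lambda>k. antipode (antipode (x k)))"
  and us_S2_0: "us_S2 0 = 0"
  by (simp_all add: us_S2_def lin_ext_add lin_ext_smul lin_ext_diff Phi_hat_def)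

lemma us_S2_Phi: "us_S2 (Phi x) = Phi (antipode (antipode x))"
  by (simp add: Phi_def us_S2_Phi_hat)

lemma antipode_antipode_cutoff: "x \<in> cutoff k \<Longrightarrow> antipode (antipode x) \<in> cutoff k"
proof -
  assume "x \<in> cutoff k"
  then obtain v y where "x = smul (emb (brace k)) v + y" "v \<in> Ufull" "y \<in> qideal"
    by (auto simp: cutoff_def)
  then have "antipode (antipode x) = smul (emb (brace k)) (antipode (antipode v)) + antipode (antipode y)"
    "antipode (antipode v) \<in> Ufull" "antipode (antipode y) \<in> qideal"
    by (auto simp: antipode_add antipode_smul antipode_antipode_Ufull antipode_antipode_qideal)
  then show ?thesis unfolding cutoff_def by blast
qed

lemma antipode_antipode_Uhat: "x \<in> Uhat \<Longrightarrow> (\<lambda>k. antipode (antipode (x k))) \<in> Uhat"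
  using antipode_antipode_cutoff antipode_antipode_Ufull by (simp add: Uhat_def antipode_diff[symmetric])

lemma us_S2_Us: "p \<in> Us \<Longrightarrow> us_S2 p \<in> Us"
proof (induction p rule: Us_induct)
  case (single x b)
  have "smul b (Phi_hat (\<lambda>k. antipode (antipode (x k)))) \<in> Us"
    unfolding Phi_hat_def by (intro Us_smul single Us_single antipode_antipode_Uhat Qz_1)
  moreover have "us_S2 (Poly_Mapping.single x b) = smul b (Phi_hat (\<lambda>k. antipode (antipode (x k))))"
    by (simp add: us_S2_def)
  ultimately show ?case by simp
qed (auto simp: us_S2_add us_S2_0 Us_0 Us_add)

lemma us_S2_null: "p \<in> us_null \<Longrightarrow> us_S2 p \<in> us_null"
proof (induction rule: us_null.induct)
  case (additive x y)
  have "(\<lambda>k. antipode (antipode ((x + y) k))) = (\<lambda>k. antipode (antipode (x k))) + (\<lambda>k. antipode (antipode (y k)))"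
    by (intro ext) (simp add: fun_apply antipode_add)
  then show ?case
    using us_null.additive[OF antipode_antipode_Uhat[OF additive(1)] antipode_antipode_Uhat[OF additive(2)]]
    by (simp add: us_S2_diff us_S2_Phi_hat)
next
  case (homogeneous c x)
  show ?case
    using us_null.homogeneous[OF homogeneous(1) antipode_antipode_Uhat[OF homogeneous(2)]]
    by (simp add: us_S2_diff us_S2_smul us_S2_Phi_hat antipode_smul)
next
  case (null x)
  then have "(\<lambda>k. antipode (antipode (x k))) \<in> Uhat_null"
    by (auto simp: Uhat_null_def antipode_antipode_Uhat antipode_antipode_cutoff)
  then show ?case unfolding us_S2_Phi_hat by (rule us_null.null)
qed (auto simp: us_S2_add us_S2_smul us_S2_0 intro: us_null.intros)

lemma linear_mod_us_S2: "us.linear_mod us_S2"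
  by (simp add: us.linear_mod_def us_S2_Us us_S2_null us_S2_add us_S2_smul eqmod_refl[OF us.add_subgroup_Z])

end

context root_datum
begin

section \<open>The coefficients of the R-matrix\<close>

text \<open>\<open>bcoef\<close> as a Laurent polynomial: (1 - q_i^(-2)) [k]_i = q_i^(k-1) -
  q_i^(-k-1), so each quantum integer in the factorial absorbs one factor 1 - q_i^(-2).\<close>

definition bpol :: "nat list \<Rightarrow> laurent" where
  "bpol r = (\<Prod>j<N. s_pow (int L * (int (d (w ! j)) * int (r ! j * (r ! j + 1) div 2)))
    * (\<Prod>k=1..r ! j. s_pow (int L * (int (d (w ! j)) * (int k - 1)))
        - s_pow (int L * (int (d (w ! j)) * (- int k - 1)))))"

lemma qi_pow_eq: "qi_pow i k = emb (s_pow (int L * (int (d i) * k)))"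
  by (simp add: qi_pow_def q_pow_def)

lemma qi_pow_add: "qi_pow i (j + k) = qi_pow i j * qi_pow i k"
  by (simp add: qi_pow_eq emb_mult[symmetric] s_pow_add[symmetric] distrib_left)

lemma qi_pow_diff_nonzero: "qi_pow i 1 - qi_pow i (- 1) \<noteq> 0"
  using L_pos d_pos[of i] by (simp add: qi_pow_eq emb_eq_iff s_pow_eq_iff)

lemma qint_mult: "(1 - qi_pow i (- 2)) * qint i k = qi_pow i (k - 1) - qi_pow i (- k - 1)"
proof -
  have "1 - qi_pow i (- 2) = qi_pow i (- 1) * (qi_pow i 1 - qi_pow i (- 1))"
    using qi_pow_add[of i "-1" 1] qi_pow_add[of i "-1" "-1"]
    by (simp add: right_diff_distrib) (simp add: qi_pow_eq)
  then have "(1 - qi_pow i (- 2)) * qint i k = qi_pow i (- 1) * (qi_pow i k - qi_pow i (- k))"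
    using qi_pow_diff_nonzero[of i] by (simp add: qint_def)
  also have "\<dots> = qi_pow i (k - 1) - qi_pow i (- k - 1)"
    using qi_pow_add[of i k "-1"] qi_pow_add[of i "- k" "-1"] by (simp add: right_diff_distrib mult.commute)
  finally show ?thesis .
qed

lemma bcoef_eq: "bcoef r = emb (bpol r)"
proof -
  have "(1 - qi_pow i (- 2)) ^ e * qfact i e
      = (\<Prod>k=1..e. qi_pow i (int k - 1) - qi_pow i (- int k - 1))" for i e
  proof -
    have "(1 - qi_pow i (- 2)) ^ e * qfact i e = (\<Prod>k=1..e. (1 - qi_pow i (- 2)) * qint i (int k))"
      by (simp add: qfact_def prod.distrib)
    then show ?thesis by (simp only: qint_mult)
  qed
  then have "bcoef r = (\<Prod>j<N. qi_pow (w ! j) (int (r ! j * (r ! j + 1) div 2))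
      * (\<Prod>k=1..r ! j. qi_pow (w ! j) (int k - 1) - qi_pow (w ! j) (- int k - 1)))"
    by (simp only: bcoef_def mult.assoc)
  then show ?thesis by (simp only: bpol_def qi_pow_eq emb_prod emb_mult emb_diff)
qed

text \<open>With D the symmetrizing integer of the root, the factor of index m is, up to a unit, 1 -
  q^(2Dm), a multiple of 1 - q^m. When \<open>r ! j\<close> is at least \<open>k\<close>, the first
  \<open>k\<close> of these factors are present.\<close>

lemma brace_dvd_bpol:
  assumes "j < N" "k \<le> r ! j" shows "brace k dvd bpol r"
proof -
  have s_pow_power: "s_pow (x * int n) = s_pow x ^ n" for x n
    by (induction n) (auto simp: distrib_left s_pow_add)
  have "1 - s_pow (int L * int m) dvd s_pow (int L * (int D * (int m - 1))) - s_pow (int L * (int D * (- int m - 1)))"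
    for m D
  proof -
    have "s_pow (int L * (int D * (int m - 1))) - s_pow (int L * (int D * (- int m - 1)))
        = - s_pow (int L * (int D * (- int m - 1))) * (1 - s_pow (int L * int m * int (2 * D)))"
      by (simp add: right_diff_distrib s_pow_add[symmetric] algebra_simps)
    also have "1 - s_pow (int L * int m * int (2 * D)) = 1 - s_pow (int L * int m) ^ (2 * D)"
      by (simp only: s_pow_power)
    finally have eq: "s_pow (int L * (int D * (int m - 1))) - s_pow (int L * (int D * (- int m - 1)))
        = - s_pow (int L * (int D * (- int m - 1))) * (1 - s_pow (int L * int m) ^ (2 * D))" .
    have "1 - s_pow (int L * int m) dvd 1 - s_pow (int L * int m) ^ (2 * D)"
      by (simp only: one_diff_power_eq) (rule dvd_triv_left)
    then show ?thesis unfolding eq by (rule dvd_mult)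
  qed
  then have "brace k dvd (\<Prod>m=1..r ! j. s_pow (int L * (int (d (w ! j)) * (int m - 1)))
      - s_pow (int L * (int (d (w ! j)) * (- int m - 1))))"
    unfolding brace_def using assms(2) by (intro prod_dvd_prod_subset2) auto
  also have "\<dots> dvd s_pow (int L * (int (d (w ! j)) * int (r ! j * (r ! j + 1) div 2)))
      * (\<Prod>m=1..r ! j. s_pow (int L * (int (d (w ! j)) * (int m - 1)))
      - s_pow (int L * (int (d (w ! j)) * (- int m - 1))))"
    by (rule dvd_triv_right)
  also have "\<dots> dvd bpol r"
    unfolding bpol_def using assms(1) by (intro dvd_prodI) auto
  finally show ?thesis .
qed

definition exponents :: "nat \<Rightarrow> nat list set" where
  "exponents k = {r. length r = N \<and> bcoef r \<notin> {emb (brace k * c) | c. True}}"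

text \<open>By the preceding divisibility every entry of such an exponent vector is below
  \<open>k\<close>.\<close>

lemma finite_exponents: "finite (exponents k)"
proof (rule finite_subset)
  show "exponents k \<subseteq> {r. set r \<subseteq> {..<k} \<and> length r = N}"
  proof
    fix r assume r: "r \<in> exponents k"
    have "e < k" if "e \<in> set r" for e
    proof (rule ccontr)
      assume "\<not> e < k"
      moreover obtain j where "j < N" "e = r ! j"
        using \<open>e \<in> set r\<close> r by (auto simp: exponents_def in_set_conv_nth)
      ultimately have "brace k dvd bpol r" using brace_dvd_bpol[of j k r] by simp
      then show False using r by (auto simp: exponents_def bcoef_eq dvd_def)
    qed
    then show "r \<in> {r. set r \<subseteq> {..<k} \<and> length r = N}" using r by (auto simp: exponents_def)
  qed
qed (rule finite_lists_length_eq, simp)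

section \<open>The R-matrix of the completed quantum group\<close>

definition R_pure :: "'n weight list \<Rightarrow> nat list \<Rightarrow> 'n falg list" where
  "R_pure \<nu> r = [Emon r * ind (\<nu> ! 0), Fmon r * ind (\<nu> ! 1)]"

lemma set_R_pure: "set (R_pure \<nu> r) \<subseteq> Ufull"
  by (auto simp: R_pure_def intro!: full.mul_C Emon_in_Ufull Fmon_in_Ufull ind_in_Ufull)

lemma length_2E:
  assumes "length xs = 2" obtains x y where "xs = [x, y]"
  using assms by (auto simp: numeral_2_eq_2 length_Suc_conv)

lemma ind_mult_homogeneous:
  assumes "homogeneous \<gamma> p"
  shows "u \<noteq> v + \<gamma> \<Longrightarrow> ind u * (p * ind v) \<in> qideal"
    and "eqmod qideal (ind (v + \<gamma>) * (p * ind v)) (p * ind v)"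
proof -
  show "ind u * (p * ind v) \<in> qideal" if "u \<noteq> v + \<gamma>"
    using ind_mult_ind_null[of p u v] that assms by (auto simp: homogeneous_def mult.assoc)
  show "eqmod qideal (ind (v + \<gamma>) * (p * ind v)) (p * ind v)"
    using Mg_mult_ind_homogeneous[OF assms, of "\<lambda>x. if x = v + \<gamma> then 1 else 0" v]
    by (simp add: ind_def mult.assoc)
qed

lemma R_theta_eq: "R_theta k \<nu> = (\<Sum>r\<in>exponents k. Poly_Mapping.single (R_pure \<nu> r) (emb (bpol r)))"
  by (simp add: R_theta_def R_pure_def exponents_def bcoef_eq)

text \<open>For each exponent vector a single intermediate pair of weights survives, namely the one
  to which \<open>Emon r\<close> and \<open>Fmon r\<close> shift \<open>\<nu>\<close>. The Cartan
  part contributes its value at this pair.\<close>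

lemma R_full_eq:
  assumes \<nu>: "length \<nu> = 2"
  shows "eqmod (tensor_null k 2) (R_full k \<nu>) (\<Sum>r\<in>exponents k. Poly_Mapping.single (R_pure \<nu> r)
    (emb (s_pow (Lpairing (\<nu> ! 0 + exp_weight r) (\<nu> ! 1 - exp_weight r)) * bpol r)))"
proof -
  obtain v0 v1 where \<nu>': "\<nu> = [v0, v1]" by (rule length_2E[OF \<nu>])
  define T where "T \<mu> r = Poly_Mapping.single [ind (\<mu> ! 0) * (Emon r * ind v0), ind (\<mu> ! 1) * (Fmon r * ind v1)]
    (emb (s_pow (Lpairing (\<mu> ! 0) (\<mu> ! 1)) * bpol r))" for \<mu> :: "'n weight list" and r
  \<comment> \<open>The only intermediate weights that contribute to the term \<open>r\<close>:
    \<open>Emon r\<close> raises by \<open>exp_weight r\<close>, \<open>Fmon r\<close> lowers by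
    it.\<close>
  define W where "W r = [v0 + exp_weight r, v1 - exp_weight r]" for r
  have prod: "tens_mult (*) (R_cartan k \<mu>) (R_theta k \<nu>) = (\<Sum>r\<in>exponents k. T \<mu> r)" if "length \<mu> = 2" for \<mu>
    using that by (auto simp: T_def R_cartan_def R_theta_eq R_pure_def \<nu>' tens_mult_sum_right emb_mult elim: length_2E)
  have in_Ufull: "ind u * (Emon r * ind v) \<in> Ufull" "ind u * (Fmon r * ind v) \<in> Ufull"
    "Emon r * ind v \<in> Ufull" "Fmon r * ind v \<in> Ufull" for u v r
    by (auto intro!: full.mul_C Emon_in_Ufull Fmon_in_Ufull ind_in_Ufull)
  have null: "T \<mu> r \<in> full.nl 2" if asm: "length \<mu> = 2" "\<mu> \<noteq> W r" for \<mu> r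
  proof -
    obtain u0 u1 where \<mu>: "\<mu> = [u0, u1]" by (rule length_2E[OF asm(1)])
    show ?thesis
    proof (cases "u0 = v0 + exp_weight r")
      case False
      then show ?thesis
        using full.nl_pure_null[of "[]" "[ind u1 * (Fmon r * ind v1)]" "ind u0 * (Emon r * ind v0)" 2]
          ind_mult_homogeneous(1)[OF homogeneous_Emon False] in_Ufull by (simp add: T_def \<mu>)
    next
      case True
      then have "u1 \<noteq> v1 + - exp_weight r" using asm(2) by (simp add: W_def \<mu>)
      then show ?thesis
        using full.nl_pure_null[of "[ind u0 * (Emon r * ind v0)]" "[]" "ind u1 * (Fmon r * ind v1)" 2]
          ind_mult_homogeneous(1)[OF homogeneous_Fmon] in_Ufull by (simp add: T_def \<mu>)
    qed
  qed
  have main: "eqmod (full.nl 2) (T (W r) r) (Poly_Mapping.single (R_pure \<nu> r)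
    (emb (s_pow (Lpairing (\<nu> ! 0 + exp_weight r) (\<nu> ! 1 - exp_weight r)) * bpol r)))" for r
  proof -
    have "eqmod (full.nl 2) (T (W r) r) (Poly_Mapping.single [Emon r * ind v0, ind (v1 - exp_weight r) * (Fmon r * ind v1)]
      (emb (s_pow (Lpairing (v0 + exp_weight r) (v1 - exp_weight r)) * bpol r)))"
      using full.nl_pure_cong[of "[]" "[ind (v1 - exp_weight r) * (Fmon r * ind v1)]", OF _ _ _ _
          ind_mult_homogeneous(2)[OF homogeneous_Emon]] in_Ufull
      by (simp add: T_def W_def)
    also have "eqmod (full.nl 2) \<dots> (Poly_Mapping.single [Emon r * ind v0, Fmon r * ind v1]
      (emb (s_pow (Lpairing (v0 + exp_weight r) (v1 - exp_weight r)) * bpol r)))"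
      using full.nl_pure_cong[of "[Emon r * ind v0]" "[]", OF _ _ _ _
          ind_mult_homogeneous(2)[OF homogeneous_Fmon]] in_Ufull
      by simp
    finally show ?thesis by (simp add: R_pure_def \<nu>')
  qed
  \<comment> \<open>Different vectors \<open>r\<close> may share the same \<open>W r\<close>. The
    intermediate sum therefore runs over the image, and for each \<open>r\<close> all other weights
    in the image give null terms.\<close>
  let ?S = "W ` exponents k"
  have "eqmod (tensor_null k 2) (R_full k \<nu>) (\<Sum>\<mu>\<in>?S. tens_mult (*) (R_cartan k \<mu>) (R_theta k \<nu>))"
    unfolding R_full_def ctensor_mult_def
  proof (rule conv_sum_eqmod[OF add_subgroup_tensor_null])
    fix \<mu> assume \<mu>: "\<mu> \<in> {\<mu> :: 'n weight list. length \<mu> = 2}" "\<mu> \<notin> ?S"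
    then have "(\<Sum>r\<in>exponents k. T \<mu> r) \<in> full.nl 2"
      by (intro add_subgroup_sum[OF full.add_subgroup_nl] null) auto
    then show "tens_mult (*) (R_cartan k \<mu>) (R_theta k \<nu>) \<in> tensor_null k 2"
      using nl_subset_tensor_null \<mu> by (auto simp: prod)
  qed (auto simp: finite_exponents W_def)
  also have "(\<Sum>\<mu>\<in>?S. tens_mult (*) (R_cartan k \<mu>) (R_theta k \<nu>)) = (\<Sum>r\<in>exponents k. \<Sum>\<mu>\<in>?S. T \<mu> r)"
    by (subst sum.swap) (auto simp: prod W_def intro!: sum.cong)
  also have "eqmod (tensor_null k 2) \<dots> (\<Sum>r\<in>exponents k. Poly_Mapping.single (R_pure \<nu> r)
    (emb (s_pow (Lpairing (\<nu> ! 0 + exp_weight r) (\<nu> ! 1 - exp_weight r)) * bpol r)))"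
  proof (intro nl_imp_tensor_null full.nl_sum)
    fix r assume r: "r \<in> exponents k"
    have "(\<Sum>\<mu>\<in>?S. T \<mu> r) = T (W r) r + (\<Sum>\<mu>\<in>?S - {W r}. T \<mu> r)"
      using r by (intro sum.remove) (auto simp: finite_exponents)
    moreover have "(\<Sum>\<mu>\<in>?S - {W r}. T \<mu> r) \<in> full.nl 2"
      by (intro add_subgroup_sum[OF full.add_subgroup_nl] null) (auto simp: W_def)
    ultimately have "eqmod (full.nl 2) (\<Sum>\<mu>\<in>?S. T \<mu> r) (T (W r) r)" by (simp add: eqmod_def)
    also note main
    finally show "eqmod (full.nl 2) (\<Sum>\<mu>\<in>?S. T \<mu> r) (Poly_Mapping.single (R_pure \<nu> r)
      (emb (s_pow (Lpairing (\<nu> ! 0 + exp_weight r) (\<nu> ! 1 - exp_weight r)) * bpol r)))" .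
  qed
  finally show ?thesis .
qed

end

context root_of_unity_datum
begin

section \<open>Orthogonality of characters\<close>

lemma z_powi_eq_1_iff: "z powi k = 1 \<longleftrightarrow> int (l * L) dvd k"
proof -
  let ?n = "l * L"
  have n: "0 < ?n" using l_pos L_pos by simp
  have pow: "z powi (int ?n * j) = 1" for j
    using primitive(1) by (simp only: power_int_mult power_int_of_nat power_int_1_left)
  have "z powi k = z powi (k mod int ?n)"
    using pow[of "k div int ?n"] z_nonzero power_int_add[of z "int ?n * (k div int ?n)" "k mod int ?n"] by simp
  also have "\<dots> = z ^ nat (k mod int ?n)" using n by (simp add: power_int_def)
  finally have *: "z powi k = z ^ nat (k mod int ?n)" .
  show ?thesis
  proof
    assume "z powi k = 1"
    then have "\<not> (0 < nat (k mod int ?n) \<and> nat (k mod int ?n) < ?n)"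
      using primitive(2)[of "nat (k mod int ?n)"] * by auto
    moreover have "nat (k mod int ?n) < ?n" using n by (simp add: nat_less_iff)
    ultimately have "nat (k mod int ?n) = 0" by simp
    moreover have "0 \<le> k mod int ?n" using n by simp
    ultimately show "int ?n dvd k" by (simp add: dvd_eq_mod_eq_0)
  next
    assume "int ?n dvd k"
    then show "z powi k = 1" using pow by (auto elim!: dvdE)
  qed
qed

lemma Lambda_l_iff: "x \<in> Lambda_l \<longleftrightarrow> (\<forall>y. int (l * L) dvd Lpairing x y)"
proof -
  have "(\<exists>m::int. pairing x y = of_int (int l * m)) \<longleftrightarrow> int (l * L) dvd Lpairing x y" for y
  proof -
    have L0: "(of_nat L :: rat) \<noteq> 0" using L_pos by simp
    have "pairing x y = of_int (int l * m) \<longleftrightarrow> Lpairing x y = int (l * L) * m" for m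
    proof -
      have "pairing x y = of_int (int l * m) \<longleftrightarrow> of_nat L * pairing x y = of_nat L * of_int (int l * m)"
        using L0 by simp
      also have "\<dots> \<longleftrightarrow> (of_int (Lpairing x y) :: rat) = of_int (int (l * L) * m)"
        by (simp add: of_int_Lpairing mult_ac)
      also have "\<dots> \<longleftrightarrow> Lpairing x y = int (l * L) * m" by (simp only: of_int_eq_iff)
      finally show ?thesis .
    qed
    then show ?thesis by (auto simp: dvd_def)
  qed
  then show ?thesis by (simp add: Lambda_l_def)
qed

lemma Lambda_l_0: "0 \<in> Lambda_l"
  and Lambda_l_add: "x \<in> Lambda_l \<Longrightarrow> y \<in> Lambda_l \<Longrightarrow> x + y \<in> Lambda_l"
  and Lambda_l_uminus: "x \<in> Lambda_l \<Longrightarrow> - x \<in> Lambda_l"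
  by (auto simp: Lambda_l_iff Lpairing_diff_left Lpairing_add_left)

definition coset_of :: "'n weight \<Rightarrow> 'n weight set" where
  "coset_of x = {y. x - y \<in> Lambda_l}"

lemma weight_cosets_eq: "weight_cosets = range coset_of"
  by (auto simp: weight_cosets_def quotient_def coset_of_def Image_def)

lemma coset_of_eq_iff: "coset_of x = coset_of y \<longleftrightarrow> x - y \<in> Lambda_l"
proof
  assume "coset_of x = coset_of y"
  then have "y \<in> coset_of x" using Lambda_l_0 by (simp add: coset_of_def)
  then show "x - y \<in> Lambda_l" by (simp add: coset_of_def)
next
  assume *: "x - y \<in> Lambda_l"
  then have "y - x \<in> Lambda_l" using Lambda_l_uminus[OF *] by simp
  with * show "coset_of x = coset_of y"
    unfolding coset_of_def
    by (metis (no_types, lifting) Lambda_l_add diff_add_cancel add_diff_eq)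
qed

lemma coset_of_coset_rep: "X \<in> weight_cosets \<Longrightarrow> coset_of (coset_rep X) = X"
proof -
  assume "X \<in> weight_cosets"
  then obtain x where X: "X = coset_of x" by (auto simp: weight_cosets_eq)
  have "x \<in> X" using Lambda_l_0 by (simp add: X coset_of_def)
  then have "coset_rep X \<in> X" unfolding coset_rep_def by (rule someI[of "\<lambda>x. x \<in> X"])
  then have "x - coset_rep X \<in> Lambda_l" unfolding X coset_of_def by simp
  then have "coset_of x = coset_of (coset_rep X)" unfolding coset_of_eq_iff .
  then show ?thesis using X by simp
qed

text \<open>\<open>Lpairing\<close> takes integer values, so multiples of \<open>l * L\<close> in
  the weight lattice belong to \<open>Lambda_l\<close>. Hence every coset has a representative with
  coordinates reduced modulo \<open>l * L\<close>.\<close>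

lemma finite_weight_cosets: "finite weight_cosets"
proof -
  let ?F = "PiE (UNIV :: 'n set) (\<lambda>_. {0..<int (l * L)})"
  have pos: "0 < int (l * L)" using l_pos L_pos by simp
  have "coset_of x \<in> coset_of ` ?F" for x
  proof
    let ?y = "\<lambda>i. x i mod int (l * L)"
    show "?y \<in> ?F" using pos by (auto simp: PiE_def)
    have "Lpairing (x - ?y) v = int (l * L) * Lpairing (\<lambda>i. x i div int (l * L)) v" for v
    proof -
      have mult: "Lpairing (\<lambda>i. int n * t i) v = int n * Lpairing t v" for n and t :: "'n weight"
      proof (induction n)
        case 0
        have "(\<lambda>i. int 0 * t i) = 0" by (intro ext) (simp add: fun_apply)
        then show ?case by simp
      next
        case (Suc n)
        have "(\<lambda>i. int (Suc n) * t i) = t + (\<lambda>i. int n * t i)" by (intro ext) (simp add: fun_apply distrib_right)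
        then show ?case using Suc by (simp add: Lpairing_add_left distrib_right)
      qed
      have "x - ?y = (\<lambda>i. int (l * L) * (x i div int (l * L)))"
        by (intro ext) (simp add: fun_apply minus_mod_eq_mult_div)
      then show ?thesis by (simp only: mult)
    qed
    then have "x - ?y \<in> Lambda_l" by (simp add: Lambda_l_iff)
    then show "coset_of x = coset_of ?y" by (simp only: coset_of_eq_iff)
  qed
  moreover have "finite ?F" by (intro finite_PiE) auto
  ultimately show ?thesis unfolding weight_cosets_eq by (metis finite_imageI finite_subset image_subsetI)
qed

lemma card_weight_cosets: "card weight_cosets \<noteq> 0"
  using finite_weight_cosets by (simp add: weight_cosets_eq)

lemma z_powi_add: "z powi (j + k) = z powi j * z powi k"
  using z_nonzero by (simp add: power_int_add)

lemma z_powi_cong: "int (l * L) dvd j - k \<Longrightarrow> z powi j = z powi k"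
  using z_powi_add[of "j - k" k] z_powi_eq_1_iff[of "j - k"] by simp

text \<open>Outside \<open>Lambda_l\<close> there is a weight \<open>t\<close> at which the
  character of \<open>c\<close> differs from 1. Translation of the cosets by \<open>t\<close>
  permutes the summands and multiplies the sum by this value.\<close>

lemma character_sum:
  "(\<Sum>X\<in>weight_cosets. z powi Lpairing c (coset_rep X)) = (if c \<in> Lambda_l then of_nat (card weight_cosets) else 0)"
proof (cases "c \<in> Lambda_l")
  case True
  then have "z powi Lpairing c x = 1" for x by (simp only: z_powi_eq_1_iff) (simp add: Lambda_l_iff)
  then show ?thesis using True by simp
next
  case False
  then obtain t where t: "z powi Lpairing c t \<noteq> 1" by (auto simp only: Lambda_l_iff z_powi_eq_1_iff)
  have char: "z powi Lpairing c (coset_rep (coset_of x)) = z powi Lpairing c x" for x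
  proof (rule z_powi_cong)
    have "coset_of x \<in> weight_cosets" by (simp add: weight_cosets_eq)
    then have "coset_rep (coset_of x) - x \<in> Lambda_l"
      using coset_of_coset_rep coset_of_eq_iff by metis
    then have "int (l * L) dvd Lpairing (coset_rep (coset_of x) - x) c" unfolding Lambda_l_iff by blast
    then show "int (l * L) dvd Lpairing c (coset_rep (coset_of x)) - Lpairing c x"
      by (simp add: Lpairing_diff_left Lpairing_commute[of c])
  qed
  let ?f = "\<lambda>X. z powi Lpairing c (coset_rep X)"
  let ?\<sigma> = "\<lambda>X. coset_of (coset_rep X + t)"
  have inj: "inj_on ?\<sigma> weight_cosets"
    by (rule inj_onI) (metis add_diff_cancel_right coset_of_coset_rep coset_of_eq_iff)
  then have bij: "bij_betw ?\<sigma> weight_cosets weight_cosets"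
    by (intro bij_betw_imageI endo_inj_surj[OF finite_weight_cosets]) (auto simp: weight_cosets_eq)
  have "sum ?f weight_cosets = (\<Sum>X\<in>weight_cosets. ?f (?\<sigma> X))"
    using sum.reindex_bij_betw[OF bij, of ?f] by simp
  also have "\<dots> = (\<Sum>X\<in>weight_cosets. ?f X * z powi Lpairing c t)"
    by (simp add: char Lpairing_add_right z_powi_add)
  also have "\<dots> = sum ?f weight_cosets * z powi Lpairing c t" by (simp add: sum_distrib_right)
  finally show ?thesis using False t by simp
qed

text \<open>Fourier inversion on the quotient by \<open>Lambda_l\<close>: for fixed \<open>Y\<close>
  the sum over \<open>X\<close> is an orthogonality sum that selects the coset of \<open>u\<close>.
  It identifies the Cartan part of \<open>R_small\<close>, acting on the weights \<open>u\<close>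
  and \<open>v\<close>, with the Cartan part of \<open>R\<close>.\<close>

lemma cartan_sum:
  "(\<Sum>X\<in>weight_cosets. \<Sum>Y\<in>weight_cosets. 1 / of_nat (card weight_cosets)
      * z powi (- Lpairing (coset_rep X) (coset_rep Y)) * z powi Lpairing u (coset_rep X) * z powi Lpairing v (coset_rep Y))
    = z powi Lpairing u v"
proof -
  let ?n = "of_nat (card weight_cosets) :: complex"
  have n: "?n \<noteq> 0" using card_weight_cosets by simp
  have "(\<Sum>X\<in>weight_cosets. \<Sum>Y\<in>weight_cosets. 1 / ?n
      * z powi (- Lpairing (coset_rep X) (coset_rep Y)) * z powi Lpairing u (coset_rep X) * z powi Lpairing v (coset_rep Y))
    = (\<Sum>Y\<in>weight_cosets. 1 / ?n * z powi Lpairing v (coset_rep Y)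
        * (\<Sum>X\<in>weight_cosets. z powi Lpairing (u - coset_rep Y) (coset_rep X)))"
    unfolding sum_distrib_left
    by (subst sum.swap, intro sum.cong refl)
      (simp add: Lpairing_diff_left Lpairing_commute[of "coset_rep _" "coset_rep _"] z_powi_add[symmetric] mult_ac add_ac)
  also have "\<dots> = (\<Sum>Y\<in>weight_cosets. if Y = coset_of u then z powi Lpairing u v else 0)"
  proof (intro sum.cong refl)
    fix Y assume Y: "Y \<in> weight_cosets"
    have "u - coset_rep Y \<in> Lambda_l \<longleftrightarrow> Y = coset_of u"
      using coset_of_coset_rep[OF Y] coset_of_eq_iff by metis
    moreover have "z powi Lpairing v (coset_rep Y) = z powi Lpairing u v" if "u - coset_rep Y \<in> Lambda_l"
    proof (rule z_powi_cong)
      have "int (l * L) dvd - Lpairing (u - coset_rep Y) v" using that by (simp add: Lambda_l_iff)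
      then show "int (l * L) dvd Lpairing v (coset_rep Y) - Lpairing u v"
        by (simp add: Lpairing_diff_left Lpairing_commute[of v])
    qed
    ultimately show "1 / ?n * z powi Lpairing v (coset_rep Y)
        * (\<Sum>X\<in>weight_cosets. z powi Lpairing (u - coset_rep Y) (coset_rep X))
      = (if Y = coset_of u then z powi Lpairing u v else 0)"
      using n by (simp add: character_sum)
  qed
  also have "\<dots> = z powi Lpairing u v"
    using finite_weight_cosets by (simp add: weight_cosets_eq)
  finally show ?thesis .
qed

end

lemma tens_null_mono:
  assumes "t \<in> tens_null B C Z m" "C \<subseteq> C'" shows "t \<in> tens_null B C' Z m"
  using assms(1)
proof (induction rule: tens_null.induct)
  case (null xs ys x)
  then show ?case using assms(2) by (intro tens_null.null) auto
next
  case (additive xs ys x y)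
  then show ?case using assms(2) by (intro tens_null.additive) auto
next
  case (homogeneous xs ys x b)
  then show ?case using assms(2) by (intro tens_null.homogeneous) auto
qed (auto intro: tens_null.intros)

lemma tens_mono: "C \<subseteq> C' \<Longrightarrow> tens B C m \<subseteq> tens B C' m"
  unfolding tens_def by fast

lemma sum_single: "(\<Sum>i\<in>I. Poly_Mapping.single p (f i)) = Poly_Mapping.single p (sum f I)"
  by (induction I rule: infinite_finite_induct) (auto simp: single_add)

lemma sum_single_swap:
  "(\<Sum>i\<in>I. \<Sum>j\<in>J. \<Sum>r\<in>R. Poly_Mapping.single (p r) (c i j r * e r))
    = (\<Sum>r\<in>R. Poly_Mapping.single (p r) ((\<Sum>i\<in>I. \<Sum>j\<in>J. c i j r) * (e r :: 'b::comm_ring_1)))"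
proof -
  have "(\<Sum>i\<in>I. \<Sum>j\<in>J. \<Sum>r\<in>R. Poly_Mapping.single (p r) (c i j r * e r))
      = (\<Sum>i\<in>I. \<Sum>r\<in>R. \<Sum>j\<in>J. Poly_Mapping.single (p r) (c i j r * e r))"
    by (intro sum.cong refl sum.swap)
  also have "\<dots> = (\<Sum>r\<in>R. \<Sum>i\<in>I. \<Sum>j\<in>J. Poly_Mapping.single (p r) (c i j r * e r))"
    by (rule sum.swap)
  finally show ?thesis by (simp only: sum_single sum_distrib_right)
qed

context quotient_algebra
begin

text \<open>Scalars coming from either factor are collected in the coefficient, first those of the
  left factor and then those of the right one.\<close>

lemma nl_pair_cong:
  assumes C: "p \<in> C" "q \<in> C" "p' \<in> C" "q' \<in> C" and B: "b \<in> B" "x \<in> B" "y \<in> B"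
    and p: "eqmod Z p (smul x p')" and q: "eqmod Z q (smul y q')"
  shows "eqmod (nl 2) (Poly_Mapping.single [p, q] b) (Poly_Mapping.single [p', q'] (b * x * y))"
proof -
  have "eqmod (nl 2) (Poly_Mapping.single ([] @ p # [q]) b) (Poly_Mapping.single ([] @ smul x p' # [q]) b)"
    using C B by (intro nl_pure_cong p C_smul) auto
  also have "eqmod (nl 2) \<dots> (smul b (Poly_Mapping.single ([] @ p' # [q]) x))"
    using nl_smul[OF B(1) nl_pure_smul[of "[]" "[q]" p' x 2]] C B by simp
  also have "smul b (Poly_Mapping.single ([] @ p' # [q]) x) = Poly_Mapping.single ([p'] @ q # []) (b * x)"
    by simp
  also have "eqmod (nl 2) \<dots> (Poly_Mapping.single ([p'] @ smul y q' # []) (b * x))"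
    using C B by (intro nl_pure_cong q C_smul B_mult) auto
  also have "eqmod (nl 2) \<dots> (smul (b * x) (Poly_Mapping.single ([p'] @ q' # []) y))"
    using nl_smul[OF B_mult[OF B(1,2)] nl_pure_smul[of "[p']" "[]" q' y 2]] C B by simp
  finally show ?thesis by simp
qed

end

context root_datum
begin

lemma R_theta_tn: "length \<nu> = 2 \<Longrightarrow> R_theta k \<nu> \<in> full.tn 2"
  unfolding R_theta_eq by (intro full.tn_sum full.tn_single emb_in_As set_R_pure) (auto simp: R_pure_def)

lemma R_cartan_tn: "length \<nu> = 2 \<Longrightarrow> R_cartan k \<nu> \<in> full.tn 2"
  unfolding R_cartan_def by (intro full.tn_single emb_in_As) (auto intro: ind_in_Ufull)

lemma R_full_tn: "length \<nu> = 2 \<Longrightarrow> R_full k \<nu> \<in> full.tn 2"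
  unfolding R_full_def ctensor_mult_def conv_sum_def
  by (intro full.tn_sum full.tn_tens_mult R_theta_tn R_cartan_tn) auto

section \<open>Uniform expansions\<close>

definition at_weights :: "'n falg list \<Rightarrow> 'n weight list \<Rightarrow> 'n falg list" where
  "at_weights xs \<mu> = map2 (\<lambda>x v. x * ind v) xs \<mu>"

lemma length_at_weights [simp]: "length (at_weights xs \<mu>) = min (length xs) (length \<mu>)"
  by (simp add: at_weights_def)

lemma nth_at_weights: "i < length xs \<Longrightarrow> i < length \<mu> \<Longrightarrow> at_weights xs \<mu> ! i = xs ! i * ind (\<mu> ! i)"
  by (simp add: at_weights_def)

lemma set_at_weights: "set xs \<subseteq> Ufull \<Longrightarrow> set (at_weights xs \<mu>) \<subseteq> Ufull"
  by (auto simp: at_weights_def intro!: full.mul_C ind_in_Ufull dest: set_zip_leftD)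

lemma at_weights_append:
  "length xs = length \<mu> \<Longrightarrow> at_weights (xs @ ys) (\<mu> @ \<nu>) = at_weights xs \<mu> @ at_weights ys \<nu>"
  by (simp add: at_weights_def)

text \<open>The components of the labels at all weights are combinations of the same finitely many pure tensors
  times indicators. This makes the sums over all weights finite.\<close>

definition expansion :: "('n falg list \<times> ('n weight list \<Rightarrow> laurent)) list \<Rightarrow> 'n weight list \<Rightarrow> 'n tensor" where
  "expansion ys \<mu> = (\<Sum>(x, f)\<leftarrow>ys. Poly_Mapping.single (at_weights x \<mu>) (emb (f \<mu>)))"

definition expansion_data :: "nat \<Rightarrow> ('n falg list \<times> ('n weight list \<Rightarrow> laurent)) list \<Rightarrow> bool" where
  "expansion_data m ys \<longleftrightarrow> (\<forall>(x, f) \<in> set ys. length x = m \<and> set x \<subseteq> Ufull)"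

definition uniform :: "nat \<Rightarrow> nat \<Rightarrow> ('n weight list \<Rightarrow> 'n tensor) \<Rightarrow> bool" where
  "uniform k m X \<longleftrightarrow> (\<exists>ys. expansion_data m ys \<and>
     (\<forall>\<mu>. length \<mu> = m \<longrightarrow> eqmod (tensor_null k m) (X \<mu>) (expansion ys \<mu>)))"

lemma expansion_tn: "expansion_data m ys \<Longrightarrow> length \<mu> = m \<Longrightarrow> expansion ys \<mu> \<in> full.tn m"
  unfolding expansion_def expansion_data_def
  by (intro full.tn_sum_list) (auto intro!: full.tn_single dest!: bspec set_at_weights[THEN subsetD, rotated])

lemma expansion_Nil [simp]: "expansion [] \<mu> = 0"
  and expansion_Cons [simp]: "expansion ((x, f) # ys) \<mu>
    = Poly_Mapping.single (at_weights x \<mu>) (emb (f \<mu>)) + expansion ys \<mu>"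
  and expansion_append [simp]: "expansion (ys @ zs) \<mu> = expansion ys \<mu> + expansion zs \<mu>"
  by (auto simp: expansion_def)

lemma expansion_data_Nil [simp]: "expansion_data m []"
  and expansion_data_Cons [simp]: "expansion_data m ((x, f) # ys) \<longleftrightarrow>
    length x = m \<and> set x \<subseteq> Ufull \<and> expansion_data m ys"
  and expansion_data_append [simp]: "expansion_data m (ys @ zs) \<longleftrightarrow> expansion_data m ys \<and> expansion_data m zs"
  by (auto simp: expansion_data_def)

lemma uniform_single: "length x = m \<Longrightarrow> set x \<subseteq> Ufull \<Longrightarrow>
    uniform k m (\<lambda>\<mu>. Poly_Mapping.single (at_weights x \<mu>) (emb (f \<mu>)))"
  unfolding uniform_def by (intro exI[of _ "[(x, f)]"]) (auto simp: tensor_null_refl)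

lemma uniform_0: "uniform k m (\<lambda>\<mu>. 0)"
  unfolding uniform_def by (intro exI[of _ "[]"]) (auto simp: tensor_null_refl)

lemma uniform_add:
  assumes "uniform k m X" "uniform k m Y" shows "uniform k m (\<lambda>\<mu>. X \<mu> + Y \<mu>)"
proof -
  obtain ys zs where "expansion_data m ys" "\<And>\<mu>. length \<mu> = m \<Longrightarrow> eqmod (tensor_null k m) (X \<mu>) (expansion ys \<mu>)"
    "expansion_data m zs" "\<And>\<mu>. length \<mu> = m \<Longrightarrow> eqmod (tensor_null k m) (Y \<mu>) (expansion zs \<mu>)"
    using assms unfolding uniform_def by auto
  then show ?thesis unfolding uniform_def
    by (intro exI[of _ "ys @ zs"]) (auto intro!: tensor_null_add)
qed

lemma uniform_sum: "(\<And>i. i \<in> I \<Longrightarrow> uniform k m (X i)) \<Longrightarrow> uniform k m (\<lambda>\<mu>. \<Sum>i\<in>I. X i \<mu>)"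
  by (induction I rule: infinite_finite_induct) (auto intro: uniform_0 uniform_add)

lemma uniform_sum_list: "(\<And>y. y \<in> set ys \<Longrightarrow> uniform k m (X y)) \<Longrightarrow> uniform k m (\<lambda>\<mu>. \<Sum>y\<leftarrow>ys. X y \<mu>)"
  by (induction ys) (auto intro: uniform_0 uniform_add)

lemma uniform_cong:
  assumes "uniform k m X" "\<And>\<mu>. length \<mu> = m \<Longrightarrow> eqmod (tensor_null k m) (Y \<mu>) (X \<mu>)"
  shows "uniform k m Y"
  using assms tensor_null_trans unfolding uniform_def by metis

lemma uniform_R_full: "uniform k 2 (R_full k)"
proof (rule uniform_cong[OF _ R_full_eq])
  have "R_pure \<nu> r = at_weights [Emon r, Fmon r] \<nu>" if "length \<nu> = 2" for \<nu> r
    using that by (auto simp: R_pure_def at_weights_def elim: length_2E)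
  then have eq: "\<And>\<nu>. length \<nu> = 2 \<Longrightarrow> (\<Sum>r\<in>exponents k. Poly_Mapping.single (R_pure \<nu> r)
      (emb (s_pow (Lpairing (\<nu> ! 0 + exp_weight r) (\<nu> ! 1 - exp_weight r)) * bpol r)))
    = (\<Sum>r\<in>exponents k. Poly_Mapping.single (at_weights [Emon r, Fmon r] \<nu>)
      (emb (s_pow (Lpairing (\<nu> ! 0 + exp_weight r) (\<nu> ! 1 - exp_weight r)) * bpol r)))"
    by (simp cong: sum.cong)
  have "uniform k 2 (\<lambda>\<nu>. \<Sum>r\<in>exponents k. Poly_Mapping.single (at_weights [Emon r, Fmon r] \<nu>)
      (emb (s_pow (Lpairing (\<nu> ! 0 + exp_weight r) (\<nu> ! 1 - exp_weight r)) * bpol r)))"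
  proof (rule uniform_sum)
    fix r
    show "uniform k 2 (\<lambda>\<nu>. Poly_Mapping.single (at_weights [Emon r, Fmon r] \<nu>)
      (emb (s_pow (Lpairing (\<nu> ! 0 + exp_weight r) (\<nu> ! 1 - exp_weight r)) * bpol r)))"
      by (rule uniform_single) (auto simp: Emon_in_Ufull Fmon_in_Ufull)
  qed
  then show "uniform k 2 (\<lambda>\<nu>. \<Sum>r\<in>exponents k. Poly_Mapping.single (R_pure \<nu> r)
      (emb (s_pow (Lpairing (\<nu> ! 0 + exp_weight r) (\<nu> ! 1 - exp_weight r)) * bpol r)))"
    by (rule uniform_cong) (simp only: eq tensor_null_refl)
qed

text \<open>At level \<open>k\<close> only the finitely many terms in the lists \<open>T i\<close>
  with \<open>i < k\<close> remain. Each of them is already a fixed pure tensor times indicators;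
  the function in the middle contributes only to the coefficient.\<close>

lemma uniform_ctensor:
  assumes "X \<in> ctensors m" shows "uniform k m (X k)"
proof -
  obtain T where T: "\<And>k. set (T k) \<subseteq> FKE_data m"
    and X: "\<And>k \<mu>. length \<mu> = m \<Longrightarrow>
      eqmod (tensor_null k m) (X k \<mu>) (\<Sum>i<k. smul (emb (brace i)) (\<Sum>y\<leftarrow>T i. FKE y \<mu>))"
    using assms unfolding ctensors_def eqmod_def by auto
  have "uniform k m (\<lambda>\<mu>. smul (emb (brace i)) (FKE y \<mu>))" if y: "y \<in> FKE_data m" for i y
  proof -
    obtain f rs ts where y': "y = (f, rs, ts)" by (cases y)
    have len: "length rs = m" "length ts = m" using y by (auto simp: y' FKE_data_def)
    let ?xs = "map2 (\<lambda>r t. Fmon r * Emon t) rs ts"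
    have "set ?xs \<subseteq> Ufull" by (auto intro!: full.mul_C Emon_in_Ufull Fmon_in_Ufull)
    then have "uniform k m (\<lambda>\<mu>. Poly_Mapping.single (at_weights ?xs \<mu>)
        (emb (brace i * f (map2 (\<lambda>v t. v + exp_weight t) \<mu> ts))))"
      using len by (intro uniform_single) auto
    moreover have "smul (emb (brace i)) (FKE y \<mu>) = Poly_Mapping.single (at_weights ?xs \<mu>)
        (emb (brace i * f (map2 (\<lambda>v t. v + exp_weight t) \<mu> ts)))" if "length \<mu> = m" for \<mu>
    proof -
      have "map (\<lambda>(r, t, v). Fmon r * Emon t * ind v) (zip rs (zip ts \<mu>)) = at_weights ?xs \<mu>"
        using len that by (intro nth_equalityI) (auto simp: at_weights_def)
      then show ?thesis by (simp add: y' FKE_def emb_mult)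
    qed
    ultimately show ?thesis using uniform_cong tensor_null_refl by (metis (no_types, lifting))
  qed
  then have "uniform k m (\<lambda>\<mu>. \<Sum>y\<leftarrow>T i. smul (emb (brace i)) (FKE y \<mu>))" for i
    using subsetD[OF T] by (intro uniform_sum_list) blast
  then have "uniform k m (\<lambda>\<mu>. \<Sum>i<k. smul (emb (brace i)) (\<Sum>y\<leftarrow>T i. FKE y \<mu>))"
    unfolding smul_sum_list by (intro uniform_sum)
  then show ?thesis using X by (rule uniform_cong)
qed

lemma expansion_times:
  assumes "expansion_data m ys" "length \<mu> = m"
  shows "expansion (concat (map (\<lambda>(x, f). map (\<lambda>(x', f'). (x @ x', \<lambda>\<mu>. f (take m \<mu>) * f' (drop m \<mu>))) zs) ys)) (\<mu> @ \<nu>)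
    = expansion ys \<mu> * expansion zs \<nu>"
proof -
  have 1: "expansion (map (\<lambda>(x', f'). (x @ x', \<lambda>\<mu>. f (take m \<mu>) * f' (drop m \<mu>))) zs) (\<mu> @ \<nu>)
    = Poly_Mapping.single (at_weights x \<mu>) (emb (f \<mu>)) * expansion zs \<nu>" if "length x = m" for x f
    using that assms(2)
    by (induction zs) (auto simp: at_weights_append mult_single plus_list_def emb_mult distrib_left)
  show ?thesis using assms(1)
    by (induction ys) (auto simp: 1 distrib_right)
qed

lemma uniform_times:
  assumes X: "uniform k m X" "\<And>\<mu>. length \<mu> = m \<Longrightarrow> X \<mu> \<in> full.tn m"
    and Y: "uniform k m' Y" "\<And>\<mu>. length \<mu> = m' \<Longrightarrow> Y \<mu> \<in> full.tn m'"
  shows "uniform k (m + m') (\<lambda>\<mu>. X (take m \<mu>) * Y (drop m \<mu>))"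
proof -
  obtain ys zs where ys: "expansion_data m ys" "\<And>\<mu>. length \<mu> = m \<Longrightarrow> eqmod (tensor_null k m) (X \<mu>) (expansion ys \<mu>)"
    and zs: "expansion_data m' zs" "\<And>\<mu>. length \<mu> = m' \<Longrightarrow> eqmod (tensor_null k m') (Y \<mu>) (expansion zs \<mu>)"
    using X(1) Y(1) unfolding uniform_def by auto
  let ?ps = "concat (map (\<lambda>(x, f). map (\<lambda>(x', f'). (x @ x', \<lambda>\<mu>. f (take m \<mu>) * f' (drop m \<mu>))) zs) ys)"
  have "expansion_data (m + m') ?ps"
    using ys(1) zs(1) unfolding expansion_data_def by fastforce
  moreover have "eqmod (tensor_null k (m + m')) (X (take m \<mu>) * Y (drop m \<mu>)) (expansion ?ps \<mu>)"
    if "length \<mu> = m + m'" for \<mu>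
  proof -
    have len: "length (take m \<mu>) = m" "length (drop m \<mu>) = m'" using that by auto
    have "eqmod (tensor_null k (m + m')) (X (take m \<mu>) * Y (drop m \<mu>)) (expansion ys (take m \<mu>) * expansion zs (drop m \<mu>))"
      using len by (intro tensor_null_times ys zs expansion_tn Y(2))
    then show ?thesis using expansion_times[OF ys(1) len(1), of zs "drop m \<mu>"] by simp
  qed
  ultimately show ?thesis unfolding uniform_def by blast
qed

lemma at_weights_update_antipode:
  assumes "length x = length \<mu>"
  shows "(at_weights x \<mu>)[i := antipode (antipode (at_weights x \<mu> ! i))] = at_weights (x[i := antipode (antipode (x ! i))]) \<mu>"
proof (rule nth_equalityI)
  fix j assume "j < length ((at_weights x \<mu>)[i := antipode (antipode (at_weights x \<mu> ! i))])"
  then show "(at_weights x \<mu>)[i := antipode (antipode (at_weights x \<mu> ! i))] ! j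
      = at_weights (x[i := antipode (antipode (x ! i))]) \<mu> ! j"
    using assms by (cases "i = j") (simp_all add: nth_at_weights antipode_antipode_ind)
qed (use assms in simp)

lemma uniform_tens_at_antipode:
  assumes X: "uniform k m X" shows "uniform k m (\<lambda>\<mu>. tens_at i (antipode \<circ> antipode) (X \<mu>))"
proof -
  obtain ys where ys: "expansion_data m ys" "\<And>\<mu>. length \<mu> = m \<Longrightarrow> eqmod (tensor_null k m) (X \<mu>) (expansion ys \<mu>)"
    using X unfolding uniform_def by auto
  let ?F = "\<lambda>xs. xs[i := (antipode \<circ> antipode) (xs ! i)]"
  have F: "set (?F xs) \<subseteq> Ufull" if "set xs \<subseteq> Ufull" for xs
  proof (cases "i < length xs")
    case True
    then show ?thesis using that antipode_antipode_Ufull[of "xs ! i"]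
      by (intro set_update_subsetI) (auto dest: nth_mem)
  qed (use that in \<open>auto simp: list_update_beyond\<close>)
  let ?zs = "map (\<lambda>(x, f). (?F x, f)) ys"
  have "expansion_data m ?zs" using ys(1) F unfolding expansion_data_def by fastforce
  moreover have "eqmod (tensor_null k m) (tens_at i (antipode \<circ> antipode) (X \<mu>)) (expansion ?zs \<mu>)" if "length \<mu> = m" for \<mu>
  proof -
    have "eqmod (tensor_null k m) (lmap ?F (X \<mu>)) (lmap ?F (expansion ys \<mu>))"
      using F by (intro tensor_null_lmap[OF full.slotwise_linear_list_update[OF linear_mod_antipode] _ ys(2)[OF that]]) auto
    also have "lmap ?F (expansion ys \<mu>) = expansion ?zs \<mu>"
      using ys(1) that by (induction ys) (auto simp: lmap_add at_weights_update_antipode)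
    finally show ?thesis by (simp add: tens_at_eq_lmap)
  qed
  ultimately show ?thesis unfolding uniform_def by blast
qed

end

context root_of_unity_datum
begin

section \<open>The R-matrix of the small quantum group\<close>

lemma small_iff: "p \<in> small \<longleftrightarrow> Poly_Mapping.keys p \<subseteq> (\<lambda>x _. x) ` Uweight \<and> (\<forall>x. Poly_Mapping.lookup p x \<in> Qz)"
  unfolding small_def by blast

lemma smallE:
  assumes "p \<in> small" shows "Poly_Mapping.keys p \<subseteq> (\<lambda>x _. x) ` Uweight" "Poly_Mapping.lookup p x \<in> Qz"
  using assms by (auto simp only: small_iff)

lemma small_0: "0 \<in> small"
  by (simp add: small_iff Qz_0)

lemma small_add:
  assumes "p \<in> small" "r \<in> small" shows "p + r \<in> small"
  unfolding small_iff
proof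
  show "Poly_Mapping.keys (p + r) \<subseteq> (\<lambda>x _. x) ` Uweight"
    using keys_add[of p r] smallE(1)[OF assms(1)] smallE(1)[OF assms(2)] by blast
qed (simp add: lookup_add Qz_add smallE(2) assms)

lemma small_single: "x \<in> Uweight \<Longrightarrow> b \<in> Qz \<Longrightarrow> Poly_Mapping.single (\<lambda>_. x) b \<in> small"
  by (auto simp: small_iff lookup_single when_def Qz_0)

lemma Phi_in_small: "x \<in> Uweight \<Longrightarrow> Phi x \<in> small"
  unfolding Phi_def Phi_hat_def by (intro small_single Qz_1)

lemma small_induct [consumes 1, case_names zero single add]:
  assumes p: "p \<in> small" and 0: "P 0"
    and single: "\<And>x b. x \<in> Uweight \<Longrightarrow> b \<in> Qz \<Longrightarrow> P (smul b (Phi x))"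
    and add: "\<And>p r. p \<in> small \<Longrightarrow> r \<in> small \<Longrightarrow> P p \<Longrightarrow> P r \<Longrightarrow> P (p + r)"
  shows "P p"
proof -
  have "P (\<Sum>x\<in>S. Poly_Mapping.single x (Poly_Mapping.lookup p x))
      \<and> (\<Sum>x\<in>S. Poly_Mapping.single x (Poly_Mapping.lookup p x)) \<in> small" if "S \<subseteq> Poly_Mapping.keys p" for S
    using that
  proof (induction S rule: infinite_finite_induct)
    case (insert y S)
    then obtain x where x: "y = (\<lambda>_. x)" "x \<in> Uweight" using smallE(1)[OF p] by auto
    have "P (Poly_Mapping.single y (Poly_Mapping.lookup p y))"
      using single[OF x(2) smallE(2)[OF p, of y]] by (simp add: x(1) Phi_def Phi_hat_def)
    then show ?case using insert smallE(2)[OF p] x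
      by (auto intro!: add small_add small_single)
  qed (auto simp: 0 small_0)
  from this[of "Poly_Mapping.keys p"] show ?thesis
    using poly_mapping_expand[of p] by simp
qed

lemma small_subset_Us: "small \<subseteq> Us"
proof
  fix p assume "p \<in> small"
  then show "p \<in> Us"
    using Uweight_subset_Ufull const_in_Uhat unfolding small_iff Us_iff by blast
qed

lemma small_mult: "p \<in> small \<Longrightarrow> r \<in> small \<Longrightarrow> us_mult p r \<in> small"
proof (induction p rule: small_induct)
  case (single x b)
  from \<open>r \<in> small\<close> show ?case
  proof (induction r rule: small_induct)
    case (single y c)
    have "Poly_Mapping.single (\<lambda>_. x * y) (b * c) \<in> small"
      using single \<open>x \<in> Uweight\<close> \<open>b \<in> Qz\<close> by (intro small_single Uweight_mult Qz_mult)
    then have "smul (b * c) (Phi (x * y)) \<in> small" by (simp add: Phi_def Phi_hat_def)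
    then show ?case by (simp add: us_mult_smul_left us_mult_smul_right Phi_mult mult.commute)
  qed (auto simp: us_mult_add_right small_0 small_add)
qed (auto simp: us_mult_add_left small_0 small_add)

lemma small_one: "us_one \<in> small"
  unfolding us_one_eq by (rule Phi_in_small[OF Uweight_1])

lemma small_S2: "p \<in> small \<Longrightarrow> us_S2 p \<in> small"
proof (induction p rule: small_induct)
  case (single x b)
  have "Poly_Mapping.single (\<lambda>_. antipode (antipode x)) b \<in> small"
    using single by (intro small_single antipode_antipode_Uweight)
  then have "smul b (Phi (antipode (antipode x))) \<in> small" by (simp add: Phi_def Phi_hat_def)
  then show ?case by (simp add: us_S2_smul us_S2_Phi)
qed (auto simp: us_S2_add us_S2_0 small_0 small_add)

lemma small_tn_subset: "tens Qz small m \<subseteq> us.tn m"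
  by (rule tens_mono[OF small_subset_Us])

lemma l_root'_le: "l_root' j \<le> l"
  unfolding l_root'_def Let_def by (auto intro: le_trans[OF div_le_dividend])

lemma l_root'_pos: "0 < l_root' j"
proof -
  let ?m = "l div gcd l (d (w ! j))"
  have "?m > 0" using l_pos by (simp add: div_greater_zero_iff gcd_le1_nat)
  moreover have "?m div 2 > 0" if "even ?m" using that \<open>?m > 0\<close> by (auto elim!: evenE)
  ultimately show ?thesis by (auto simp: l_root'_def Let_def)
qed

text \<open>Halving \<open>l div gcd l (d (w ! j))\<close> when it is even is undone by the factor
  2, and the gcd removed from \<open>l\<close> divides \<open>d (w ! j)\<close>.\<close>

lemma l_dvd_l_root': "l dvd d (w ! j) * (2 * l_root' j)"
proof -
  let ?g = "gcd l (d (w ! j))"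
  let ?m = "l div ?g"
  have "?m dvd 2 * l_root' j" by (auto simp: l_root'_def Let_def)
  moreover have "l = ?g * ?m" by simp
  moreover have "?g dvd d (w ! j)" by simp
  ultimately show ?thesis by (metis mult_dvd_mono)
qed

text \<open>The factor of index \<open>l_root' j\<close> is a difference of two powers of q whose
  exponents differ by \<open>d (w ! j) * (2 * l_root' j)\<close>. This is a multiple of
  \<open>l\<close>, so the two powers agree at the root of unity.\<close>

lemma ev_bpol_null:
  assumes j: "j < N" "l_root' j \<le> r ! j" shows "ev (bpol r) = 0"
proof -
  let ?k = "l_root' j" and ?D = "d (w ! j)"
  have "z powi (int L * (int ?D * (int ?k - 1))) = z powi (int L * (int ?D * (- int ?k - 1)))"
  proof (rule z_powi_cong)
    have "int (l * L) dvd int (?D * (2 * ?k) * L)"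
      using l_dvd_l_root'[of j] by (subst int_dvd_int_iff) (rule mult_dvd_mono, auto)
    also have "int (?D * (2 * ?k) * L) = int L * (int ?D * (int ?k - 1)) - int L * (int ?D * (- int ?k - 1))"
      by (simp add: algebra_simps)
    finally show "int (l * L) dvd int L * (int ?D * (int ?k - 1)) - int L * (int ?D * (- int ?k - 1))" .
  qed
  then have "ev (\<Prod>k=1..r ! j. s_pow (int L * (int ?D * (int k - 1))) - s_pow (int L * (int ?D * (- int k - 1)))) = 0"
    unfolding ev_prod using j l_root'_pos[of j] by (intro prod_zero bexI[of _ ?k]) (auto simp: ev_diff)
  then show ?thesis
    unfolding bpol_def ev_prod using j(1) by (intro prod_zero bexI[of _ j]) (auto simp: ev_mult ev_prod)
qed

definition small_exponents :: "nat list set" where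
  "small_exponents = {r. length r = N \<and> (\<forall>j<N. r ! j < l_root' j)}"

lemma finite_small_exponents: "finite small_exponents"
proof (rule finite_subset)
  show "small_exponents \<subseteq> {r. set r \<subseteq> {..<l} \<and> length r = N}"
    using l_root'_le by (fastforce simp: small_exponents_def in_set_conv_nth intro: less_le_trans)
qed (rule finite_lists_length_eq, simp)

lemma R_small_eq: "R_small = tens_mult us_mult
     (\<Sum>X\<in>weight_cosets. \<Sum>Y\<in>weight_cosets.
        Poly_Mapping.single [Phi (Kg (coset_rep X)), Phi (Kg (coset_rep Y))]
          (1 / of_nat (card weight_cosets) * z powi (- Lpairing (coset_rep X) (coset_rep Y))))
     (\<Sum>r\<in>small_exponents. Poly_Mapping.single [Phi (Emon r), Phi (Fmon r)] (ev (bpol r)))"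
  by (simp add: R_small_def small_exponents_def bcoef_eq)

lemma cartan_coeff_in_Qz: "1 / of_nat (card weight_cosets) * z powi k \<in> Qz"
  using Qz_mult[OF Qz_divide[OF Qz_1 Qz_of_int[of "int (card weight_cosets)"]] Qz_powi] by simp

lemma R_small_eq': "R_small = (\<Sum>X\<in>weight_cosets. \<Sum>Y\<in>weight_cosets. \<Sum>r\<in>small_exponents.
    Poly_Mapping.single [Phi (Kg (coset_rep X) * Emon r), Phi (Kg (coset_rep Y) * Fmon r)]
      (1 / of_nat (card weight_cosets) * z powi (- Lpairing (coset_rep X) (coset_rep Y)) * ev (bpol r)))"
  by (simp only: R_small_eq tens_mult_sum_left) (simp add: tens_mult_sum_right Phi_mult)

lemma small_smul: "b \<in> Qz \<Longrightarrow> p \<in> small \<Longrightarrow> smul b p \<in> small"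
  unfolding small_iff by (auto simp: in_keys_iff Qz_mult)

text \<open>Relations are imposed inside \<open>Us\<close>. With \<open>{0}\<close> as null set this
  instance records only that the entries of a tensor stay in \<open>small\<close>.\<close>

sublocale sm: quotient_algebra Qz small "{0}" us_mult us_one
  by standard (auto simp: Qz_1 Qz_diff Qz_mult small_0 small_add small_smul small_mult small_one
    us_mult_add_left us_mult_add_right us_mult_smul_left us_mult_smul_right us_mult_assoc
    us_mult_one_left us_mult_one_right)

lemma R_small_small: "R_small \<in> sm.tn 2"
  unfolding R_small_eq'
  by (intro sm.tn_sum sm.tn_single Qz_mult[OF cartan_coeff_in_Qz ev_in_Qz])
    (auto intro!: Phi_in_small Uweight_mult Uweight_Kg Emon_in_Uweight Fmon_in_Uweight)

lemma R_small_tn: "R_small \<in> us.tn 2"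
  using R_small_small small_tn_subset by auto

lemma Phi_Kg_mult:
  assumes "homogeneous \<gamma> p" "p \<in> Ufull"
  shows "eqmod us_null (Phi (Kg \<kappa> * p * ind v)) (smul (z powi Lpairing (v + \<gamma>) \<kappa>) (Phi (p * ind v)))"
proof -
  have in_Ufull: "p * ind v \<in> Ufull" "Kg \<kappa> * p * ind v \<in> Ufull" using assms(2)
    by (auto intro!: full.mul_C Mg_in_Ufull ind_in_Ufull)
  have "eqmod us_null (Phi (Kg \<kappa> * p * ind v)) (Phi (smul (emb (s_pow (Lpairing (v + \<gamma>) \<kappa>))) (p * ind v)))"
    using Mg_mult_ind_homogeneous[OF assms(1), of "Kfun \<kappa>" v] in_Ufull
    by (intro Phi_cong full.C_smul) (auto simp: Kfun_def)
  moreover have "eqmod us_null \<dots> (smul (z powi Lpairing (v + \<gamma>) \<kappa>) (Phi (p * ind v)))"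
    using Phi_smul[OF in_Ufull(1), of "s_pow (Lpairing (v + \<gamma>) \<kappa>)"] by simp
  ultimately show ?thesis by (rule eqmod_trans[OF us.add_subgroup_Z])
qed

text \<open>In front of an indicator each \<open>Kg\<close> acts by a scalar, determined by the
  weight to which \<open>Emon r\<close> or \<open>Fmon r\<close> leads. The resulting double sum of
  scalars is \<open>cartan_sum\<close>.\<close>

lemma component_at_R_small:
  assumes \<nu>: "length \<nu> = 2"
  shows "eqmod (us.nl 2) (component_at \<nu> R_small) (\<Sum>r\<in>small_exponents. Poly_Mapping.single (map Phi (R_pure \<nu> r))
    (z powi Lpairing (\<nu> ! 0 + exp_weight r) (\<nu> ! 1 - exp_weight r) * ev (bpol r)))"
proof -
  obtain v0 v1 where \<nu>': "\<nu> = [v0, v1]" by (rule length_2E[OF \<nu>])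
  let ?c = "\<lambda>X Y. 1 / of_nat (card weight_cosets) * z powi (- Lpairing (coset_rep X) (coset_rep Y))"
  let ?x = "\<lambda>X r. z powi Lpairing (v0 + exp_weight r) (coset_rep X)"
  let ?y = "\<lambda>Y r. z powi Lpairing (v1 - exp_weight r) (coset_rep Y)"
  have 0: "component_at \<nu> R_small = (\<Sum>X\<in>weight_cosets. \<Sum>Y\<in>weight_cosets. \<Sum>r\<in>small_exponents.
      Poly_Mapping.single [Phi (Kg (coset_rep X) * Emon r * ind v0), Phi (Kg (coset_rep Y) * Fmon r * ind v1)]
      (?c X Y * ev (bpol r)))"
    unfolding component_at_eq R_small_eq' tens_mult_sum_left by (simp add: \<nu>' Phi_mult)
  have 1: "eqmod (us.nl 2) (component_at \<nu> R_small) (\<Sum>X\<in>weight_cosets. \<Sum>Y\<in>weight_cosets. \<Sum>r\<in>small_exponents.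
      Poly_Mapping.single [Phi (Emon r * ind v0), Phi (Fmon r * ind v1)] (?c X Y * ?x X r * ?y Y r * ev (bpol r)))"
    unfolding 0
  proof (intro us.nl_sum)
    fix X Y r
    let ?E = "Phi (Kg (coset_rep X) * Emon r * ind v0)" and ?F = "Phi (Kg (coset_rep Y) * Fmon r * ind v1)"
    let ?E' = "Phi (Emon r * ind v0)" and ?F' = "Phi (Fmon r * ind v1)"
    have in_Us: "?E \<in> Us" "?F \<in> Us" "?E' \<in> Us" "?F' \<in> Us"
      by (intro Phi_in_Us full.mul_C Mg_in_Ufull ind_in_Ufull Emon_in_Ufull Fmon_in_Ufull)+
    have Qz: "?c X Y * ev (bpol r) \<in> Qz" "?x X r \<in> Qz" "?y Y r \<in> Qz"
      by (rule Qz_mult[OF cartan_coeff_in_Qz ev_in_Qz], rule Qz_powi, rule Qz_powi)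
    have E: "eqmod us_null ?E (smul (?x X r) ?E')"
      by (rule Phi_Kg_mult[OF homogeneous_Emon Emon_in_Ufull])
    have F: "eqmod us_null ?F (smul (?y Y r) ?F')"
      using Phi_Kg_mult[OF homogeneous_Fmon Fmon_in_Ufull, of "coset_rep Y" r v1] by simp
    have "eqmod (us.nl 2) (Poly_Mapping.single [?E, ?F] (?c X Y * ev (bpol r)))
        (Poly_Mapping.single [?E', ?F'] (?c X Y * ev (bpol r) * ?x X r * ?y Y r))"
      by (rule us.nl_pair_cong[OF in_Us Qz E F])
    moreover have "?c X Y * ev (bpol r) * ?x X r * ?y Y r = ?c X Y * ?x X r * ?y Y r * ev (bpol r)"
      by (simp only: mult_ac)
    ultimately show "eqmod (us.nl 2) (Poly_Mapping.single [?E, ?F] (?c X Y * ev (bpol r)))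
        (Poly_Mapping.single [?E', ?F'] (?c X Y * ?x X r * ?y Y r * ev (bpol r)))"
      by (rule back_subst)
  qed
  have "(\<Sum>X\<in>weight_cosets. \<Sum>Y\<in>weight_cosets. \<Sum>r\<in>small_exponents.
      Poly_Mapping.single [Phi (Emon r * ind v0), Phi (Fmon r * ind v1)] (?c X Y * ?x X r * ?y Y r * ev (bpol r)))
    = (\<Sum>r\<in>small_exponents. Poly_Mapping.single [Phi (Emon r * ind v0), Phi (Fmon r * ind v1)]
      ((\<Sum>X\<in>weight_cosets. \<Sum>Y\<in>weight_cosets. ?c X Y * ?x X r * ?y Y r) * ev (bpol r)))"
    by (rule sum_single_swap)
  also have "\<dots> = (\<Sum>r\<in>small_exponents. Poly_Mapping.single (map Phi (R_pure \<nu> r))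
    (z powi Lpairing (\<nu> ! 0 + exp_weight r) (\<nu> ! 1 - exp_weight r) * ev (bpol r)))"
    unfolding cartan_sum R_pure_def \<nu>' by simp
  finally show ?thesis using 1 by (simp only:)
qed

text \<open>Both sides are the same sum, over different finite sets of exponent vectors. A vector
  outside \<open>exponents l\<close> has coefficient divisible by \<open>brace l\<close>, and a
  vector of length \<open>N\<close> outside \<open>small_exponents\<close> has an entry reaching
  \<open>l_root' j\<close>; either way the coefficient evaluates to 0.\<close>

lemma Phi_tensor_R_full:
  assumes \<nu>: "length \<nu> = 2"
  shows "eqmod (us.nl 2) (Phi_tensor (R_full l \<nu>)) (component_at \<nu> R_small)"
proof -
  let ?c = "\<lambda>r. s_pow (Lpairing (\<nu> ! 0 + exp_weight r) (\<nu> ! 1 - exp_weight r)) * bpol r"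
  let ?g = "\<lambda>r. Poly_Mapping.single (map Phi (R_pure \<nu> r))
    (z powi Lpairing (\<nu> ! 0 + exp_weight r) (\<nu> ! 1 - exp_weight r) * ev (bpol r))"
  have "eqmod (us.nl 2) (Phi_tensor (R_full l \<nu>)) (Phi_tensor (\<Sum>r\<in>exponents l. Poly_Mapping.single (R_pure \<nu> r) (emb (?c r))))"
    by (intro Phi_tensor_cong R_full_eq[OF \<nu>] tn_integral[OF R_full_tn[OF \<nu>]] integral_sum integral_single)
  also have "Phi_tensor (\<Sum>r\<in>exponents l. Poly_Mapping.single (R_pure \<nu> r) (emb (?c r))) = sum ?g (exponents l)"
    by (simp add: Phi_tensor_sum integral_single Phi_tensor_single ev_mult)
  also have "sum ?g (exponents l) = sum ?g (exponents l \<union> small_exponents)"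
  proof (rule sum.mono_neutral_left)
    have "ev (bpol r) = 0" if "r \<in> small_exponents" "r \<notin> exponents l" for r
      using that by (auto simp: exponents_def small_exponents_def bcoef_eq emb_eq_iff ev_mult ev_brace)
    then show "\<forall>r\<in>exponents l \<union> small_exponents - exponents l. ?g r = 0" by auto
  qed (auto simp: finite_exponents finite_small_exponents)
  also have "\<dots> = sum ?g small_exponents"
  proof (rule sum.mono_neutral_right)
    have "ev (bpol r) = 0" if "r \<in> exponents l" "r \<notin> small_exponents" for r
      using that ev_bpol_null[of _ r] by (auto simp: exponents_def small_exponents_def not_less)
    then show "\<forall>r\<in>exponents l \<union> small_exponents - small_exponents. ?g r = 0" by auto
  qed (auto simp: finite_exponents finite_small_exponents)
  also have "eqmod (us.nl 2) \<dots> (component_at \<nu> R_small)"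
    by (rule us.nl_sym[OF component_at_R_small[OF \<nu>]])
  finally show ?thesis .
qed

end

section \<open>Sums over boxes of weights\<close>

lemma add_subgroup_sum_list: "add_subgroup Z \<Longrightarrow> (\<And>y. y \<in> set ys \<Longrightarrow> f y \<in> Z) \<Longrightarrow> (\<Sum>y\<leftarrow>ys. f y) \<in> Z"
  by (induction ys) (auto simp: add_subgroup_0 add_subgroup_add)

definition box :: "nat \<Rightarrow> (nat \<Rightarrow> 'a set) \<Rightarrow> 'a list set" where
  "box m A = {\<mu>. length \<mu> = m \<and> (\<forall>i<m. \<mu> ! i \<in> A i)}"

lemma finite_box: "(\<And>i. i < m \<Longrightarrow> finite (A i)) \<Longrightarrow> finite (box m A)"
proof (rule finite_subset)
  show "box m A \<subseteq> {\<mu>. set \<mu> \<subseteq> (\<Union>i<m. A i) \<and> length \<mu> = m}"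
    by (fastforce simp: box_def in_set_conv_nth)
qed (rule finite_lists_length_eq, simp)

lemma box_0: "box 0 A = {[]}"
  by (auto simp: box_def)

lemma box_Suc: "box (Suc m) A = (\<lambda>(\<mu>, v). \<mu> @ [v]) ` (box m A \<times> A m)"
proof
  show "box (Suc m) A \<subseteq> (\<lambda>(\<mu>, v). \<mu> @ [v]) ` (box m A \<times> A m)"
  proof
    fix \<mu> assume \<mu>: "\<mu> \<in> box (Suc m) A"
    then have len: "length \<mu> = Suc m" by (simp add: box_def)
    have "\<mu> = butlast \<mu> @ [last \<mu>]" using len by (cases \<mu> rule: rev_cases) auto
    moreover have "butlast \<mu> \<in> box m A" using \<mu> by (auto simp: box_def nth_butlast)
    moreover have "last \<mu> \<in> A m" using \<mu> len by (cases \<mu> rule: rev_cases) (auto simp: box_def)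
    ultimately show "\<mu> \<in> (\<lambda>(\<mu>, v). \<mu> @ [v]) ` (box m A \<times> A m)" by force
  qed
qed (auto simp: box_def nth_append less_Suc_eq)

lemma sum_box_Suc: "sum f (box (Suc m) A) = (\<Sum>\<mu>\<in>box m A. \<Sum>v\<in>A m. f (\<mu> @ [v]))"
proof -
  have "sum f (box (Suc m) A) = (\<Sum>(\<mu>, v)\<in>box m A \<times> A m. f (\<mu> @ [v]))"
    unfolding box_Suc by (subst sum.reindex) (auto simp: inj_on_def case_prod_beta intro!: sum.cong)
  then show ?thesis by (simp add: sum.cartesian_product)
qed

context quotient_algebra
begin

lemma nl_nth_null:
  assumes "set xs \<subseteq> C" "i < length xs" "xs ! i \<in> Z" "b \<in> B" "length xs = m"
  shows "Poly_Mapping.single xs b \<in> nl m"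
proof -
  have "Poly_Mapping.single (take i xs @ xs ! i # drop (Suc i) xs) b \<in> nl m"
    using assms by (intro nl_pure_null) (auto dest: in_set_takeD in_set_dropD)
  then show ?thesis using assms(2) by (simp flip: id_take_nth_drop)
qed

lemma nl_map_cong:
  assumes "\<And>i. i < length xs \<Longrightarrow> eqmod Z (xs ! i) (ys ! i)" "set xs \<subseteq> C" "set ys \<subseteq> C"
    and "length xs = m" "length ys = m" "b \<in> B"
  shows "eqmod (nl m) (Poly_Mapping.single xs b) (Poly_Mapping.single ys b)"
  using assms
proof (induction xs arbitrary: ys m b)
  case Nil
  then show ?case by (simp add: nl_refl)
next
  case (Cons x xs)
  then obtain y ys' where ys: "ys = y # ys'" by (cases ys) auto
  have "eqmod (nl m) (Poly_Mapping.single ([] @ x # xs) b) (Poly_Mapping.single ([] @ y # xs) b)"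
    using Cons.prems Cons.prems(1)[of 0] by (intro nl_pure_cong) (auto simp: ys)
  moreover have "eqmod (nl (1 + (m - 1))) (Poly_Mapping.single [y] 1 * Poly_Mapping.single xs b)
      (Poly_Mapping.single [y] 1 * Poly_Mapping.single ys' b)"
  proof (intro times_cong_nl nl_refl Cons.IH)
    fix i assume "i < length xs" then show "eqmod Z (xs ! i) (ys' ! i)" using Cons.prems(1)[of "Suc i"] ys by simp
  qed (use Cons.prems ys B1 in \<open>auto intro!: tn_single\<close>)
  ultimately show ?case
    using Cons.prems by (auto simp: ys mult_single plus_list_def intro: nl_trans)
qed

text \<open>Multilinearity of the pure tensor, applied one factor at a time from the right.\<close>

lemma nl_box_sum:
  assumes "\<And>i v. i < m \<Longrightarrow> v \<in> A i \<Longrightarrow> F i v \<in> C" "b \<in> B"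
  shows "eqmod (nl m) (\<Sum>\<mu>\<in>box m A. Poly_Mapping.single (map (\<lambda>i. F i (\<mu> ! i)) [0..<m]) b)
    (Poly_Mapping.single (map (\<lambda>i. \<Sum>v\<in>A i. F i v) [0..<m]) b)"
  using assms(1)
proof (induction m)
  case 0
  then show ?case by (simp add: box_0 nl_refl)
next
  case (Suc m)
  have "(\<Sum>\<mu>\<in>box (Suc m) A. Poly_Mapping.single (map (\<lambda>i. F i (\<mu> ! i)) [0..<Suc m]) b)
      = (\<Sum>\<mu>\<in>box m A. \<Sum>v\<in>A m. Poly_Mapping.single (map (\<lambda>i. F i ((\<mu> @ [v]) ! i)) [0..<Suc m]) b)"
    by (rule sum_box_Suc)
  also have "\<dots> = (\<Sum>\<mu>\<in>box m A. \<Sum>v\<in>A m.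
      Poly_Mapping.single (map (\<lambda>i. F i (\<mu> ! i)) [0..<m]) b * Poly_Mapping.single [F m v] 1)"
  proof (intro sum.cong refl)
    fix \<mu> v assume "\<mu> \<in> box m A"
    then have "map (\<lambda>i. F i ((\<mu> @ [v]) ! i)) [0..<Suc m] = map (\<lambda>i. F i (\<mu> ! i)) [0..<m] @ [F m v]"
      by (auto simp: box_def nth_append)
    then show "Poly_Mapping.single (map (\<lambda>i. F i ((\<mu> @ [v]) ! i)) [0..<Suc m]) b
        = Poly_Mapping.single (map (\<lambda>i. F i (\<mu> ! i)) [0..<m]) b * Poly_Mapping.single [F m v] 1"
      by (simp only: mult_single plus_list_def mult_1_right)
  qed
  also have "\<dots> = (\<Sum>\<mu>\<in>box m A. Poly_Mapping.single (map (\<lambda>i. F i (\<mu> ! i)) [0..<m]) b)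
      * (\<Sum>v\<in>A m. Poly_Mapping.single [F m v] 1)"
    by (simp add: sum_product)
  finally have 1: "(\<Sum>\<mu>\<in>box (Suc m) A. Poly_Mapping.single (map (\<lambda>i. F i (\<mu> ! i)) [0..<Suc m]) b)
      = (\<Sum>\<mu>\<in>box m A. Poly_Mapping.single (map (\<lambda>i. F i (\<mu> ! i)) [0..<m]) b)
        * (\<Sum>v\<in>A m. Poly_Mapping.single [F m v] 1)" .
  have 2: "Poly_Mapping.single (map (\<lambda>i. \<Sum>v\<in>A i. F i v) [0..<Suc m]) b
      = Poly_Mapping.single (map (\<lambda>i. \<Sum>v\<in>A i. F i v) [0..<m]) b * Poly_Mapping.single [\<Sum>v\<in>A m. F m v] 1"
    by (simp add: mult_single plus_list_def)
  have "eqmod (nl (m + 1)) ((\<Sum>\<mu>\<in>box m A. Poly_Mapping.single (map (\<lambda>i. F i (\<mu> ! i)) [0..<m]) b)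
        * (\<Sum>v\<in>A m. Poly_Mapping.single [F m v] 1))
      (Poly_Mapping.single (map (\<lambda>i. \<Sum>v\<in>A i. F i v) [0..<m]) b * Poly_Mapping.single [\<Sum>v\<in>A m. F m v] 1)"
  proof (rule times_cong_nl)
    show "eqmod (nl 1) (\<Sum>v\<in>A m. Poly_Mapping.single [F m v] 1) (Poly_Mapping.single [\<Sum>v\<in>A m. F m v] 1)"
      using nl_sym[OF nl_pure_sum[of "[]" "[]" "A m" "F m" 1 1]] Suc.prems B1 by simp
    show "Poly_Mapping.single (map (\<lambda>i. \<Sum>v\<in>A i. F i v) [0..<m]) b \<in> tn m"
      using Suc.prems assms(2) by (intro tn_single) (auto intro!: C_sum)
    show "(\<Sum>v\<in>A m. Poly_Mapping.single [F m v] 1) \<in> tn 1"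
      using Suc.prems B1 by (intro tn_sum tn_single) auto
  qed (use Suc in auto)
  then show ?case unfolding 1 2 by simp
qed

end

context root_datum
begin

lemma expansion_weights_finite: "finite (\<Union>(y, f)\<in>set ys. weights (y ! i))"
  by (auto simp: finite_weights)

text \<open>In factor \<open>i\<close> the element \<open>y ! i\<close> stands between
  \<open>ind (\<mu> ! i)\<close> and \<open>ind (\<nu> ! i)\<close>, which vanishes; one null factor
  makes the whole pure tensor null.\<close>

lemma map2_mult_at_weights_null:
  assumes "set x \<subseteq> Ufull" "set y \<subseteq> Ufull" "length x = m" "length y = m" "length \<mu> = m" "length \<nu> = m"
    and i: "i < m" "\<And>\<gamma>. \<gamma> \<in> weights (y ! i) \<Longrightarrow> \<mu> ! i \<noteq> \<nu> ! i + \<gamma>"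
  shows "Poly_Mapping.single (map2 (*) (at_weights x \<mu>) (at_weights y \<nu>)) (emb c) \<in> full.nl m"
proof (rule full.nl_nth_null[of _ i])
  let ?xs = "map2 (*) (at_weights x \<mu>) (at_weights y \<nu>)"
  show "set ?xs \<subseteq> Ufull"
    using set_at_weights[OF assms(1), of \<mu>] set_at_weights[OF assms(2), of \<nu>]
    by (auto intro!: full.mul_C dest: set_zip_leftD set_zip_rightD)
  have "?xs ! i = x ! i * (ind (\<mu> ! i) * (y ! i) * ind (\<nu> ! i))"
    using assms by (simp add: nth_at_weights mult.assoc)
  then show "?xs ! i \<in> qideal"
    using ind_mult_ind_null[of "y ! i" "\<mu> ! i" "\<nu> ! i"] i by (simp add: qideal.left)
qed (use assms in auto)

text \<open>Factor by factor, the sum over the box becomes the sum of the indicators in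
  \<open>A i\<close>. This is absorbed by every \<open>y ! i\<close>, because \<open>A i\<close>
  contains all weights to which \<open>y ! i\<close> shifts \<open>\<nu> ! i\<close>.\<close>

lemma sum_ind_mult_expansion:
  assumes ys: "expansion_data m ys" and \<nu>: "length \<nu> = m"
    and A: "\<And>i. finite (A i)" "\<And>i y f \<gamma>. i < m \<Longrightarrow> (y, f) \<in> set ys \<Longrightarrow> \<gamma> \<in> weights (y ! i) \<Longrightarrow> \<nu> ! i + \<gamma> \<in> A i"
  shows "eqmod (full.nl m) (\<Sum>\<mu>\<in>box m A. tens_mult (*) (Poly_Mapping.single (map ind \<mu>) 1) (expansion ys \<nu>)) (expansion ys \<nu>)"
  using ys A(2)
proof (induction ys)
  case Nil
  then show ?case by (simp add: full.nl_refl)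
next
  case (Cons p ys)
  obtain y f where p: "p = (y, f)" by (cases p)
  have y: "length y = m" "set y \<subseteq> Ufull" using Cons.prems(1) p by auto
  have yi: "y ! i \<in> Ufull" if "i < m" for i using y that by (auto dest: nth_mem)
  have e1: "(\<Sum>\<mu>\<in>box m A. tens_mult (*) (Poly_Mapping.single (map ind \<mu>) 1) (Poly_Mapping.single (at_weights y \<nu>) (emb (f \<nu>))))
    = (\<Sum>\<mu>\<in>box m A. Poly_Mapping.single (map (\<lambda>i. ind (\<mu> ! i) * (y ! i * ind (\<nu> ! i))) [0..<m]) (emb (f \<nu>)))"
  proof (rule sum.cong[OF refl])
    fix \<mu> assume "\<mu> \<in> box m A"
    then have "map2 (*) (map ind \<mu>) (at_weights y \<nu>) = map (\<lambda>i. ind (\<mu> ! i) * (y ! i * ind (\<nu> ! i))) [0..<m]"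
      using y \<nu> by (intro nth_equalityI) (auto simp: box_def nth_at_weights)
    then show "tens_mult (*) (Poly_Mapping.single (map ind \<mu>) 1) (Poly_Mapping.single (at_weights y \<nu>) (emb (f \<nu>)))
      = Poly_Mapping.single (map (\<lambda>i. ind (\<mu> ! i) * (y ! i * ind (\<nu> ! i))) [0..<m]) (emb (f \<nu>))"
      by (simp only: tens_mult_single) simp
  qed
  have e2: "eqmod (full.nl m) (\<Sum>\<mu>\<in>box m A. Poly_Mapping.single (map (\<lambda>i. ind (\<mu> ! i) * (y ! i * ind (\<nu> ! i))) [0..<m]) (emb (f \<nu>)))
    (Poly_Mapping.single (map (\<lambda>i. \<Sum>u\<in>A i. ind u * (y ! i * ind (\<nu> ! i))) [0..<m]) (emb (f \<nu>)))"
    by (intro full.nl_box_sum full.mul_C yi ind_in_Ufull emb_in_As)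
  have e3: "eqmod (full.nl m) (Poly_Mapping.single (map (\<lambda>i. \<Sum>u\<in>A i. ind u * (y ! i * ind (\<nu> ! i))) [0..<m]) (emb (f \<nu>)))
    (Poly_Mapping.single (at_weights y \<nu>) (emb (f \<nu>)))"
  proof (rule full.nl_map_cong)
    fix i assume "i < length (map (\<lambda>i. \<Sum>u\<in>A i. ind u * (y ! i * ind (\<nu> ! i))) [0..<m])"
    then have i: "i < m" by simp
    have "eqmod qideal ((\<Sum>u\<in>A i. ind u) * y ! i * ind (\<nu> ! i)) (y ! i * ind (\<nu> ! i))"
      by (rule sum_ind_mult_ind[OF A(1)]) (rule Cons.prems(2)[OF i, of y f], simp_all add: p)
    then show "eqmod qideal (map (\<lambda>i. \<Sum>u\<in>A i. ind u * (y ! i * ind (\<nu> ! i))) [0..<m] ! i) (at_weights y \<nu> ! i)"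
      using i y \<nu> by (simp add: nth_at_weights sum_distrib_right mult.assoc)
  next
    show "set (map (\<lambda>i. \<Sum>u\<in>A i. ind u * (y ! i * ind (\<nu> ! i))) [0..<m]) \<subseteq> Ufull"
      by (auto intro!: full.C_sum full.mul_C yi ind_in_Ufull)
  qed (use y \<nu> set_at_weights[OF y(2)] in auto)
  have 1: "eqmod (full.nl m) (\<Sum>\<mu>\<in>box m A. tens_mult (*) (Poly_Mapping.single (map ind \<mu>) 1) (Poly_Mapping.single (at_weights y \<nu>) (emb (f \<nu>))))
    (Poly_Mapping.single (at_weights y \<nu>) (emb (f \<nu>)))" 
    unfolding e1 by (rule full.nl_trans[OF e2 e3])
  have "eqmod (full.nl m) (\<Sum>\<mu>\<in>box m A. tens_mult (*) (Poly_Mapping.single (map ind \<mu>) 1) (expansion ys \<nu>)) (expansion ys \<nu>)"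
    using Cons.prems(1) Cons.prems(2) p by (intro Cons.IH) auto
  from full.nl_add[OF 1 this] show ?case
    by (simp add: p tens_mult_add_right sum.distrib)
qed

end

context root_of_unity_datum
begin

lemma Phi_tensor_ind: "Phi_tensor (Poly_Mapping.single (map ind \<nu>) 1) = Poly_Mapping.single (map (\<lambda>v. Phi (ind v)) \<nu>) 1"
  using Phi_tensor_single[of "map ind \<nu>" 1] by (simp add: comp_def)

text \<open>Inverses in the completed tensor square are unique; the tensor
  \<open>R_small\<close> is multiplied with the sum of all components of \<open>R'\<close>, of which only finitely many
  matter.\<close>

lemma Phi_tensor_R_inverse:
  assumes R': "is_R_full_inverse R'" and Rs: "is_R_small_inverse Rs" and \<nu>: "length \<nu> = 2"
  shows "eqmod (us.nl 2) (Phi_tensor (R' l \<nu>)) (component_at \<nu> Rs)"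
proof -
  have R'_ct: "R' \<in> ctensors 2"
    and R'_inv: "eqmod (tensor_null l 2) (ctensor_mult 2 R_full R' l \<nu>) (ctensor_one l \<nu>)"
    using R' \<nu> by (auto simp: is_R_full_inverse_def eqmod_def)
  have Rs_small: "Rs \<in> sm.tn 2"
    and Rs_inv: "tens_mult us_mult Rs R_small - Poly_Mapping.single [us_one, us_one] 1 \<in> small_tensor_null 2"
    using Rs by (auto simp: is_R_small_inverse_def)
  have Rs_tn: "Rs \<in> us.tn 2" using Rs_small small_tn_subset by auto
  have R'_tn: "R' l \<nu> \<in> full.tn 2" using R'_ct \<nu> by (auto simp: ctensors_def)
  obtain ys where ys: "expansion_data 2 ys"
    and R'_ys: "eqmod (tensor_null l 2) (R' l \<nu>) (expansion ys \<nu>)"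
    using uniform_ctensor[OF R'_ct, of l] \<nu> unfolding uniform_def by blast
  obtain rs where rs: "expansion_data 2 rs"
    and R_rs: "\<And>\<mu>. length \<mu> = 2 \<Longrightarrow> eqmod (tensor_null l 2) (R_full l \<mu>) (expansion rs \<mu>)"
    using uniform_R_full[of l] unfolding uniform_def by blast
  \<comment> \<open>The weights to which the i-th factors in the expansion of the component of
    \<open>R'\<close> at \<open>\<nu>\<close> can shift \<open>\<nu> ! i\<close>. Indicators outside
    this box annihilate that component.\<close>
  define A where "A i = (\<lambda>\<gamma>. \<nu> ! i + \<gamma>) ` (\<Union>(y, f)\<in>set ys. weights (y ! i))" for i
  have finA: "finite (A i)" for i unfolding A_def by (intro finite_imageI expansion_weights_finite)
  have null: "tens_mult (*) (R_full l \<mu>) (R' l \<nu>) \<in> tensor_null l 2" if \<mu>: "length \<mu> = 2" "\<mu> \<notin> box 2 A" for \<mu>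
  proof -
    obtain i where i: "i < 2" "\<mu> ! i \<notin> A i" using \<mu> by (auto simp: box_def)
    have "tens_mult (*) (expansion rs \<mu>) (expansion ys \<nu>) \<in> full.nl 2"
    proof -
      have "tens_mult (*) (Poly_Mapping.single (at_weights x \<mu>) (emb (g \<mu>))) (Poly_Mapping.single (at_weights y \<nu>) (emb (f \<nu>))) \<in> full.nl 2"
        if "(x, g) \<in> set rs" "(y, f) \<in> set ys" for x g y f
      proof -
        have "length x = 2" "set x \<subseteq> Ufull" "length y = 2" "set y \<subseteq> Ufull"
          using that rs ys unfolding expansion_data_def by blast+
        moreover have "\<mu> ! i \<noteq> \<nu> ! i + \<gamma>" if "\<gamma> \<in> weights (y ! i)" for \<gamma>
          using i(2) that \<open>(y, f) \<in> set ys\<close> unfolding A_def by blast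
        ultimately show ?thesis
          unfolding tens_mult_single emb_mult[symmetric]
          by (intro map2_mult_at_weights_null[OF _ _ _ _ \<mu>(1) \<nu> i(1)])
      qed
      then show ?thesis
        unfolding expansion_def tens_mult_sum_list_left tens_mult_sum_list_right
        by (intro add_subgroup_sum_list[OF full.add_subgroup_nl]) auto
    qed
    moreover have "eqmod (tensor_null l 2) (tens_mult (*) (R_full l \<mu>) (R' l \<nu>)) (tens_mult (*) (expansion rs \<mu>) (expansion ys \<nu>))"
      by (intro tensor_null_tens_mult R_rs[OF \<mu>(1)] R'_ys expansion_tn rs \<mu>(1) R'_tn)
    ultimately show ?thesis
      using eqmod_in[OF add_subgroup_tensor_null] nl_subset_tensor_null by blast
  qed
  let ?I = "\<lambda>\<mu>. Poly_Mapping.single (map (\<lambda>v. Phi (ind v)) \<mu>) (1 :: complex)"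
  let ?P = "Phi_tensor (R' l \<nu>)"
  have P_tn: "?P \<in> us.tn 2" by (rule Phi_tensor_tn[OF R'_tn])
  have box_len: "length \<mu> = 2" if "\<mu> \<in> box 2 A" for \<mu> using that by (simp add: box_def)
  have "eqmod (tensor_null l 2) (ctensor_mult 2 R_full R' l \<nu>) (\<Sum>\<mu>\<in>box 2 A. tens_mult (*) (R_full l \<mu>) (R' l \<nu>))"
    unfolding ctensor_mult_def
  proof (rule conv_sum_eqmod[OF add_subgroup_tensor_null finite_box[OF finA]])
    show "box 2 A \<subseteq> {\<mu>. length \<mu> = 2}" using box_len by auto
    show "tens_mult (*) (R_full l \<mu>) (R' l \<nu>) \<in> tensor_null l 2" if "\<mu> \<in> {\<mu>. length \<mu> = 2}" "\<mu> \<notin> box 2 A" for \<mu>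
      by (rule null) (use that in auto)
  qed
  from tensor_null_trans[OF tensor_null_sym[OF this] R'_inv]
  have "eqmod (tensor_null l 2) (\<Sum>\<mu>\<in>box 2 A. tens_mult (*) (R_full l \<mu>) (R' l \<nu>)) (ctensor_one l \<nu>)" .
  then have "eqmod (us.nl 2) (Phi_tensor (\<Sum>\<mu>\<in>box 2 A. tens_mult (*) (R_full l \<mu>) (R' l \<nu>))) (Phi_tensor (ctensor_one l \<nu>))"
    using integral_single[of "map ind \<nu>" 1] box_len
    by (intro Phi_tensor_cong integral_sum integral_tens_mult tn_integral[OF R_full_tn] tn_integral[OF R'_tn])
      (auto simp: ctensor_one_def)
  moreover have "Phi_tensor (\<Sum>\<mu>\<in>box 2 A. tens_mult (*) (R_full l \<mu>) (R' l \<nu>))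
      = (\<Sum>\<mu>\<in>box 2 A. tens_mult us_mult (Phi_tensor (R_full l \<mu>)) ?P)"
    using box_len by (subst Phi_tensor_sum)
      (auto intro!: sum.cong Phi_tensor_tens_mult integral_tens_mult tn_integral[OF R_full_tn] tn_integral[OF R'_tn])
  ultimately have 1: "eqmod (us.nl 2) (\<Sum>\<mu>\<in>box 2 A. tens_mult us_mult (Phi_tensor (R_full l \<mu>)) ?P) (?I \<nu>)"
    by (simp add: ctensor_one_def Phi_tensor_ind)
  have "eqmod (us.nl 2) (\<Sum>\<mu>\<in>box 2 A. tens_mult us_mult (Phi_tensor (R_full l \<mu>)) ?P)
      (\<Sum>\<mu>\<in>box 2 A. tens_mult us_mult (component_at \<mu> R_small) ?P)"
    using box_len by (intro us.nl_sum us.tens_mult_cong_nl Phi_tensor_R_full us.nl_refl component_at_tn R_small_tn P_tn) auto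
  \<comment> \<open>\<open>R_small\<close> is one tensor for all \<open>\<mu>\<close>, so the
    indicators can be gathered to the right of it. This is not possible for \<open>R_full\<close>,
    which is given by components only.\<close>
  moreover have "(\<Sum>\<mu>\<in>box 2 A. tens_mult us_mult (component_at \<mu> R_small) ?P)
      = tens_mult us_mult R_small (\<Sum>\<mu>\<in>box 2 A. tens_mult us_mult (?I \<mu>) ?P)"
    by (simp add: component_at_eq tens_mult_assoc[OF us_mult_assoc] tens_mult_sum_right)
  ultimately have 2: "eqmod (us.nl 2) (tens_mult us_mult R_small (\<Sum>\<mu>\<in>box 2 A. tens_mult us_mult (?I \<mu>) ?P)) (?I \<nu>)"
    using us.nl_trans[OF us.nl_sym 1] by simp
  have ind_tn: "Poly_Mapping.single (map ind \<mu>) 1 \<in> full.tn 2" if "length \<mu> = 2" for \<mu> :: "'n weight list"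
    using that by (intro full.tn_single full.B1) (auto intro: ind_in_Ufull)
  \<comment> \<open>By the choice of \<open>A\<close> the gathered indicators act as the identity on
    the component of \<open>R'\<close>.\<close>
  have "eqmod (tensor_null l 2) (\<Sum>\<mu>\<in>box 2 A. tens_mult (*) (Poly_Mapping.single (map ind \<mu>) 1) (R' l \<nu>))
      (\<Sum>\<mu>\<in>box 2 A. tens_mult (*) (Poly_Mapping.single (map ind \<mu>) 1) (expansion ys \<nu>))"
    using box_len by (intro tensor_null_sum tensor_null_tens_mult tensor_null_refl R'_ys ind_tn R'_tn) auto
  also have "eqmod (tensor_null l 2) \<dots> (expansion ys \<nu>)"
    using finA by (intro nl_imp_tensor_null sum_ind_mult_expansion ys \<nu>) (auto simp: A_def)
  also have "eqmod (tensor_null l 2) \<dots> (R' l \<nu>)"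
    by (rule tensor_null_sym[OF R'_ys])
  finally have "eqmod (us.nl 2) (Phi_tensor (\<Sum>\<mu>\<in>box 2 A. tens_mult (*) (Poly_Mapping.single (map ind \<mu>) 1) (R' l \<nu>))) ?P"
    using box_len by (intro Phi_tensor_cong integral_sum integral_tens_mult tn_integral[OF ind_tn] tn_integral[OF R'_tn])
  moreover have "Phi_tensor (\<Sum>\<mu>\<in>box 2 A. tens_mult (*) (Poly_Mapping.single (map ind \<mu>) 1) (R' l \<nu>))
      = (\<Sum>\<mu>\<in>box 2 A. tens_mult us_mult (?I \<mu>) ?P)"
    unfolding Phi_tensor_ind[symmetric] using box_len by (subst Phi_tensor_sum)
      (auto intro!: sum.cong Phi_tensor_tens_mult integral_tens_mult tn_integral[OF ind_tn] tn_integral[OF R'_tn])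
  ultimately have 3: "eqmod (us.nl 2) (\<Sum>\<mu>\<in>box 2 A. tens_mult us_mult (?I \<mu>) ?P) ?P" by simp
  have sum_tn: "(\<Sum>\<mu>\<in>box 2 A. tens_mult us_mult (?I \<mu>) ?P) \<in> us.tn 2"
    using box_len by (intro us.tn_sum us.tn_tens_mult ind_tensor_tn P_tn)
  have "eqmod (us.nl 2) (tens_mult us_mult R_small ?P) (?I \<nu>)"
    using us.nl_trans[OF us.nl_sym[OF us.tens_mult_cong_nl[OF us.nl_refl 3 R_small_tn sum_tn]] 2] .
  \<comment> \<open>Thus \<open>R_small\<close> times the image of this component is the tensor of
    indicators at \<open>\<nu>\<close>. Multiplication by the left inverse \<open>Rs\<close> now
    isolates the image.\<close>
  then have 4: "eqmod (us.nl 2) (tens_mult us_mult Rs (tens_mult us_mult R_small ?P)) (component_at \<nu> Rs)"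
    unfolding component_at_eq
    by (intro us.tens_mult_cong_nl us.nl_refl Rs_tn us.tn_tens_mult R_small_tn P_tn)
  have "eqmod (us.nl 2) (tens_mult us_mult Rs R_small) (Poly_Mapping.single [us_one, us_one] 1)"
    using tens_null_mono[OF Rs_inv small_subset_Us] by (simp add: eqmod_def)
  then have "eqmod (us.nl 2) (tens_mult us_mult (tens_mult us_mult Rs R_small) ?P)
      (tens_mult us_mult (Poly_Mapping.single [us_one, us_one] 1) ?P)"
    by (intro us.tens_mult_cong_nl us.nl_refl P_tn us.tn_single us.B1) (auto intro: us.one_C)
  moreover have "tens_mult us_mult (Poly_Mapping.single [us_one, us_one] 1) ?P = ?P"
    using P_tn
  proof (induction rule: us.tn_induct)
    case (single xs b)
    then obtain p q where "xs = [p, q]" by (elim length_2E)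
    then show ?case by (simp add: us_mult_one_left)
  qed (auto simp: tens_mult_add_right)
  ultimately have "eqmod (us.nl 2) (tens_mult us_mult (tens_mult us_mult Rs R_small) ?P) ?P" by simp
  then show ?thesis
    using us.nl_trans[OF us.nl_sym 4] by (simp add: tens_mult_assoc[OF us_mult_assoc])
qed

end

section \<open>Every slot is met exactly once\<close>

definition valid :: "nat \<Rightarrow> slice list \<Rightarrow> point \<Rightarrow> bool" where
  "valid n D = (\<lambda>(h, p, u). h \<le> length D \<and> p < width n D h)"

definition flip :: "point \<Rightarrow> point" where
  "flip = (\<lambda>(h, p, u). (h, p, \<not> u))"

definition stationary :: "point \<Rightarrow> bool" where
  "stationary x \<longleftrightarrow> (\<exists>p. x = (0, p, False))"

lemma flip_flip [simp]: "flip (flip x) = x"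
  by (cases x) (simp add: flip_def)

lemma flip_eq_iff: "flip x = flip y \<longleftrightarrow> x = y"
  by (metis flip_flip)

lemma cross_perm_cross_perm [simp]: "cross_perm i (cross_perm i p) = p"
  by (simp add: cross_perm_def)

lemma width_Suc: "h < length D \<Longrightarrow> width n D (Suc h) = next_width (width n D h) (D ! h)"
  by (simp add: width_def take_Suc_conv_app_nth)

lemma width_0: "width n D 0 = 2 * n"
  by (simp add: width_def)

lemma step_stationary: "stationary x \<Longrightarrow> step D x = x"
  by (auto simp: stationary_def)

lemma path_0: "path D j 0 = (0, 2 * j + 1, True)"
  and path_Suc: "path D j (Suc t) = step D (path D j t)"
  by (simp_all add: path_def)

lemma distinct_concat_upt:
  assumes "\<And>t. t < T \<Longrightarrow> distinct (f t)"
    and "\<And>s t. s < t \<Longrightarrow> t < T \<Longrightarrow> set (f s) \<inter> set (f t) = {}"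
  shows "distinct (concat (map f [0..<T]))"
  using assms
proof (induction T)
  case (Suc T)
  have "set (concat (map f [0..<T])) \<inter> set (f T) = {}" using Suc.prems(2)[of _ T] by fastforce
  then show ?case using Suc by simp
qed simp

lemma distinct_slots_at: "distinct (slots_at n D h)"
  and fst_slots_at: "\<sigma> \<in> set (slots_at n D h) \<Longrightarrow> fst \<sigma> = h"
  by (auto simp: slots_at_def split: slice.splits if_splits)

lemma distinct_slots: "distinct (slots n D)"
  unfolding slots_def
  by (rule distinct_concat_upt[OF distinct_slots_at]) (auto dest!: fst_slots_at)

lemma distinct_visit: "distinct (visit D x)"
proof -
  obtain h p u where x: "x = (h, p, u)" by (cases x)
  show ?thesis unfolding x by (cases u; cases h) (auto split: slice.split)
qed

definition end_time :: "slice list \<Rightarrow> nat \<Rightarrow> nat" where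
  "end_time D j = (LEAST t. path D j t = (0, 2 * j, False))"

lemma component_slots_eq: "component_slots D j = concat (map (\<lambda>t. visit D (path D j t)) [0..<end_time D j])"
  by (simp add: component_slots_def end_time_def)

locale tangle =
  fixes n :: nat and D :: "slice list"
  assumes tangle: "bottom_tangle n D"
begin

lemma slice_ok: "h < length D \<Longrightarrow> slice_ok (width n D h) (D ! h)"
  and width_top: "width n D (length D) = 0"
  and visited_ex: "h \<le> length D \<Longrightarrow> p < width n D h \<Longrightarrow> \<exists>u. (h, p, u) \<in> visited n D"
  using tangle unfolding bottom_tangle_def by blast+

lemma path_end_time:
  assumes "j < n" shows "path D j (end_time D j) = (0, 2 * j, False)"
proof -
  have "\<forall>j<n. \<exists>t. path D j t = (0, 2 * j, False)"
    using tangle unfolding bottom_tangle_def by (elim conjE)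
  then have "\<exists>t. path D j t = (0, 2 * j, False)" using assms by simp
  then show ?thesis unfolding end_time_def by (rule LeastI_ex)
qed

lemma validE:
  assumes "valid n D x" "\<not> stationary x"
  obtains h p where "x = (h, p, True)" "h < length D" "p < width n D h"
  | h p where "x = (Suc h, p, False)" "h < length D" "p < width n D (Suc h)"
proof -
  obtain h p u where x: "x = (h, p, u)" by (cases x)
  have v: "h \<le> length D" "p < width n D h" using assms(1) unfolding x valid_def by simp_all
  show thesis
  proof (cases u)
    case True
    have "h \<noteq> length D" using v width_top by (cases "h = length D") simp_all
    with v have "h < length D" by simp
    from that(1)[OF _ this v(2)] show ?thesis using True x by simp
  next
    case False
    then obtain h' where h: "h = Suc h'" using assms(2) unfolding x stationary_def by (cases h) simp_all
    from that(2)[of h' p] show ?thesis using False x v h by simp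
  qed
qed

lemma step_valid:
  assumes x: "valid n D x" shows "valid n D (step D x)"
proof (cases "stationary x")
  case False
  with x show ?thesis
  proof (cases rule: validE)
    case (1 h p)
    then show ?thesis using slice_ok[of h] width_Suc[of h D n]
      by (cases "D ! h") (auto simp: valid_def cross_perm_def)
  next
    case (2 h p)
    then show ?thesis using slice_ok[of h] width_Suc[of h D n]
      by (cases "D ! h") (auto simp: valid_def cross_perm_def)
  qed
qed (simp add: step_stationary x)

text \<open>Every event of a diagram can be traversed backwards. This reversibility yields both the
  injectivity of paths and the fact that no path runs along a reversed path.\<close>

lemma step_flip_step:
  assumes x: "valid n D x" "\<not> stationary x" shows "step D (flip (step D x)) = flip x"
  using x
proof (cases rule: validE)
  case (1 h p)
  then show ?thesis by (cases "D ! h") (auto simp: flip_def)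
next
  case (2 h p)
  then show ?thesis by (cases "D ! h") (auto simp: flip_def)
qed

text \<open>An upward point is the result of climbing a slice or of turning at a local minimum, and
  in both cases its height is positive.\<close>

lemma step_not_start: "valid n D x \<Longrightarrow> step D x \<noteq> (0, q, True)"
proof (cases "stationary x")
  case False
  assume "valid n D x"
  from this False show ?thesis
    by (cases rule: validE) (auto split: slice.splits)
qed (auto simp: stationary_def)

lemma path_valid: "j < n \<Longrightarrow> valid n D (path D j t)"
proof (induction t)
  case 0
  then show ?case by (simp add: path_0 valid_def width_0)
qed (simp add: path_Suc step_valid)

lemma path_stationary: "stationary (path D j s) \<Longrightarrow> path D j (s + i) = path D j s"
  by (induction i) (auto simp: path_Suc step_stationary)

lemma stationary_path_eq:
  assumes "j < n" "stationary (path D j t)" shows "path D j t = (0, 2 * j, False)"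
proof (cases "t \<le> end_time D j")
  case True
  then show ?thesis using path_stationary[OF assms(2), of "end_time D j - t"] path_end_time[OF assms(1)] by simp
next
  case False
  have "stationary (path D j (end_time D j))" using path_end_time[OF assms(1)] by (simp add: stationary_def)
  from path_stationary[OF this, of "t - end_time D j"] False show ?thesis
    using path_end_time[OF assms(1)] by simp
qed

lemma not_stationary_iff:
  assumes j: "j < n" shows "\<not> stationary (path D j t) \<longleftrightarrow> t < end_time D j"
proof
  assume ns: "\<not> stationary (path D j t)"
  show "t < end_time D j"
  proof (rule ccontr)
    assume "\<not> t < end_time D j"
    then obtain i where t: "t = end_time D j + i" using le_Suc_ex not_less by blast
    have "stationary (path D j (end_time D j))" using path_end_time[OF j] by (simp add: stationary_def)
    with ns path_stationary[OF this, of i] show False unfolding t by simp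
  qed
next
  assume "t < end_time D j"
  then have "path D j t \<noteq> (0, 2 * j, False)" unfolding end_time_def by (rule not_less_Least)
  then show "\<not> stationary (path D j t)" using stationary_path_eq[OF j] by blast
qed

text \<open>A path meeting a reversed path would follow it back to its starting point, where no path ends.\<close>

lemma path_neq_flip: "j < n \<Longrightarrow> k < n \<Longrightarrow> path D j s \<noteq> flip (path D k t)"
proof (induction t arbitrary: s)
  case 0
  show ?case
  proof
    assume *: "path D j s = flip (path D k 0)"
    then have "stationary (path D j s)" by (simp add: path_0 flip_def stationary_def)
    \<comment> \<open>Paths end at even bottom positions, whereas the reversed starting point has
      the odd position \<open>2 * k + 1\<close>.\<close>
    from stationary_path_eq[OF 0(1) this] * show False by (simp add: path_0 flip_def) presburger
  qed
next
  case (Suc t)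
  show ?case
  proof
    assume *: "path D j s = flip (path D k (Suc t))"
    show False
    proof (cases "stationary (path D k t)")
      case True
      then show ?thesis using * Suc.IH[OF Suc.prems, of s] by (simp add: path_Suc step_stationary)
    next
      case False
      have "path D j (Suc s) = step D (flip (step D (path D k t)))" using * by (simp add: path_Suc)
      also have "\<dots> = flip (path D k t)" by (rule step_flip_step[OF path_valid[OF Suc.prems(2)] False])
      finally show ?thesis using Suc.IH[OF Suc.prems, of "Suc s"] by simp
    qed
  qed
qed

lemma path_Suc_neq_start: "k < n \<Longrightarrow> path D k (Suc t) \<noteq> path D j 0"
  unfolding path_0 path_Suc by (rule step_not_start[OF path_valid])

text \<open>By reversibility a step is injective on points that are not stationary. Equal points can
  thus be traced back simultaneously until one path is at its start, which no path enters
  later.\<close>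

lemma path_inj:
  "j < n \<Longrightarrow> k < n \<Longrightarrow> s < end_time D j \<Longrightarrow> t < end_time D k \<Longrightarrow> path D j s = path D k t \<Longrightarrow> j = k \<and> s = t"
proof (induction s arbitrary: t)
  case 0
  show ?case
  proof (cases t)
    case t: 0
    have "(0, 2 * j + 1, True) = (0::nat, 2 * k + 1, True)"
      using 0(5) unfolding t path_0 .
    then show ?thesis using t by simp
  next
    case (Suc t')
    then show ?thesis using path_Suc_neq_start[OF 0(2), of t' j] 0(5) by metis
  qed
next
  case (Suc s)
  show ?case
  proof (cases t)
    case 0
    then show ?thesis using path_Suc_neq_start[OF Suc.prems(1), of s k] Suc.prems(5) by metis
  next
    case t: (Suc t')
    have lt: "s < end_time D j" "t' < end_time D k" using Suc.prems(3,4) t by simp_all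
    have ns: "\<not> stationary (path D j s)" "\<not> stationary (path D k t')"
      using not_stationary_iff[OF Suc.prems(1)] not_stationary_iff[OF Suc.prems(2)] lt by blast+
    have eq: "step D (path D j s) = step D (path D k t')"
      using Suc.prems(5) unfolding t path_Suc .
    have "flip (path D j s) = step D (flip (step D (path D j s)))"
      by (rule step_flip_step[OF path_valid[OF Suc.prems(1)] ns(1), symmetric])
    also have "\<dots> = flip (path D k t')"
      unfolding eq by (rule step_flip_step[OF path_valid[OF Suc.prems(2)] ns(2)])
    finally have "path D j s = path D k t'" by (simp only: flip_eq_iff)
    then show ?thesis using Suc.IH[OF Suc.prems(1,2) lt] t by simp
  qed
qed

lemma visitE:
  assumes "(h, b) \<in> set (visit D x)" "valid n D x"
  obtains i where "h < length D" "D ! h = Cup i" "\<not> b" "x = (Suc h, i, False)"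
  | i where "h < length D" "D ! h = Cap i" "\<not> b" "x = (h, i, True)"
  | i c where "h < length D" "D ! h = Cross i c" "x = (h, if b = c then i else i + 1, True)"
  | i c where "h < length D" "D ! h = Cross i c" "x = (Suc h, if b = c then i + 1 else i, False)"
proof -
  have "\<not> stationary x" using assms(1) by (auto simp: stationary_def)
  with assms(2) show thesis
  proof (cases rule: validE)
    case (1 h' p)
    show ?thesis
    proof (cases "D ! h'")
      case (Cup i)
      then show ?thesis using assms(1) 1 by simp
    next
      case (Cap i)
      then have "p = i" "h = h'" "\<not> b" using assms(1) 1 by (simp_all split: if_splits)
      then show ?thesis using that(2)[of i] Cap 1 by simp
    next
      case (Cross i c)
      then have "h = h'" "p = (if b = c then i else i + 1)" using assms(1) 1 by (auto split: if_splits)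
      then show ?thesis using that(3)[of i c] Cross 1 by simp
    qed
  next
    case (2 h' p)
    show ?thesis
    proof (cases "D ! h'")
      case (Cup i)
      then have "p = i" "h = h'" "\<not> b" using assms(1) 2 by (simp_all split: if_splits)
      then show ?thesis using that(1)[of i] Cup 2 by simp
    next
      case (Cap i)
      then show ?thesis using assms(1) 2 by simp
    next
      case (Cross i c)
      then have "h = h'" "p = (if b = c then i + 1 else i)" using assms(1) 2 by (auto split: if_splits)
      then show ?thesis using that(4)[of i c] Cross 2 by simp
    qed
  qed
qed

text \<open>The slot of an extremum is met from only one possible point. A slot of a crossing could
  be met from below or from above, but the two passages are reverses of each other and
  \<open>path_neq_flip\<close> excludes that both occur.\<close>

lemma slot_path_unique:
  assumes jk: "j < n" "k < n" and st: "s < end_time D j" "t < end_time D k"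
    and \<sigma>: "(h, b) \<in> set (visit D (path D j s))" "(h, b) \<in> set (visit D (path D k t))"
  shows "j = k \<and> s = t"
proof -
  have opposite: False if asm: "j' < n" "k' < n" "D ! h = Cross i c" "path D j' s' = (h, if b = c then i else i + 1, True)"
    "path D k' t' = (Suc h, if b = c then i + 1 else i, False)" for j' k' s' t' i c
  proof -
    have "path D k' (Suc t') = flip (path D j' s')"
      using asm(3-5) by (simp add: path_Suc flip_def cross_perm_def)
    then show False using path_neq_flip[OF asm(2,1)] by blast
  qed
  have "path D j s = path D k t"
    using \<sigma>(1) path_valid[OF jk(1)]
  proof (cases rule: visitE)
    case (1 i)
    from \<sigma>(2) path_valid[OF jk(2)] show ?thesis by (cases rule: visitE) (use 1 in auto)
  next
    case (2 i)
    from \<sigma>(2) path_valid[OF jk(2)] show ?thesis by (cases rule: visitE) (use 2 in auto)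
  next
    case (3 i c)
    from \<sigma>(2) path_valid[OF jk(2)] show ?thesis
    proof (cases rule: visitE)
      case (4 i' c')
      have ic: "i' = i" "c' = c" using 3(2) 4(2) by simp_all
      show ?thesis using opposite[OF jk 3(2,3)] 4(3) unfolding ic by blast
    qed (use 3 in auto)
  next
    case (4 i c)
    from \<sigma>(2) path_valid[OF jk(2)] show ?thesis
    proof (cases rule: visitE)
      case (3 i' c')
      have ic: "i' = i" "c' = c" using 3(2) 4(2) by simp_all
      show ?thesis using opposite[OF jk(2,1) 3(2,3)] 4(3) unfolding ic by blast
    qed (use 4 in auto)
  qed
  then show ?thesis using path_inj jk st by blast
qed

lemma mem_slots_iff: "(h, b) \<in> set (slots n D) \<longleftrightarrow> h < length D \<and> (h, b) \<in> set (slots_at n D h)"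
proof -
  have "(h, b) \<in> set (slots n D) \<longleftrightarrow> (\<exists>h'<length D. (h, b) \<in> set (slots_at n D h'))"
    by (auto simp: slots_def)
  then show ?thesis using fst_slots_at[of "(h, b)" n D] by auto
qed

lemma mem_component_slots:
  "\<sigma> \<in> set (component_slots D j) \<longleftrightarrow> (\<exists>t<end_time D j. \<sigma> \<in> set (visit D (path D j t)))"
  by (auto simp: component_slots_eq)

lemma path_visited: "j < n \<Longrightarrow> path D j t \<in> visited n D"
  unfolding visited_def by blast

lemma visit_in_slots:
  assumes j: "j < n" and visit: "(h, b) \<in> set (visit D (path D j t))"
  shows "(h, b) \<in> set (slots n D)"
  using visit path_valid[OF j]
proof (cases rule: visitE)
  case (1 i)
  then have "(Suc h, i, False) \<in> visited n D" using path_visited[OF j, of t] by simp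
  then show ?thesis using 1(1-3) by (simp add: mem_slots_iff slots_at_def right_extremum_def)
next
  case (2 i)
  then have "(h, i, True) \<in> visited n D" using path_visited[OF j, of t] by simp
  then show ?thesis using 2(1-3) by (simp add: mem_slots_iff slots_at_def right_extremum_def)
next
  case (3 i c)
  then show ?thesis by (simp add: mem_slots_iff slots_at_def)
next
  case (4 i c)
  then show ?thesis by (simp add: mem_slots_iff slots_at_def)
qed

lemma visitedI:
  assumes "j < n" "path D j t = x" "\<not> stationary x" "\<sigma> \<in> set (visit D x)"
  shows "\<exists>j<n. \<sigma> \<in> set (component_slots D j)"
  using assms not_stationary_iff[OF assms(1), of t] unfolding mem_component_slots by blast

lemma slot_in_component:
  assumes "(h, b) \<in> set (slots n D)"
  shows "\<exists>j<n. (h, b) \<in> set (component_slots D j)"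
proof -
  have h: "h < length D" "(h, b) \<in> set (slots_at n D h)" using assms by (simp_all add: mem_slots_iff)
  show ?thesis
  proof (cases "D ! h")
    case (Cup i)
    then have b: "\<not> b" "(Suc h, i, False) \<in> visited n D"
      using h(2) by (simp_all add: slots_at_def right_extremum_def split: if_splits)
    then obtain j t where jt: "j < n" "path D j t = (Suc h, i, False)" unfolding visited_def by auto
    show ?thesis by (rule visitedI[OF jt]) (use b(1) Cup in \<open>simp_all add: stationary_def\<close>)
  next
    case (Cap i)
    then have b: "\<not> b" "(h, i, True) \<in> visited n D"
      using h(2) by (simp_all add: slots_at_def right_extremum_def split: if_splits)
    then obtain j t where jt: "j < n" "path D j t = (h, i, True)" unfolding visited_def by auto
    show ?thesis by (rule visitedI[OF jt]) (use b(1) Cap h(1) in \<open>simp_all add: stationary_def\<close>)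
  next
    case (Cross i c)
    let ?p = "if b = c then i else i + 1"
    have "?p < width n D h" using slice_ok[OF h(1)] Cross by simp
    then obtain u where "(h, ?p, u) \<in> visited n D" using visited_ex[of h ?p] h(1) by auto
    then obtain j t0 where j: "j < n" and t0: "path D j t0 = (h, ?p, u)" unfolding visited_def by auto
    show ?thesis
    proof (cases u)
      case True
      show ?thesis by (rule visitedI[OF j t0]) (use True Cross h(1) in \<open>simp_all add: stationary_def\<close>)
    next
      case False
      \<comment> \<open>On a strand traversed downwards the slot is met on the step that arrives at
        this point. Taking the first arrival ensures that the preceding point exists and that the
        path is not merely resting at its end.\<close>
      define t where "t = (LEAST t. path D j t = (h, ?p, u))"
      have t: "path D j t = (h, ?p, u)" unfolding t_def using t0 by (rule LeastI)
      have "t \<noteq> 0"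
      proof
        assume "t = 0"
        then show False using t False by (simp add: path_0)
      qed
      then obtain t' where t': "t = Suc t'" by (cases t) simp_all
      have "path D j t' \<noteq> (h, ?p, u)"
        by (rule not_less_Least[of t' "\<lambda>t. path D j t = (h, ?p, u)", folded t_def]) (simp add: t')
      then have "step D (path D j t') \<noteq> path D j t'" using t unfolding t' path_Suc by metis
      then have ns: "\<not> stationary (path D j t')" using step_stationary by blast
      have "flip (path D j t') = step D (flip (step D (path D j t')))"
        by (rule step_flip_step[OF path_valid[OF j] ns, symmetric])
      also have "step D (path D j t') = (h, ?p, u)" using t unfolding t' path_Suc .
      also have "step D (flip (h, ?p, u)) = (Suc h, cross_perm i ?p, True)"
        using False Cross h(1) by (simp add: flip_def)
      finally have "path D j t' = flip (Suc h, cross_perm i ?p, True)" by (metis flip_flip)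
      then have eq: "path D j t' = (Suc h, if b = c then i + 1 else i, False)"
        by (simp add: flip_def cross_perm_def)
      show ?thesis by (rule visitedI[OF j eq]) (use Cross in \<open>simp_all add: stationary_def\<close>)
    qed
  qed
qed

lemma distinct_component_slots: "j < n \<Longrightarrow> distinct (component_slots D j)"
  unfolding component_slots_eq
proof (rule distinct_concat_upt[OF distinct_visit])
  fix s t assume *: "j < n" "s < t" "t < end_time D j"
  have "s < end_time D j" using * by simp
  then have "(h, b) \<notin> set (visit D (path D j t))" if "(h, b) \<in> set (visit D (path D j s))" for h b
    using slot_path_unique[OF *(1,1) _ *(3) that] *(2) by blast
  then show "set (visit D (path D j s)) \<inter> set (visit D (path D j t)) = {}" by fast
qed

lemma component_slots_disjoint:
  assumes "j < n" "k < n" "(h, b) \<in> set (component_slots D j)" "(h, b) \<in> set (component_slots D k)"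
  shows "j = k"
  using assms(3,4) slot_path_unique[OF assms(1,2)] unfolding mem_component_slots by blast

lemma component_slots_subset:
  assumes "j < n" shows "set (component_slots D j) \<subseteq> set (slots n D)"
proof
  fix \<sigma> assume "\<sigma> \<in> set (component_slots D j)"
  then show "\<sigma> \<in> set (slots n D)"
    unfolding mem_component_slots using visit_in_slots[OF assms] by (cases \<sigma>) blast
qed

text \<open>The component containing the \<open>i\<close>-th slot, split at this slot; the label met later stands further
  to the left.\<close>

lemma slot_split:
  assumes i: "i < length (slots n D)"
  obtains j L1 L2 where "j < n" "rev (component_slots D j) = L1 @ slots n D ! i # L2"
    "slots n D ! i \<notin> set L1" "slots n D ! i \<notin> set L2"
    "\<And>k. k < n \<Longrightarrow> k \<noteq> j \<Longrightarrow> slots n D ! i \<notin> set (component_slots D k)"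
proof -
  obtain h b where \<sigma>: "slots n D ! i = (h, b)" by (cases "slots n D ! i")
  have "(h, b) \<in> set (slots n D)" using i \<sigma> nth_mem by metis
  then obtain j where j: "j < n" "(h, b) \<in> set (component_slots D j)" using slot_in_component by blast
  then have "(h, b) \<in> set (rev (component_slots D j))" by simp
  then obtain L1 L2 where L: "rev (component_slots D j) = L1 @ (h, b) # L2" by (metis split_list)
  have "distinct (L1 @ (h, b) # L2)" using distinct_component_slots[OF j(1)] L by (metis distinct_rev)
  then have "(h, b) \<notin> set L1" "(h, b) \<notin> set L2" by simp_all
  then show ?thesis using that[OF j(1)] L j component_slots_disjoint unfolding \<sigma> by blast
qed

end

section \<open>Products along the components\<close>

definition slot_val :: "nat \<Rightarrow> slice list \<Rightarrow> 'a list \<Rightarrow> slot \<Rightarrow> 'a" where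
  "slot_val n D xs \<sigma> = the (map_of (zip (slots n D) xs) \<sigma>)"

lemma component_products_eq: "component_products mul one n D xs =
    map (\<lambda>j. foldr mul (map (slot_val n D xs) (rev (component_slots D j))) one) [0..<n]"
  by (simp add: component_products_def slot_val_def[abs_def])

text \<open>Distinctness of the slots makes \<open>map_of\<close> return the entry at the intended
  position.\<close>

lemma slot_val_nth: "length xs = length (slots n D) \<Longrightarrow> i < length xs \<Longrightarrow> slot_val n D xs (slots n D ! i) = xs ! i"
  using map_of_zip_nth[of "slots n D" xs i] distinct_slots[of n D] by (simp add: slot_val_def)

lemma slot_val_map:
  assumes "length xs = length (slots n D)" "\<sigma> \<in> set (slots n D)"
  shows "slot_val n D (map f xs) \<sigma> = f (slot_val n D xs \<sigma>)"
proof -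
  obtain i where "i < length (slots n D)" "\<sigma> = slots n D ! i" using assms(2) by (auto simp: in_set_conv_nth)
  then show ?thesis using assms(1) slot_val_nth[of xs n D i] slot_val_nth[of "map f xs" n D i] by simp
qed

lemma slot_val_in_set:
  assumes "length xs = length (slots n D)" "\<sigma> \<in> set (slots n D)"
  shows "slot_val n D xs \<sigma> \<in> set xs"
proof -
  obtain i where "i < length (slots n D)" "\<sigma> = slots n D ! i" using assms(2) by (auto simp: in_set_conv_nth)
  then show ?thesis using assms(1) slot_val_nth[of xs n D i] by simp
qed

context quotient_algebra
begin

lemma foldr_mul_C: "set xs \<subseteq> C \<Longrightarrow> foldr mul xs one \<in> C"
  by (induction xs) (simp_all add: one_C mul_C)

lemma foldr_mul_append: "foldr mul (xs @ ys) one = mul (foldr mul xs one) (foldr mul ys one)"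
  by (induction xs) (simp_all add: one_left mul_assoc)

lemma component_products_C:
  assumes D: "tangle n D" and xs: "length xs = length (slots n D)" "set xs \<subseteq> C"
  shows "set (component_products mul one n D xs) \<subseteq> C"
proof
  fix p assume "p \<in> set (component_products mul one n D xs)"
  then obtain j where j: "j < n" "p = foldr mul (map (slot_val n D xs) (rev (component_slots D j))) one"
    by (auto simp: component_products_eq)
  have "slot_val n D xs \<sigma> \<in> C" if "\<sigma> \<in> set (component_slots D j)" for \<sigma>
    using slot_val_in_set[OF xs(1)] tangle.component_slots_subset[OF D j(1)] that xs(2) by blast
  then have "set (map (slot_val n D xs) (rev (component_slots D j))) \<subseteq> C" by auto
  then show "p \<in> C" unfolding j(2) by (rule foldr_mul_C)
qed

text \<open>Each slot is met exactly once, so its label is one factor of exactly one component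
  product. As a function of that label this product has the form \<open>mul P (mul y Q)\<close>, and
  the other products are constant.\<close>

lemma slotwise_linear_component_products:
  assumes D: "tangle n D"
  shows "slotwise_linear (length (slots n D)) n (component_products mul one n D)"
  unfolding slotwise_linear_def
proof (intro allI impI)
  fix xs ys assume h: "set xs \<subseteq> C" "set ys \<subseteq> C" "length xs + length ys + 1 = length (slots n D)"
  let ?i = "length xs" and ?v = "\<lambda>y. slot_val n D (xs @ y # ys)"
  let ?\<sigma> = "slots n D ! ?i"
  have i: "?i < length (slots n D)" using h(3) by simp
  have len: "length (xs @ y # ys) = length (slots n D)" for y using h(3) by simp
  obtain j L1 L2 where j: "j < n" "rev (component_slots D j) = L1 @ ?\<sigma> # L2"
    and nin: "?\<sigma> \<notin> set L1" "?\<sigma> \<notin> set L2" "\<And>k. k < n \<Longrightarrow> k \<noteq> j \<Longrightarrow> ?\<sigma> \<notin> set (component_slots D k)"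
    by (rule tangle.slot_split[OF D i]) blast
  have v\<sigma>: "?v y ?\<sigma> = y" for y using slot_val_nth[OF len, of ?i y] by simp
  \<comment> \<open>\<open>one\<close> is only a placeholder for the varying entry; the values at
    all other slots ignore it.\<close>
  have v: "?v y \<sigma> = ?v one \<sigma>" if \<sigma>: "\<sigma> \<in> set (slots n D)" "\<sigma> \<noteq> ?\<sigma>" for y \<sigma>
  proof -
    obtain k where k: "k < length (slots n D)" "\<sigma> = slots n D ! k" using \<sigma>(1) by (auto simp: in_set_conv_nth)
    then have "k \<noteq> ?i" using \<sigma>(2) by auto
    then have "(xs @ y # ys) ! k = (xs @ one # ys) ! k" by (simp add: nth_append nth_Cons')
    then show ?thesis using slot_val_nth[OF len, of k y] slot_val_nth[OF len, of k one] k len by simp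
  qed
  have vC: "?v one \<sigma> \<in> C" if "\<sigma> \<in> set (slots n D)" for \<sigma>
    using slot_val_in_set[OF len that, of one] h one_C by auto
  let ?g = "\<lambda>y k. foldr mul (map (?v y) (rev (component_slots D k))) one"
  have sub: "set (component_slots D k) \<subseteq> set (slots n D)" if "k < n" for k
    by (rule tangle.component_slots_subset[OF D that])
  have g: "?g y k = ?g one k" if "k < n" "k \<noteq> j" for y k
  proof -
    have "map (?v y) (rev (component_slots D k)) = map (?v one) (rev (component_slots D k))"
      using sub[OF that(1)] nin(3)[OF that] by (intro map_cong refl v) auto
    then show ?thesis by (simp only:)
  qed
  have subL: "set L1 \<union> set L2 \<subseteq> set (slots n D)"
  proof -
    have "set L1 \<union> set L2 \<subseteq> set (rev (component_slots D j))" unfolding j(2) by auto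
    then show ?thesis using sub[OF j(1)] by auto
  qed
  define P where "P = foldr mul (map (?v one) L1) one"
  define Q where "Q = foldr mul (map (?v one) L2) one"
  have gj: "?g y j = mul P (mul y Q)" for y
  proof -
    have "map (?v y) L1 = map (?v one) L1" "map (?v y) L2 = map (?v one) L2"
      using subL nin by (auto intro!: map_cong v)
    then show ?thesis
      unfolding j(2) P_def Q_def map_append foldr_mul_append list.map foldr.simps o_apply v\<sigma> by (simp only:)
  qed
  have PQ: "P \<in> C" "Q \<in> C"
    unfolding P_def Q_def by (intro foldr_mul_C, use subL vC in auto)+
  have split: "[0..<n] = [0..<j] @ j # [Suc j..<n]"
  proof -
    have "[0..<n] = [0..<j] @ [j..<n]" using upt_add_eq_append[of 0 j "n - j"] j(1) by simp
    then show ?thesis using upt_conv_Cons[OF j(1)] by simp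
  qed
  have gC: "?g one k \<in> C" if "k < n" for k
    using sub[OF that] vC by (intro foldr_mul_C) auto
  have C: "set (map (?g one) ks) \<subseteq> C" if "set ks \<subseteq> {..<n}" for ks
    using that gC by auto
  have "component_products mul one n D (xs @ y # ys)
      = map (?g one) [0..<j] @ mul P (mul y Q) # map (?g one) [Suc j..<n]" for y
  proof -
    have "map (?g y) [0..<j] = map (?g one) [0..<j]" "map (?g y) [Suc j..<n] = map (?g one) [Suc j..<n]"
      using j(1) by (intro map_cong refl g; simp)+
    then show ?thesis unfolding component_products_eq split map_append list.map gj by (simp only:)
  qed
  moreover have "set (map (?g one) [0..<j]) \<subseteq> C"
    by (rule C) (use j(1) in auto)
  moreover have "set (map (?g one) [Suc j..<n]) \<subseteq> C"
    by (rule C) auto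
  moreover have "length (map (?g one) [0..<j]) + length (map (?g one) [Suc j..<n]) + 1 = n"
    using j(1) by simp
  moreover have "linear_mod (\<lambda>y. mul P (mul y Q))" by (rule linear_mod_mul[OF PQ])
  ultimately show "\<exists>xs' ys' \<phi>. set xs' \<subseteq> C \<and> set ys' \<subseteq> C \<and> length xs' + length ys' + 1 = n \<and> linear_mod \<phi>
      \<and> (\<forall>y\<in>C. component_products mul one n D (xs @ y # ys) = xs' @ \<phi> y # ys')"
    by blast
qed

end

lemma length_component_products [simp]: "length (component_products mul one n D xs) = n"
  by (simp add: component_products_eq)

section \<open>Weights along a component and absorption of the indicators\<close>

context root_datum
begin

text \<open>Formed from the labels without indicators. Indicators have weight 0, so the same finite
  set bounds the weights of the product whichever indicators are inserted.\<close>

fun weight_sums :: "('s \<Rightarrow> 'n falg) \<Rightarrow> 's list \<Rightarrow> 'n weight set" where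
  "weight_sums f [] = {0}"
| "weight_sums f (\<sigma> # ls) = {\<gamma> + \<delta> | \<gamma> \<delta>. \<gamma> \<in> weights (f \<sigma>) \<and> \<delta> \<in> weight_sums f ls}"

lemma finite_weight_sums: "finite (weight_sums f ls)"
proof (induction ls)
  case (Cons \<sigma> ls)
  have "weight_sums f (\<sigma> # ls) = (\<lambda>(\<gamma>, \<delta>). \<gamma> + \<delta>) ` (weights (f \<sigma>) \<times> weight_sums f ls)" by auto
  then show ?case using Cons finite_weights by simp
qed simp

lemma weights_foldr:
  "(\<And>\<sigma>. \<sigma> \<in> set ls \<Longrightarrow> weights (g \<sigma>) \<subseteq> weights (f \<sigma>)) \<Longrightarrow> weights (foldr (*) (map g ls) 1) \<subseteq> weight_sums f ls"
proof (induction ls)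
  case (Cons \<sigma> ls)
  have "weights (g \<sigma> * foldr (*) (map g ls) 1) \<subseteq> {\<gamma> + \<delta> | \<gamma> \<delta>. \<gamma> \<in> weights (g \<sigma>) \<and> \<delta> \<in> weights (foldr (*) (map g ls) 1)}"
    by (rule weights_mult)
  also have "\<dots> \<subseteq> weight_sums f (\<sigma> # ls)"
    using Cons.prems[of \<sigma>] Cons.IH Cons.prems by fastforce
  finally show ?case by simp
qed (simp add: weights_1)

lemma weights_mult_ind: "weights (p * ind v) \<subseteq> weights p"
  using weights_mult[of p "ind v"] by (auto simp: weights_ind)

text \<open>The sums of indicators are removed from the right. Each stands in front of the product
  of a suffix of the list, whose weights shift \<open>v\<close> into \<open>A\<close>; this is why
  the hypothesis speaks of all suffixes.\<close>

lemma foldr_ind_absorb: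
  assumes A: "finite A" and "\<And>k \<gamma>. k \<le> length ls \<Longrightarrow> \<gamma> \<in> weight_sums f (drop k ls) \<Longrightarrow> v + \<gamma> \<in> A"
  shows "eqmod qideal (foldr (*) (map (\<lambda>\<sigma>. f \<sigma> * (\<Sum>u\<in>A. ind u)) ls) 1 * ind v) (foldr (*) (map f ls) 1 * ind v)"
  using assms(2)
proof (induction ls)
  case Nil
  then show ?case by (simp add: qideal_refl)
next
  case (Cons \<sigma> ls)
  have IH: "eqmod qideal (foldr (*) (map (\<lambda>\<sigma>. f \<sigma> * (\<Sum>u\<in>A. ind u)) ls) 1 * ind v) (foldr (*) (map f ls) 1 * ind v)"
    by (rule Cons.IH) (rule Cons.prems[of "Suc _"], simp_all)
  have "\<gamma> \<in> weight_sums f ls" if "\<gamma> \<in> weights (foldr (*) (map f ls) 1)" for \<gamma>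
    using weights_foldr[of ls f f] that by blast
  then have absorb: "eqmod qideal ((\<Sum>u\<in>A. ind u) * foldr (*) (map f ls) 1 * ind v) (foldr (*) (map f ls) 1 * ind v)"
    using Cons.prems[of 1] by (intro sum_ind_mult_ind[OF A]) simp
  have "eqmod qideal (f \<sigma> * ((\<Sum>u\<in>A. ind u) * (foldr (*) (map (\<lambda>\<sigma>. f \<sigma> * (\<Sum>u\<in>A. ind u)) ls) 1 * ind v)))
      (f \<sigma> * ((\<Sum>u\<in>A. ind u) * (foldr (*) (map f ls) 1 * ind v)))"
    by (intro qideal_mult_left IH)
  also have "eqmod qideal \<dots> (f \<sigma> * (foldr (*) (map f ls) 1 * ind v))"
    using qideal_mult_left[OF absorb, of "f \<sigma>"] by (simp only: mult.assoc)
  finally show ?case by (simp only: list.map foldr.simps o_apply mult.assoc)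
qed

text \<open>The weights at which the indicators in a component can sit in a nonzero product.\<close>

definition reachable :: "nat \<Rightarrow> slice list \<Rightarrow> 'n weight list \<Rightarrow> 'n falg list \<Rightarrow> 'n weight set" where
  "reachable n D \<nu> x = (\<Union>j<n. \<Union>k\<le>length (component_slots D j).
     (\<lambda>\<gamma>. \<nu> ! j + \<gamma>) ` weight_sums (slot_val n D x) (drop k (rev (component_slots D j))))"

lemma finite_reachable: "finite (reachable n D \<nu> x)"
  unfolding reachable_def by (intro finite_UN_I finite_imageI finite_weight_sums) auto

lemma slot_val_at_weights:
  assumes "length x = length (slots n D)" "length \<mu> = length (slots n D)" "\<sigma> \<in> set (slots n D)"
  shows "slot_val n D (at_weights x \<mu>) \<sigma> = slot_val n D x \<sigma> * ind (slot_val n D \<mu> \<sigma>)"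
proof -
  obtain i where i: "i < length (slots n D)" "\<sigma> = slots n D ! i" using assms(3) by (auto simp: in_set_conv_nth)
  show ?thesis
    unfolding i(2) using assms(1,2) i(1)
    by (simp add: slot_val_nth nth_at_weights)
qed

abbreviation full_product :: "nat \<Rightarrow> slice list \<Rightarrow> 'n weight list \<Rightarrow> 'n falg list \<Rightarrow> 'n falg list" where
  "full_product n D \<nu> xs \<equiv> at_weights (component_products (*) 1 n D xs) \<nu>"

lemma nth_full_product:
  "j < n \<Longrightarrow> length \<nu> = n \<Longrightarrow> full_product n D \<nu> xs ! j
    = foldr (*) (map (slot_val n D xs) (rev (component_slots D j))) 1 * ind (\<nu> ! j)"
  by (simp add: nth_at_weights component_products_eq)

lemma set_full_product:
  assumes "tangle n D" "length xs = length (slots n D)" "set xs \<subseteq> Ufull"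
  shows "set (full_product n D \<nu> xs) \<subseteq> Ufull"
  by (rule set_at_weights[OF full.component_products_C[OF assms]])

lemma slotwise_linear_at_weights: "length \<nu> = n \<Longrightarrow> full.slotwise_linear n n (\<lambda>xs. at_weights xs \<nu>)"
  unfolding at_weights_def by (intro full.slotwise_linear_map2 full.linear_mod_mul_right ind_in_Ufull)

lemma lmap_full_product_cong:
  assumes D: "tangle n D" and \<nu>: "length \<nu> = n" and eq: "eqmod (full.nl (length (slots n D))) t u"
  shows "eqmod (full.nl n) (lmap (full_product n D \<nu>) t) (lmap (full_product n D \<nu>) u)"
  using full.lmap_cong_nl[OF slotwise_linear_at_weights[OF \<nu>]
      full.lmap_cong_nl[OF full.slotwise_linear_component_products[OF D] eq]]
  by (simp only: lmap_lmap)

lemma lmap_full_product_tensor_null: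
  assumes D: "tangle n D" and \<nu>: "length \<nu> = n" and eq: "eqmod (tensor_null k (length (slots n D))) t u"
  shows "eqmod (tensor_null k n) (lmap (full_product n D \<nu>) t) (lmap (full_product n D \<nu>) u)"
proof -
  have "eqmod (tensor_null k n) (lmap (component_products (*) 1 n D) t) (lmap (component_products (*) 1 n D) u)"
    using full.component_products_C[OF D]
    by (intro tensor_null_lmap[OF full.slotwise_linear_component_products[OF D] _ eq]) simp
  then have "eqmod (tensor_null k n) (lmap (\<lambda>xs. at_weights xs \<nu>) (lmap (component_products (*) 1 n D) t))
      (lmap (\<lambda>xs. at_weights xs \<nu>) (lmap (component_products (*) 1 n D) u))"
    using \<nu> set_at_weights by (intro tensor_null_lmap[OF slotwise_linear_at_weights[OF \<nu>]]) simp_all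
  then show ?thesis by (simp only: lmap_lmap)
qed

text \<open>In the component through slot \<open>i\<close> the indicator
  \<open>ind (\<mu> ! i)\<close> stands immediately to the left of the labels met earlier. These
  shift \<open>\<nu> ! j\<close> to reachable weights only, so the indicator annihilates
  them.\<close>

lemma full_product_null:
  assumes D: "tangle n D" and x: "length x = length (slots n D)" "set x \<subseteq> Ufull" and \<nu>: "length \<nu> = n"
    and \<mu>: "length \<mu> = length (slots n D)" "i < length (slots n D)" "\<mu> ! i \<notin> reachable n D \<nu> x"
  shows "Poly_Mapping.single (full_product n D \<nu> (at_weights x \<mu>)) (emb c) \<in> full.nl n"
proof -
  let ?v = "slot_val n D (at_weights x \<mu>)" and ?\<sigma> = "slots n D ! i"
  obtain j L1 L2 where j: "j < n" "rev (component_slots D j) = L1 @ ?\<sigma> # L2"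
    by (rule tangle.slot_split[OF D \<mu>(2)]) blast
  have "set (rev (component_slots D j)) \<subseteq> set (slots n D)"
    using tangle.component_slots_subset[OF D j(1)] by simp
  then have L2: "set L2 \<subseteq> set (slots n D)" unfolding j(2) by auto
  have wts: "weights (foldr (*) (map ?v L2) 1) \<subseteq> weight_sums (slot_val n D x) L2"
  proof (rule weights_foldr)
    fix \<sigma> assume "\<sigma> \<in> set L2"
    then have "\<sigma> \<in> set (slots n D)" using L2 by blast
    then show "weights (?v \<sigma>) \<subseteq> weights (slot_val n D x \<sigma>)"
      by (simp only: slot_val_at_weights[OF x(1) \<mu>(1)] weights_mult_ind)
  qed
  have drop: "L2 = drop (Suc (length L1)) (rev (component_slots D j))" unfolding j(2) by simp
  have "Suc (length L1) \<le> length (component_slots D j)"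
    using arg_cong[OF j(2), of length] by simp
  then have "(\<lambda>\<gamma>. \<nu> ! j + \<gamma>) ` weight_sums (slot_val n D x) L2 \<subseteq> reachable n D \<nu> x"
    using j(1) unfolding reachable_def drop by blast
  then have "\<mu> ! i \<noteq> \<nu> ! j + \<gamma>" if "\<gamma> \<in> weights (foldr (*) (map ?v L2) 1)" for \<gamma>
    using that wts \<mu>(3) by blast
  then have null: "ind (\<mu> ! i) * foldr (*) (map ?v L2) 1 * ind (\<nu> ! j) \<in> qideal"
    by (rule ind_mult_ind_null)
  have v\<sigma>: "?v ?\<sigma> = x ! i * ind (\<mu> ! i)"
    using x \<mu> by (simp add: slot_val_nth nth_at_weights)
  have "full_product n D \<nu> (at_weights x \<mu>) ! j
      = foldr (*) (map ?v L1) 1 * (x ! i * (ind (\<mu> ! i) * foldr (*) (map ?v L2) 1 * ind (\<nu> ! j)))"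
    unfolding nth_full_product[OF j(1) \<nu>] j(2) map_append full.foldr_mul_append by (simp add: v\<sigma> mult.assoc)
  also have "\<dots> \<in> qideal" by (intro qideal.left null)
  finally have "full_product n D \<nu> (at_weights x \<mu>) ! j \<in> qideal" .
  then show ?thesis
    using j(1) \<nu> x \<mu> set_at_weights[OF x(2)]
    by (intro full.nl_nth_null[OF set_full_product[OF D], of _ j]) simp_all
qed

text \<open>By multilinearity the sum over the box places the sum of all indicators in
  \<open>A\<close> behind every label. Along each component these sums are absorbed, because
  \<open>A\<close> contains all reachable weights.\<close>

lemma full_product_sum:
  assumes D: "tangle n D" and x: "length x = length (slots n D)" "set x \<subseteq> Ufull" and \<nu>: "length \<nu> = n"
    and A: "finite A" "reachable n D \<nu> x \<subseteq> A"
  shows "eqmod (full.nl n) (\<Sum>\<mu>\<in>box (length (slots n D)) (\<lambda>_. A). Poly_Mapping.single (full_product n D \<nu> (at_weights x \<mu>)) 1)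
    (Poly_Mapping.single (full_product n D \<nu> x) 1)"
proof -
  let ?M = "length (slots n D)" and ?G = "full_product n D \<nu>"
  let ?X = "map (\<lambda>i. \<Sum>v\<in>A. x ! i * ind v) [0..<?M]"
  have xi: "x ! i \<in> Ufull" if "i < ?M" for i using x that nth_mem[of i x] by auto
  have X: "set ?X \<subseteq> Ufull" by (auto intro!: full.C_sum full.mul_C xi ind_in_Ufull)
  have "(\<Sum>\<mu>\<in>box ?M (\<lambda>_. A). Poly_Mapping.single (at_weights x \<mu>) (1 :: lfrac))
      = (\<Sum>\<mu>\<in>box ?M (\<lambda>_. A). Poly_Mapping.single (map (\<lambda>i. x ! i * ind (\<mu> ! i)) [0..<?M]) 1)"
  proof (rule sum.cong[OF refl])
    fix \<mu> assume "\<mu> \<in> box ?M (\<lambda>_. A)"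
    then have "at_weights x \<mu> = map (\<lambda>i. x ! i * ind (\<mu> ! i)) [0..<?M]"
      using x by (intro nth_equalityI) (simp_all add: box_def nth_at_weights)
    then show "Poly_Mapping.single (at_weights x \<mu>) (1 :: lfrac)
        = Poly_Mapping.single (map (\<lambda>i. x ! i * ind (\<mu> ! i)) [0..<?M]) 1" by (simp only:)
  qed
  moreover have "eqmod (full.nl ?M) (\<Sum>\<mu>\<in>box ?M (\<lambda>_. A). Poly_Mapping.single (map (\<lambda>i. x ! i * ind (\<mu> ! i)) [0..<?M]) 1)
      (Poly_Mapping.single ?X 1)"
    by (intro full.nl_box_sum full.mul_C xi ind_in_Ufull full.B1)
  ultimately have "eqmod (full.nl ?M) (\<Sum>\<mu>\<in>box ?M (\<lambda>_. A). Poly_Mapping.single (at_weights x \<mu>) 1) (Poly_Mapping.single ?X 1)"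
    by (simp only:)
  from lmap_full_product_cong[OF D \<nu> this]
  have 1: "eqmod (full.nl n) (\<Sum>\<mu>\<in>box ?M (\<lambda>_. A). Poly_Mapping.single (?G (at_weights x \<mu>)) 1) (Poly_Mapping.single (?G ?X) 1)"
    by (simp only: lmap_sum lmap_single)
  have 2: "eqmod (full.nl n) (Poly_Mapping.single (?G ?X) 1) (Poly_Mapping.single (?G x) 1)"
  proof (rule full.nl_map_cong[OF _ set_full_product[OF D _ X] set_full_product[OF D x] _ _ full.B1])
    fix j assume "j < length (?G ?X)"
    then have j: "j < n" using \<nu> by simp
    let ?L = "rev (component_slots D j)"
    have val: "slot_val n D ?X \<sigma> = slot_val n D x \<sigma> * (\<Sum>v\<in>A. ind v)" if "\<sigma> \<in> set (slots n D)" for \<sigma>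
    proof -
      have "?X = map (\<lambda>y. y * (\<Sum>v\<in>A. ind v)) x"
        using x by (intro nth_equalityI) (simp_all add: sum_distrib_left)
      then show ?thesis using slot_val_map[OF x(1) that] by (simp only:)
    qed
    have "map (slot_val n D ?X) ?L = map (\<lambda>\<sigma>. slot_val n D x \<sigma> * (\<Sum>v\<in>A. ind v)) ?L"
      using tangle.component_slots_subset[OF D j] by (intro map_cong refl val) auto
    moreover have "eqmod qideal (foldr (*) (map (\<lambda>\<sigma>. slot_val n D x \<sigma> * (\<Sum>v\<in>A. ind v)) ?L) 1 * ind (\<nu> ! j))
        (foldr (*) (map (slot_val n D x) ?L) 1 * ind (\<nu> ! j))"
    proof (rule foldr_ind_absorb[OF A(1)])
      fix k \<gamma> assume "k \<le> length ?L" "\<gamma> \<in> weight_sums (slot_val n D x) (drop k ?L)"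
      then have "\<nu> ! j + \<gamma> \<in> reachable n D \<nu> x" using j unfolding reachable_def by auto
      then show "\<nu> ! j + \<gamma> \<in> A" using A(2) by blast
    qed
    ultimately show "eqmod qideal (?G ?X ! j) (?G x ! j)"
      by (simp only: nth_full_product[OF j \<nu>])
  qed (use \<nu> in simp_all)
  show ?thesis by (rule full.nl_trans[OF 1 2])
qed

end

section \<open>Labels of slices\<close>

lemma one_eq_single: "(1 :: 'a list \<Rightarrow>\<^sub>0 'b::zero_neq_one) = Poly_Mapping.single [] 1"
  by (metis single_one zero_list_def)

context root_of_unity_datum
begin

definition full_label :: "'n ctensor \<Rightarrow> nat \<Rightarrow> slice list \<Rightarrow> nat \<Rightarrow> 'n weight list \<Rightarrow> 'n tensor" where
  "full_label R' n D h \<nu> = slice_label n D (antipode \<circ> antipode) (R_full l \<nu>) (R' l \<nu>)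
       (Poly_Mapping.single [Kg two_rho * ind (\<nu> ! 0)] 1) (Poly_Mapping.single [Kg (- two_rho) * ind (\<nu> ! 0)] 1) h"

definition small_label :: "('n us list \<Rightarrow>\<^sub>0 complex) \<Rightarrow> nat \<Rightarrow> slice list \<Rightarrow> nat \<Rightarrow> ('n us list \<Rightarrow>\<^sub>0 complex)" where
  "small_label Rs n D h = slice_label n D us_S2 R_small Rs
       (Poly_Mapping.single [Phi (Kg two_rho)] 1) (Poly_Mapping.single [Phi (Kg (- two_rho))] 1) h"

text \<open>\<open>X\<close> is a label over the completed algebra, \<open>Y\<close> the one over the small quantum group.\<close>

definition compatible :: "nat \<Rightarrow> ('n weight list \<Rightarrow> 'n tensor) \<Rightarrow> ('n us list \<Rightarrow>\<^sub>0 complex) \<Rightarrow> bool" where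
  "compatible m X Y \<longleftrightarrow> (\<forall>\<nu>. length \<nu> = m \<longrightarrow> X \<nu> \<in> full.tn m) \<and> uniform l m X \<and> Y \<in> sm.tn m
     \<and> (\<forall>\<nu>. length \<nu> = m \<longrightarrow> eqmod (us.nl m) (Phi_tensor (X \<nu>)) (component_at \<nu> Y))"

lemma component_at_eq_lmap: "component_at \<nu> = lmap (\<lambda>ps. map2 (\<lambda>p v. us_mult p (Phi (ind v))) ps \<nu>)"
  by (simp add: component_at_def lmap_def)

lemma map_Phi_at_weights: "map Phi (at_weights x \<nu>) = map2 (\<lambda>p v. us_mult p (Phi (ind v))) (map Phi x) \<nu>"
  by (rule nth_equalityI) (simp_all add: nth_at_weights Phi_mult)

lemma component_at_Phi:
  "component_at \<nu> (Poly_Mapping.single (map Phi x) c) = Poly_Mapping.single (map Phi (at_weights x \<nu>)) c"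
  by (simp only: component_at_eq_lmap lmap_single map_Phi_at_weights)

lemma compatible_single:
  assumes x: "length x = m" "set x \<subseteq> Uweight"
  shows "compatible m (\<lambda>\<nu>. Poly_Mapping.single (at_weights x \<nu>) 1) (Poly_Mapping.single (map Phi x) 1)"
proof -
  have xU: "set x \<subseteq> Ufull" using x(2) Uweight_subset_Ufull by blast
  have "Poly_Mapping.single (at_weights x \<nu>) 1 \<in> full.tn m" if "length \<nu> = m" for \<nu>
    using that x(1) set_at_weights[OF xU] by (intro full.tn_single full.B1) simp_all
  moreover have "uniform l m (\<lambda>\<nu>. Poly_Mapping.single (at_weights x \<nu>) 1)"
    using uniform_single[OF x(1) xU, of l "\<lambda>_. 1"] by simp
  moreover have "Poly_Mapping.single (map Phi x) 1 \<in> sm.tn m"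
    using x by (intro sm.tn_single Qz_1) (auto intro: Phi_in_small)
  moreover have "Phi_tensor (Poly_Mapping.single (at_weights x \<nu>) 1) = component_at \<nu> (Poly_Mapping.single (map Phi x) 1)" for \<nu>
    using Phi_tensor_single[of "at_weights x \<nu>" 1] by (simp add: component_at_Phi)
  ultimately show ?thesis unfolding compatible_def using us.nl_refl by simp
qed

lemma compatible_cong:
  assumes "compatible m X Y" "\<And>\<nu>. length \<nu> = m \<Longrightarrow> X' \<nu> = X \<nu>" shows "compatible m X' Y"
proof -
  have "uniform l m X'"
    using assms by (intro uniform_cong[of l m X X']) (simp_all add: compatible_def tensor_null_refl)
  then show ?thesis using assms unfolding compatible_def by simp
qed

text \<open>Indicators are fixed by the square of the antipode, so it commutes with passing to
  components.\<close>

lemma us_S2_mult_Phi_ind: "us_S2 (us_mult p (Phi (ind v))) = us_mult (us_S2 p) (Phi (ind v))"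
proof (induction p rule: pm_induct)
  case (single x b)
  have "antipode (antipode (x k * ind v)) = antipode (antipode (x k)) * ind v" for k
    by (rule antipode_antipode_ind)
  moreover have "(\<lambda>k. antipode (antipode (x k))) * (\<lambda>_. ind v) = (\<lambda>k. antipode (antipode (x k)) * ind v)"
    by (intro ext) (simp add: fun_apply)
  ultimately show ?case by (simp add: Phi_def Phi_hat_def us_S2_def fun_apply)
qed (simp_all add: us_mult_add_left us_S2_add us_S2_0)

lemma compatible_antipode:
  assumes c: "compatible m X Y"
  shows "compatible m (\<lambda>\<nu>. tens_at i (antipode \<circ> antipode) (X \<nu>)) (tens_at i us_S2 Y)"
proof -
  let ?F = "\<lambda>xs. xs[i := (antipode \<circ> antipode) (xs ! i)]" and ?H = "\<lambda>xs. xs[i := us_S2 (xs ! i)]"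
  have upd: "set (xs[i := f (xs ! i)]) \<subseteq> C'" if "set xs \<subseteq> C'" "\<And>x. x \<in> C' \<Longrightarrow> f x \<in> C'" for f C' and xs :: "'x list"
  proof (cases "i < length xs")
    case True
    then show ?thesis using that nth_mem[OF True] by (intro set_update_subsetI) blast+
  qed (use that in \<open>simp add: list_update_beyond\<close>)
  have X: "X \<nu> \<in> full.tn m" if "length \<nu> = m" for \<nu> using c that by (simp add: compatible_def)
  have tn: "tens_at i (antipode \<circ> antipode) (X \<nu>) \<in> full.tn m" if "length \<nu> = m" for \<nu>
    unfolding tens_at_eq_lmap using upd[of _ Ufull "antipode \<circ> antipode"] antipode_antipode_Ufull
    by (intro full.tn_lmap[OF X[OF that]]) simp
  have uni: "uniform l m (\<lambda>\<nu>. tens_at i (antipode \<circ> antipode) (X \<nu>))"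
    using c by (intro uniform_tens_at_antipode) (simp add: compatible_def)
  have small: "tens_at i us_S2 Y \<in> sm.tn m"
    unfolding tens_at_eq_lmap using upd[of _ small us_S2] small_S2 c
    by (intro sm.tn_lmap[of Y m]) (simp_all add: compatible_def)
  have "eqmod (us.nl m) (Phi_tensor (tens_at i (antipode \<circ> antipode) (X \<nu>))) (component_at \<nu> (tens_at i us_S2 Y))"
    if \<nu>: "length \<nu> = m" for \<nu>
  proof -
    have "map Phi (?F xs) = ?H (map Phi xs)" for xs
      by (cases "i < length xs") (simp_all add: map_update us_S2_Phi list_update_beyond)
    then have 1: "Phi_tensor (tens_at i (antipode \<circ> antipode) (X \<nu>)) = lmap ?H (Phi_tensor (X \<nu>))"
      unfolding tens_at_eq_lmap by (intro Phi_tensor_lmap tn_integral[OF X[OF \<nu>]])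
    have Yc: "eqmod (us.nl m) (Phi_tensor (X \<nu>)) (component_at \<nu> Y)" using c \<nu> by (simp add: compatible_def)
    have 2: "eqmod (us.nl m) (lmap ?H (Phi_tensor (X \<nu>))) (lmap ?H (component_at \<nu> Y))"
      by (rule us.lmap_cong_nl[OF us.slotwise_linear_list_update[OF linear_mod_us_S2] Yc])
    have "?H (map2 (\<lambda>p v. us_mult p (Phi (ind v))) ps \<nu>) = map2 (\<lambda>p v. us_mult p (Phi (ind v))) (?H ps) \<nu>"
      if "length ps = m" for ps
    proof (rule nth_equalityI)
      fix k assume "k < length (?H (map2 (\<lambda>p v. us_mult p (Phi (ind v))) ps \<nu>))"
      then show "?H (map2 (\<lambda>p v. us_mult p (Phi (ind v))) ps \<nu>) ! k = map2 (\<lambda>p v. us_mult p (Phi (ind v))) (?H ps) \<nu> ! k"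
        using that \<nu> by (cases "i = k") (simp_all add: us_S2_mult_Phi_ind)
    qed simp
    moreover have "length ps = m" if "ps \<in> Poly_Mapping.keys Y" for ps
      using c that by (auto simp: compatible_def tens_def)
    ultimately have 3: "lmap ?H (component_at \<nu> Y) = component_at \<nu> (tens_at i us_S2 Y)"
      unfolding component_at_eq_lmap tens_at_eq_lmap lmap_lmap by (intro lmap_cong) blast
    show ?thesis using 2 unfolding 1 3 .
  qed
  with tn uni small show ?thesis unfolding compatible_def by blast
qed

lemma compatible_times:
  assumes X: "compatible m X Y" and X': "compatible m' X' Y'"
  shows "compatible (m + m') (\<lambda>\<nu>. X (take m \<nu>) * X' (drop m \<nu>)) (Y * Y')"
proof -
  have tn: "length \<nu> = m \<Longrightarrow> X \<nu> \<in> full.tn m" and tn': "length \<nu> = m' \<Longrightarrow> X' \<nu> \<in> full.tn m'"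
    and Y: "Y \<in> sm.tn m" and Y': "Y' \<in> sm.tn m'"
    and eq: "length \<nu> = m \<Longrightarrow> eqmod (us.nl m) (Phi_tensor (X \<nu>)) (component_at \<nu> Y)"
    and eq': "length \<nu> = m' \<Longrightarrow> eqmod (us.nl m') (Phi_tensor (X' \<nu>)) (component_at \<nu> Y')" for \<nu>
    using X X' by (simp_all add: compatible_def)
  have uni: "uniform l (m + m') (\<lambda>\<nu>. X (take m \<nu>) * X' (drop m \<nu>))"
    using X X' by (intro uniform_times tn tn') (simp_all add: compatible_def)
  have us: "Y \<in> us.tn m" "Y' \<in> us.tn m'" using Y Y' small_tn_subset by blast+
  have "X (take m \<nu>) * X' (drop m \<nu>) \<in> full.tn (m + m')"
    and "eqmod (us.nl (m + m')) (Phi_tensor (X (take m \<nu>) * X' (drop m \<nu>))) (component_at \<nu> (Y * Y'))"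
    if "length \<nu> = m + m'" for \<nu>
  proof -
    have len: "length (take m \<nu>) = m" "length (drop m \<nu>) = m'" using that by simp_all
    show "X (take m \<nu>) * X' (drop m \<nu>) \<in> full.tn (m + m')" by (intro full.tn_times tn tn' len)
    have 1: "Phi_tensor (X (take m \<nu>) * X' (drop m \<nu>)) = Phi_tensor (X (take m \<nu>)) * Phi_tensor (X' (drop m \<nu>))"
      by (intro Phi_tensor_times tn_integral[OF tn] tn_integral[OF tn'] len)
    have 2: "component_at \<nu> (Y * Y') = component_at (take m \<nu>) Y * component_at (drop m \<nu>) Y'"
      using component_at_times[OF us(1) len(1), of "drop m \<nu>" Y'] by simp
    show "eqmod (us.nl (m + m')) (Phi_tensor (X (take m \<nu>) * X' (drop m \<nu>))) (component_at \<nu> (Y * Y'))"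
      unfolding 1 2 by (intro us.times_cong_nl eq eq' len component_at_tn us Phi_tensor_tn tn')
  qed
  with uni sm.tn_times[OF Y Y'] show ?thesis unfolding compatible_def by blast
qed

lemma compatible_slice:
  assumes R': "is_R_full_inverse R'" and Rs: "is_R_small_inverse Rs"
  shows "compatible (length (slots_at n D h)) (full_label R' n D h) (small_label Rs n D h)"
proof -
  have R: "compatible 2 (R_full l) R_small"
    unfolding compatible_def using R_full_tn uniform_R_full R_small_small Phi_tensor_R_full by blast
  have "R' \<in> ctensors 2" using R' by (simp add: is_R_full_inverse_def)
  then have Ri: "compatible 2 (R' l) Rs"
    using Phi_tensor_R_inverse[OF R' Rs] uniform_ctensor Rs
    unfolding compatible_def is_R_small_inverse_def ctensors_def by blast
  have one: "compatible 0 (\<lambda>_. 1) 1"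
    using compatible_single[of "[]" 0] by (simp add: one_eq_single at_weights_def)
  have K: "compatible 1 (\<lambda>\<nu>. Poly_Mapping.single [Kg \<gamma> * ind (\<nu> ! 0)] 1) (Poly_Mapping.single [Phi (Kg \<gamma>)] 1)" for \<gamma>
  proof -
    have c: "compatible 1 (\<lambda>\<nu>. Poly_Mapping.single (at_weights [Kg \<gamma>] \<nu>) 1) (Poly_Mapping.single [Phi (Kg \<gamma>)] 1)"
      using compatible_single[of "[Kg \<gamma>]" 1] Uweight_Kg by simp
    have "at_weights [Kg \<gamma>] \<nu> = [Kg \<gamma> * ind (\<nu> ! 0)]" if "length \<nu> = 1" for \<nu>
      using that by (cases \<nu>) (simp_all add: at_weights_def)
    then show ?thesis by (intro compatible_cong[OF c]) (simp only:)
  qed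
  show ?thesis
  proof (cases "D ! h")
    case (Cup i)
    then show ?thesis using K[of two_rho] one
      unfolding full_label_def[abs_def] small_label_def slice_label_def slots_at_def by simp
  next
    case (Cap i)
    then show ?thesis using K[of "- two_rho"] one
      unfolding full_label_def[abs_def] small_label_def slice_label_def slots_at_def by simp
  next
    case (Cross i b)
    have len: "length (slots_at n D h) = 2" using Cross by (simp add: slots_at_def)
    let ?c = "slash_up n D h i \<and> \<not> backslash_up n D h i"
    let ?p = "b \<longleftrightarrow> (slash_up n D h i \<longleftrightarrow> backslash_up n D h i)"
    have "compatible 2 (\<lambda>\<nu>. if ?p then R_full l \<nu> else R' l \<nu>) (if ?p then R_small else Rs)"
    proof (cases ?p)
      case True
      show ?thesis unfolding if_P[OF True] by (rule R)
    next
      case False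
      show ?thesis unfolding if_not_P[OF False] by (rule Ri)
    qed
    note base = this
    have "compatible 2 (\<lambda>\<nu>. (if ?c then tens_at (if b then 1 else 0) (antipode \<circ> antipode) else id) (if ?p then R_full l \<nu> else R' l \<nu>))
        ((if ?c then tens_at (if b then 1 else 0) us_S2 else id) (if ?p then R_small else Rs))"
    proof (cases ?c)
      case True
      show ?thesis unfolding if_P[OF True] by (rule compatible_antipode[OF base])
    next
      case False
      show ?thesis unfolding if_not_P[OF False] id_apply by (rule base)
    qed
    then show ?thesis
      unfolding full_label_def[abs_def] small_label_def slice_label_def len by (simp only: Cross slice.case)
  qed
qed

text \<open>Induction over the slices. The weights of the slots in the first slices form a prefix of
  the whole list, and \<open>chunk\<close> for an earlier slice does not see what follows that
  prefix.\<close>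

lemma compatible_labels:
  assumes R': "is_R_full_inverse R'" and Rs: "is_R_small_inverse Rs"
  shows "compatible (length (slots n D)) (labels_full R' n D l) (prod_list (map (small_label Rs n D) [0..<length D]))"
proof -
  let ?M = "\<lambda>h. length (concat (map (slots_at n D) [0..<h]))"
  let ?P = "\<lambda>h \<mu>. prod_list (map (\<lambda>h. full_label R' n D h (chunk n D h \<mu>)) [0..<h])"
  have M_Suc: "?M (Suc h) = ?M h + length (slots_at n D h)" for h by simp
  have mono: "?M h \<le> ?M h'" if "h \<le> h'" for h h'
    using that by (induction h' rule: dec_induct) (simp_all only: M_Suc)
  have chunk_take: "chunk n D h (take (?M h') \<mu>) = chunk n D h \<mu>" if "h < h'" for h h' and \<mu> :: "'n weight list"
  proof -
    have "length (slots_at n D h) \<le> ?M h' - ?M h" using mono[of "Suc h" h'] that M_Suc[of h] by simp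
    then show ?thesis unfolding chunk_def drop_take take_take by (simp add: min_absorb1)
  qed
  have "compatible (?M h) (?P h) (prod_list (map (small_label Rs n D) [0..<h]))" for h
  proof (induction h)
    case 0
    show ?case using compatible_single[of "[]" 0] by (simp add: one_eq_single at_weights_def)
  next
    case (Suc h)
    have "compatible (?M (Suc h)) (\<lambda>\<mu>. ?P h (take (?M h) \<mu>) * full_label R' n D h (drop (?M h) \<mu>))
        (prod_list (map (small_label Rs n D) [0..<h]) * small_label Rs n D h)"
      unfolding M_Suc by (rule compatible_times[OF Suc compatible_slice[OF R' Rs]])
    then have "compatible (?M (Suc h)) (?P (Suc h)) (prod_list (map (small_label Rs n D) [0..<h]) * small_label Rs n D h)"
    proof (rule compatible_cong)
      fix \<mu> :: "'n weight list" assume \<mu>: "length \<mu> = ?M (Suc h)"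
      have last: "chunk n D h \<mu> = drop (?M h) \<mu>" using \<mu> unfolding M_Suc chunk_def by simp
      have "map (\<lambda>h'. full_label R' n D h' (chunk n D h' (take (?M h) \<mu>))) [0..<h]
          = map (\<lambda>h'. full_label R' n D h' (chunk n D h' \<mu>)) [0..<h]"
      proof (intro map_cong refl)
        fix h' assume "h' \<in> set [0..<h]"
        then have "h' < h" by simp
        from chunk_take[OF this, of \<mu>]
        show "full_label R' n D h' (chunk n D h' (take (?M h) \<mu>)) = full_label R' n D h' (chunk n D h' \<mu>)"
          by (simp only:)
      qed
      then show "?P (Suc h) \<mu> = ?P h (take (?M h) \<mu>) * full_label R' n D h (drop (?M h) \<mu>)"
        by (simp only: last upt_Suc_append[OF le0] map_append list.map prod_list.append prod_list.Cons
            prod_list.Nil mult_1_right)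
    qed
    then show ?case by simp
  qed
  from this[of "length D"] show ?thesis
    unfolding labels_full_def[abs_def] slots_def full_label_def .
qed

end

context root_of_unity_datum
begin

section \<open>The invariants without closed components\<close>

definition Phi_expansion :: "('n falg list \<times> complex) list \<Rightarrow> ('n us list \<Rightarrow>\<^sub>0 complex)" where
  "Phi_expansion zs = (\<Sum>(x, c)\<leftarrow>zs. Poly_Mapping.single (map Phi x) c)"

definition Phi_data :: "nat \<Rightarrow> ('n falg list \<times> complex) list \<Rightarrow> bool" where
  "Phi_data m zs \<longleftrightarrow> (\<forall>(x, c) \<in> set zs. length x = m \<and> set x \<subseteq> Ufull \<and> c \<in> Qz)"

text \<open>Weights are defined in the free algebra only. Expanding every factor of a small tensor
  into elements \<open>Phi x\<close> makes \<open>weights\<close> and \<open>reachable\<close>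
  applicable to the small invariant.\<close>

definition Phi_spanned :: "nat \<Rightarrow> ('n us list \<Rightarrow>\<^sub>0 complex) \<Rightarrow> bool" where
  "Phi_spanned m t \<longleftrightarrow> (\<exists>zs. Phi_data m zs \<and> eqmod (us.nl m) t (Phi_expansion zs))"

lemma Phi_data_tn: "Phi_data m zs \<Longrightarrow> Phi_expansion zs \<in> us.tn m"
  unfolding Phi_expansion_def
proof (rule us.tn_sum_list)
  fix y assume "Phi_data m zs" "y \<in> set zs"
  then obtain x c where "y = (x, c)" "length x = m" "set x \<subseteq> Ufull" "c \<in> Qz"
    unfolding Phi_data_def by (cases y) auto
  then show "(case y of (x, c) \<Rightarrow> Poly_Mapping.single (map Phi x) c) \<in> us.tn m"
    using map_Phi_Us[of x] by (simp add: us.tn_single)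
qed

lemma Phi_spanned_single: "length x = m \<Longrightarrow> set x \<subseteq> Ufull \<Longrightarrow> c \<in> Qz \<Longrightarrow> Phi_spanned m (Poly_Mapping.single (map Phi x) c)"
  unfolding Phi_spanned_def
  by (intro exI[of _ "[(x, c)]"]) (simp add: Phi_data_def Phi_expansion_def us.nl_refl)

lemma Phi_spanned_0: "Phi_spanned m 0"
  unfolding Phi_spanned_def
  by (intro exI[of _ "[]"]) (simp add: Phi_data_def Phi_expansion_def us.nl_refl)

lemma Phi_spanned_add:
  assumes "Phi_spanned m t" "Phi_spanned m u" shows "Phi_spanned m (t + u)"
proof -
  obtain zs zs' where "Phi_data m zs" "eqmod (us.nl m) t (Phi_expansion zs)"
    "Phi_data m zs'" "eqmod (us.nl m) u (Phi_expansion zs')"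
    using assms unfolding Phi_spanned_def by blast
  moreover have "Phi_expansion (zs @ zs') = Phi_expansion zs + Phi_expansion zs'"
    by (simp add: Phi_expansion_def)
  ultimately show ?thesis unfolding Phi_spanned_def
    by (intro exI[of _ "zs @ zs'"]) (simp add: Phi_data_def ball_Un us.nl_add)
qed

lemma Phi_spanned_cong: "Phi_spanned m u \<Longrightarrow> eqmod (us.nl m) t u \<Longrightarrow> Phi_spanned m t"
  unfolding Phi_spanned_def using us.nl_trans by blast

lemma Phi_spanned_smul:
  assumes b: "b \<in> Qz" and t: "Phi_spanned m t" shows "Phi_spanned m (smul b t)"
proof -
  obtain zs where zs: "Phi_data m zs" "eqmod (us.nl m) t (Phi_expansion zs)"
    using t unfolding Phi_spanned_def by blast
  have "Phi_data m zs \<Longrightarrow> Phi_spanned m (smul b (Phi_expansion zs))" for zs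
  proof (induction zs)
    case Nil
    then show ?case using Phi_spanned_0 by (simp add: Phi_expansion_def)
  next
    case (Cons y zs)
    obtain x c where y: "y = (x, c)" by (cases y)
    have "Phi_spanned m (Poly_Mapping.single (map Phi x) (b * c) + smul b (Phi_expansion zs))"
      using Cons b y by (intro Phi_spanned_add Phi_spanned_single) (simp_all add: Phi_data_def Qz_mult)
    then show ?case by (simp add: Phi_expansion_def y smul_add)
  qed
  from this[OF zs(1)] us.nl_smul[OF b zs(2)] show ?thesis by (rule Phi_spanned_cong)
qed

text \<open>The new factor \<open>p\<close> is itself a combination of elements
  \<open>Phi x\<close>; linearity in the first factor reduces to prefixing one such element to each
  term of the expansion of \<open>t\<close>.\<close>

lemma Phi_spanned_Cons:
  assumes p: "p \<in> small" and t: "Phi_spanned m t" "t \<in> us.tn m"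
  shows "Phi_spanned (Suc m) (Poly_Mapping.single [p] 1 * t)"
proof -
  obtain zs where zs: "Phi_data m zs" "eqmod (us.nl m) t (Phi_expansion zs)"
    using t unfolding Phi_spanned_def by blast
  have pure: "Phi_spanned (Suc m) (Poly_Mapping.single [Phi x] 1 * Phi_expansion zs)" if x: "x \<in> Ufull" for x
    using zs(1)
  proof (induction zs)
    case Nil
    then show ?case using Phi_spanned_0 by (simp add: Phi_expansion_def)
  next
    case (Cons y zs)
    obtain x' c where y: "y = (x', c)" by (cases y)
    have "Phi_spanned (Suc m) (Poly_Mapping.single (map Phi (x # x')) c + Poly_Mapping.single [Phi x] 1 * Phi_expansion zs)"
      using Cons x y by (intro Phi_spanned_add Phi_spanned_single) (simp_all add: Phi_data_def)
    then show ?case by (simp add: Phi_expansion_def y distrib_left mult_single plus_list_def)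
  qed
  have E: "Phi_expansion zs \<in> us.tn m" by (rule Phi_data_tn[OF zs(1)])
  have in_Us: "r \<in> Us" if "r \<in> small" for r using that small_subset_Us by blast
  have tn1: "Poly_Mapping.single [r] 1 \<in> us.tn 1" if "r \<in> Us" for r
    using that by (intro us.tn_single us.B1) simp_all
  have "Phi_spanned (Suc m) (Poly_Mapping.single [p] 1 * Phi_expansion zs)"
    using p
  proof (induction p rule: small_induct)
    case zero
    have "Poly_Mapping.single [0] 1 \<in> us.nl 1"
      using us.nl_pure_null[of "[]" "[]" 0 1 1] us.Z0 us.B1 by simp
    from us.times_nl_left[OF this E] show ?case
      using Phi_spanned_cong[OF Phi_spanned_0] by (simp add: eqmod_0)
  next
    case (single x b)
    have x: "x \<in> Ufull" using single Uweight_subset_Ufull by blast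
    have "eqmod (us.nl 1) (Poly_Mapping.single [smul b (Phi x)] 1) (smul b (Poly_Mapping.single [Phi x] 1))"
      using us.nl_pure_smul[of "[]" "[]" "Phi x" b 1] single Phi_in_Us[OF x] by simp
    from us.times_cong_nl[OF this us.nl_refl us.tn_smul[OF single(2) tn1[OF Phi_in_Us[OF x]]] E]
    have "eqmod (us.nl (Suc m)) (Poly_Mapping.single [smul b (Phi x)] 1 * Phi_expansion zs)
        (smul b (Poly_Mapping.single [Phi x] 1 * Phi_expansion zs))"
      by (simp only: smul_mult_left plus_1_eq_Suc)
    then show ?case by (rule Phi_spanned_cong[OF Phi_spanned_smul[OF single(2) pure[OF x]]])
  next
    case (add p r)
    have "eqmod (us.nl 1) (Poly_Mapping.single [p + r] 1) (Poly_Mapping.single [p] 1 + Poly_Mapping.single [r] 1)"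
      using us.nl_pure_add[of "[]" "[]" p r 1] in_Us add by simp
    from us.times_cong_nl[OF this us.nl_refl us.tn_add[OF tn1 tn1] E] in_Us add
    have "eqmod (us.nl (Suc m)) (Poly_Mapping.single [p + r] 1 * Phi_expansion zs)
        (Poly_Mapping.single [p] 1 * Phi_expansion zs + Poly_Mapping.single [r] 1 * Phi_expansion zs)"
      by (simp only: distrib_right plus_1_eq_Suc)
    then show ?case by (rule Phi_spanned_cong[OF Phi_spanned_add[OF add(3,4)]])
  qed
  moreover have "eqmod (us.nl (Suc m)) (Poly_Mapping.single [p] 1 * t) (Poly_Mapping.single [p] 1 * Phi_expansion zs)"
    using us.times_cong_nl[OF us.nl_refl zs(2) tn1[OF in_Us[OF p]] t(2)] by (simp only: plus_1_eq_Suc)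
  ultimately show ?thesis by (rule Phi_spanned_cong)
qed

lemma Phi_spanned_small: "t \<in> sm.tn m \<Longrightarrow> Phi_spanned m t"
proof (induction rule: sm.tn_induct)
  case (single xs b)
  have "length xs = m \<Longrightarrow> set xs \<subseteq> small \<Longrightarrow> Phi_spanned m (Poly_Mapping.single xs 1)" for xs m
  proof (induction xs arbitrary: m)
    case Nil
    then show ?case using Phi_spanned_single[of "[]" 0 1] Qz_1 by simp
  next
    case (Cons p xs)
    then obtain m' where m: "m = Suc m'" by auto
    have "Poly_Mapping.single xs 1 \<in> us.tn m'"
      using Cons.prems m small_subset_Us by (intro us.tn_single us.B1) auto
    moreover have "Phi_spanned m' (Poly_Mapping.single xs 1)" using Cons m by simp
    ultimately have "Phi_spanned m (Poly_Mapping.single [p] 1 * Poly_Mapping.single xs 1)"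
      using Cons.prems unfolding m by (intro Phi_spanned_Cons) simp_all
    then show ?case by (simp add: mult_single plus_list_def)
  qed
  from Phi_spanned_smul[OF single(3) this[OF single(1,2)]] show ?case by simp
qed (auto intro: Phi_spanned_0 Phi_spanned_add)

abbreviation us_products :: "nat \<Rightarrow> slice list \<Rightarrow> 'n us list \<Rightarrow> 'n us list" where
  "us_products \<equiv> component_products us_mult us_one"

lemma map_Phi_component_products:
  assumes D: "tangle n D" and xs: "length xs = length (slots n D)"
  shows "map Phi (component_products (*) 1 n D xs) = us_products n D (map Phi xs)"
proof -
  have foldr: "Phi (foldr (*) ys 1) = foldr us_mult (map Phi ys) us_one" for ys :: "'n falg list"
    by (induction ys) (simp_all add: us_one_eq Phi_mult)
  have "map Phi (map (slot_val n D xs) (rev (component_slots D j))) = map (slot_val n D (map Phi xs)) (rev (component_slots D j))"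
    if "j < n" for j
    using slot_val_map[OF xs, of _ Phi] tangle.component_slots_subset[OF D that] by auto
  note vals = this
  show ?thesis
    unfolding component_products_eq map_map
  proof (intro map_cong refl)
    fix j assume "j \<in> set [0..<n]"
    then have "j < n" by simp
    from vals[OF this]
    show "(Phi \<circ> (\<lambda>j. foldr (*) (map (slot_val n D xs) (rev (component_slots D j))) 1)) j
      = foldr us_mult (map (slot_val n D (map Phi xs)) (rev (component_slots D j))) us_one"
      by (simp only: o_apply foldr)
  qed
qed

text \<open>Outside the box some slot carries a weight that is reachable for none of the finitely
  many pure tensors in the expansion, so each of their products vanishes.\<close>

lemma Gamma_full_cong:
  assumes D: "tangle n D" and \<nu>: "length \<nu> = n" and len: "\<And>\<mu>. length \<mu> = length (slots n D) \<Longrightarrow> X \<mu> \<in> full.tn (length (slots n D))"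
    and ys: "expansion_data (length (slots n D)) ys"
    and X: "\<And>\<mu>. length \<mu> = length (slots n D) \<Longrightarrow> eqmod (tensor_null l (length (slots n D))) (X \<mu>) (expansion ys \<mu>)"
    and A: "finite A" "\<And>x f. (x, f) \<in> set ys \<Longrightarrow> reachable n D \<nu> x \<subseteq> A"
  shows "eqmod (tensor_null l n)
    (conv_sum (tensor_null l n) {\<mu>. length \<mu> = length (slots n D)} (\<lambda>\<mu>. lmap (full_product n D \<nu>) (X \<mu>)))
    (\<Sum>\<mu>\<in>box (length (slots n D)) (\<lambda>_. A). lmap (full_product n D \<nu>) (X \<mu>))"
proof (rule conv_sum_eqmod[OF add_subgroup_tensor_null])
  show "finite (box (length (slots n D)) (\<lambda>_. A))" by (rule finite_box) (rule A(1))
  show "box (length (slots n D)) (\<lambda>_. A) \<subseteq> {\<mu>. length \<mu> = length (slots n D)}" by (auto simp: box_def)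
  fix \<mu> assume \<mu>: "\<mu> \<in> {\<mu> :: 'n weight list. length \<mu> = length (slots n D)}" "\<mu> \<notin> box (length (slots n D)) (\<lambda>_. A)"
  then have len: "length \<mu> = length (slots n D)" by simp
  obtain i where i: "i < length (slots n D)" "\<mu> ! i \<notin> A" using \<mu> by (auto simp: box_def)
  have "lmap (full_product n D \<nu>) (expansion ys \<mu>) \<in> full.nl n"
    unfolding expansion_def lmap_sum_list
  proof (rule add_subgroup_sum_list[OF full.add_subgroup_nl])
    fix y assume y: "y \<in> set ys"
    obtain x f where y': "y = (x, f)" by (cases y)
    have "length x = length (slots n D)" "set x \<subseteq> Ufull" "\<mu> ! i \<notin> reachable n D \<nu> x"
      using ys y A(2)[of x f] i(2) unfolding y' expansion_data_def by blast+
    then have "Poly_Mapping.single (full_product n D \<nu> (at_weights x \<mu>)) (emb (f \<mu>)) \<in> full.nl n"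
      by (intro full_product_null[OF D _ _ \<nu> len i(1)])
    then show "lmap (full_product n D \<nu>) (case y of (x, f) \<Rightarrow> Poly_Mapping.single (at_weights x \<mu>) (emb (f \<mu>))) \<in> full.nl n"
      by (simp add: y')
  qed
  then have "lmap (full_product n D \<nu>) (expansion ys \<mu>) \<in> tensor_null l n" using nl_subset_tensor_null by blast
  with lmap_full_product_tensor_null[OF D \<nu> X[OF len]] show "lmap (full_product n D \<nu>) (X \<mu>) \<in> tensor_null l n"
    by (rule eqmod_in[OF add_subgroup_tensor_null])
qed

lemma component_at_us_products_cong:
  assumes D: "tangle n D" and \<nu>: "length \<nu> = n" and eq: "eqmod (us.nl (length (slots n D))) t u"
  shows "eqmod (us.nl n) (component_at \<nu> (lmap (us_products n D) t)) (component_at \<nu> (lmap (us_products n D) u))"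
  by (rule component_at_cong[OF us.lmap_cong_nl[OF us.slotwise_linear_component_products[OF D] eq] \<nu>])

lemma Phi_full_product:
  assumes D: "tangle n D" and xs: "length xs = length (slots n D)"
  shows "component_at \<nu> (lmap (us_products n D) (Poly_Mapping.single (map Phi xs) c))
    = Poly_Mapping.single (map Phi (full_product n D \<nu> xs)) c"
  unfolding lmap_single map_Phi_component_products[OF D xs, symmetric] component_at_Phi ..

text \<open>Over a common box the generic invariant becomes a finite sum in which the labels may be
  replaced by components of the small labels. The sum over the box then removes the indicators
  again.\<close>

theorem Phi_Gamma_full:
  assumes D: "tangle n D" and R': "is_R_full_inverse R'" and Rs: "is_R_small_inverse Rs" and \<nu>: "length \<nu> = n"
  shows "eqmod (us.nl n) (Phi_tensor (Gamma_full R' n D l \<nu>)) (component_at \<nu> (Gamma_small Rs n D))"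
    and "integral (Gamma_full R' n D l \<nu>)"
proof -
  let ?M = "length (slots n D)" and ?X = "labels_full R' n D l" and ?G = "full_product n D \<nu>"
  let ?S = "prod_list (map (small_label Rs n D) [0..<length D])"
  let ?H = "\<lambda>t. component_at \<nu> (lmap (us_products n D) t)"
  have compat: "compatible ?M ?X ?S" by (rule compatible_labels[OF R' Rs])
  have X_tn: "?X \<mu> \<in> full.tn ?M" if "length \<mu> = ?M" for \<mu> using compat that by (simp add: compatible_def)
  have X_Phi: "eqmod (us.nl ?M) (Phi_tensor (?X \<mu>)) (component_at \<mu> ?S)" if "length \<mu> = ?M" for \<mu>
    using compat that by (simp add: compatible_def)
  have S: "?S \<in> sm.tn ?M" using compat by (simp add: compatible_def)
  obtain ys where ys: "expansion_data ?M ys"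
    and X_ys: "\<And>\<mu>. length \<mu> = ?M \<Longrightarrow> eqmod (tensor_null l ?M) (?X \<mu>) (expansion ys \<mu>)"
    using compat unfolding compatible_def uniform_def by blast
  obtain zs where zs: "Phi_data ?M zs" "eqmod (us.nl ?M) ?S (Phi_expansion zs)"
    using Phi_spanned_small[OF S] unfolding Phi_spanned_def by blast
  \<comment> \<open>The box serves two expansions: \<open>ys\<close> cuts off the sum defining the
    generic invariant, and \<open>zs\<close> requires enough indicators for their sum to act as the
    identity on the small labels.\<close>
  define A where "A = (\<Union>(x, f)\<in>set ys. reachable n D \<nu> x) \<union> (\<Union>(x, c)\<in>set zs. reachable n D \<nu> x)"
  have A: "finite A" unfolding A_def using finite_reachable by auto
  have A_ys: "reachable n D \<nu> x \<subseteq> A" if "(x, f) \<in> set ys" for x f using that unfolding A_def by blast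
  have A_zs: "reachable n D \<nu> x \<subseteq> A" if "(x, c) \<in> set zs" for x c using that unfolding A_def by blast
  let ?Box = "box ?M (\<lambda>_. A)"
  have box_len: "length \<mu> = ?M" if "\<mu> \<in> ?Box" for \<mu> using that by (simp add: box_def)
  have Gamma: "Gamma_full R' n D l \<nu> = conv_sum (tensor_null l n) {\<mu>. length \<mu> = ?M} (\<lambda>\<mu>. lmap ?G (?X \<mu>))"
    unfolding Gamma_full_def lmap_def at_weights_def ..
  have G_int: "integral (lmap ?G (?X \<mu>))" if "length \<mu> = ?M" for \<mu>
    by (intro integral_lmap tn_integral[OF X_tn[OF that]])
  show Gamma_int: "integral (Gamma_full R' n D l \<nu>)"
    unfolding Gamma conv_sum_def by (intro integral_sum G_int) simp
  have G_H: "Phi_tensor (lmap ?G (?X \<mu>)) = ?H (Phi_tensor (?X \<mu>))" if "length \<mu> = ?M" for \<mu>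
  proof -
    have "Phi_tensor (lmap ?G (?X \<mu>)) = lmap (\<lambda>ps. map2 (\<lambda>p v. us_mult p (Phi (ind v))) (us_products n D ps) \<nu>) (Phi_tensor (?X \<mu>))"
      by (rule Phi_tensor_lmap_length[OF X_tn[OF that]])
        (simp only: map_Phi_at_weights map_Phi_component_products[OF D])
    then show ?thesis by (simp only: component_at_eq_lmap lmap_lmap)
  qed
  have int_box: "integral (\<Sum>\<mu>\<in>?Box. lmap ?G (?X \<mu>))" by (intro integral_sum G_int box_len)
  have 1: "eqmod (us.nl n) (Phi_tensor (Gamma_full R' n D l \<nu>)) (\<Sum>\<mu>\<in>?Box. ?H (Phi_tensor (?X \<mu>)))"
  proof -
    have "eqmod (tensor_null l n) (Gamma_full R' n D l \<nu>) (\<Sum>\<mu>\<in>?Box. lmap ?G (?X \<mu>))"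
      unfolding Gamma by (rule Gamma_full_cong[OF D \<nu> X_tn ys X_ys A A_ys])
    from Phi_tensor_cong[OF this Gamma_int int_box]
    have "eqmod (us.nl n) (Phi_tensor (Gamma_full R' n D l \<nu>)) (Phi_tensor (\<Sum>\<mu>\<in>?Box. lmap ?G (?X \<mu>)))" .
    moreover have "Phi_tensor (\<Sum>\<mu>\<in>?Box. lmap ?G (?X \<mu>)) = (\<Sum>\<mu>\<in>?Box. Phi_tensor (lmap ?G (?X \<mu>)))"
      by (intro Phi_tensor_sum G_int box_len)
    moreover have "(\<Sum>\<mu>\<in>?Box. Phi_tensor (lmap ?G (?X \<mu>))) = (\<Sum>\<mu>\<in>?Box. ?H (Phi_tensor (?X \<mu>)))"
      by (intro sum.cong refl G_H box_len)
    ultimately show ?thesis by (simp only:)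
  qed
  have 2: "eqmod (us.nl n) (\<Sum>\<mu>\<in>?Box. ?H (Phi_tensor (?X \<mu>))) (\<Sum>\<mu>\<in>?Box. ?H (component_at \<mu> (Phi_expansion zs)))"
  proof (intro us.nl_sum component_at_us_products_cong[OF D \<nu>])
    fix \<mu> assume "\<mu> \<in> ?Box"
    then have len: "length \<mu> = ?M" by (rule box_len)
    show "eqmod (us.nl ?M) (Phi_tensor (?X \<mu>)) (component_at \<mu> (Phi_expansion zs))"
      by (rule us.nl_trans[OF X_Phi[OF len] component_at_cong[OF zs(2) len]])
  qed
  \<comment> \<open>Here the indicators inserted at the slots disappear, one pure tensor
    \<open>map Phi x\<close> at a time, by \<open>full_product_sum\<close>. Only those at
    \<open>\<nu>\<close> remain.\<close>
  have 3: "eqmod (us.nl n) (\<Sum>\<mu>\<in>?Box. ?H (component_at \<mu> (Phi_expansion zs))) (?H (Phi_expansion zs))"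
    using zs(1) A_zs
  proof (induction zs)
    case Nil
    then show ?case by (simp add: Phi_expansion_def component_at_eq us.nl_refl)
  next
    case (Cons y zs)
    obtain x c where y: "y = (x, c)" by (cases y)
    have x: "length x = ?M" "set x \<subseteq> Ufull" "c \<in> Qz" using Cons.prems(1) unfolding y Phi_data_def by simp_all
    have IH: "eqmod (us.nl n) (\<Sum>\<mu>\<in>?Box. ?H (component_at \<mu> (Phi_expansion zs))) (?H (Phi_expansion zs))"
    proof (rule Cons.IH)
      show "Phi_data ?M zs" using Cons.prems(1) by (simp add: Phi_data_def)
      show "reachable n D \<nu> x \<subseteq> A" if "(x, c) \<in> set zs" for x c
        by (rule Cons.prems(2)[of x c]) (use that in simp)
    qed
    have H: "?H (component_at \<mu> (Poly_Mapping.single (map Phi x) c)) = smul c (Phi_tensor (Poly_Mapping.single (?G (at_weights x \<mu>)) 1))"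
      if "\<mu> \<in> ?Box" for \<mu>
    proof -
      have "?H (component_at \<mu> (Poly_Mapping.single (map Phi x) c)) = Poly_Mapping.single (map Phi (?G (at_weights x \<mu>))) c"
        unfolding component_at_Phi using x box_len[OF that] by (intro Phi_full_product[OF D]) simp
      then show ?thesis using Phi_tensor_single[of "?G (at_weights x \<mu>)" 1] by simp
    qed
    have int1: "integral (Poly_Mapping.single xs 1)" for xs using integral_single[of xs 1] by simp
    have "eqmod (us.nl n) (smul c (Phi_tensor (\<Sum>\<mu>\<in>?Box. Poly_Mapping.single (?G (at_weights x \<mu>)) 1)))
        (smul c (Phi_tensor (Poly_Mapping.single (?G x) 1)))"
      using Cons.prems(2)[of x c] y
      by (intro us.nl_smul x Phi_tensor_cong nl_imp_tensor_null full_product_sum D A integral_sum int1 \<nu>) simp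
    moreover have "smul c (Phi_tensor (\<Sum>\<mu>\<in>?Box. Poly_Mapping.single (?G (at_weights x \<mu>)) 1))
        = (\<Sum>\<mu>\<in>?Box. ?H (component_at \<mu> (Poly_Mapping.single (map Phi x) c)))"
      unfolding Phi_tensor_sum[OF int1] smul_sum by (intro sum.cong refl H[symmetric])
    moreover have "smul c (Phi_tensor (Poly_Mapping.single (?G x) 1)) = ?H (Poly_Mapping.single (map Phi x) c)"
      unfolding Phi_full_product[OF D x(1)] using Phi_tensor_single[of "?G x" 1] by simp
    ultimately have "eqmod (us.nl n) (\<Sum>\<mu>\<in>?Box. ?H (component_at \<mu> (Poly_Mapping.single (map Phi x) c)))
        (?H (Poly_Mapping.single (map Phi x) c))" by (simp only:)
    from us.nl_add[OF this IH] show ?case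
      by (simp add: y Phi_expansion_def component_at_eq_lmap lmap_add sum.distrib)
  qed
  have 4: "eqmod (us.nl n) (?H (Phi_expansion zs)) (?H ?S)"
    by (rule component_at_us_products_cong[OF D \<nu> us.nl_sym[OF zs(2)]])
  have "Gamma_small Rs n D = lmap (us_products n D) ?S"
    unfolding Gamma_small_def lmap_def small_label_def[abs_def] ..
  then show "eqmod (us.nl n) (Phi_tensor (Gamma_full R' n D l \<nu>)) (component_at \<nu> (Gamma_small Rs n D))"
    using us.nl_trans[OF us.nl_trans[OF 1 2] us.nl_trans[OF 3 4]] by (simp only:)
qed

lemma Gamma_small_small:
  assumes D: "tangle n D" and R': "is_R_full_inverse R'" and Rs: "is_R_small_inverse Rs"
  shows "Gamma_small Rs n D \<in> sm.tn n"
proof -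
  have S: "prod_list (map (small_label Rs n D) [0..<length D]) \<in> sm.tn (length (slots n D))"
    using compatible_labels[OF R' Rs, of n D] by (simp add: compatible_def)
  have "Gamma_small Rs n D = lmap (us_products n D) (prod_list (map (small_label Rs n D) [0..<length D]))"
    unfolding Gamma_small_def lmap_def small_label_def[abs_def] ..
  then show ?thesis
    using sm.component_products_C[OF D] by (simp only:) (intro sm.tn_lmap[OF S], simp)
qed

end

section \<open>Closed components\<close>

abbreviation open_count :: "'f option list \<Rightarrow> nat" where
  "open_count lab \<equiv> length (filter (\<lambda>f. f = None) lab)"

lemma open_part_Nil [simp]: "open_part [] xs = []"
  and open_part_Cons: "open_part (o' # lab) (x # xs) = (if o' = None then x # open_part lab xs else open_part lab xs)"
  by (simp_all add: open_part_def)

lemma open_part_append: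
  "length lab = length xs \<Longrightarrow> open_part (lab @ lab') (xs @ ys) = open_part lab xs @ open_part lab' ys"
  by (simp add: open_part_def)

lemma apply_labels_append:
  assumes "length lab = length xs"
  shows "apply_labels (lab @ lab') (xs @ ys) = apply_labels lab xs * apply_labels lab' ys"
  using assms by (simp add: apply_labels_def open_part_append mult_single plus_list_def)

lemma apply_labels_Nil: "apply_labels [] [] = 1"
  by (simp add: apply_labels_def one_eq_single)

lemma apply_labels_Cons: "apply_labels (o' # lab) (x # xs) = apply_labels [o'] [x] * apply_labels lab xs"
  using apply_labels_append[of "[o']" "[x]" lab xs] by simp

lemma apply_labels_None: "apply_labels [None] [x] = Poly_Mapping.single [x] 1"
  and apply_labels_Some: "apply_labels [Some \<psi>] [x] = Poly_Mapping.single [] (\<psi> x)"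
  by (simp_all add: apply_labels_def open_part_def)

lemma single_Nil_times: "Poly_Mapping.single [] c * t = smul c t"
  for t :: "'a list \<Rightarrow>\<^sub>0 'b::comm_ring_1"
  by (simp add: smul_def mult_map_scale_conv_mult zero_list_def)

context root_of_unity_datum
begin

abbreviation labels_ok :: "('n us \<Rightarrow> complex) option list \<Rightarrow> bool" where
  "labels_ok lab \<equiv> (\<forall>\<psi>. Some \<psi> \<in> set lab \<longrightarrow> \<psi> \<in> inv_functionals)"

lemma inv_functionalD:
  assumes "\<psi> \<in> inv_functionals"
  shows "p \<in> Us \<Longrightarrow> \<psi> p \<in> Qz"
    and "p \<in> Us \<Longrightarrow> r \<in> Us \<Longrightarrow> \<psi> (p + r) = \<psi> p + \<psi> r"
    and "b \<in> Qz \<Longrightarrow> p \<in> Us \<Longrightarrow> \<psi> (smul b p) = b * \<psi> p"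
    and "p \<in> us_null \<Longrightarrow> \<psi> p = 0"
    and "us_continuous \<psi>"
  using assms unfolding inv_functionals_def us_linear_def by blast+

lemma functional_cong:
  assumes \<psi>: "\<psi> \<in> inv_functionals" and p: "p \<in> Us" "r \<in> Us" and eq: "eqmod us_null p r"
  shows "\<psi> p = \<psi> r"
proof -
  have z: "p - r \<in> us_null" "p - r \<in> Us" using eq us_null_subset by (auto simp: eqmod_def)
  have "\<psi> (r + (p - r)) = \<psi> r + \<psi> (p - r)" by (rule inv_functionalD(2)[OF \<psi> p(2) z(2)])
  then show ?thesis using inv_functionalD(4)[OF \<psi> z(1)] by simp
qed

lemma apply_labels_tn:
  "length lab = length ps \<Longrightarrow> set ps \<subseteq> Us \<Longrightarrow> labels_ok lab \<Longrightarrow> apply_labels lab ps \<in> us.tn (open_count lab)"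
proof (induction lab ps rule: list_induct2)
  case Nil
  then show ?case by (simp add: apply_labels_Nil one_eq_single us.tn_single Qz_1)
next
  case (Cons o' lab p ps)
  have IH: "apply_labels lab ps \<in> us.tn (open_count lab)" using Cons by simp
  show ?case
  proof (cases o')
    case None
    have "Poly_Mapping.single [p] 1 \<in> us.tn 1" using Cons.prems by (intro us.tn_single us.B1) simp_all
    from us.tn_times[OF this IH] show ?thesis
      using None by (simp only: apply_labels_Cons[of _ _ p ps] apply_labels_None) simp
  next
    case (Some \<psi>)
    then have "\<psi> p \<in> Qz" using Cons.prems by (intro inv_functionalD(1)) simp_all
    from us.tn_smul[OF this IH] show ?thesis
      using Some by (simp only: apply_labels_Cons[of _ _ p ps] apply_labels_Some single_Nil_times) simp
  qed
qed

text \<open>\<open>apply_labels\<close> is an external product of maps of single factors: an open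
  factor is kept and a closed one becomes a scalar. A relation in one factor thus becomes a relation
  in the middle of a product, by the linearity of the functional if that factor is closed.\<close>

lemma apply_labels_nl:
  assumes lab: "labels_ok lab" and t: "t \<in> us.nl (length lab)"
  shows "lin_ext (apply_labels lab) t \<in> us.nl (open_count lab)"
proof (rule us.tens_null_lift[OF t us.add_subgroup_nl tens_null.scale])
  let ?n = "open_count lab"
  let ?o = "\<lambda>xs. lab ! length xs" and ?pre = "\<lambda>xs. take (length xs) lab" and ?post = "\<lambda>xs. drop (Suc (length xs)) lab"
  have split: "apply_labels lab (xs @ y # ys) = apply_labels (?pre xs) xs * (apply_labels [?o xs] [y] * apply_labels (?post xs) ys)"
    and pre: "apply_labels (?pre xs) xs \<in> us.tn (open_count (?pre xs))"
    and post: "apply_labels (?post xs) ys \<in> us.tn (open_count (?post xs))"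
    and count: "?n = open_count (?pre xs) + (open_count [?o xs] + open_count (?post xs))"
    and o_ok: "\<And>\<psi>. ?o xs = Some \<psi> \<Longrightarrow> \<psi> \<in> inv_functionals"
    if h: "set xs \<subseteq> Us" "set ys \<subseteq> Us" "length xs + length ys + 1 = length lab" for xs ys y
  proof -
    have i: "length xs < length lab" using h(3) by simp
    have lab_eq: "lab = ?pre xs @ ?o xs # ?post xs" using i by (rule id_take_nth_drop)
    have len: "length (?pre xs) = length xs" "length (?post xs) = length ys" using h(3) by simp_all
    have "apply_labels lab (xs @ y # ys) = apply_labels (?pre xs @ ?o xs # ?post xs) (xs @ y # ys)"
      using lab_eq by simp
    also have "\<dots> = apply_labels (?pre xs) xs * apply_labels (?o xs # ?post xs) (y # ys)"
      by (rule apply_labels_append[OF len(1)])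
    finally show "apply_labels lab (xs @ y # ys) = apply_labels (?pre xs) xs * (apply_labels [?o xs] [y] * apply_labels (?post xs) ys)"
      by (simp only: apply_labels_Cons[of _ _ y ys])
    have "labels_ok (?pre xs)" "labels_ok (?post xs)" using lab by (auto dest: in_set_takeD in_set_dropD)
    then show "apply_labels (?pre xs) xs \<in> us.tn (open_count (?pre xs))"
      "apply_labels (?post xs) ys \<in> us.tn (open_count (?post xs))"
      by (simp_all only: apply_labels_tn[OF len(1) h(1)] apply_labels_tn[OF len(2) h(2)])
    have "?n = open_count (?pre xs @ ?o xs # ?post xs)" using lab_eq by simp
    also have "\<dots> = open_count (?pre xs) + (open_count [?o xs] + open_count (?post xs))" by simp
    finally show "?n = open_count (?pre xs) + (open_count [?o xs] + open_count (?post xs))" .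
    show "\<psi> \<in> inv_functionals" if "?o xs = Some \<psi>" for \<psi> using lab nth_mem[OF i] that by simp
  qed
  have context_cong: "eqmod (us.nl ?n) (apply_labels (?pre xs) xs * (t * apply_labels (?post xs) ys))
      (apply_labels (?pre xs) xs * (u * apply_labels (?post xs) ys))"
    if h: "set xs \<subseteq> Us" "set ys \<subseteq> Us" "length xs + length ys + 1 = length lab"
      and tu: "eqmod (us.nl (open_count [?o xs])) t u" "t \<in> us.tn (open_count [?o xs])" "u \<in> us.tn (open_count [?o xs])" for xs ys t u
    unfolding count[OF h]
    by (intro us.times_cong_nl us.nl_refl tu us.tn_times pre[OF h] post[OF h])
  have mid_tn: "apply_labels [?o xs] [x] \<in> us.tn (open_count [?o xs])"
    if h: "set xs \<subseteq> Us" "set ys \<subseteq> Us" "length xs + length ys + 1 = length lab" and x: "x \<in> Us" for xs ys x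
    using o_ok[OF h] x by (intro apply_labels_tn) auto
  show "eqmod (us.nl ?n) (apply_labels lab (xs @ (x + y) # ys)) (apply_labels lab (xs @ x # ys) + apply_labels lab (xs @ y # ys))"
    if h: "set xs \<subseteq> Us" "set ys \<subseteq> Us" and xy: "x \<in> Us" "y \<in> Us" and len: "length xs + length ys + 1 = length lab" for xs ys x y
  proof -
    have mid: "eqmod (us.nl (open_count [?o xs])) (apply_labels [?o xs] [x + y]) (apply_labels [?o xs] [x] + apply_labels [?o xs] [y])"
    proof (cases "?o xs")
      case None
      then show ?thesis using us.nl_pure_add[of "[]" "[]" x y 1] xy by (simp add: apply_labels_None)
    next
      case (Some \<psi>)
      from inv_functionalD(2)[OF o_ok[OF h len Some] xy] show ?thesis
        using Some by (simp add: apply_labels_Some single_add us.nl_refl)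
    qed
    have "eqmod (us.nl ?n) (apply_labels (?pre xs) xs * (apply_labels [?o xs] [x + y] * apply_labels (?post xs) ys))
      (apply_labels (?pre xs) xs * ((apply_labels [?o xs] [x] + apply_labels [?o xs] [y]) * apply_labels (?post xs) ys))"
      by (intro context_cong h len mid mid_tn[OF h len] us.C_add us.tn_add xy)
    then show ?thesis unfolding split[OF h len] by (simp only: distrib_left distrib_right)
  qed
  show "eqmod (us.nl ?n) (apply_labels lab (xs @ smul b x # ys)) (smul b (apply_labels lab (xs @ x # ys)))"
    if h: "set xs \<subseteq> Us" "set ys \<subseteq> Us" and x: "x \<in> Us" "b \<in> Qz" and len: "length xs + length ys + 1 = length lab" for xs ys x b
  proof -
    have mid: "eqmod (us.nl (open_count [?o xs])) (apply_labels [?o xs] [smul b x]) (smul b (apply_labels [?o xs] [x]))"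
    proof (cases "?o xs")
      case None
      then show ?thesis using us.nl_pure_smul[of "[]" "[]" x b 1] x by (simp add: apply_labels_None)
    next
      case (Some \<psi>)
      from inv_functionalD(3)[OF o_ok[OF h len Some] x(2,1)] show ?thesis
        using Some by (simp add: apply_labels_Some us.nl_refl)
    qed
    have "eqmod (us.nl ?n) (apply_labels (?pre xs) xs * (apply_labels [?o xs] [smul b x] * apply_labels (?post xs) ys))
      (apply_labels (?pre xs) xs * (smul b (apply_labels [?o xs] [x]) * apply_labels (?post xs) ys))"
      by (intro context_cong h len mid mid_tn[OF h len] us.C_smul us.tn_smul x)
    then show ?thesis unfolding split[OF h len] by (simp only: smul_mult_left smul_mult_right)
  qed
  show "apply_labels lab (xs @ x # ys) \<in> us.nl ?n"
    if h: "set xs \<subseteq> Us" "set ys \<subseteq> Us" and x: "x \<in> us_null" and len: "length xs + length ys + 1 = length lab" for xs ys x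
  proof -
    have mid: "apply_labels [?o xs] [x] \<in> us.nl (open_count [?o xs])"
    proof (cases "?o xs")
      case None
      then show ?thesis using us.nl_pure_null[of "[]" "[]" x 1 1] x by (simp add: apply_labels_None Qz_1)
    next
      case (Some \<psi>)
      from inv_functionalD(4)[OF o_ok[OF h len Some] x] show ?thesis
        using Some by (simp add: apply_labels_Some tens_null.zero)
    qed
    show ?thesis unfolding split[OF h len] count[OF h len]
      by (intro us.times_nl_right us.times_nl_left mid pre[OF h len] post[OF h len])
  qed
qed

lemma apply_labels_cong_nl:
  "labels_ok lab \<Longrightarrow> eqmod (us.nl (length lab)) t u \<Longrightarrow>
    eqmod (us.nl (open_count lab)) (lin_ext (apply_labels lab) t) (lin_ext (apply_labels lab) u)"
  unfolding eqmod_def lin_ext_diff[symmetric] by (rule apply_labels_nl)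

text \<open>Continuity makes the sum over all indicators in a closed component finite.\<close>

lemma functional_sum:
  assumes \<psi>: "\<psi> \<in> inv_functionals" and x: "x \<in> Ufull"
  obtains S where "finite S" "\<And>u. u \<notin> S \<Longrightarrow> \<psi> (Phi (x * ind u)) = 0" "(\<Sum>u\<in>S. \<psi> (Phi (x * ind u))) = \<psi> (Phi x)"
proof -
  obtain S where S: "finite S" "\<And>f. (\<forall>v\<in>S. f v = 0) \<Longrightarrow> \<psi> (Phi (x * Mg f)) = 0"
    using inv_functionalD(5)[OF \<psi>] x unfolding us_continuous_def by blast
  have null: "\<psi> (Phi (x * ind u)) = 0" if "u \<notin> S" for u
    unfolding ind_def by (rule S(2)) (use that in auto)
  \<comment> \<open>The constant function 1 is split into the characteristic functions of
    \<open>S\<close> and of its complement. The first is a finite sum of indicators, and continuity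
    makes the second contribute 0.\<close>
  let ?in = "\<lambda>v. if v \<in> S then 1 else 0 :: laurent" and ?out = "\<lambda>v. if v \<in> S then 0 else 1 :: laurent"
  have xind: "x * ind u \<in> Ufull" "x * Mg f \<in> Ufull" for u f by (intro full.mul_C x ind_in_Ufull Mg_in_Ufull)+
  have sum_Ufull: "(\<Sum>u\<in>T. x * ind u) \<in> Ufull" for T by (intro full.C_sum xind)
  have "eqmod qideal (Mg (\<lambda>_. 1)) 1" using Mg_const[of 1] by simp
  from qideal_sym[OF this] have "eqmod qideal 1 (Mg (\<lambda>_. 1))" .
  also have "(\<lambda>_. 1) = ?in + ?out" by (intro ext) (simp add: fun_apply)
  also have "eqmod qideal (Mg (?in + ?out)) (Mg ?in + Mg ?out)" by (rule Mg_add)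
  also have "eqmod qideal \<dots> ((\<Sum>u\<in>S. ind u) + Mg ?out)"
    by (intro qideal_add qideal_refl qideal_sym[OF sum_ind_eq_Mg[OF S(1)]])
  finally have "eqmod qideal x ((\<Sum>u\<in>S. x * ind u) + x * Mg ?out)"
    using qideal_mult_left[of 1 "(\<Sum>u\<in>S. ind u) + Mg ?out" x] by (simp add: distrib_left sum_distrib_left)
  then have "\<psi> (Phi x) = \<psi> (Phi ((\<Sum>u\<in>S. x * ind u) + x * Mg ?out))"
    by (intro functional_cong[OF \<psi>] Phi_cong Phi_in_Us x full.C_add sum_Ufull xind)
  also have "\<dots> = \<psi> (Phi (\<Sum>u\<in>S. x * ind u) + Phi (x * Mg ?out))"
    by (intro functional_cong[OF \<psi>] Phi_add Phi_in_Us us.C_add full.C_add sum_Ufull xind)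
  also have "\<dots> = \<psi> (Phi (\<Sum>u\<in>S. x * ind u)) + \<psi> (Phi (x * Mg ?out))"
    by (intro inv_functionalD(2)[OF \<psi>] Phi_in_Us sum_Ufull xind)
  also have "\<psi> (Phi (x * Mg ?out)) = 0" by (rule S(2)) simp
  finally have 1: "\<psi> (Phi x) = \<psi> (Phi (\<Sum>u\<in>S. x * ind u))" by simp
  have "\<psi> (Phi (\<Sum>u\<in>T. x * ind u)) = (\<Sum>u\<in>T. \<psi> (Phi (x * ind u)))" if "finite T" for T
    using that
  proof (induction T rule: finite_induct)
    case empty
    show ?case using inv_functionalD(4)[OF \<psi> Phi_null[OF full.Z0]] by simp
  next
    case (insert u T)
    have "\<psi> (Phi (x * ind u + (\<Sum>u\<in>T. x * ind u))) = \<psi> (Phi (x * ind u) + Phi (\<Sum>u\<in>T. x * ind u))"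
      by (intro functional_cong[OF \<psi>] Phi_add Phi_in_Us us.C_add full.C_add sum_Ufull xind)
    also have "\<dots> = \<psi> (Phi (x * ind u)) + \<psi> (Phi (\<Sum>u\<in>T. x * ind u))"
      by (intro inv_functionalD(2)[OF \<psi>] Phi_in_Us sum_Ufull xind)
    finally show ?case using insert by simp
  qed
  from this[OF S(1)] 1 null S(1) show thesis by (intro that[of S]) simp_all
qed

lemma component_at_Nil: "component_at [] (1 :: 'n us list \<Rightarrow>\<^sub>0 complex) = 1"
  by (simp add: component_at_def one_eq_single)

text \<open>Induction over the components. An open component has its weight prescribed by
  \<open>\<nu>\<close>. A closed one contributes the finite set of \<open>functional_sum\<close>,
  over which its functional sums to the value without indicator.\<close>

lemma apply_labels_sum:
  assumes "length lab = length x" "labels_ok lab" "set x \<subseteq> Ufull" "length \<nu> = open_count lab"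
  shows "\<exists>S. finite S \<and> S \<subseteq> {\<mu>. length \<mu> = length lab \<and> open_part lab \<mu> = \<nu>}
    \<and> (\<forall>\<mu>. length \<mu> = length lab \<and> open_part lab \<mu> = \<nu> \<and> \<mu> \<notin> S \<longrightarrow> apply_labels lab (map Phi (at_weights x \<mu>)) = 0)
    \<and> (\<Sum>\<mu>\<in>S. apply_labels lab (map Phi (at_weights x \<mu>))) = component_at \<nu> (apply_labels lab (map Phi x))"
  using assms
proof (induction lab x arbitrary: \<nu> rule: list_induct2)
  case Nil
  then show ?case
    by (intro exI[of _ "{[]}"]) (simp add: at_weights_def apply_labels_Nil component_at_Nil)
next
  case (Cons o' lab x0 x)
  have x: "x0 \<in> Ufull" "set x \<subseteq> Ufull" using Cons.prems(2) by simp_all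
  have ok: "labels_ok lab" using Cons.prems(1) by simp
  have aw: "at_weights (x0 # x) (v # \<mu>) = (x0 * ind v) # at_weights x \<mu>" for v \<mu> by (simp add: at_weights_def)
  have lab_tn: "apply_labels lab (map Phi x) \<in> us.tn (open_count lab)"
    using Cons.hyps ok map_Phi_Us[OF x(2)] by (intro apply_labels_tn) simp_all
  show ?case
  proof (cases o')
    case None
    then obtain v \<nu>' where \<nu>: "\<nu> = v # \<nu>'" using Cons.prems(3) by (cases \<nu>) simp_all
    then have "length \<nu>' = open_count lab" using Cons.prems(3) None by simp
    from Cons.IH[OF ok x(2) this] obtain S where S: "finite S" "S \<subseteq> {\<mu>. length \<mu> = length lab \<and> open_part lab \<mu> = \<nu>'}"
      and S0: "\<And>\<mu>. length \<mu> = length lab \<Longrightarrow> open_part lab \<mu> = \<nu>' \<Longrightarrow> \<mu> \<notin> S \<Longrightarrow> apply_labels lab (map Phi (at_weights x \<mu>)) = 0"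
      and S1: "(\<Sum>\<mu>\<in>S. apply_labels lab (map Phi (at_weights x \<mu>))) = component_at \<nu>' (apply_labels lab (map Phi x))"
      by blast
    have summand: "apply_labels (o' # lab) (map Phi (at_weights (x0 # x) (v # \<mu>)))
        = Poly_Mapping.single [Phi (x0 * ind v)] 1 * apply_labels lab (map Phi (at_weights x \<mu>))" for \<mu>
      unfolding aw list.map None by (subst apply_labels_Cons) (simp only: apply_labels_None)
    have sum: "(\<Sum>\<mu>\<in>(#) v ` S. apply_labels (o' # lab) (map Phi (at_weights (x0 # x) \<mu>)))
        = component_at \<nu> (apply_labels (o' # lab) (map Phi (x0 # x)))"
    proof -
      have "(\<Sum>\<mu>\<in>(#) v ` S. apply_labels (o' # lab) (map Phi (at_weights (x0 # x) \<mu>)))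
          = Poly_Mapping.single [Phi (x0 * ind v)] 1 * component_at \<nu>' (apply_labels lab (map Phi x))"
      proof -
        have "(\<Sum>\<mu>\<in>(#) v ` S. apply_labels (o' # lab) (map Phi (at_weights (x0 # x) \<mu>)))
            = (\<Sum>\<mu>\<in>S. apply_labels (o' # lab) (map Phi (at_weights (x0 # x) (v # \<mu>))))"
          by (rule sum.reindex_cong[OF _ refl refl]) (simp add: inj_on_def)
        then show ?thesis unfolding summand sum_distrib_left[symmetric] S1 .
      qed
      moreover have "component_at [v] (Poly_Mapping.single [Phi x0] 1) = Poly_Mapping.single [Phi (x0 * ind v)] 1"
        using component_at_Phi[of "[v]" "[x0]" 1] by (simp add: at_weights_def)
      moreover have "component_at ([v] @ \<nu>') (Poly_Mapping.single [Phi x0] 1 * apply_labels lab (map Phi x))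
          = component_at [v] (Poly_Mapping.single [Phi x0] 1) * component_at \<nu>' (apply_labels lab (map Phi x))"
        using Phi_in_Us[OF x(1)] by (intro component_at_times[of _ 1] us.tn_single us.B1) simp_all
      moreover have "apply_labels (o' # lab) (map Phi (x0 # x)) = Poly_Mapping.single [Phi x0] 1 * apply_labels lab (map Phi x)"
        unfolding list.map None by (subst apply_labels_Cons) (simp only: apply_labels_None)
      ultimately show ?thesis by (simp only: \<nu> append_Cons append_Nil)
    qed
    have null: "apply_labels (o' # lab) (map Phi (at_weights (x0 # x) \<mu>)) = 0"
      if \<mu>: "length \<mu> = length (o' # lab)" "open_part (o' # lab) \<mu> = \<nu>" "\<mu> \<notin> (#) v ` S" for \<mu>
    proof -
      obtain v' \<mu>' where \<mu>': "\<mu> = v' # \<mu>'" using \<mu>(1) by (cases \<mu>) simp_all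
      have *: "v' = v" "open_part lab \<mu>' = \<nu>'" "length \<mu>' = length lab"
        using \<mu>(1,2) by (simp_all add: \<mu>' open_part_Cons None \<nu>)
      have "\<mu>' \<notin> S"
      proof
        assume "\<mu>' \<in> S"
        then have "v # \<mu>' \<in> (#) v ` S" by (rule imageI)
        then show False using \<mu>(3) unfolding \<mu>' *(1) by contradiction
      qed
      from S0[OF *(3,2) this] show ?thesis unfolding \<mu>' *(1) summand by (simp only: mult_zero_right)
    qed
    have sub: "(#) v ` S \<subseteq> {\<mu>. length \<mu> = length (o' # lab) \<and> open_part (o' # lab) \<mu> = \<nu>}"
      using S(2) by (auto simp: open_part_Cons None \<nu>)
    show ?thesis
    proof (intro exI conjI)
      show "finite ((#) v ` S)" by (rule finite_imageI[OF S(1)])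
      show "(#) v ` S \<subseteq> {\<mu>. length \<mu> = length (o' # lab) \<and> open_part (o' # lab) \<mu> = \<nu>}" by (rule sub)
      show "\<forall>\<mu>. length \<mu> = length (o' # lab) \<and> open_part (o' # lab) \<mu> = \<nu> \<and> \<mu> \<notin> (#) v ` S
          \<longrightarrow> apply_labels (o' # lab) (map Phi (at_weights (x0 # x) \<mu>)) = 0"
        by (intro allI impI, elim conjE) (rule null)
      show "(\<Sum>\<mu>\<in>(#) v ` S. apply_labels (o' # lab) (map Phi (at_weights (x0 # x) \<mu>)))
          = component_at \<nu> (apply_labels (o' # lab) (map Phi (x0 # x)))" by (rule sum)
    qed
  next
    case (Some \<psi>)
    have \<psi>: "\<psi> \<in> inv_functionals" using Cons.prems(1) Some by simp
    obtain S0 where S0: "finite S0" and S0_null: "\<And>u. u \<notin> S0 \<Longrightarrow> \<psi> (Phi (x0 * ind u)) = 0"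
      and S0_sum: "(\<Sum>u\<in>S0. \<psi> (Phi (x0 * ind u))) = \<psi> (Phi x0)"
      by (rule functional_sum[OF \<psi> x(1)]) blast
    have "length \<nu> = open_count lab" using Cons.prems(3) Some by simp
    from Cons.IH[OF ok x(2) this] obtain S where S: "finite S" "S \<subseteq> {\<mu>. length \<mu> = length lab \<and> open_part lab \<mu> = \<nu>}"
      and S_null: "\<And>\<mu>. length \<mu> = length lab \<Longrightarrow> open_part lab \<mu> = \<nu> \<Longrightarrow> \<mu> \<notin> S \<Longrightarrow> apply_labels lab (map Phi (at_weights x \<mu>)) = 0"
      and S_sum: "(\<Sum>\<mu>\<in>S. apply_labels lab (map Phi (at_weights x \<mu>))) = component_at \<nu> (apply_labels lab (map Phi x))"
      by blast
    let ?T = "(\<lambda>(u, \<mu>). u # \<mu>) ` (S0 \<times> S)"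
    have summand: "apply_labels (o' # lab) (map Phi (at_weights (x0 # x) (u # \<mu>)))
        = smul (\<psi> (Phi (x0 * ind u))) (apply_labels lab (map Phi (at_weights x \<mu>)))" for u \<mu>
      unfolding aw list.map Some by (subst apply_labels_Cons) (simp only: apply_labels_Some single_Nil_times)
    have smul_sum_left: "smul (sum f I) t = (\<Sum>i\<in>I. smul (f i) t)" for f :: "'n weight \<Rightarrow> complex" and I and t :: "'n us list \<Rightarrow>\<^sub>0 complex"
      by (induction I rule: infinite_finite_induct) (simp_all add: smul_add_left)
    have sum: "(\<Sum>\<mu>\<in>?T. apply_labels (o' # lab) (map Phi (at_weights (x0 # x) \<mu>)))
        = component_at \<nu> (apply_labels (o' # lab) (map Phi (x0 # x)))"
    proof -
      have "(\<Sum>\<mu>\<in>?T. apply_labels (o' # lab) (map Phi (at_weights (x0 # x) \<mu>)))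
          = (\<Sum>(u, \<mu>)\<in>S0 \<times> S. smul (\<psi> (Phi (x0 * ind u))) (apply_labels lab (map Phi (at_weights x \<mu>))))"
        by (subst sum.reindex) (auto simp: inj_on_def summand intro!: sum.cong)
      also have "\<dots> = (\<Sum>u\<in>S0. smul (\<psi> (Phi (x0 * ind u))) (\<Sum>\<mu>\<in>S. apply_labels lab (map Phi (at_weights x \<mu>))))"
        unfolding smul_sum by (rule sum.cartesian_product[symmetric])
      also have "\<dots> = smul (\<psi> (Phi x0)) (component_at \<nu> (apply_labels lab (map Phi x)))"
        unfolding S_sum smul_sum_left[symmetric] S0_sum ..
      also have "\<dots> = component_at \<nu> (smul (\<psi> (Phi x0)) (apply_labels lab (map Phi x)))"
        by (simp only: component_at_eq_lmap lmap_smul)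
      also have "smul (\<psi> (Phi x0)) (apply_labels lab (map Phi x)) = apply_labels (o' # lab) (map Phi (x0 # x))"
        unfolding list.map Some 
        by (simp only: apply_labels_Cons[of "Some \<psi>" lab "Phi x0" "map Phi x"] apply_labels_Some single_Nil_times)
      finally show ?thesis .
    qed
    have null: "apply_labels (o' # lab) (map Phi (at_weights (x0 # x) \<mu>)) = 0"
      if \<mu>: "length \<mu> = length (o' # lab)" "open_part (o' # lab) \<mu> = \<nu>" "\<mu> \<notin> ?T" for \<mu>
    proof -
      obtain u \<mu>' where \<mu>': "\<mu> = u # \<mu>'" using \<mu>(1) by (cases \<mu>) simp_all
      have op: "open_part lab \<mu>' = \<nu>" "length \<mu>' = length lab"
        using \<mu>(1,2) by (simp_all add: \<mu>' open_part_Cons Some)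
      have "u \<notin> S0 \<or> \<mu>' \<notin> S" using \<mu>(3) \<mu>' by force
      then show ?thesis
      proof
        assume "u \<notin> S0"
        from S0_null[OF this] show ?thesis unfolding \<mu>' summand by simp
      next
        assume "\<mu>' \<notin> S"
        from S_null[OF op(2,1) this] show ?thesis unfolding \<mu>' summand by simp
      qed
    qed
    have sub: "?T \<subseteq> {\<mu>. length \<mu> = length (o' # lab) \<and> open_part (o' # lab) \<mu> = \<nu>}"
      using S(2) by (auto simp: open_part_Cons Some)
    have fin: "finite ?T" using S(1) S0 by simp
    show ?thesis
    proof (intro exI conjI)
      show "finite (?T)" by (rule fin)
      show "?T \<subseteq> {\<mu>. length \<mu> = length (o' # lab) \<and> open_part (o' # lab) \<mu> = \<nu>}" by (rule sub)
      show "\<forall>\<mu>. length \<mu> = length (o' # lab) \<and> open_part (o' # lab) \<mu> = \<nu> \<and> \<mu> \<notin> ?T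
          \<longrightarrow> apply_labels (o' # lab) (map Phi (at_weights (x0 # x) \<mu>)) = 0"
        by (intro allI impI, elim conjE) (rule null)
      show "(\<Sum>\<mu>\<in>?T. apply_labels (o' # lab) (map Phi (at_weights (x0 # x) \<mu>)))
          = component_at \<nu> (apply_labels (o' # lab) (map Phi (x0 # x)))" by (rule sum)
    qed
  qed
qed

lemma Phi_tensor_labeled_eq: "Phi_tensor_labeled lab t = lin_ext (apply_labels lab) (Phi_tensor t)"
  unfolding Phi_tensor_labeled_def Phi_tensor_def lin_ext_sum lin_ext_single ..

text \<open>All entries of the small invariant lie in \<open>small\<close>, where a restricted
  functional keeps its values.\<close>

lemma Gamma_small_labeled_eq:
  assumes "Gamma_small Rs n D \<in> sm.tn n"
  shows "Gamma_small_labeled Rs n D lab = lin_ext (apply_labels lab) (Gamma_small Rs n D)"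
  unfolding Gamma_small_labeled_def
proof (rule lin_ext_cong)
  fix ps assume "ps \<in> Poly_Mapping.keys (Gamma_small Rs n D)"
  then have ps: "set ps \<subseteq> small" using assms by (simp add: tens_def)
  have "set ps \<subseteq> small \<Longrightarrow> apply_labels (map (map_option (\<lambda>\<psi>. restrict \<psi> small)) lab) ps = apply_labels lab ps" for lab ps
  proof (induction lab arbitrary: ps)
    case Nil
    then show ?case by simp
  next
    case (Cons o' lab)
    show ?case
    proof (cases ps)
      case Nil
      then show ?thesis by (simp add: apply_labels_def open_part_def)
    next
      case (Cons p ps')
      have "apply_labels [map_option (\<lambda>\<psi>. restrict \<psi> small) o'] [p] = apply_labels [o'] [p]"
        using Cons.prems Cons by (cases o') (simp_all add: apply_labels_None apply_labels_Some)
      moreover have "apply_labels (map (map_option (\<lambda>\<psi>. restrict \<psi> small)) lab) ps' = apply_labels lab ps'"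
      proof (rule Cons.IH)
        show "set ps' \<subseteq> small" using Cons.prems Cons by simp
      qed
      ultimately show ?thesis
        unfolding Cons list.map by (subst (1 2) apply_labels_Cons) (simp only:)
    qed
  qed
  from this[OF ps] show "apply_labels (map (map_option (\<lambda>\<psi>. restrict \<psi> small)) lab) ps = apply_labels lab ps" .
qed

text \<open>At each \<open>\<mu>\<close> the labels are applied to the identity without closed
  components. Expanding the small invariant into finitely many tensors \<open>map Phi x\<close>
  makes the summands explicit, and \<open>apply_labels_sum\<close> then supplies both finiteness and
  the value of the sum over the closed weights.\<close>

theorem Phi_Gamma_full_labeled:
  assumes D: "tangle n D" and R': "is_R_full_inverse R'" and Rs: "is_R_small_inverse Rs"
    and lab: "length lab = n" "labels_ok lab" and \<nu>: "length \<nu> = open_count lab"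
  shows "eqmod (us.nl (open_count lab)) (Phi_Gamma_full_labeled R' n D lab \<nu>) (component_at \<nu> (Gamma_small_labeled Rs n D lab))"
proof -
  let ?G = "Gamma_small Rs n D" and ?m = "open_count lab" and ?AL = "lin_ext (apply_labels lab)"
  have G: "?G \<in> sm.tn n" by (rule Gamma_small_small[OF D R' Rs])
  obtain zs where zs: "Phi_data n zs" "eqmod (us.nl n) ?G (Phi_expansion zs)"
    using Phi_spanned_small[OF G] unfolding Phi_spanned_def by blast
  let ?I = "{\<mu> :: 'n weight list. length \<mu> = n \<and> open_part lab \<mu> = \<nu>}"
  let ?t = "\<lambda>x \<mu>. apply_labels lab (map Phi (at_weights x \<mu>))"
  let ?ok = "\<lambda>x S. finite S \<and> S \<subseteq> ?I \<and> (\<forall>\<mu>. \<mu> \<in> ?I - S \<longrightarrow> ?t x \<mu> = 0)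
      \<and> (\<Sum>\<mu>\<in>S. ?t x \<mu>) = component_at \<nu> (apply_labels lab (map Phi x))"
  \<comment> \<open>The finite set of \<open>apply_labels_sum\<close> depends on the pure tensor.
    One is chosen for each \<open>x\<close>, and their union over the expansion is the common index
    set \<open>T\<close>.\<close>
  define S where "S x = (SOME S. ?ok x S)" for x
  have S: "?ok x (S x)" if x: "length x = n \<and> set x \<subseteq> Ufull" for x
  proof -
    have "length lab = length x" "set x \<subseteq> Ufull" using x lab(1) by simp_all
    from apply_labels_sum[OF this(1) lab(2) this(2) \<nu>] have "\<exists>S. ?ok x S"
      unfolding lab(1) by blast
    then show ?thesis unfolding S_def by (rule someI_ex)
  qed
  define T where "T = (\<Union>(x, c)\<in>set zs. S x)"
  have data: "length x = n \<and> set x \<subseteq> Ufull" if "(x, c) \<in> set zs" for x c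
    using zs(1) that unfolding Phi_data_def by blast
  have T: "finite T" "T \<subseteq> ?I" unfolding T_def using S[OF data] by fast+
  have T_sub: "S x \<subseteq> T" if "(x, c) \<in> set zs" for x c using that unfolding T_def by blast
  let ?f = "\<lambda>\<mu>. Phi_tensor_labeled lab (Gamma_full R' n D l \<mu>)"
  let ?g = "\<lambda>\<mu>. \<Sum>(x, c)\<leftarrow>zs. smul c (?t x \<mu>)"
  have f: "eqmod (us.nl ?m) (?f \<mu>) (?g \<mu>)" if \<mu>: "length \<mu> = n" for \<mu>
  proof -
    have "eqmod (us.nl n) (Phi_tensor (Gamma_full R' n D l \<mu>)) (component_at \<mu> (Phi_expansion zs))"
      by (rule us.nl_trans[OF Phi_Gamma_full(1)[OF D R' Rs \<mu>] component_at_cong[OF zs(2) \<mu>]])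
    then have "eqmod (us.nl ?m) (?f \<mu>) (?AL (component_at \<mu> (Phi_expansion zs)))"
      unfolding Phi_tensor_labeled_eq using lab by (intro apply_labels_cong_nl) simp_all
    moreover have "?AL (component_at \<mu> (Phi_expansion zs)) = ?g \<mu>"
      by (induction zs) (auto simp: Phi_expansion_def component_at_eq_lmap lmap_add lin_ext_add map_Phi_at_weights)
    ultimately show ?thesis by (simp only:)
  qed
  have c1: "eqmod (us.nl ?m) (conv_sum (us.nl ?m) ?I ?f) (sum ?f T)"
  proof (rule conv_sum_eqmod[OF us.add_subgroup_nl T])
    fix \<mu> assume \<mu>: "\<mu> \<in> ?I" "\<mu> \<notin> T"
    have "?g \<mu> = (\<Sum>y\<leftarrow>zs. 0)"
    proof (intro arg_cong[of _ _ sum_list] map_cong refl)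
      fix y assume y: "y \<in> set zs"
      obtain x c where y': "y = (x, c)" by (cases y)
      have "\<mu> \<in> ?I - S x" using T_sub[of x c] y \<mu> unfolding y' by blast
      moreover have "\<forall>\<mu>. \<mu> \<in> ?I - S x \<longrightarrow> ?t x \<mu> = 0" using S[OF data] y unfolding y' by blast
      ultimately have "?t x \<mu> = 0" by blast
      then show "(case y of (x, c) \<Rightarrow> smul c (?t x \<mu>)) = 0" by (simp add: y')
    qed
    then have g: "?g \<mu> = 0" by simp
    have "length \<mu> = n" using \<mu>(1) by simp
    from f[OF this] show "?f \<mu> \<in> us.nl ?m" unfolding g eqmod_0 .
  qed
  have c2: "eqmod (us.nl ?m) (sum ?f T) (sum ?g T)"
    using T(2) by (intro us.nl_sum f) auto
  have c3: "sum ?g T = component_at \<nu> (?AL (Phi_expansion zs))"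
    using data T_sub
  proof (induction zs)
    case Nil
    then show ?case by (simp add: Phi_expansion_def component_at_eq)
  next
    case (Cons y zs)
    obtain x c where y: "y = (x, c)" by (cases y)
    have x: "length x = n \<and> set x \<subseteq> Ufull" using Cons.prems(1)[of x c] y by simp
    have "(\<Sum>\<mu>\<in>T. ?t x \<mu>) = (\<Sum>\<mu>\<in>S x. ?t x \<mu>)"
    proof (rule sum.mono_neutral_right[OF T(1)])
      show "S x \<subseteq> T" by (rule Cons.prems(2)[of x c]) (simp add: y)
      have "\<forall>\<mu>. \<mu> \<in> ?I - S x \<longrightarrow> ?t x \<mu> = 0" using S[OF x] by blast
      then show "\<forall>\<mu>\<in>T - S x. ?t x \<mu> = 0" using T(2) by blast
    qed
    also have "\<dots> = component_at \<nu> (apply_labels lab (map Phi x))" using S[OF x] by simp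
    finally have "(\<Sum>\<mu>\<in>T. smul c (?t x \<mu>)) = component_at \<nu> (smul c (apply_labels lab (map Phi x)))"
      by (simp add: smul_sum[symmetric] component_at_eq_lmap lmap_smul)
    moreover have "(\<Sum>\<mu>\<in>T. \<Sum>(x, c)\<leftarrow>zs. smul c (?t x \<mu>)) = component_at \<nu> (?AL (Phi_expansion zs))"
    proof (rule Cons.IH)
      show "length x = n \<and> set x \<subseteq> Ufull" if "(x, c) \<in> set zs" for x c
        by (rule Cons.prems(1)[of x c]) (use that in simp)
      show "S x \<subseteq> T" if "(x, c) \<in> set zs" for x c
        by (rule Cons.prems(2)[of x c]) (use that in simp)
    qed
    ultimately show ?case
      by (simp add: y sum.distrib Phi_expansion_def lin_ext_add component_at_eq_lmap lmap_add)
  qed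
  have c4: "eqmod (us.nl ?m) (component_at \<nu> (?AL (Phi_expansion zs))) (component_at \<nu> (?AL ?G))"
    using lab us.nl_sym[OF zs(2)] by (intro component_at_cong apply_labels_cong_nl \<nu>) simp_all
  have c5: "Phi_Gamma_full_labeled R' n D lab \<nu> = conv_sum (us.nl ?m) ?I ?f"
    unfolding Phi_Gamma_full_labeled_def \<nu> ..
  show ?thesis
    unfolding Gamma_small_labeled_eq[OF G] c5
    by (rule us.nl_trans[OF us.nl_trans[OF c1 c2[unfolded c3]] c4])
qed

end

theorem proposition2p1:
  fixes a :: "'n::finite \<Rightarrow> 'n \<Rightarrow> int" and d :: "'n \<Rightarrow> nat" and w :: "'n list"
    and l :: nat and z :: complex
    and n :: nat and P :: "slice list" and lab :: "('n us \<Rightarrow> complex) option list"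
    and Rfull_inv :: "'n ctensor" and Rsmall_inv :: "'n us list \<Rightarrow>\<^sub>0 complex"
  assumes datum: "root_of_unity_datum a d w l z"
    and Rfull_inv: "root_datum.is_R_full_inverse a d w Rfull_inv"
    and Rsmall_inv: "root_of_unity_datum.is_R_small_inverse a d w l z Rsmall_inv"
    and tangle: "bottom_tangle n P" "length lab = n"
    and labels: "\<And>\<psi>. Some \<psi> \<in> set lab \<Longrightarrow> \<psi> \<in> root_of_unity_datum.inv_functionals a d w l z"
  shows "root_of_unity_datum.ctensor_eq a d w l z (length (filter (\<lambda>f. f = None) lab))
    (root_of_unity_datum.Phi_Gamma_full_labeled a d w l z Rfull_inv n P lab)
    (\<lambda>\<nu>. component_at \<nu>
       (root_of_unity_datum.Gamma_small_labeled a d w l z Rsmall_inv n P lab))"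
proof -
  interpret root_of_unity_datum a d w l z by (rule datum)
  have "tangle n P" by (simp add: tangle_def tangle(1))
  then show ?thesis
    unfolding ctensor_eq_def
    using Phi_Gamma_full_labeled[OF _ Rfull_inv Rsmall_inv tangle(2)] labels
    by (auto simp: eqmod_def)
qed

end
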